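(* Let $J$ be a profinite group and let $N$ be a finite nilpotent $J$-group. Suppose that either the semidirect product $NJ = N\rtimes J$ is prosupersolvable or $J$ is pronilpotent. For each $p\in\pi(J)$ let $J_p$ be a Sylow $p$-subgroup of $J$. Then the map $\varphi \mapsto (\varphi|_{J_p})_{p\in\pi(J)}$ on cocycles induces an isomorphism of pointed sets $$H^1(J,N) \cong \prod_{p\in\pi(J)} \operatorname{inv}_J H^1(J_p,N).$$
   Context: $\pi(J)$ is the set of primes dividing the (supernatural) order $|J|$. A profinite group is pronilpotent (resp. prosupersolvable) if it is an inverse limit of finite nilpotent (resp. finite supersolvable) groups. For a profinite group $J$, a $J$-group is a discrete topological group $N$ on which $J$ acts continuously by automorphisms; the action is written as a right action $n\mapsto n^j$, which is conjugation $n^j=j^{-1}nj$ in $NJ=N\rtimes J$. For group elements, $x^j=j^{-1}xj$, and for subgroups $K^{j^{-1}}=jKj^{-1}$. Cocycles: $Z^1(J,N)$ is the set of continuous maps $\varphi:J\to N$ with $\varphi(jj')=\varphi(j)\,\varphi(j')^{j^{-1}}$ for all $j,j'\in J$. Two cocycles $\varphi,\varphi'$ are cohomologous, $\varphi\sim\varphi'$, if there is $n\in N$ with $\varphi'(j)=n^{-1}\varphi(j)n^{j^{-1}}$ for all $j\in J$. $H^1(J,N)=Z^1(J,N)/\!\sim$, pointed by the class of the constant map $1$. A closed subgroup $K\le J$ acts on $N$ by restriction, giving $Z^1(K,N)$ and $H^1(K,N)$. Invariance: for $K\le J$ closed, $j\in J$ and $\varphi\in Z^1(K,N)$, define $\varphi^j\in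 Z^1(K^{j^{-1}},N)$ by $\varphi^j(x)=\varphi(x^j)^{j^{-1}}$ for $x\in K^{j^{-1}}$. The cocycle $\varphi$ is $J$-invariant if $\varphi|_{K\cap K^{j^{-1}}}\sim\varphi^j|_{K\cap K^{j^{-1}}}$ in $Z^1(K\cap K^{j^{-1}},N)$ for all $j\in J$. $\operatorname{inv}_J H^1(K,N)\subseteq H^1(K,N)$ denotes the set of classes of $J$-invariant cocycles (restrictions to $K$ of cocycles on $J$ are always $J$-invariant). The product of pointed sets is pointed by the tuple of distinguished points, and an isomorphism of pointed sets is a bijection preserving distinguished points. *)

theory Defs
  imports
    "HOL-Algebra.Product_Groups"
    "HOL-Algebra.Generated_Groups"
    "HOL-Analysis.Function_Topology"
    "HOL-Analysis.Product_Topology"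
    "HOL-Library.Extended_Nat"
    "HOL-Computational_Algebra.Primes"
begin

section \<open>Finite nilpotent and finite supersolvable groups\<close>

primrec lower_central_series :: "('a, 'b) monoid_scheme \<Rightarrow> nat \<Rightarrow> 'a set" where
  "lower_central_series G 0 = carrier G"
| "lower_central_series G (Suc n) =
     generate G {x \<otimes>\<^bsub>G\<^esub> y \<otimes>\<^bsub>G\<^esub> inv\<^bsub>G\<^esub> x \<otimes>\<^bsub>G\<^esub> inv\<^bsub>G\<^esub> y | x y.
                   x \<in> lower_central_series G n \<and> y \<in> carrier G}"

definition nilpotent_group :: "('a, 'b) monoid_scheme \<Rightarrow> bool" where
  "nilpotent_group G \<longleftrightarrow> group G \<and> (\<exists>n. lower_central_series G n = {\<one>\<^bsub>G\<^esub>})"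

definition supersolvable_group :: "('a, 'b) monoid_scheme \<Rightarrow> bool" where
  "supersolvable_group G \<longleftrightarrow> group G \<and>
     (\<exists>n (H :: nat \<Rightarrow> 'a set).
        H 0 = {\<one>\<^bsub>G\<^esub>} \<and> H n = carrier G \<and> (\<forall>i\<le>n. H i \<lhd> G) \<and>
        (\<forall>i<n. H i \<subseteq> H (Suc i) \<and> cyclic_group (G\<lparr>carrier := H (Suc i)\<rparr> Mod H i)))"


section \<open>Profinite groups\<close>

definition topological_group :: "('a, 'b) monoid_scheme \<Rightarrow> 'a topology \<Rightarrow> bool" where
  "topological_group G T \<longleftrightarrow> group G \<and> topspace T = carrier G \<and>
     continuous_map (prod_topology T T) T (\<lambda>(x, y). x \<otimes>\<^bsub>G\<^esub> y) \<and>
     continuous_map T T (\<lambda>x. inv\<^bsub>G\<^esub> x)"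

text \<open>
  Inverse systems of groups over a directed partially ordered set \<open>I\<close>; \<open>(i, j) \<in> r\<close> is \<open>i \<le> j\<close>,
  and then \<open>f i j\<close> is the transition map from \<open>G j\<close> to \<open>G i\<close>.
\<close>

definition inverse_system ::
    "'i set \<Rightarrow> 'i rel \<Rightarrow> ('i \<Rightarrow> ('g, 'b) monoid_scheme) \<Rightarrow> ('i \<Rightarrow> 'i \<Rightarrow> 'g \<Rightarrow> 'g) \<Rightarrow> bool" where
  "inverse_system I r G f \<longleftrightarrow>
     I \<noteq> {} \<and> partial_order_on I r \<and>
     (\<forall>i\<in>I. \<forall>j\<in>I. \<exists>k\<in>I. (i, k) \<in> r \<and> (j, k) \<in> r) \<and>
     (\<forall>i\<in>I. group (G i)) \<and>
     (\<forall>i j. (i, j) \<in> r \<longrightarrow> f i j \<in> hom (G j) (G i)) \<and>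
     (\<forall>i\<in>I. \<forall>x\<in>carrier (G i). f i i x = x) \<and>
     (\<forall>i j k. (i, j) \<in> r \<and> (j, k) \<in> r \<longrightarrow> (\<forall>x\<in>carrier (G k). f i j (f j k x) = f i k x))"

definition inverse_limit_carrier ::
    "'i set \<Rightarrow> 'i rel \<Rightarrow> ('i \<Rightarrow> ('g, 'b) monoid_scheme) \<Rightarrow> ('i \<Rightarrow> 'i \<Rightarrow> 'g \<Rightarrow> 'g) \<Rightarrow> ('i \<Rightarrow> 'g) set" where
  "inverse_limit_carrier I r G f =
     {x \<in> (\<Pi>\<^sub>E i\<in>I. carrier (G i)). \<forall>i j. (i, j) \<in> r \<longrightarrow> f i j (x j) = x i}"

definition inverse_limit ::
    "'i set \<Rightarrow> 'i rel \<Rightarrow> ('i \<Rightarrow> ('g, 'b) monoid_scheme) \<Rightarrow> ('i \<Rightarrow> 'i \<Rightarrow> 'g \<Rightarrow> 'g) \<Rightarrow> ('i \<Rightarrow> 'g) monoid" where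
  "inverse_limit I r G f = (product_group I G)\<lparr>carrier := inverse_limit_carrier I r G f\<rparr>"

definition inverse_limit_topology ::
    "'i set \<Rightarrow> 'i rel \<Rightarrow> ('i \<Rightarrow> ('g, 'b) monoid_scheme) \<Rightarrow> ('i \<Rightarrow> 'i \<Rightarrow> 'g \<Rightarrow> 'g) \<Rightarrow> ('i \<Rightarrow> 'g) topology" where
  "inverse_limit_topology I r G f =
     subtopology (product_topology (\<lambda>i. discrete_topology (carrier (G i))) I)
       (inverse_limit_carrier I r G f)"

text \<open>
  \<open>pro_group P G T\<close>: the topological group \<open>G\<close> is (topologically isomorphic to) an inverse limit
  of finite discrete groups with property \<open>P\<close>. HOL has no quantification over types, so the types
  of the index set and of the finite groups have to be chosen in advance. Every finite group has
  an isomorphic copy on \<open>nat\<close>. For classes closed under subgroups and quotients (all finite groups,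
  nilpotent groups, supersolvable groups) every inverse limit of finite groups from the class is
  the limit of its quotients by open normal subgroups, which are indexed by subsets of the group,
  so the choice is no restriction for these classes.
\<close>

definition pro_group :: "(nat monoid \<Rightarrow> bool) \<Rightarrow> ('a, 'b) monoid_scheme \<Rightarrow> 'a topology \<Rightarrow> bool" where
  "pro_group P G T \<longleftrightarrow> topological_group G T \<and>
     (\<exists>(I :: 'a set set) r (Q :: 'a set \<Rightarrow> nat monoid) f h.
        inverse_system I r Q f \<and> (\<forall>i\<in>I. finite (carrier (Q i)) \<and> P (Q i)) \<and>
        h \<in> iso G (inverse_limit I r Q f) \<and>
        homeomorphic_map T (inverse_limit_topology I r Q f) h)"

definition profinite_group :: "('a, 'b) monoid_scheme \<Rightarrow> 'a topology \<Rightarrow> bool" where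
  "profinite_group G T \<longleftrightarrow> pro_group (\<lambda>_. True) G T"

definition pronilpotent_group :: "('a, 'b) monoid_scheme \<Rightarrow> 'a topology \<Rightarrow> bool" where
  "pronilpotent_group G T \<longleftrightarrow> pro_group nilpotent_group G T"

definition prosupersolvable_group :: "('a, 'b) monoid_scheme \<Rightarrow> 'a topology \<Rightarrow> bool" where
  "prosupersolvable_group G T \<longleftrightarrow> pro_group supersolvable_group G T"


section \<open>Supernatural orders and Sylow subgroups\<close>

text \<open>
  A supernatural number \<open>\<Prod>p. p ^ n p\<close> with \<open>n p \<in> {0, 1, 2, \<dots>, \<infinity>}\<close> is represented by its exponent
  function \<open>n\<close>; only the values at primes are meaningful.
\<close>

type_synonym supernatural = "nat \<Rightarrow> enat"

definition prime_dvd_supernatural :: "nat \<Rightarrow> supernatural \<Rightarrow> bool" where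
  "prime_dvd_supernatural p n \<longleftrightarrow> prime p \<and> 1 \<le> n p"

definition closed_subgroup :: "'a set \<Rightarrow> ('a, 'b) monoid_scheme \<Rightarrow> 'a topology \<Rightarrow> bool" where
  "closed_subgroup H G T \<longleftrightarrow> subgroup H G \<and> closedin T H"

text \<open>
  The index \<open>|G : H|\<close> is the least common multiple of the indices \<open>|G : HU|\<close>, and the order \<open>|G|\<close>
  the least common multiple of the orders \<open>|G/U|\<close>, where \<open>U\<close> ranges over the open normal subgroups.
\<close>

definition supernatural_index ::
    "('a, 'b) monoid_scheme \<Rightarrow> 'a topology \<Rightarrow> 'a set \<Rightarrow> supernatural" where
  "supernatural_index G T H p =
     (SUP U \<in> {U. U \<lhd> G \<and> openin T U}. enat (multiplicity p (card (rcosets\<^bsub>G\<^esub> (H <#>\<^bsub>G\<^esub> U)))))"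

definition supernatural_order ::
    "('a, 'b) monoid_scheme \<Rightarrow> 'a topology \<Rightarrow> supernatural" where
  "supernatural_order G T p =
     (SUP U \<in> {U. U \<lhd> G \<and> openin T U}. enat (multiplicity p (order (G Mod U))))"

definition prime_set :: "('a, 'b) monoid_scheme \<Rightarrow> 'a topology \<Rightarrow> nat set" where
  "prime_set G T = {p. prime_dvd_supernatural p (supernatural_order G T)}"

definition sylow_subgroup ::
    "nat \<Rightarrow> 'a set \<Rightarrow> ('a, 'b) monoid_scheme \<Rightarrow> 'a topology \<Rightarrow> bool" where
  "sylow_subgroup p H G T \<longleftrightarrow> prime p \<and> closed_subgroup H G T \<and>
     prime_set (G\<lparr>carrier := H\<rparr>) (subtopology T H) \<subseteq> {p} \<and>
     \<not> prime_dvd_supernatural p (supernatural_index G T H)"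


section \<open>\<open>J\<close>-groups and semidirect products\<close>

text \<open>\<open>act n j\<close> is the right action \<open>n\<^sup>j\<close>; the group \<open>N\<close> carries the discrete topology.\<close>

definition J_group ::
    "('j, 'a) monoid_scheme \<Rightarrow> 'j topology \<Rightarrow> ('n, 'b) monoid_scheme \<Rightarrow> ('n \<Rightarrow> 'j \<Rightarrow> 'n) \<Rightarrow> bool" where
  "J_group J T N act \<longleftrightarrow> group N \<and>
     (\<forall>j\<in>carrier J. (\<lambda>n. act n j) \<in> iso N N) \<and>
     (\<forall>n\<in>carrier N. act n \<one>\<^bsub>J\<^esub> = n) \<and>
     (\<forall>n\<in>carrier N. \<forall>j\<in>carrier J. \<forall>k\<in>carrier J. act n (j \<otimes>\<^bsub>J\<^esub> k) = act (act n j) k) \<and>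
     continuous_map (prod_topology (discrete_topology (carrier N)) T)
       (discrete_topology (carrier N)) (\<lambda>(n, j). act n j)"

text \<open>
  The pair \<open>(n, j)\<close> stands for the product \<open>nj\<close> in \<open>NJ\<close>. Since \<open>n\<^sup>j = j\<inverse>nj\<close> there,
  \<open>(nj)(mk) = n m\<^bsup>j\<inverse>\<^esup> jk\<close>.
\<close>

definition semidirect_product ::
    "('n, 'b) monoid_scheme \<Rightarrow> ('j, 'a) monoid_scheme \<Rightarrow> ('n \<Rightarrow> 'j \<Rightarrow> 'n) \<Rightarrow> ('n \<times> 'j) monoid" where
  "semidirect_product N J act =
     \<lparr>carrier = carrier N \<times> carrier J,
      monoid.mult = (\<lambda>(n, j) (m, k). (n \<otimes>\<^bsub>N\<^esub> act m (inv\<^bsub>J\<^esub> j), j \<otimes>\<^bsub>J\<^esub> k)),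
      one = (\<one>\<^bsub>N\<^esub>, \<one>\<^bsub>J\<^esub>)\<rparr>"

definition semidirect_topology ::
    "('n, 'b) monoid_scheme \<Rightarrow> 'j topology \<Rightarrow> ('n \<times> 'j) topology" where
  "semidirect_topology N T = prod_topology (discrete_topology (carrier N)) T"


section \<open>Nonabelian cohomology\<close>

text \<open>
  Throughout, \<open>K\<close> is a closed subgroup of \<open>J\<close> with the restricted action; \<open>H\<^sup>1(J, N)\<close> itself is the
  case \<open>K = carrier J\<close>. Cocycles are extensional on \<open>K\<close>, so that equality of cocycles
  is equality of maps on \<open>K\<close>.
\<close>

definition Z1 ::
    "('j, 'a) monoid_scheme \<Rightarrow> 'j topology \<Rightarrow> ('n, 'b) monoid_scheme \<Rightarrow> ('n \<Rightarrow> 'j \<Rightarrow> 'n) \<Rightarrow>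
     'j set \<Rightarrow> ('j \<Rightarrow> 'n) set" where
  "Z1 J T N act K =
     {\<phi> \<in> extensional K.
        continuous_map (subtopology T K) (discrete_topology (carrier N)) \<phi> \<and>
        (\<forall>x\<in>K. \<forall>y\<in>K. \<phi> (x \<otimes>\<^bsub>J\<^esub> y) = \<phi> x \<otimes>\<^bsub>N\<^esub> act (\<phi> y) (inv\<^bsub>J\<^esub> x))}"

definition cohomologous ::
    "('j, 'a) monoid_scheme \<Rightarrow> 'j topology \<Rightarrow> ('n, 'b) monoid_scheme \<Rightarrow> ('n \<Rightarrow> 'j \<Rightarrow> 'n) \<Rightarrow>
     'j set \<Rightarrow> ('j \<Rightarrow> 'n) rel" where
  "cohomologous J T N act K =
     {(\<phi>, \<psi>). \<phi> \<in> Z1 J T N act K \<and> \<psi> \<in> Z1 J T N act K \<and>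
        (\<exists>n\<in>carrier N. \<forall>x\<in>K. \<psi> x = inv\<^bsub>N\<^esub> n \<otimes>\<^bsub>N\<^esub> \<phi> x \<otimes>\<^bsub>N\<^esub> act n (inv\<^bsub>J\<^esub> x))}"

definition H1 ::
    "('j, 'a) monoid_scheme \<Rightarrow> 'j topology \<Rightarrow> ('n, 'b) monoid_scheme \<Rightarrow> ('n \<Rightarrow> 'j \<Rightarrow> 'n) \<Rightarrow>
     'j set \<Rightarrow> ('j \<Rightarrow> 'n) set set" where
  "H1 J T N act K = Z1 J T N act K // cohomologous J T N act K"

definition H1_class ::
    "('j, 'a) monoid_scheme \<Rightarrow> 'j topology \<Rightarrow> ('n, 'b) monoid_scheme \<Rightarrow> ('n \<Rightarrow> 'j \<Rightarrow> 'n) \<Rightarrow>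
     'j set \<Rightarrow> ('j \<Rightarrow> 'n) \<Rightarrow> ('j \<Rightarrow> 'n) set" where
  "H1_class J T N act K \<phi> = cohomologous J T N act K `` {\<phi>}"

definition H1_point ::
    "('j, 'a) monoid_scheme \<Rightarrow> 'j topology \<Rightarrow> ('n, 'b) monoid_scheme \<Rightarrow> ('n \<Rightarrow> 'j \<Rightarrow> 'n) \<Rightarrow>
     'j set \<Rightarrow> ('j \<Rightarrow> 'n) set" where
  "H1_point J T N act K = H1_class J T N act K (\<lambda>x\<in>K. \<one>\<^bsub>N\<^esub>)"

text \<open>\<open>conj_inv J K j\<close> is \<open>K\<^bsup>j\<inverse>\<^esup> = jKj\<inverse>\<close>.\<close>

definition conj_inv :: "('j, 'a) monoid_scheme \<Rightarrow> 'j set \<Rightarrow> 'j \<Rightarrow> 'j set" where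
  "conj_inv J K j = (\<lambda>k. j \<otimes>\<^bsub>J\<^esub> k \<otimes>\<^bsub>J\<^esub> inv\<^bsub>J\<^esub> j) ` K"

definition conj_cocycle ::
    "('j, 'a) monoid_scheme \<Rightarrow> ('n \<Rightarrow> 'j \<Rightarrow> 'n) \<Rightarrow> 'j set \<Rightarrow> ('j \<Rightarrow> 'n) \<Rightarrow> 'j \<Rightarrow> ('j \<Rightarrow> 'n)" where
  "conj_cocycle J act K \<phi> j =
     (\<lambda>x\<in>conj_inv J K j. act (\<phi> (inv\<^bsub>J\<^esub> j \<otimes>\<^bsub>J\<^esub> x \<otimes>\<^bsub>J\<^esub> j)) (inv\<^bsub>J\<^esub> j))"

definition invariant_cocycle ::
    "('j, 'a) monoid_scheme \<Rightarrow> 'j topology \<Rightarrow> ('n, 'b) monoid_scheme \<Rightarrow> ('n \<Rightarrow> 'j \<Rightarrow> 'n) \<Rightarrow>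
     'j set \<Rightarrow> ('j \<Rightarrow> 'n) \<Rightarrow> bool" where
  "invariant_cocycle J T N act K \<phi> \<longleftrightarrow> \<phi> \<in> Z1 J T N act K \<and>
     (\<forall>j\<in>carrier J.
        (restrict \<phi> (K \<inter> conj_inv J K j),
         restrict (conj_cocycle J act K \<phi> j) (K \<inter> conj_inv J K j))
          \<in> cohomologous J T N act (K \<inter> conj_inv J K j))"

definition inv_H1 ::
    "('j, 'a) monoid_scheme \<Rightarrow> 'j topology \<Rightarrow> ('n, 'b) monoid_scheme \<Rightarrow> ('n \<Rightarrow> 'j \<Rightarrow> 'n) \<Rightarrow>
     'j set \<Rightarrow> ('j \<Rightarrow> 'n) set set" where
  "inv_H1 J T N act K = H1_class J T N act K ` {\<phi>. invariant_cocycle J T N act K \<phi>}"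


section \<open>Pointed sets\<close>

definition pointed_iso :: "('a \<Rightarrow> 'b) \<Rightarrow> 'a set \<times> 'a \<Rightarrow> 'b set \<times> 'b \<Rightarrow> bool" where
  "pointed_iso F X Y \<longleftrightarrow> bij_betw F (fst X) (fst Y) \<and> F (snd X) = snd Y"

end

theory Submission
  imports
    Defs
    "HOL-Algebra.Multiplicative_Group"
    "HOL-Algebra.Sylow"
    "HOL-Algebra.Group_Action"
    "HOL-Algebra.Zassenhaus"
    "HOL-Number_Theory.Cong"
    "HOL-Analysis.Abstract_Topological_Spaces"
begin

text \<open>
  Write \<open>a x n\<close> for \<open>n\<^bsup>x\<inverse>\<^esup>\<close>, a left action, so
  that a cocycle satisfies \<open>\<phi> (x y) = \<phi> x \<cdot> a x (\<phi> y)\<close>. The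
  finite nilpotent group \<open>N\<close> is the direct product of its primary components
  \<open>N\<^sub>p\<close>, which every automorphism preserves, so cocycles and cohomologies
  decompose into their \<open>p\<close>-components. On \<open>J\<^sub>q\<close> with \<open>q
  \<noteq> p\<close>, and on \<open>J\<close> itself if \<open>p \<notin> \<pi>(J)\<close>, the
  \<open>p\<close>-component of every cocycle is cohomologically trivial for reasons of order.
  What has to be shown is that, for each \<open>p \<in> \<pi>(J)\<close>, restriction identifies
  the cohomology classes of \<open>J\<close> with values in \<open>N\<^sub>p\<close> with the
  invariant classes of \<open>J\<^sub>p\<close>.

  If \<open>J\<^sub>p\<close> were normal, this would be coprime cohomology. Two cocycles that
  agree on a normal subgroup of index prime to \<open>p\<close> are cohomologous: twist the action
  so that one of them becomes trivial and average the other along the lower central series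
  (\<open>cocycle_unique_extension\<close>). A cocycle \<open>\<phi>\<close> on a normal subgroup
  \<open>R\<close> of index prime to \<open>p\<close> whose class is invariant extends: the pairs
  \<open>(m, g)\<close> for which \<open>m\<close> realizes the invariance of
  \<open>\<phi>\<close> under \<open>g\<close> form a group that contains the graph of
  \<open>\<phi>\<close>, and by the relative form of the Schur-Zassenhaus theorem
  (\<open>relative_complement\<close>) it contains the graph of an extension of
  \<open>\<phi>\<close> (\<open>cocycle_extension_normal\<close>).

  A Sylow subgroup need not be normal, and this is where the hypothesis on \<open>NJ\<close> or
  \<open>J\<close> is used. Every cocycle is trivial on some open normal subgroup \<open>U\<close>
  that acts trivially on \<open>N\<close>. Let \<open>R = J\<^sub>p U\<close> and let
  \<open>B\<close> be its normalizer. There is a normal subgroup \<open>M\<close> with \<open>J =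
  B M\<close> that acts trivially on \<open>N\<^sub>p\<close> and whose elements have order prime
  to \<open>p\<close> modulo \<open>U\<close> (\<open>sylow_supplement\<close>). A cocycle that is
  trivial on \<open>U\<close> is a homomorphism on \<open>M\<close> and hence trivial there, so it
  is determined by its restriction to \<open>B\<close>, where \<open>R\<close> is normal of index
  prime to \<open>p\<close> (\<open>restriction_injective\<close>,
  \<open>restriction_surjective\<close>). If \<open>J\<close> is pronilpotent, then
  \<open>R\<close> is normal and \<open>M = U\<close> will do. If \<open>NJ\<close> is
  prosupersolvable, let \<open>F\<close> be the set of elements of \<open>J\<close> that
  centralize all factors of a normal series with cyclic factors of a sufficiently large finite
  quotient of \<open>NJ\<close>. Since automorphism groups of cyclic groups are abelian,
  \<open>F\<close> contains all commutators; its image in \<open>J/U\<close> is nilpotent, and the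
  part of order prime to \<open>p\<close> of that image gives \<open>M\<close>. The Frattini
  argument gives \<open>J = B M\<close> (\<open>frattini_nilpotent\<close>), and \<open>M\<close>
  acts trivially on \<open>N\<^sub>p\<close> because it stabilizes a chain of subgroups of
  \<open>N\<^sub>p\<close> while its elements have order prime to \<open>p\<close> modulo
  \<open>U\<close> (\<open>coprime_chain_action_trivial\<close>).

  For surjectivity one more point is needed: the invariance of \<open>\<phi>\<close> concerns
  elements that normalize \<open>J\<^sub>p\<close>, but the extension argument requires it for all
  elements that normalize \<open>J\<^sub>p U\<close>. By compactness of \<open>J\<close> the
  latter follows from the former once \<open>U\<close> is small enough
  (\<open>invariant_at_finite_level\<close>).
\<close>

section \<open>Averaging over a quotient of coprime order\<close>

lemma hom_finprod:
  assumes "comm_group A" "comm_group B" "h \<in> hom A B" "f \<in> I \<rightarrow> carrier A"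
  shows "h (finprod A f I) = finprod B (\<lambda>i. h (f i)) I"
proof -
  interpret A: comm_group A by fact
  interpret B: comm_group B by fact
  interpret h: group_hom A B h using assms(3) by unfold_locales
  show ?thesis using assms(4)
  proof (induction I rule: infinite_finite_induct)
    case (insert x F)
    then have f: "f \<in> F \<rightarrow> carrier A" "f x \<in> carrier A" by auto
    moreover have "(\<lambda>i. h (f i)) \<in> F \<rightarrow> carrier B" using f h.hom_closed by blast
    ultimately show ?case using insert by simp
  qed auto
qed

lemma finprod_translate:
  assumes "group Q" "comm_group A" "x \<in> carrier Q" "f \<in> carrier Q \<rightarrow> carrier A"
  shows "finprod A (\<lambda>c. f (x \<otimes>\<^bsub>Q\<^esub> c)) (carrier Q) = finprod A f (carrier Q)"
proof -
  interpret A: comm_group A by fact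
  interpret Q: group Q by fact
  have im: "(\<lambda>c. x \<otimes>\<^bsub>Q\<^esub> c) ` carrier Q = carrier Q" using assms(3) Q.surj_const_mult by blast
  have "finprod A f ((\<lambda>c. x \<otimes>\<^bsub>Q\<^esub> c) ` carrier Q) = finprod A (\<lambda>c. f (x \<otimes>\<^bsub>Q\<^esub> c)) (carrier Q)"
    using assms im by (intro A.finprod_reindex) (auto simp: Q.inj_on_cmult)
  then show ?thesis by (simp add: im)
qed

text \<open>
  For an element whose \<open>k\<close>-th power is trivial, raising to the power \<open>e\<close>
  undoes raising to the power \<open>m\<close>.
\<close>

lemma coprime_power_inverse:
  fixes k m :: nat
  assumes "coprime k m" "k > 0" "m > 0"
  obtains e q where "m * e = 1 + k * q"
proof -
  have "coprime m k" using assms by (simp add: coprime_commute)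
  then obtain e where e: "[m * e = 1] (mod k)" using cong_solve_coprime_nat by auto
  show ?thesis
  proof (cases "k = 1")
    case True
    then show ?thesis using that[of 1 "m-1"] that[of 0] assms by (cases m) auto
  next
    case False
    then have "(m * e) mod k = 1" using e assms(2) by (simp add: cong_def)
    then show ?thesis using that[of e "(m*e) div k"] by (metis add.commute mult_div_mod_eq)
  qed
qed

lemma (in group) cancel_inv_left:
  assumes "x \<in> carrier G" "y \<in> carrier G"
  shows "x \<otimes> (inv x \<otimes> y) = y" "inv x \<otimes> (x \<otimes> y) = y"
  using assms by (simp_all add: m_assoc[symmetric])

lemma (in group) coprime_exponents:
  fixes k l :: nat
  assumes "x \<in> carrier G" "x [^] k = \<one>" "x [^] l = \<one>" "coprime l k"
  shows "x = \<one>"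
proof -
  have "ord x dvd k" "ord x dvd l" using assms pow_eq_id by auto
  then have "ord x = 1" using assms(4) coprime_common_divisor_nat by blast
  then show ?thesis using pow_ord_eq_1[OF assms(1)] assms(1) by simp
qed

lemma (in group) FactGroup_abelian:
  assumes "H \<lhd> G" "\<And>x y. x \<in> carrier G \<Longrightarrow> y \<in> carrier G \<Longrightarrow> x \<otimes> y \<otimes> inv x \<otimes> inv y \<in> H"
  shows "comm_group (G Mod H)"
proof -
  interpret H: normal H G by fact
  interpret Q: group "G Mod H" by (rule H.factorgroup_is_group)
  have sub: "subgroup H G" by (rule H.subgroup_axioms)
  show ?thesis
  proof (rule Q.group_comm_groupI)
    fix X Y assume "X \<in> carrier (G Mod H)" "Y \<in> carrier (G Mod H)"
    then obtain x y where x: "x \<in> carrier G" "X = H #> x" and y: "y \<in> carrier G" "Y = H #> y"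
      by (auto simp: carrier_FactGroup)
    have "x \<otimes> y \<otimes> inv (y \<otimes> x) \<in> H"
      using assms(2)[OF x(1) y(1)] x y by (simp add: inv_mult_group m_assoc)
    then have "x \<otimes> y \<in> H #> (y \<otimes> x)"
      using x y H.rcos_module[OF is_group, of "y \<otimes> x" "x \<otimes> y"] by simp
    then have "H #> (x \<otimes> y) = H #> (y \<otimes> x)"
      using x y repr_independence[OF _ _ sub, of "x \<otimes> y" "y \<otimes> x"] by simp
    then show "X \<otimes>\<^bsub>G Mod H\<^esub> Y = Y \<otimes>\<^bsub>G Mod H\<^esub> X"
      using x y by (simp add: H.rcos_sum)
  qed
qed

text \<open>
  Only homomorphisms \<open>a g\<close> are required; they are automorphisms because \<open>a
  g\<close> and \<open>a (inv g)\<close> are inverse to each other.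
\<close>

locale left_action = G: group G + N: group N
  for G :: "('g, 'a) monoid_scheme" (structure) and N :: "('n, 'b) monoid_scheme"
    and a :: "'g \<Rightarrow> 'n \<Rightarrow> 'n" +
  assumes a_hom: "g \<in> carrier G \<Longrightarrow> a g \<in> hom N N"
    and a_one: "n \<in> carrier N \<Longrightarrow> a \<one> n = n"
    and a_mult: "\<lbrakk>g \<in> carrier G; h \<in> carrier G; n \<in> carrier N\<rbrakk> \<Longrightarrow> a (g \<otimes> h) n = a g (a h n)"
begin

lemma a_closed [simp]: "\<lbrakk>g \<in> carrier G; n \<in> carrier N\<rbrakk> \<Longrightarrow> a g n \<in> carrier N"
  using a_hom by (auto simp: hom_def)

lemma a_N_mult [simp]:
  "\<lbrakk>g \<in> carrier G; m \<in> carrier N; n \<in> carrier N\<rbrakk> \<Longrightarrow> a g (m \<otimes>\<^bsub>N\<^esub> n) = a g m \<otimes>\<^bsub>N\<^esub> a g n"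
  using a_hom hom_mult by fastforce

lemma a_group_hom: "g \<in> carrier G \<Longrightarrow> group_hom N N (a g)"
  by (simp add: a_hom group_hom_axioms_def group_hom_def)

lemma a_N_one [simp]: "g \<in> carrier G \<Longrightarrow> a g \<one>\<^bsub>N\<^esub> = \<one>\<^bsub>N\<^esub>"
  using group_hom.hom_one[OF a_group_hom] .

lemma a_N_inv [simp]: "\<lbrakk>g \<in> carrier G; n \<in> carrier N\<rbrakk> \<Longrightarrow> a g (inv\<^bsub>N\<^esub> n) = inv\<^bsub>N\<^esub> (a g n)"
  using group_hom.hom_inv[OF a_group_hom] .

lemma a_N_pow: "\<lbrakk>g \<in> carrier G; n \<in> carrier N\<rbrakk> \<Longrightarrow> a g (n [^]\<^bsub>N\<^esub> (k::nat)) = a g n [^]\<^bsub>N\<^esub> k"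
  using group_hom.hom_nat_pow[OF a_group_hom] .

lemma a_inv_left [simp]: "\<lbrakk>g \<in> carrier G; n \<in> carrier N\<rbrakk> \<Longrightarrow> a (inv g) (a g n) = n"
  using a_mult[of "inv g" g n] by (simp add: a_one)

definition cocycle :: "'g set \<Rightarrow> ('g \<Rightarrow> 'n) \<Rightarrow> bool" where
  "cocycle K \<phi> \<longleftrightarrow> (\<forall>x\<in>K. \<phi> x \<in> carrier N) \<and> (\<forall>x\<in>K. \<forall>y\<in>K. \<phi> (x \<otimes> y) = \<phi> x \<otimes>\<^bsub>N\<^esub> a x (\<phi> y))"

text \<open>
  The cocycle \<open>\<theta>\<close> is constant on cosets of \<open>R\<close>, so in the abelian
  group \<open>A/A'\<close> the product \<open>W\<close> of its values over the finite group
  \<open>G/R\<close> makes sense. Translating the index of the product by \<open>g\<close> gives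
  \<open>W = \<theta>(g)\<^sup>m \<cdot> a g W\<close> with \<open>m = |G : R|\<close>. As
  \<open>m\<close> is invertible modulo the exponent \<open>k\<close>, an \<open>m\<close>-th root
  of \<open>W\<close> trivializes \<open>\<theta>\<close> modulo \<open>A'\<close>.
\<close>

lemma averaging_step:
  assumes R: "R \<lhd> G" "finite (rcosets R)"
    and A: "subgroup A N" and A': "A' \<lhd> N\<lparr>carrier := A\<rparr>"
    and comm: "\<And>x y. x \<in> A \<Longrightarrow> y \<in> A \<Longrightarrow> x \<otimes>\<^bsub>N\<^esub> y \<otimes>\<^bsub>N\<^esub> inv\<^bsub>N\<^esub> x \<otimes>\<^bsub>N\<^esub> inv\<^bsub>N\<^esub> y \<in> A'"
    and aA: "\<And>g x. g \<in> carrier G \<Longrightarrow> x \<in> A \<Longrightarrow> a g x \<in> A"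
    and aA': "\<And>g x. g \<in> carrier G \<Longrightarrow> x \<in> A' \<Longrightarrow> a g x \<in> A'"
    and k: "coprime k (card (rcosets R))" "k > 0" "\<And>x. x \<in> A \<Longrightarrow> x [^]\<^bsub>N\<^esub> (k::nat) = \<one>\<^bsub>N\<^esub>"
    and \<theta>: "\<And>g. g \<in> carrier G \<Longrightarrow> \<theta> g \<in> A"
      "\<And>g h. g \<in> carrier G \<Longrightarrow> h \<in> carrier G \<Longrightarrow> \<theta> (g \<otimes> h) = \<theta> g \<otimes>\<^bsub>N\<^esub> a g (\<theta> h)"
      "\<And>r g. r \<in> R \<Longrightarrow> g \<in> carrier G \<Longrightarrow> \<theta> (r \<otimes> g) = \<theta> g"
  shows "\<exists>v\<in>A. \<forall>g\<in>carrier G. inv\<^bsub>N\<^esub> v \<otimes>\<^bsub>N\<^esub> \<theta> g \<otimes>\<^bsub>N\<^esub> a g v \<in> A'"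
proof -
  interpret R: normal R G by fact
  define NA where "NA = N\<lparr>carrier := A\<rparr>"
  interpret NA: group NA unfolding NA_def using A by (simp add: N.subgroup_imp_group)
  interpret A': normal A' NA using A' unfolding NA_def .
  have [simp]: "carrier NA = A" "monoid.mult NA = monoid.mult N" "\<one>\<^bsub>NA\<^esub> = \<one>\<^bsub>N\<^esub>" by (auto simp: NA_def)
  have invNA: "inv\<^bsub>NA\<^esub> x = inv\<^bsub>N\<^esub> x" if "x \<in> A" for x
    unfolding NA_def using N.m_inv_consistent[OF A that] by simp
  have AN: "A \<subseteq> carrier N" using A subgroup.subset by blast
  define Q where "Q = NA Mod A'"
  interpret Q: comm_group Q unfolding Q_def
    using NA.FactGroup_abelian[OF A'.normal_axioms] comm by (simp add: invNA)
  define cl where "cl = (\<lambda>x. A' #>\<^bsub>NA\<^esub> x)"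
  have cl_hom: "cl \<in> hom NA Q" unfolding cl_def Q_def by (rule A'.r_coset_hom_Mod)
  interpret cl: group_hom NA Q cl using cl_hom by unfold_locales
  have cl_mult [simp]: "cl (x \<otimes>\<^bsub>N\<^esub> y) = cl x \<otimes>\<^bsub>Q\<^esub> cl y" if "x \<in> A" "y \<in> A" for x y
    using cl.hom_mult[of x y] that by simp
  have cl_surj: "\<exists>x\<in>A. X = cl x" if "X \<in> carrier Q" for X
    using that unfolding Q_def cl_def by (auto simp: carrier_FactGroup)
  have cl_eq: "cl x = cl y \<Longrightarrow> x \<otimes>\<^bsub>N\<^esub> inv\<^bsub>N\<^esub> y \<in> A'" if "x \<in> A" "y \<in> A" for x y
    using NA.repr_independenceD[of A' x y] A'.rcos_module[of y x] that NA.is_group A'.subgroup_axioms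
    unfolding cl_def by (metis \<open>carrier NA = A\<close> \<open>monoid.mult NA = monoid.mult N\<close> invNA)
  have cl_one: "cl x = \<one>\<^bsub>Q\<^esub> \<longleftrightarrow> x \<in> A'" if "x \<in> A" for x
    using that unfolding cl_def Q_def
    by (metis A'.rcos_const A'.subgroup_axioms NA.coset_join1 NA.is_group \<open>carrier NA = A\<close> one_FactGroup A'.subset)

  define Gb where "Gb = G Mod R"
  interpret Gb: group Gb unfolding Gb_def by (rule R.factorgroup_is_group)
  have Gb_elim: "\<exists>x\<in>carrier G. c = R #> x" if "c \<in> carrier Gb" for c
    using that by (auto simp: Gb_def carrier_FactGroup)
  have carGb: "carrier Gb = rcosets R" unfolding Gb_def FactGroup_def by simp
  define m where "m = card (carrier Gb)"
  have m0: "m > 0" unfolding m_def using R(2) carGb Gb.one_closed by (metis card_gt_0_iff empty_iff)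
  obtain e q where eq: "m * e = 1 + k * q"
    using coprime_power_inverse[of k m] k m0 unfolding m_def carGb by metis
  \<comment> \<open>The function induced by the cocycle on the quotient by \<open>R\<close>; the choice of a
    representative does not matter.\<close>
  define f where "f = (\<lambda>c. cl (\<theta> (SOME x. x \<in> c)))"
  have f_cl: "f (R #> x) = cl (\<theta> x)" if x: "x \<in> carrier G" for x
  proof -
    have "(SOME y. y \<in> R #> x) \<in> R #> x"
      using G.rcos_self[OF x R.subgroup_axioms] by (metis someI)
    then obtain r where "r \<in> R" "(SOME y. y \<in> R #> x) = r \<otimes> x" by (auto simp: r_coset_def)
    then show ?thesis unfolding f_def using \<theta>(3) x by simp
  qed
  have f_car: "f c \<in> carrier Q" if c: "c \<in> carrier Gb" for c
  proof -
    obtain x where "x \<in> carrier G" "c = R #> x" using Gb_elim c by blast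
    then show ?thesis using f_cl \<theta>(1) by (simp)
  qed
  \<comment> \<open>The inverse \<open>e\<close> of the index modulo \<open>k\<close> provides the root
    \<open>v\<close> of \<open>W\<close> modulo \<open>A'\<close>.\<close>
  define W where "W = finprod Q f (carrier Gb)"
  have Wc: "W \<in> carrier Q" unfolding W_def using f_car by (intro Q.finprod_closed) auto
  obtain v where v: "v \<in> A" "W [^]\<^bsub>Q\<^esub> e = cl v" using cl_surj Wc by (metis Q.nat_pow_closed)
  have "inv\<^bsub>N\<^esub> v \<otimes>\<^bsub>N\<^esub> \<theta> g \<otimes>\<^bsub>N\<^esub> a g v \<in> A'" if g: "g \<in> carrier G" for g
  proof -
    have hg: "(\<lambda>x. cl (a g x)) \<in> hom NA Q"
      using g aA AN by (auto intro!: homI simp: subset_eq cl.hom_mult[simplified])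
    have A'A: "A' \<subseteq> A" using A'.subset by simp
    \<comment> \<open>The action of \<open>g\<close> on \<open>A/A'\<close>.\<close>
    obtain \<alpha> where \<alpha>: "\<alpha> \<in> hom Q Q" "\<And>x. x \<in> A \<Longrightarrow> \<alpha> (cl x) = cl (a g x)"
    proof (rule FactGroup_universal[OF hg A'.normal_axioms])
      fix x y assume xy: "x \<in> carrier NA" "y \<in> carrier NA" "A' #>\<^bsub>NA\<^esub> x = A' #>\<^bsub>NA\<^esub> y"
      then have "x \<otimes>\<^bsub>N\<^esub> inv\<^bsub>N\<^esub> y \<in> A'" using cl_eq unfolding cl_def by simp
      then have "a g (x \<otimes>\<^bsub>N\<^esub> inv\<^bsub>N\<^esub> y) \<in> A'" using aA' g by blast
      then have "a g x \<otimes>\<^bsub>N\<^esub> inv\<^bsub>N\<^esub> (a g y) \<in> A'" using xy g AN by (simp add: subset_eq)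
      then have "cl (a g x \<otimes>\<^bsub>NA\<^esub> inv\<^bsub>NA\<^esub> (a g y)) = \<one>\<^bsub>Q\<^esub>" using cl_one aA g xy A'A by (simp add: invNA subset_eq)
      then have "cl (a g x) \<otimes>\<^bsub>Q\<^esub> inv\<^bsub>Q\<^esub> (cl (a g y)) = \<one>\<^bsub>Q\<^esub>"
        using cl.hom_mult[of "a g x" "inv\<^bsub>NA\<^esub> (a g y)"] cl.hom_inv[of "a g y"] NA.inv_closed[of "a g y"] aA g xy by simp
      then show "cl (a g x) = cl (a g y)" using aA g xy Q.inv_equality[of "cl (a g x)" "inv\<^bsub>Q\<^esub> (cl (a g y))"]
        by (simp)
    next
      fix h assume "h \<in> hom (NA Mod A') Q" "\<And>x. x \<in> carrier NA \<Longrightarrow> h (A' #>\<^bsub>NA\<^esub> x) = cl (a g x)"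
      then show thesis using that[of h] unfolding Q_def cl_def by simp
    qed
    interpret \<alpha>: group_hom Q Q \<alpha> using \<alpha>(1) by unfold_locales
    have step: "f ((R #> g) \<otimes>\<^bsub>Gb\<^esub> c) = cl (\<theta> g) \<otimes>\<^bsub>Q\<^esub> \<alpha> (f c)" if c: "c \<in> carrier Gb" for c
    proof -
      obtain x where x: "x \<in> carrier G" "c = R #> x" using Gb_elim c by blast
      have "(R #> g) \<otimes>\<^bsub>Gb\<^esub> c = R #> (g \<otimes> x)" unfolding Gb_def using x g by (simp add: R.rcos_sum)
      then have "f ((R #> g) \<otimes>\<^bsub>Gb\<^esub> c) = cl (\<theta> g \<otimes>\<^bsub>NA\<^esub> a g (\<theta> x))" using f_cl x g \<theta>(2) by simp
      also have "\<dots> = cl (\<theta> g) \<otimes>\<^bsub>Q\<^esub> \<alpha> (f c)" using x g \<theta>(1) aA \<alpha>(2) f_cl by simp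
      finally show ?thesis .
    qed
    have Rg: "R #> g \<in> carrier Gb" using g unfolding Gb_def by (auto simp: carrier_FactGroup)
    have tg: "cl (\<theta> g) \<in> carrier Q" using \<theta>(1) g by simp
    have "W = finprod Q (\<lambda>c. f ((R #> g) \<otimes>\<^bsub>Gb\<^esub> c)) (carrier Gb)"
      unfolding W_def using finprod_translate[OF Gb.is_group Q.comm_group_axioms Rg, of f] f_car by auto
    also have "\<dots> = finprod Q (\<lambda>c. cl (\<theta> g) \<otimes>\<^bsub>Q\<^esub> \<alpha> (f c)) (carrier Gb)"
      using f_car tg by (intro Q.finprod_cong') (auto simp: step)
    also have "\<dots> = finprod Q (\<lambda>c. cl (\<theta> g)) (carrier Gb) \<otimes>\<^bsub>Q\<^esub> finprod Q (\<lambda>c. \<alpha> (f c)) (carrier Gb)"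
      using f_car tg by (intro Q.finprod_multf) auto
    also have "\<dots> = cl (\<theta> g) [^]\<^bsub>Q\<^esub> m \<otimes>\<^bsub>Q\<^esub> \<alpha> W"
      unfolding W_def m_def using hom_finprod[OF Q.comm_group_axioms Q.comm_group_axioms \<alpha>(1), of f "carrier Gb"] f_car tg
      by (simp add: Q.finprod_const Pi_def)
    finally have W: "W = cl (\<theta> g) [^]\<^bsub>Q\<^esub> m \<otimes>\<^bsub>Q\<^esub> \<alpha> W" .
    have tk: "cl (\<theta> g) [^]\<^bsub>Q\<^esub> k = \<one>\<^bsub>Q\<^esub>"
    proof -
      have "cl (\<theta> g) [^]\<^bsub>Q\<^esub> k = cl (\<theta> g [^]\<^bsub>NA\<^esub> k)" using \<theta>(1) g by (simp add: cl.hom_nat_pow)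
      also have "\<theta> g [^]\<^bsub>NA\<^esub> k = \<one>\<^bsub>NA\<^esub>" using k(3) \<theta>(1) g N.nat_pow_consistent[of "\<theta> g" k A] by (simp add: NA_def)
      finally show ?thesis using cl.hom_one by simp
    qed
    have "cl v = (cl (\<theta> g) [^]\<^bsub>Q\<^esub> m) [^]\<^bsub>Q\<^esub> e \<otimes>\<^bsub>Q\<^esub> \<alpha> W [^]\<^bsub>Q\<^esub> e"
      using W v(2) tg Wc by (metis Q.nat_pow_closed Q.pow_mult_distrib Q.m_comm \<alpha>.hom_closed)
    also have "(cl (\<theta> g) [^]\<^bsub>Q\<^esub> m) [^]\<^bsub>Q\<^esub> e = cl (\<theta> g)"
      using tg tk by (simp add: Q.nat_pow_pow eq Q.nat_pow_mult[symmetric] del: Q.nat_pow_mult)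
        (simp add: Q.nat_pow_pow[symmetric])
    also have "\<alpha> W [^]\<^bsub>Q\<^esub> e = \<alpha> (cl v)" using Wc v(2) by (simp add: \<alpha>.hom_nat_pow[symmetric])
    also have "\<dots> = cl (a g v)" using \<alpha>(2) v(1) by simp
    finally have "cl v = cl (\<theta> g \<otimes>\<^bsub>NA\<^esub> a g v)" using \<theta>(1) g aA v(1) by simp
    then have "cl (inv\<^bsub>NA\<^esub> v \<otimes>\<^bsub>NA\<^esub> (\<theta> g \<otimes>\<^bsub>NA\<^esub> a g v)) = \<one>\<^bsub>Q\<^esub>"
      using \<theta>(1) g aA v(1) NA.m_closed NA.inv_closed by (metis Q.l_inv cl.hom_closed cl.hom_inv cl.hom_mult \<open>carrier NA = A\<close>)
    then have "inv\<^bsub>N\<^esub> v \<otimes>\<^bsub>N\<^esub> (\<theta> g \<otimes>\<^bsub>N\<^esub> a g v) \<in> A'"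
      using cl_one[of "inv\<^bsub>NA\<^esub> v \<otimes>\<^bsub>NA\<^esub> (\<theta> g \<otimes>\<^bsub>NA\<^esub> a g v)"] \<theta>(1) g aA v(1) NA.m_closed NA.inv_closed
      by (simp add: invNA)
    then show ?thesis using \<theta>(1) g aA v(1) AN by (simp add: N.m_assoc subset_eq)
  qed
  then show ?thesis using v(1) by blast
qed

end

section \<open>Cocycles that agree on a normal subgroup of coprime index\<close>

text \<open>
  The indexing descends, as for the lower central series. That the factors are abelian is
  expressed by commutators so that no quotient groups have to be formed.
\<close>

definition abelian_chain :: "('n, 'b) monoid_scheme \<Rightarrow> (nat \<Rightarrow> 'n set) \<Rightarrow> nat \<Rightarrow> bool" where
  "abelian_chain N K n \<longleftrightarrow> K 0 = carrier N \<and> K n = {\<one>\<^bsub>N\<^esub>} \<and> (\<forall>i\<le>n. K i \<lhd> N) \<and>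
     (\<forall>i<n. K (Suc i) \<subseteq> K i \<and>
       (\<forall>x\<in>K i. \<forall>y\<in>K i. x \<otimes>\<^bsub>N\<^esub> y \<otimes>\<^bsub>N\<^esub> inv\<^bsub>N\<^esub> x \<otimes>\<^bsub>N\<^esub> inv\<^bsub>N\<^esub> y \<in> K (Suc i)))"

context left_action
begin

text \<open>
  The subgroup \<open>S\<close> on which \<open>R\<close> acts trivially is needed because the
  averaging step requires a cocycle that is constant on cosets of \<open>R\<close>, and
  multiplication by the coboundary of \<open>v\<close> preserves this property only if
  \<open>R\<close> fixes \<open>v\<close>.
\<close>

lemma coprime_cocycle_trivial_fixed:
  assumes R: "R \<lhd> G" "finite (rcosets R)"
    and k: "coprime k (card (rcosets R))" "k > 0" "\<And>x. x \<in> carrier N \<Longrightarrow> x [^]\<^bsub>N\<^esub> (k::nat) = \<one>\<^bsub>N\<^esub>"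
    and K: "abelian_chain N K n"
    and aK: "\<And>i g x. i \<le> n \<Longrightarrow> g \<in> carrier G \<Longrightarrow> x \<in> K i \<Longrightarrow> a g x \<in> K i"
    and S: "subgroup S N" "\<And>g x. g \<in> carrier G \<Longrightarrow> x \<in> S \<Longrightarrow> a g x \<in> S"
      "\<And>r x. r \<in> R \<Longrightarrow> x \<in> S \<Longrightarrow> a r x = x"
    and \<theta>: "cocycle (carrier G) \<theta>" "\<And>g. g \<in> carrier G \<Longrightarrow> \<theta> g \<in> S" "\<And>r. r \<in> R \<Longrightarrow> \<theta> r = \<one>\<^bsub>N\<^esub>"
  shows "\<exists>v\<in>S. \<forall>g\<in>carrier G. inv\<^bsub>N\<^esub> v \<otimes>\<^bsub>N\<^esub> \<theta> g \<otimes>\<^bsub>N\<^esub> a g v = \<one>\<^bsub>N\<^esub>"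
proof -
  interpret R: normal R G by fact
  interpret S: subgroup S N by fact
  have RG: "R \<subseteq> carrier G" by (rule R.subset)
  have SN: "x \<in> S \<Longrightarrow> x \<in> carrier N" for x by (rule S.mem_carrier)
  have "\<exists>v\<in>S. \<forall>g\<in>carrier G. inv\<^bsub>N\<^esub> v \<otimes>\<^bsub>N\<^esub> \<theta> g \<otimes>\<^bsub>N\<^esub> a g v \<in> K i" if "i \<le> n" for i
    using that
  proof (induction i)
    case 0
    then show ?case using K \<theta>(2) SN unfolding abelian_chain_def by (intro bexI[of _ "\<one>\<^bsub>N\<^esub>"]) auto
  next
    case (Suc i)
    then obtain v where v: "v \<in> S" "\<And>g. g \<in> carrier G \<Longrightarrow> inv\<^bsub>N\<^esub> v \<otimes>\<^bsub>N\<^esub> \<theta> g \<otimes>\<^bsub>N\<^esub> a g v \<in> K i" by auto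
    define \<theta>' where "\<theta>' = (\<lambda>g. inv\<^bsub>N\<^esub> v \<otimes>\<^bsub>N\<^esub> \<theta> g \<otimes>\<^bsub>N\<^esub> a g v)"
    have vN: "v \<in> carrier N" using v SN by simp
    have \<theta>N: "\<theta> g \<in> carrier N" if "g \<in> carrier G" for g using \<theta>(2) SN that by simp
    have nK: "K i \<lhd> N" "K (Suc i) \<lhd> N" using K Suc.prems unfolding abelian_chain_def by auto
    have sK: "subgroup (K i) N" "subgroup (K (Suc i)) N" using nK normal_imp_subgroup by auto
    have KK: "K (Suc i) \<subseteq> K i" using K Suc.prems unfolding abelian_chain_def by auto
    have sA: "subgroup (S \<inter> K i) N" by (rule N.subgroups_Inter_pair[OF S(1) sK(1)])
    have "\<exists>w\<in>S \<inter> K i. \<forall>g\<in>carrier G. inv\<^bsub>N\<^esub> w \<otimes>\<^bsub>N\<^esub> \<theta>' g \<otimes>\<^bsub>N\<^esub> a g w \<in> S \<inter> K (Suc i)"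
    proof (rule averaging_step[OF R sA _ _ _ _ k(1,2)])
      interpret NA: group "N\<lparr>carrier := S \<inter> K i\<rparr>" using sA N.subgroup_imp_group by blast
      have "subgroup (S \<inter> K (Suc i)) (N\<lparr>carrier := S \<inter> K i\<rparr>)"
        by (rule N.subgroup_incl[OF N.subgroups_Inter_pair[OF S(1) sK(2)] sA]) (use KK in auto)
      then show "S \<inter> K (Suc i) \<lhd> N\<lparr>carrier := S \<inter> K i\<rparr>"
      proof (rule NA.normal_invI)
        fix x h assume "x \<in> carrier (N\<lparr>carrier := S \<inter> K i\<rparr>)" "h \<in> S \<inter> K (Suc i)"
        then show "x \<otimes>\<^bsub>N\<lparr>carrier := S \<inter> K i\<rparr>\<^esub> h \<otimes>\<^bsub>N\<lparr>carrier := S \<inter> K i\<rparr>\<^esub> inv\<^bsub>N\<lparr>carrier := S \<inter> K i\<rparr>\<^esub> x \<in> S \<inter> K (Suc i)"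
          using N.m_inv_consistent[OF sA, of x] N.normal_invE(2)[OF nK(2), of x h] SN by simp
      qed
    next
      fix x y assume "x \<in> S \<inter> K i" "y \<in> S \<inter> K i"
      then show "x \<otimes>\<^bsub>N\<^esub> y \<otimes>\<^bsub>N\<^esub> inv\<^bsub>N\<^esub> x \<otimes>\<^bsub>N\<^esub> inv\<^bsub>N\<^esub> y \<in> S \<inter> K (Suc i)"
        using K Suc.prems unfolding abelian_chain_def by simp
    next
      fix g h assume g: "g \<in> carrier G" and h: "h \<in> carrier G"
      show "\<theta>' (g \<otimes> h) = \<theta>' g \<otimes>\<^bsub>N\<^esub> a g (\<theta>' h)"
        using g h vN \<theta>N \<theta>(1) unfolding \<theta>'_def cocycle_def
        by (simp add: N.m_assoc N.cancel_inv_left a_mult)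
    next
      fix r g assume r: "r \<in> R" and g: "g \<in> carrier G"
      then have "\<theta> (r \<otimes> g) = \<theta> g" "a (r \<otimes> g) v = a g v" 
        using \<theta> S v RG unfolding cocycle_def by (auto simp: a_mult vN SN subset_eq)
      then show "\<theta>' (r \<otimes> g) = \<theta>' g" unfolding \<theta>'_def by simp
    next
      fix g assume "g \<in> carrier G"
      then show "\<theta>' g \<in> S \<inter> K i" using v \<theta>(2) S(2) unfolding \<theta>'_def by simp
    qed (use aK[of i] aK[of "Suc i"] Suc.prems S(2) k(3) SN in auto)
    then obtain w where w: "w \<in> S" "\<And>g. g \<in> carrier G \<Longrightarrow> inv\<^bsub>N\<^esub> w \<otimes>\<^bsub>N\<^esub> \<theta>' g \<otimes>\<^bsub>N\<^esub> a g w \<in> K (Suc i)" by blast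
    have "inv\<^bsub>N\<^esub> (v \<otimes>\<^bsub>N\<^esub> w) \<otimes>\<^bsub>N\<^esub> \<theta> g \<otimes>\<^bsub>N\<^esub> a g (v \<otimes>\<^bsub>N\<^esub> w) \<in> K (Suc i)" if "g \<in> carrier G" for g
      using w(2)[OF that] w(1) vN \<theta>N[OF that] that SN unfolding \<theta>'_def
      by (simp add: N.m_assoc N.inv_mult_group)
    then show ?case using v(1) w(1) by blast
  qed
  from this[of n] show ?thesis using K unfolding abelian_chain_def by simp
qed

text \<open>
  The values of a cocycle that is trivial on the normal subgroup \<open>R\<close> are fixed by
  \<open>R\<close>: compare the values at \<open>r g\<close> and at \<open>g (g\<inverse> r
  g)\<close>. So the fixed points of \<open>R\<close> can be taken for \<open>S\<close>.
\<close>

lemma coprime_cocycle_trivial: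
  assumes R: "R \<lhd> G" "finite (rcosets R)"
    and k: "coprime k (card (rcosets R))" "k > 0" "\<And>x. x \<in> carrier N \<Longrightarrow> x [^]\<^bsub>N\<^esub> (k::nat) = \<one>\<^bsub>N\<^esub>"
    and K: "abelian_chain N K n"
    and aK: "\<And>i g x. i \<le> n \<Longrightarrow> g \<in> carrier G \<Longrightarrow> x \<in> K i \<Longrightarrow> a g x \<in> K i"
    and \<theta>: "cocycle (carrier G) \<theta>" "\<And>r. r \<in> R \<Longrightarrow> \<theta> r = \<one>\<^bsub>N\<^esub>"
  shows "\<exists>v\<in>carrier N. \<forall>g\<in>carrier G. inv\<^bsub>N\<^esub> v \<otimes>\<^bsub>N\<^esub> \<theta> g \<otimes>\<^bsub>N\<^esub> a g v = \<one>\<^bsub>N\<^esub>"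
proof -
  interpret R: normal R G by fact
  define S where "S = {x \<in> carrier N. \<forall>r\<in>R. a r x = x}"
  have rG: "r \<in> R \<Longrightarrow> r \<in> carrier G" for r by (rule R.mem_carrier)
  have swap: "inv g \<otimes> r \<otimes> g \<in> R" "r \<otimes> g = g \<otimes> (inv g \<otimes> r \<otimes> g)" if "r \<in> R" "g \<in> carrier G" for r g
    using that R.inv_op_closed1 rG by (auto simp: G.m_assoc G.cancel_inv_left)
  have S: "subgroup S N"
    by (rule N.subgroupI) (auto simp: S_def rG)
  have aS: "a g x \<in> S" if g: "g \<in> carrier G" and x: "x \<in> S" for g x
  proof -
    have "a r (a g x) = a g x" if r: "r \<in> R" for r
    proof -
      have xN: "x \<in> carrier N" using x unfolding S_def by simp
      have "a r (a g x) = a (r \<otimes> g) x" using g xN rG[OF r] by (simp add: a_mult)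
      also have "\<dots> = a (g \<otimes> (inv g \<otimes> r \<otimes> g)) x" using swap(2)[OF r g] by simp
      also have "\<dots> = a g (a (inv g \<otimes> r \<otimes> g) x)" using g xN rG[OF r] by (intro a_mult) auto
      finally have "a r (a g x) = a g (a (inv g \<otimes> r \<otimes> g) x)" .
      then show ?thesis using swap(1)[OF r g] x unfolding S_def by simp
    qed
    then show ?thesis using g x unfolding S_def by simp
  qed
  have \<theta>N: "\<theta> g \<in> carrier N" if "g \<in> carrier G" for g using \<theta>(1) that unfolding cocycle_def by simp
  have \<theta>S: "\<theta> g \<in> S" if g: "g \<in> carrier G" for g
  proof -
    have "a r (\<theta> g) = \<theta> g" if r: "r \<in> R" for r
    proof -
      have "a r (\<theta> g) = \<theta> (r \<otimes> g)" using \<theta> r g rG \<theta>N unfolding cocycle_def by simp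
      also have "\<dots> = \<theta> (g \<otimes> (inv g \<otimes> r \<otimes> g))" using swap[OF r g] by simp
      also have "\<dots> = \<theta> g" using \<theta>(1) g \<theta>N rG[OF swap(1)[OF r g]] \<theta>(2)[OF swap(1)[OF r g]] unfolding cocycle_def by simp
      finally show ?thesis .
    qed
    then show ?thesis using \<theta>N g unfolding S_def by simp
  qed
  have "\<exists>v\<in>S. \<forall>g\<in>carrier G. inv\<^bsub>N\<^esub> v \<otimes>\<^bsub>N\<^esub> \<theta> g \<otimes>\<^bsub>N\<^esub> a g v = \<one>\<^bsub>N\<^esub>"
    by (rule coprime_cocycle_trivial_fixed[OF R k K aK S aS _ \<theta>(1) \<theta>S \<theta>(2)]) (simp_all add: S_def)
  then show ?thesis unfolding S_def by blast
qed

lemma restrict_action: "subgroup H G \<Longrightarrow> left_action (G\<lparr>carrier := H\<rparr>) N a"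
  by (intro left_action.intro left_action_axioms.intro)
    (auto simp: G.subgroup_imp_group N.is_group a_hom a_one a_mult subgroup.mem_carrier)

text \<open>
  The element \<open>n\<close> is kept as a parameter because it has to be compared and combined
  over the primary components of \<open>N\<close>.
\<close>

definition cohomologous_by :: "'g set \<Rightarrow> 'n \<Rightarrow> ('g \<Rightarrow> 'n) \<Rightarrow> ('g \<Rightarrow> 'n) \<Rightarrow> bool" where
  "cohomologous_by H n \<phi> \<psi> \<longleftrightarrow> n \<in> carrier N \<and> (\<forall>x\<in>H. \<psi> x = inv\<^bsub>N\<^esub> n \<otimes>\<^bsub>N\<^esub> \<phi> x \<otimes>\<^bsub>N\<^esub> a x n)"

text \<open>
  Twisting the action by \<open>\<phi>\<close>, that is, letting \<open>g\<close> act by \<open>b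
  g n = \<phi> g \<cdot> a g n \<cdot> (\<phi> g)\<inverse>\<close>, turns the quotient
  \<open>\<theta> = \<psi> \<phi>\<inverse>\<close> into a cocycle. It is trivial on
  \<open>R\<close>, hence a coboundary.
\<close>

lemma cocycle_unique_extension:
  assumes H: "subgroup H G" and R: "R \<lhd> G\<lparr>carrier := H\<rparr>" "finite (rcosets\<^bsub>G\<lparr>carrier := H\<rparr>\<^esub> R)"
    and k: "coprime k (card (rcosets\<^bsub>G\<lparr>carrier := H\<rparr>\<^esub> R))" "k > 0"
      "\<And>x. x \<in> carrier N \<Longrightarrow> x [^]\<^bsub>N\<^esub> (k::nat) = \<one>\<^bsub>N\<^esub>"
    and K: "abelian_chain N K n"
    and aK: "\<And>i g x. i \<le> n \<Longrightarrow> g \<in> H \<Longrightarrow> x \<in> K i \<Longrightarrow> a g x \<in> K i"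
    and \<phi>: "cocycle H \<phi>" and \<psi>: "cocycle H \<psi>" and eq: "\<And>r. r \<in> R \<Longrightarrow> \<phi> r = \<psi> r"
  shows "\<exists>v. cohomologous_by H v \<phi> \<psi>"
proof -
  interpret H: subgroup H G by fact
  have HG: "x \<in> H \<Longrightarrow> x \<in> carrier G" for x by (rule H.mem_carrier)
  have \<phi>N: "\<phi> x \<in> carrier N" and \<psi>N: "\<psi> x \<in> carrier N" if "x \<in> H" for x
    using \<phi> \<psi> that unfolding cocycle_def by auto
  have \<phi>m: "\<phi> (x \<otimes> y) = \<phi> x \<otimes>\<^bsub>N\<^esub> a x (\<phi> y)" and \<psi>m: "\<psi> (x \<otimes> y) = \<psi> x \<otimes>\<^bsub>N\<^esub> a x (\<psi> y)" if "x \<in> H" "y \<in> H" for x y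
    using \<phi> \<psi> that unfolding cocycle_def by auto
  have \<phi>1: "\<phi> \<one> = \<one>\<^bsub>N\<^esub>"
  proof -
    have "\<phi> \<one> = \<phi> \<one> \<otimes>\<^bsub>N\<^esub> \<phi> \<one>" using \<phi>m[of \<one> \<one>] \<phi>N[of \<one>] by (simp add: a_one)
    then show ?thesis using \<phi>N[of \<one>] N.l_cancel_one' by simp
  qed
  define b where "b = (\<lambda>g n. \<phi> g \<otimes>\<^bsub>N\<^esub> a g n \<otimes>\<^bsub>N\<^esub> inv\<^bsub>N\<^esub> (\<phi> g))"
  define \<theta> where "\<theta> = (\<lambda>g. \<psi> g \<otimes>\<^bsub>N\<^esub> inv\<^bsub>N\<^esub> (\<phi> g))"
  have act: "left_action (G\<lparr>carrier := H\<rparr>) N b"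
  proof (intro left_action.intro left_action_axioms.intro)
    fix g assume g: "g \<in> carrier (G\<lparr>carrier := H\<rparr>)"
    show "b g \<in> hom N N"
      by (rule homI) (use g in \<open>auto simp: b_def \<phi>N HG N.m_assoc N.cancel_inv_left\<close>)
  next
    fix n assume "n \<in> carrier N"
    then show "b \<one>\<^bsub>G\<lparr>carrier := H\<rparr>\<^esub> n = n" by (simp add: b_def \<phi>1 a_one)
  next
    fix g h n assume "g \<in> carrier (G\<lparr>carrier := H\<rparr>)" "h \<in> carrier (G\<lparr>carrier := H\<rparr>)" "n \<in> carrier N"
    then show "b (g \<otimes>\<^bsub>G\<lparr>carrier := H\<rparr>\<^esub> h) n = b g (b h n)"
      by (simp add: b_def \<phi>N HG \<phi>m a_mult N.m_assoc N.inv_mult_group)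
  qed (auto simp: G.subgroup_imp_group H N.is_group)
  interpret b: left_action "G\<lparr>carrier := H\<rparr>" N b by (rule act)
  have RH: "r \<in> R \<Longrightarrow> r \<in> H" for r using R(1) normal_imp_subgroup subgroup.mem_carrier by fastforce
  have "\<exists>v\<in>carrier N. \<forall>g\<in>carrier (G\<lparr>carrier := H\<rparr>). inv\<^bsub>N\<^esub> v \<otimes>\<^bsub>N\<^esub> \<theta> g \<otimes>\<^bsub>N\<^esub> b g v = \<one>\<^bsub>N\<^esub>"
  proof (rule b.coprime_cocycle_trivial[OF R k K])
    fix i g x assume i: "i \<le> n" and g: "g \<in> carrier (G\<lparr>carrier := H\<rparr>)" and x: "x \<in> K i"
    have "K i \<lhd> N" using K i unfolding abelian_chain_def by simp
    then show "b g x \<in> K i" using aK[OF i _ x] g N.normal_invE(2)[of "K i" "\<phi> g" "a g x"] \<phi>N by (simp add: b_def)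
  next
    show "b.cocycle (carrier (G\<lparr>carrier := H\<rparr>)) \<theta>"
      unfolding b.cocycle_def unfolding \<theta>_def b_def
      by (auto simp: \<phi>N \<psi>N HG \<phi>m \<psi>m N.m_assoc N.inv_mult_group N.cancel_inv_left)
  next
    fix r assume "r \<in> R"
    then show "\<theta> r = \<one>\<^bsub>N\<^esub>" unfolding \<theta>_def using eq RH \<psi>N by simp
  qed
  then obtain v where v: "v \<in> carrier N" "\<And>g. g \<in> H \<Longrightarrow> inv\<^bsub>N\<^esub> v \<otimes>\<^bsub>N\<^esub> \<theta> g \<otimes>\<^bsub>N\<^esub> b g v = \<one>\<^bsub>N\<^esub>" by auto
  have "\<psi> g = v \<otimes>\<^bsub>N\<^esub> \<phi> g \<otimes>\<^bsub>N\<^esub> inv\<^bsub>N\<^esub> (a g v)" if g: "g \<in> H" for g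
  proof -
    have "v \<otimes>\<^bsub>N\<^esub> (inv\<^bsub>N\<^esub> v \<otimes>\<^bsub>N\<^esub> \<theta> g \<otimes>\<^bsub>N\<^esub> b g v) \<otimes>\<^bsub>N\<^esub> \<phi> g \<otimes>\<^bsub>N\<^esub> inv\<^bsub>N\<^esub> (a g v) = v \<otimes>\<^bsub>N\<^esub> \<phi> g \<otimes>\<^bsub>N\<^esub> inv\<^bsub>N\<^esub> (a g v)"
      using v(2)[OF g] v(1) by simp
    then show ?thesis unfolding \<theta>_def b_def using g v(1) by (simp add: \<phi>N \<psi>N HG N.m_assoc N.cancel_inv_left)
  qed
  then have "cohomologous_by H (inv\<^bsub>N\<^esub> v) \<phi> \<psi>" using v(1) unfolding cohomologous_by_def by (simp add: HG)
  then show ?thesis by blast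
qed

end

section \<open>Relative complements\<close>

text \<open>
  The crossed homomorphism \<open>d g = \<Prod>\<^sub>c g s(c) s(g c)\<inverse>\<close> into the
  abelian group \<open>D/E\<close>, where \<open>s\<close> is a section of \<open>G \<rightarrow>
  G/D\<close>, restricts to the \<open>m\<close>-th power map on \<open>D\<close> with \<open>m =
  |G : D|\<close>. Since \<open>m\<close> is prime to the exponent of \<open>D/E\<close>, this
  restriction is bijective modulo \<open>E\<close>, and the zero set of \<open>d\<close> is the
  complement.
\<close>

lemma (in group) relative_complement_step:
  assumes D: "D \<lhd> G" and E: "E \<lhd> G" and ED: "E \<subseteq> D"
    and comm: "\<And>x y. x \<in> D \<Longrightarrow> y \<in> D \<Longrightarrow> x \<otimes> y \<otimes> inv x \<otimes> inv y \<in> E"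
    and fin: "finite (rcosets D)"
    and k: "coprime k (card (rcosets D))" "k > 0" "\<And>x. x \<in> D \<Longrightarrow> x [^] (k::nat) \<in> E"
  shows "\<exists>H. subgroup H G \<and> H \<inter> D = E \<and> (\<forall>g\<in>carrier G. \<exists>d\<in>D. \<exists>h\<in>H. g = d \<otimes> h)"
proof -
  interpret D: normal D G by fact
  interpret E: normal E G by fact
  define GD where "GD = G\<lparr>carrier := D\<rparr>"
  interpret GD: group GD unfolding GD_def using D.subgroup_axioms by (simp add: subgroup_imp_group)
  have GD_simps [simp]: "carrier GD = D" "monoid.mult GD = monoid.mult G" "\<one>\<^bsub>GD\<^esub> = \<one>" by (auto simp: GD_def)
  have invGD: "inv\<^bsub>GD\<^esub> x = inv x" if "x \<in> D" for x
    unfolding GD_def using m_inv_consistent[OF D.subgroup_axioms that] by simp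
  have powGD: "x [^]\<^bsub>GD\<^esub> (j::nat) = x [^] j" for x j
    unfolding GD_def using nat_pow_consistent[of x j D] by simp
  have DG: "x \<in> D \<Longrightarrow> x \<in> carrier G" for x by (rule D.mem_carrier)
  have EG: "x \<in> E \<Longrightarrow> x \<in> carrier G" for x by (rule E.mem_carrier)
  have EsubGD: "subgroup E GD" unfolding GD_def
    by (rule subgroup_incl[OF E.subgroup_axioms D.subgroup_axioms ED])
  have E_GD: "E \<lhd> GD"
    by (rule GD.normal_invI[OF EsubGD]) (simp add: invGD E.inv_op_closed2 DG)
  interpret E': normal E GD by (rule E_GD)
  define A where "A = GD Mod E"
  interpret A: comm_group A unfolding A_def
    using GD.FactGroup_abelian[OF E_GD] comm by (simp add: invGD)
  define cl where "cl = (\<lambda>x. E #>\<^bsub>GD\<^esub> x)"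
  have cl_hom: "cl \<in> hom GD A" unfolding cl_def A_def by (rule E'.r_coset_hom_Mod)
  interpret cl: group_hom GD A cl using cl_hom by unfold_locales
  have cl_mult [simp]: "cl (x \<otimes> y) = cl x \<otimes>\<^bsub>A\<^esub> cl y" if "x \<in> D" "y \<in> D" for x y
    using cl.hom_mult[of x y] that by simp
  have cl_closed [simp]: "cl x \<in> carrier A" if "x \<in> D" for x
    using cl.hom_closed[of x] that by simp
  have cl_pow: "cl (x [^] (j::nat)) = cl x [^]\<^bsub>A\<^esub> j" if "x \<in> D" for x j
    using cl.hom_nat_pow[of x j] that by (simp add: powGD)
  have cl_surj: "\<exists>x\<in>D. X = cl x" if "X \<in> carrier A" for X
    using that unfolding A_def cl_def by (auto simp: carrier_FactGroup)
  have cl_one: "cl x = \<one>\<^bsub>A\<^esub> \<longleftrightarrow> x \<in> E" if "x \<in> D" for x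
    using that unfolding cl_def A_def
    by (metis E'.rcos_const EsubGD GD.coset_join1 GD.is_group GD_simps(1) one_FactGroup)
  have cl_k: "X [^]\<^bsub>A\<^esub> k = \<one>\<^bsub>A\<^esub>" if "X \<in> carrier A" for X
  proof -
    obtain x where x: "x \<in> D" "X = cl x" using cl_surj[OF \<open>X \<in> carrier A\<close>] by blast
    then have "X [^]\<^bsub>A\<^esub> k = cl (x [^] k)" by (simp add: cl_pow)
    then show ?thesis using k(3)[OF x(1)] cl_one[of "x [^] k"] ED by auto
  qed
  define Gb where "Gb = G Mod D"
  interpret Gb: group Gb unfolding Gb_def by (rule D.factorgroup_is_group)
  have carGb: "carrier Gb = rcosets D" unfolding Gb_def FactGroup_def by simp
  define m where "m = card (carrier Gb)"
  have m0: "m > 0" unfolding m_def using fin carGb Gb.one_closed by (metis card_gt_0_iff empty_iff)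
  obtain e q where eq: "m * e = 1 + k * q"
    using coprime_power_inverse[of k m] k m0 unfolding m_def carGb by metis
  have root: "(X [^]\<^bsub>A\<^esub> m) [^]\<^bsub>A\<^esub> e = X" if X: "X \<in> carrier A" for X
  proof -
    have "(X [^]\<^bsub>A\<^esub> m) [^]\<^bsub>A\<^esub> e = X [^]\<^bsub>A\<^esub> (1 + k * q)" using X by (simp add: A.nat_pow_pow eq)
    also have "\<dots> = X [^]\<^bsub>A\<^esub> (1::nat) \<otimes>\<^bsub>A\<^esub> (X [^]\<^bsub>A\<^esub> k) [^]\<^bsub>A\<^esub> q" using X
      by (metis A.nat_pow_mult A.nat_pow_pow)
    also have "\<dots> = X" using X cl_k[OF X] by simp
    finally show ?thesis .
  qed
  have Dg: "D #> g \<in> carrier Gb" if "g \<in> carrier G" for g using that by (auto simp: Gb_def carrier_FactGroup)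
  have Gb_elim: "\<exists>x\<in>carrier G. c = D #> x" if "c \<in> carrier Gb" for c
    using that by (auto simp: Gb_def carrier_FactGroup)
  define s :: "'a set \<Rightarrow> 'a" where "s = (\<lambda>c. SOME x. x \<in> c)"
  have s_in: "s c \<in> c" if c: "c \<in> carrier Gb" for c
  proof -
    obtain x where "x \<in> carrier G" "c = D #> x" using Gb_elim[OF c] by blast
    then have "x \<in> c" using rcos_self[OF _ D.subgroup_axioms] by simp
    then show ?thesis unfolding s_def by (rule someI)
  qed
  have sG: "s c \<in> carrier G" if c: "c \<in> carrier Gb" for c
    using s_in[OF c] Gb_elim[OF c] D.elemrcos_carrier[OF is_group] by blast
  \<comment> \<open>The element of \<open>D\<close> by which left multiplication by \<open>g\<close> fails to
    respect the section.\<close>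
  define t where "t = (\<lambda>g c. g \<otimes> s c \<otimes> inv (s ((D #> g) \<otimes>\<^bsub>Gb\<^esub> c)))"
  have tD: "t g c \<in> D" if g: "g \<in> carrier G" and c: "c \<in> carrier Gb" for g c
  proof -
    obtain x where x: "x \<in> carrier G" "c = D #> x" using Gb_elim[OF c] by blast
    have c': "(D #> g) \<otimes>\<^bsub>Gb\<^esub> c \<in> carrier Gb" using Dg[OF g] c by simp
    have "g \<otimes> s c \<in> D #> (g \<otimes> s c)" using g sG[OF c] by (intro rcos_self D.subgroup_axioms) simp
    also have "D #> (g \<otimes> s c) = (D #> g) \<otimes>\<^bsub>Gb\<^esub> (D #> s c)" unfolding Gb_def using g sG[OF c] by (simp add: D.rcos_sum)
    also have "D #> s c = c" using repr_independence[OF _ x(1) D.subgroup_axioms, of "s c"] s_in[OF c] x(2) by simp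
    finally have "g \<otimes> s c \<in> (D #> g) \<otimes>\<^bsub>Gb\<^esub> c" .
    then show ?thesis unfolding t_def
      using diff_neutralizes[OF D.subgroup_axioms _ _ s_in[OF c']] c' carGb by simp
  qed
  define d where "d = (\<lambda>g. finprod A (\<lambda>c. cl (t g c)) (carrier Gb))"
  have dA: "d g \<in> carrier A" if "g \<in> carrier G" for g
    unfolding d_def using tD[OF that] by (intro A.finprod_closed) auto
  have conj_hom: "\<exists>\<alpha>. \<alpha> \<in> hom A A \<and> (\<forall>x\<in>D. \<alpha> (cl x) = cl (g \<otimes> x \<otimes> inv g))" if g: "g \<in> carrier G" for g
  proof -
    have cD: "g \<otimes> x \<otimes> inv g \<in> D" if "x \<in> D" for x using D.inv_op_closed2[OF g that] .
    have hg: "(\<lambda>x. cl (g \<otimes> x \<otimes> inv g)) \<in> hom GD A"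
    proof (rule homI)
      fix x y assume xy: "x \<in> carrier GD" "y \<in> carrier GD"
      then have "g \<otimes> (x \<otimes> y) \<otimes> inv g = (g \<otimes> x \<otimes> inv g) \<otimes> (g \<otimes> y \<otimes> inv g)"
        using g DG by (simp add: m_assoc cancel_inv_left)
      then show "cl (g \<otimes> (x \<otimes>\<^bsub>GD\<^esub> y) \<otimes> inv g) = cl (g \<otimes> x \<otimes> inv g) \<otimes>\<^bsub>A\<^esub> cl (g \<otimes> y \<otimes> inv g)"
        using xy cD by simp
    qed (use cD in auto)
    show ?thesis
    proof (rule FactGroup_universal[OF hg E_GD])
      fix x y assume xy: "x \<in> carrier GD" "y \<in> carrier GD" "E #>\<^bsub>GD\<^esub> x = E #>\<^bsub>GD\<^esub> y"
      then have "y \<in> E #>\<^bsub>GD\<^esub> x" by (intro GD.repr_independenceD[OF EsubGD]) auto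
      then obtain z where z: "z \<in> E" "y = z \<otimes> x" by (auto simp: r_coset_def)
      have "g \<otimes> y \<otimes> inv g = (g \<otimes> z \<otimes> inv g) \<otimes> (g \<otimes> x \<otimes> inv g)"
        using g z xy DG EG by (simp add: m_assoc cancel_inv_left)
      moreover have "g \<otimes> z \<otimes> inv g \<in> E" using E.inv_op_closed2[OF g z(1)] .
      ultimately show "cl (g \<otimes> x \<otimes> inv g) = cl (g \<otimes> y \<otimes> inv g)"
        using cl_one[of "g \<otimes> z \<otimes> inv g"] ED cD xy by auto
    next
      fix h assume "h \<in> hom (GD Mod E) A" "\<And>x. x \<in> carrier GD \<Longrightarrow> h (E #>\<^bsub>GD\<^esub> x) = cl (g \<otimes> x \<otimes> inv g)"
      then show "\<exists>\<alpha>. \<alpha> \<in> hom A A \<and> (\<forall>x\<in>D. \<alpha> (cl x) = cl (g \<otimes> x \<otimes> inv g))"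
        unfolding A_def[symmetric] cl_def[symmetric] by auto
    qed
  qed
  have "\<forall>g\<in>carrier G. \<exists>\<alpha>. \<alpha> \<in> hom A A \<and> (\<forall>x\<in>D. \<alpha> (cl x) = cl (g \<otimes> x \<otimes> inv g))"
    using conj_hom by blast
  from bchoice[OF this] obtain \<alpha> where
    \<alpha>: "\<And>g. g \<in> carrier G \<Longrightarrow> \<alpha> g \<in> hom A A"
      "\<And>g x. g \<in> carrier G \<Longrightarrow> x \<in> D \<Longrightarrow> \<alpha> g (cl x) = cl (g \<otimes> x \<otimes> inv g)"
    by blast
  \<comment> \<open>\<open>d\<close> is a crossed homomorphism for the conjugation action \<open>\<alpha>\<close>
    of \<open>G\<close> on \<open>D/E\<close>.\<close>
  have d_mult: "d (g \<otimes> h) = \<alpha> g (d h) \<otimes>\<^bsub>A\<^esub> d g" if g: "g \<in> carrier G" and h: "h \<in> carrier G" for g h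
  proof -
    have t_mult: "t (g \<otimes> h) c = (g \<otimes> t h c \<otimes> inv g) \<otimes> t g ((D #> h) \<otimes>\<^bsub>Gb\<^esub> c)" if c: "c \<in> carrier Gb" for c
    proof -
      have "(D #> (g \<otimes> h)) \<otimes>\<^bsub>Gb\<^esub> c = (D #> g) \<otimes>\<^bsub>Gb\<^esub> ((D #> h) \<otimes>\<^bsub>Gb\<^esub> c)"
        using Gb.m_assoc[OF Dg[OF g] Dg[OF h] c] D.rcos_sum[OF g h] by (simp add: Gb_def)
      moreover have "s ((D #> h) \<otimes>\<^bsub>Gb\<^esub> c) \<in> carrier G" "s ((D #> g) \<otimes>\<^bsub>Gb\<^esub> ((D #> h) \<otimes>\<^bsub>Gb\<^esub> c)) \<in> carrier G"
        using sG Dg g h c by auto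
      ultimately show ?thesis unfolding t_def
        using g h sG[OF c] by (simp add: m_assoc cancel_inv_left)
    qed
    have cD: "g \<otimes> x \<otimes> inv g \<in> D" if "x \<in> D" for x using D.inv_op_closed2[OF g that] .
    have hc: "(D #> h) \<otimes>\<^bsub>Gb\<^esub> c \<in> carrier Gb" if "c \<in> carrier Gb" for c using Dg[OF h] that by simp
    have "d (g \<otimes> h) = finprod A (\<lambda>c. \<alpha> g (cl (t h c)) \<otimes>\<^bsub>A\<^esub> cl (t g ((D #> h) \<otimes>\<^bsub>Gb\<^esub> c))) (carrier Gb)"
      unfolding d_def
      by (rule A.finprod_cong') (use tD[OF g hc] tD[OF h] cD in \<open>auto simp: t_mult \<alpha>[OF g]\<close>)
    also have "\<dots> = finprod A (\<lambda>c. \<alpha> g (cl (t h c))) (carrier Gb)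
                 \<otimes>\<^bsub>A\<^esub> finprod A (\<lambda>c. cl (t g ((D #> h) \<otimes>\<^bsub>Gb\<^esub> c))) (carrier Gb)"
      by (rule A.finprod_multf) (use tD[OF g hc] tD[OF h] cD in \<open>auto simp: \<alpha>[OF g]\<close>)
    also have "finprod A (\<lambda>c. cl (t g ((D #> h) \<otimes>\<^bsub>Gb\<^esub> c))) (carrier Gb) = d g" unfolding d_def
      by (rule finprod_translate[OF Gb.is_group A.comm_group_axioms Dg[OF h], of "\<lambda>c. cl (t g c)"])
        (use tD[OF g] in auto)
    also have "finprod A (\<lambda>c. \<alpha> g (cl (t h c))) (carrier Gb) = \<alpha> g (d h)" unfolding d_def
      by (rule hom_finprod[OF A.comm_group_axioms A.comm_group_axioms \<alpha>(1)[OF g], symmetric])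
        (use tD[OF h] in auto)
    finally show ?thesis .
  qed
  have d_D: "d x = cl x [^]\<^bsub>A\<^esub> m" if x: "x \<in> D" for x
  proof -
    have "t x c = x" if c: "c \<in> carrier Gb" for c
    proof -
      have "(D #> x) \<otimes>\<^bsub>Gb\<^esub> c = c" using D.rcos_const[OF is_group x] c Gb.l_one[OF c] by (simp add: Gb_def)
      then show ?thesis unfolding t_def using sG[OF c] DG[OF x] by (simp add: m_assoc)
    qed
    then have "d x = finprod A (\<lambda>c. cl x) (carrier Gb)" unfolding d_def
      by (intro A.finprod_cong') (use x in auto)
    then show ?thesis unfolding m_def using x by (simp add: A.finprod_const)
  qed
  have \<alpha>_hom: "group_hom A A (\<alpha> g)" if "g \<in> carrier G" for g
    using \<alpha>(1)[OF that] by unfold_locales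
  define H where "H = {g \<in> carrier G. d g = \<one>\<^bsub>A\<^esub>}"
  have "subgroup H G"
  proof (rule subgroupI)
    have "d \<one> = \<one>\<^bsub>A\<^esub>" using d_D[of \<one>] cl.hom_one by simp
    then show "H \<noteq> {}" unfolding H_def by auto
  next
    fix g assume "g \<in> H"
    then have g: "g \<in> carrier G" "d g = \<one>\<^bsub>A\<^esub>" unfolding H_def by auto
    have "\<one>\<^bsub>A\<^esub> = d (inv g \<otimes> g)" using g d_D[of \<one>] cl.hom_one by simp
    also have "\<dots> = d (inv g)" using d_mult[of "inv g" g] g group_hom.hom_one[OF \<alpha>_hom[of "inv g"]] dA[of "inv g"] by simp
    finally show "inv g \<in> H" unfolding H_def using g by simp
  next
    fix g h assume "g \<in> H" "h \<in> H"
    then show "g \<otimes> h \<in> H" unfolding H_def using d_mult[of g h] group_hom.hom_one[OF \<alpha>_hom[of g]] by auto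
  qed (auto simp: H_def)
  moreover have "H \<inter> D = E"
  proof
    show "H \<inter> D \<subseteq> E"
    proof
      fix x assume "x \<in> H \<inter> D"
      then have x: "x \<in> D" "cl x [^]\<^bsub>A\<^esub> m = \<one>\<^bsub>A\<^esub>" using d_D unfolding H_def by auto
      then have "cl x = \<one>\<^bsub>A\<^esub>" using root[of "cl x"] by simp
      then show "x \<in> E" using cl_one x(1) by simp
    qed
    show "E \<subseteq> H \<inter> D"
    proof
      fix x assume x: "x \<in> E"
      then have "cl x = \<one>\<^bsub>A\<^esub>" using cl_one ED by auto
      then show "x \<in> H \<inter> D" using x ED d_D[of x] EG unfolding H_def by auto
    qed
  qed
  moreover have "\<exists>x\<in>D. \<exists>h\<in>H. g = x \<otimes> h" if g: "g \<in> carrier G" for g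
  proof -
    obtain y where y: "y \<in> D" "d g [^]\<^bsub>A\<^esub> e = cl y" using cl_surj[of "d g [^]\<^bsub>A\<^esub> e"] dA[OF g] by auto
    have ym: "cl y [^]\<^bsub>A\<^esub> m = d g"
      using root[OF dA[OF g]] y(2) dA[OF g] by (metis A.nat_pow_pow mult.commute)
    have iy: "inv y \<in> D" using y(1) by simp
    \<comment> \<open>\<open>D\<close> acts trivially on the abelian group \<open>D/E\<close>.\<close>
    have ai: "\<alpha> (inv y) (d g) = d g"
    proof -
      obtain z where z: "z \<in> D" "d g = cl z" using cl_surj[OF dA[OF g]] by blast
      have "\<alpha> (inv y) (d g) = cl (inv y \<otimes> z \<otimes> inv (inv y))" using \<alpha>(2)[OF DG[OF iy] z(1)] z(2) by simp
      also have "\<dots> = cl (inv y) \<otimes>\<^bsub>A\<^esub> cl z \<otimes>\<^bsub>A\<^esub> cl y" using y z DG by simp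
      also have "\<dots> = cl z \<otimes>\<^bsub>A\<^esub> (cl (inv y) \<otimes>\<^bsub>A\<^esub> cl y)"
        using y(1) z(1) iy by (simp add: A.m_ac)
      also have "cl (inv y) \<otimes>\<^bsub>A\<^esub> cl y = \<one>\<^bsub>A\<^esub>"
        using cl_mult[OF iy y(1)] y(1) DG cl.hom_one by simp
      also have "cl z \<otimes>\<^bsub>A\<^esub> \<one>\<^bsub>A\<^esub> = d g" using z by simp
      finally show ?thesis .
    qed
    have "d (inv y \<otimes> g) = d g \<otimes>\<^bsub>A\<^esub> d (inv y)" using d_mult[OF DG[OF iy] g] ai by simp
    also have "\<dots> = cl y [^]\<^bsub>A\<^esub> m \<otimes>\<^bsub>A\<^esub> cl (inv y) [^]\<^bsub>A\<^esub> m" using ym d_D[OF iy] by simp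
    also have "\<dots> = (cl y \<otimes>\<^bsub>A\<^esub> cl (inv y)) [^]\<^bsub>A\<^esub> m" using y(1) iy by (simp add: A.pow_mult_distrib A.m_comm)
    also have "cl y \<otimes>\<^bsub>A\<^esub> cl (inv y) = \<one>\<^bsub>A\<^esub>" using cl_mult[OF y(1) iy] y(1) DG cl.hom_one by simp
    finally have "inv y \<otimes> g \<in> H" unfolding H_def using g DG y(1) by simp
    moreover have "g = y \<otimes> (inv y \<otimes> g)" using g y(1) DG by (simp add: cancel_inv_left)
    ultimately show ?thesis using y(1) by blast
  qed
  ultimately show ?thesis by blast
qed

lemma (in group_hom) card_rcosets_kernel:
  assumes "h ` carrier G = carrier H"
  shows "card (rcosets (kernel G H h)) = card (carrier H)"
    and "finite (carrier H) \<Longrightarrow> finite (rcosets (kernel G H h))"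
proof -
  have "(\<lambda>X. the_elem (h`X)) \<in> iso (G Mod (kernel G H h)) H" by (rule FactGroup_iso_set[OF assms])
  then have b: "bij_betw (\<lambda>X. the_elem (h`X)) (rcosets (kernel G H h)) (carrier H)"
    by (simp add: iso_def FactGroup_def)
  show "card (rcosets (kernel G H h)) = card (carrier H)" using bij_betw_same_card[OF b] .
  show "finite (carrier H) \<Longrightarrow> finite (rcosets (kernel G H h))" using bij_betw_finite[OF b] by simp
qed

text \<open>
  The composition \<open>H \<rightarrow> G \<rightarrow> G/D\<close> is onto with kernel \<open>H
  \<inter> D\<close>.
\<close>

lemma (in group) rcosets_complement:
  assumes D: "D \<lhd> G" and H: "subgroup H G" and HD: "\<And>g. g \<in> carrier G \<Longrightarrow> \<exists>d\<in>D. \<exists>h\<in>H. g = d \<otimes> h"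
    and fin: "finite (rcosets D)"
  shows "card (rcosets\<^bsub>G\<lparr>carrier := H\<rparr>\<^esub> (H \<inter> D)) = card (rcosets D)"
    and "finite (rcosets\<^bsub>G\<lparr>carrier := H\<rparr>\<^esub> (H \<inter> D))"
proof -
  interpret D: normal D G by fact
  interpret Q: group "G Mod D" by (rule D.factorgroup_is_group)
  interpret H: subgroup H G by fact
  interpret GH: group "G\<lparr>carrier := H\<rparr>" using H by (rule subgroup_imp_group)
  have c: "carrier (G Mod D) = rcosets D" by (simp add: FactGroup_def)
  interpret f: group_hom "G\<lparr>carrier := H\<rparr>" "G Mod D" "\<lambda>x. D #> x"
    by unfold_locales (auto simp: hom_def D.rcos_sum carrier_FactGroup)
  have surj: "(\<lambda>x. D #> x) ` carrier (G\<lparr>carrier := H\<rparr>) = carrier (G Mod D)"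
  proof
    show "carrier (G Mod D) \<subseteq> (\<lambda>x. D #> x) ` carrier (G\<lparr>carrier := H\<rparr>)"
    proof
      fix X assume "X \<in> carrier (G Mod D)"
      then obtain g where g: "g \<in> carrier G" "X = D #> g" by (auto simp: carrier_FactGroup)
      then obtain d h where dh: "d \<in> D" "h \<in> H" "g = d \<otimes> h" using HD by blast
      then have "D #> g = D #> h"
        using D.rcos_sum[of d h] D.rcos_const[OF is_group] D.rcosets_mult_eq[of "D #> h"] rcosetsI[OF D.subset, of h]
        by (metis D.mem_carrier H.mem_carrier)
      then show "X \<in> (\<lambda>x. D #> x) ` carrier (G\<lparr>carrier := H\<rparr>)" using g dh by auto
    qed
  qed (auto simp: carrier_FactGroup)
  have ker: "kernel (G\<lparr>carrier := H\<rparr>) (G Mod D) (\<lambda>x. D #> x) = H \<inter> D"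
    using coset_join1[OF _ _ D.subgroup_axioms] D.rcos_const[OF is_group] by (auto simp: kernel_def)
  show "card (rcosets\<^bsub>G\<lparr>carrier := H\<rparr>\<^esub> (H \<inter> D)) = card (rcosets D)"
    "finite (rcosets\<^bsub>G\<lparr>carrier := H\<rparr>\<^esub> (H \<inter> D))"
    using f.card_rcosets_kernel[OF surj] fin unfolding ker c by auto
qed

text \<open>
  The existence part of the Schur-Zassenhaus theorem for \<open>D 0\<close> modulo \<open>D
  n\<close>, with a solvable kernel. Each step replaces a complement modulo \<open>D i\<close> by
  a complement modulo \<open>D (Suc i)\<close> inside it, using the case of an abelian kernel. The
  group \<open>G\<close> may be infinite; only the index of \<open>D 0\<close> has to be finite.
\<close>

lemma (in group) relative_complement:
  assumes D: "\<And>i. i \<le> n \<Longrightarrow> D i \<lhd> G" and DD: "\<And>i. i < n \<Longrightarrow> D (Suc i) \<subseteq> D i"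
    and comm: "\<And>i x y. i < n \<Longrightarrow> x \<in> D i \<Longrightarrow> y \<in> D i \<Longrightarrow> x \<otimes> y \<otimes> inv x \<otimes> inv y \<in> D (Suc i)"
    and fin: "finite (rcosets (D 0))"
    and k: "coprime k (card (rcosets (D 0)))" "k > 0" "\<And>x. x \<in> D 0 \<Longrightarrow> x [^] (k::nat) \<in> D n"
  shows "\<exists>H. subgroup H G \<and> H \<inter> D 0 = D n \<and> (\<forall>g\<in>carrier G. \<exists>d\<in>D 0. \<exists>h\<in>H. g = d \<otimes> h)"
proof -
  have "\<exists>H. subgroup H G \<and> H \<inter> D 0 = D i \<and> (\<forall>g\<in>carrier G. \<exists>d\<in>D 0. \<exists>h\<in>H. g = d \<otimes> h)" if "i \<le> n" for i
    using that
  proof (induction i)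
    case 0
    have "subgroup (D 0) G" using D[of 0] normal_imp_subgroup by simp
    then interpret D0: subgroup "D 0" G .
    have "\<exists>d\<in>D 0. \<exists>h\<in>carrier G. g = d \<otimes> h" if "g \<in> carrier G" for g
      by (rule bexI[of _ \<one>], rule bexI[of _ g]) (use that in auto)
    then show ?case using subgroup_self D0.subset by (intro exI[of _ "carrier G"]) blast
  next
    case (Suc i)
    then obtain H where H: "subgroup H G" "H \<inter> D 0 = D i"
      and HD: "\<And>g. g \<in> carrier G \<Longrightarrow> \<exists>d\<in>D 0. \<exists>h\<in>H. g = d \<otimes> h" by auto
    interpret H: subgroup H G by fact
    interpret GH: group "G\<lparr>carrier := H\<rparr>" using H(1) by (rule subgroup_imp_group)
    have sub: "D j \<lhd> G\<lparr>carrier := H\<rparr>" if "j \<le> n" "D j \<subseteq> H" for j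
    proof (rule GH.normal_invI)
      have "subgroup (D j) G" using D that normal_imp_subgroup by blast
      then show "subgroup (D j) (G\<lparr>carrier := H\<rparr>)" using H(1) that(2) by (rule subgroup_incl)
      fix x h assume "x \<in> carrier (G\<lparr>carrier := H\<rparr>)" "h \<in> D j"
      then show "x \<otimes>\<^bsub>G\<lparr>carrier := H\<rparr>\<^esub> h \<otimes>\<^bsub>G\<lparr>carrier := H\<rparr>\<^esub> inv\<^bsub>G\<lparr>carrier := H\<rparr>\<^esub> x \<in> D j"
        using m_inv_consistent[OF H(1), of x] normal_invE(2)[OF D[OF that(1)], of x h] H.mem_carrier by simp
    qed
    have DiH: "D i \<subseteq> H" using H(2) by blast
    have DSi: "D (Suc i) \<subseteq> D i" using DD Suc.prems by simp
    have anti: "D n \<subseteq> D j" if "j \<le> n" for j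
      using that by (induction rule: inc_induct) (use DD in auto)
    have "\<exists>M. subgroup M (G\<lparr>carrier := H\<rparr>) \<and> M \<inter> D i = D (Suc i) \<and>
        (\<forall>g\<in>carrier (G\<lparr>carrier := H\<rparr>). \<exists>d\<in>D i. \<exists>h\<in>M. g = d \<otimes>\<^bsub>G\<lparr>carrier := H\<rparr>\<^esub> h)"
    proof (rule GH.relative_complement_step)
      show "D i \<lhd> G\<lparr>carrier := H\<rparr>" "D (Suc i) \<lhd> G\<lparr>carrier := H\<rparr>" using sub Suc.prems DiH DSi by auto
      show "D (Suc i) \<subseteq> D i" by fact
      show "finite (rcosets\<^bsub>G\<lparr>carrier := H\<rparr>\<^esub> D i)" "coprime k (card (rcosets\<^bsub>G\<lparr>carrier := H\<rparr>\<^esub> D i))"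
        using rcosets_complement[OF D[of 0] H(1) HD fin] k(1) unfolding H(2) by auto
      fix x assume x: "x \<in> D i"
      then show "x [^]\<^bsub>G\<lparr>carrier := H\<rparr>\<^esub> k \<in> D (Suc i)"
        using k(3)[of x] anti[of "Suc i"] Suc.prems H(2) nat_pow_consistent[of x k H] by auto
      fix y assume y: "y \<in> D i"
      then show "x \<otimes>\<^bsub>G\<lparr>carrier := H\<rparr>\<^esub> y \<otimes>\<^bsub>G\<lparr>carrier := H\<rparr>\<^esub> inv\<^bsub>G\<lparr>carrier := H\<rparr>\<^esub> x \<otimes>\<^bsub>G\<lparr>carrier := H\<rparr>\<^esub> inv\<^bsub>G\<lparr>carrier := H\<rparr>\<^esub> y \<in> D (Suc i)"
        using m_inv_consistent[OF H(1)] x DiH comm[of i x y] Suc.prems by (simp add: subset_eq)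
    qed (use k in auto)
    then obtain M where M: "subgroup M (G\<lparr>carrier := H\<rparr>)" "M \<inter> D i = D (Suc i)"
      and MD: "\<And>g. g \<in> H \<Longrightarrow> \<exists>d\<in>D i. \<exists>h\<in>M. g = d \<otimes> h" by auto
    have MH: "M \<subseteq> H" using subgroup.subset[OF M(1)] by simp
    have "subgroup M G" using incl_subgroup[OF H(1) M(1)] .
    moreover have "M \<inter> D 0 = D (Suc i)" using M(2) H(2) MH by blast
    moreover have "\<exists>d\<in>D 0. \<exists>h\<in>M. g = d \<otimes> h" if g: "g \<in> carrier G" for g
    proof -
      obtain d h where dh: "d \<in> D 0" "h \<in> H" "g = d \<otimes> h" using HD[OF g] by blast
      obtain d' h' where dh': "d' \<in> D i" "h' \<in> M" "h = d' \<otimes> h'" using MD[OF dh(2)] by blast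
      have s0: "subgroup (D 0) G" using D[of 0] normal_imp_subgroup by simp
      have "d' \<in> D 0" using dh'(1) H(2) by blast
      moreover have "g = (d \<otimes> d') \<otimes> h'"
        using dh dh' \<open>d' \<in> D 0\<close> MH H.mem_carrier subgroup.mem_carrier[OF s0] by (auto simp: m_assoc)
      ultimately show ?thesis using subgroup.m_closed[OF s0 dh(1)] dh'(2) by blast
    qed
    ultimately show ?case by blast
  qed
  from this[of n] show ?thesis by simp
qed

section \<open>Extending a cocycle from a normal subgroup of coprime index\<close>

lemma (in group) normal_commI:
  assumes "subgroup H G" "\<And>x h. x \<in> carrier G \<Longrightarrow> h \<in> H \<Longrightarrow> \<exists>h'\<in>H. x \<otimes> h = h' \<otimes> x"
  shows "H \<lhd> G"
proof (rule normal_invI[OF assms(1)])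
  fix x h assume x: "x \<in> carrier G" and h: "h \<in> H"
  then obtain h' where h': "h' \<in> H" "x \<otimes> h = h' \<otimes> x" using assms(2) by blast
  then have "x \<otimes> h \<otimes> inv x = h'" using x subgroup.mem_carrier[OF assms(1)] by (simp add: m_assoc)
  then show "x \<otimes> h \<otimes> inv x \<in> H" using h'(1) by simp
qed

context left_action
begin

lemma cocycle_one: "cocycle H \<phi> \<Longrightarrow> \<one> \<in> H \<Longrightarrow> \<phi> \<one> = \<one>\<^bsub>N\<^esub>"
  unfolding cocycle_def by (metis G.l_one G.one_closed N.r_cancel_one' a_one)

text \<open>
  Let \<open>L\<close> consist of the pairs \<open>(m, g)\<close> in \<open>N \<rtimes> G\<close>
  that normalize the graph of \<open>\<phi>\<close>. Invariance says that \<open>L\<close>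
  projects onto \<open>G\<close>. The part of \<open>L\<close> over \<open>R\<close> is \<open>C
  \<times> graph \<phi>\<close>, where \<open>C\<close> consists of the elements \<open>c\<close>
  of \<open>N\<close> with \<open>(c, 1) \<in> L\<close>. A subgroup of \<open>L\<close> that
  meets this part exactly in the graph of \<open>\<phi>\<close> and still projects onto
  \<open>G\<close> is the graph of an extension of \<open>\<phi>\<close>; it exists because
  \<open>C\<close> has an exponent prime to the index of \<open>R\<close>.
\<close>

lemma cocycle_extension_normal:
  assumes R: "R \<lhd> G" "finite (rcosets R)"
    and k: "coprime k (card (rcosets R))" "k > 0" "\<And>x. x \<in> carrier N \<Longrightarrow> x [^]\<^bsub>N\<^esub> (k::nat) = \<one>\<^bsub>N\<^esub>"
    and K: "abelian_chain N K n"
    and aK: "\<And>i g x. i \<le> n \<Longrightarrow> g \<in> carrier G \<Longrightarrow> x \<in> K i \<Longrightarrow> a g x \<in> K i"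
    and \<phi>: "cocycle R \<phi>"
    and inv: "\<And>g. g \<in> carrier G \<Longrightarrow> \<exists>m\<in>carrier N. \<forall>r\<in>R. a g (\<phi> (inv g \<otimes> r \<otimes> g)) = inv\<^bsub>N\<^esub> m \<otimes>\<^bsub>N\<^esub> \<phi> r \<otimes>\<^bsub>N\<^esub> a r m"
  shows "\<exists>\<psi>. cocycle (carrier G) \<psi> \<and> (\<forall>r\<in>R. \<psi> r = \<phi> r)"
proof -
  interpret R: normal R G by fact
  have RG: "r \<in> R \<Longrightarrow> r \<in> carrier G" for r by (rule R.mem_carrier)
  have \<phi>N: "\<phi> r \<in> carrier N" if "r \<in> R" for r using \<phi> that unfolding cocycle_def by simp
  have \<phi>m: "\<phi> (r \<otimes> s) = \<phi> r \<otimes>\<^bsub>N\<^esub> a r (\<phi> s)" if "r \<in> R" "s \<in> R" for r s using \<phi> that unfolding cocycle_def by simp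
  have \<phi>1: "\<phi> \<one> = \<one>\<^bsub>N\<^esub>" using cocycle_one[OF \<phi> R.one_closed] .
  have conjR: "inv g \<otimes> r \<otimes> g \<in> R" "g \<otimes> r \<otimes> inv g \<in> R" if "g \<in> carrier G" "r \<in> R" for g r
    using that R.inv_op_closed1 R.inv_op_closed2 by auto
  \<comment> \<open>The condition is the invariance relation for \<open>\<phi>\<close>, multiplied by
    \<open>m\<close> from the left.\<close>
  define LC where "LC = {(m, g). m \<in> carrier N \<and> g \<in> carrier G \<and>
      (\<forall>r\<in>R. \<phi> r \<otimes>\<^bsub>N\<^esub> a r m = m \<otimes>\<^bsub>N\<^esub> a g (\<phi> (inv g \<otimes> r \<otimes> g)))}"
  define L where "L = \<lparr>carrier = LC, monoid.mult = (\<lambda>(m, g) (m', g'). (m \<otimes>\<^bsub>N\<^esub> a g m', g \<otimes> g')), one = (\<one>\<^bsub>N\<^esub>, \<one>)\<rparr>"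
  have L_simps [simp]: "carrier L = LC" "\<one>\<^bsub>L\<^esub> = (\<one>\<^bsub>N\<^esub>, \<one>)" "\<And>m g m' g'. (m, g) \<otimes>\<^bsub>L\<^esub> (m', g') = (m \<otimes>\<^bsub>N\<^esub> a g m', g \<otimes> g')"
    by (auto simp: L_def)
  have LCD: "m \<in> carrier N" "g \<in> carrier G" "\<And>r. r \<in> R \<Longrightarrow> \<phi> r \<otimes>\<^bsub>N\<^esub> a r m = m \<otimes>\<^bsub>N\<^esub> a g (\<phi> (inv g \<otimes> r \<otimes> g))"
    if "(m, g) \<in> LC" for m g using that unfolding LC_def by auto
  have L_mult: "(m \<otimes>\<^bsub>N\<^esub> a g m', g \<otimes> g') \<in> LC" if x: "(m, g) \<in> LC" and y: "(m', g') \<in> LC" for m g m' g'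
  proof -
    note m = LCD[OF x] and m' = LCD[OF y]
    have "\<phi> r \<otimes>\<^bsub>N\<^esub> a r (m \<otimes>\<^bsub>N\<^esub> a g m') = (m \<otimes>\<^bsub>N\<^esub> a g m') \<otimes>\<^bsub>N\<^esub> a (g \<otimes> g') (\<phi> (inv (g \<otimes> g') \<otimes> r \<otimes> (g \<otimes> g')))"
      if r: "r \<in> R" for r
    proof -
      define s where "s = inv g \<otimes> r \<otimes> g"
      have s: "s \<in> R" unfolding s_def using conjR m(2) r by blast
      have "r \<otimes> g = g \<otimes> s" unfolding s_def using m(2) RG[OF r] by (simp add: G.m_assoc G.cancel_inv_left)
      then have rg: "a r (a g m') = a g (a s m')" using m(2) m'(1) RG[OF r] RG[OF s] by (metis a_mult)
      have "inv (g \<otimes> g') \<otimes> r \<otimes> (g \<otimes> g') = inv g' \<otimes> s \<otimes> g'"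
        unfolding s_def using m(2) m'(2) RG[OF r] by (simp add: G.m_assoc G.inv_mult_group)
      then have "(m \<otimes>\<^bsub>N\<^esub> a g m') \<otimes>\<^bsub>N\<^esub> a (g \<otimes> g') (\<phi> (inv (g \<otimes> g') \<otimes> r \<otimes> (g \<otimes> g')))
          = m \<otimes>\<^bsub>N\<^esub> a g (m' \<otimes>\<^bsub>N\<^esub> a g' (\<phi> (inv g' \<otimes> s \<otimes> g')))"
        using m(1,2) m'(1,2) \<phi>N[OF conjR(1)[OF m'(2) s]] by (simp add: a_mult N.m_assoc)
      also have "\<dots> = m \<otimes>\<^bsub>N\<^esub> a g (\<phi> s \<otimes>\<^bsub>N\<^esub> a s m')" using m'(3)[OF s] by simp
      also have "\<dots> = \<phi> r \<otimes>\<^bsub>N\<^esub> a r m \<otimes>\<^bsub>N\<^esub> a r (a g m')"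
        using m(3)[OF r] m(1,2) m'(1,2) \<phi>N[OF s] RG[OF s] rg unfolding s_def[symmetric] by (simp add: N.m_assoc)
      also have "\<dots> = \<phi> r \<otimes>\<^bsub>N\<^esub> a r (m \<otimes>\<^bsub>N\<^esub> a g m')"
        using m(1,2) m'(1) RG[OF r] \<phi>N[OF r] by (simp add: N.m_assoc)
      finally show ?thesis by simp
    qed
    then show ?thesis unfolding LC_def using m m' by simp
  qed
  have L_inv: "(a (inv g) (inv\<^bsub>N\<^esub> m), inv g) \<in> LC" if x: "(m, g) \<in> LC" for m g
  proof -
    note m = LCD[OF x]
    have "\<phi> r \<otimes>\<^bsub>N\<^esub> a r (a (inv g) (inv\<^bsub>N\<^esub> m)) = a (inv g) (inv\<^bsub>N\<^esub> m) \<otimes>\<^bsub>N\<^esub> a (inv g) (\<phi> (inv (inv g) \<otimes> r \<otimes> inv g))"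
      if r: "r \<in> R" for r
    proof -
      define s where "s = g \<otimes> r \<otimes> inv g"
      have s: "s \<in> R" unfolding s_def using conjR m(2) r by blast
      have r_s: "r = inv g \<otimes> s \<otimes> g" unfolding s_def using m(2) RG[OF r] by (simp add: G.m_assoc G.cancel_inv_left)
      have "s \<otimes> g = g \<otimes> r" unfolding s_def using m(2) RG[OF r] by (simp add: G.m_assoc)
      then have "r \<otimes> inv g = inv g \<otimes> s" unfolding s_def using m(2) RG[OF r] by (simp add: G.m_assoc G.cancel_inv_left)
      then have e: "a r (a (inv g) (inv\<^bsub>N\<^esub> m)) = a (inv g) (a s (inv\<^bsub>N\<^esub> m))"
        using m(1,2) RG[OF r] RG[OF s] by (metis a_mult G.inv_closed N.inv_closed)
      have "m \<otimes>\<^bsub>N\<^esub> a g (\<phi> r) = \<phi> s \<otimes>\<^bsub>N\<^esub> a s m" using m(3)[OF s] r_s by simp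
      then have "a g (\<phi> r) = inv\<^bsub>N\<^esub> m \<otimes>\<^bsub>N\<^esub> (\<phi> s \<otimes>\<^bsub>N\<^esub> a s m)" using m(1,2) \<phi>N[OF r] \<phi>N[OF s] RG[OF s]
        by (metis N.cancel_inv_left(2) a_closed)
      then have "\<phi> r = a (inv g) (inv\<^bsub>N\<^esub> m \<otimes>\<^bsub>N\<^esub> (\<phi> s \<otimes>\<^bsub>N\<^esub> a s m))" using m(2) \<phi>N[OF r] a_inv_left by metis
      then have "\<phi> r \<otimes>\<^bsub>N\<^esub> a r (a (inv g) (inv\<^bsub>N\<^esub> m)) = a (inv g) (inv\<^bsub>N\<^esub> m \<otimes>\<^bsub>N\<^esub> \<phi> s)"
        unfolding e using m(1,2) \<phi>N[OF s] RG[OF s] by (simp add: N.m_assoc)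
      then show ?thesis using m(1,2) \<phi>N[OF s] by (simp add: s_def)
    qed
    then show ?thesis unfolding LC_def using m by simp
  qed
  have L_one: "(\<one>\<^bsub>N\<^esub>, \<one>) \<in> LC" unfolding LC_def using \<phi>N RG by (auto simp: a_one)
  have gL: "group L"
  proof (rule groupI)
    fix x y z assume "x \<in> carrier L" "y \<in> carrier L" "z \<in> carrier L"
    then show "x \<otimes>\<^bsub>L\<^esub> y \<otimes>\<^bsub>L\<^esub> z = x \<otimes>\<^bsub>L\<^esub> (y \<otimes>\<^bsub>L\<^esub> z)"
      by (cases x; cases y; cases z) (use LCD(1,2) in \<open>auto simp: N.m_assoc G.m_assoc a_mult\<close>)
  next
    fix x assume x: "x \<in> carrier L"
    obtain m g where mg: "x = (m, g)" by (cases x)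
    show "\<one>\<^bsub>L\<^esub> \<otimes>\<^bsub>L\<^esub> x = x" using x LCD[of m g] unfolding mg by (simp add: a_one)
    show "\<exists>y\<in>carrier L. y \<otimes>\<^bsub>L\<^esub> x = \<one>\<^bsub>L\<^esub>"
      using x L_inv[of m g] LCD[of m g] unfolding mg
      by (intro bexI[of _ "(a (inv g) (inv\<^bsub>N\<^esub> m), inv g)"]) auto
  qed (use L_mult L_one in auto)
  interpret L: group L by (rule gL)
  define C where "C = {c \<in> carrier N. (c, \<one>) \<in> LC}"
  have CD: "c \<in> carrier N" "\<And>r. r \<in> R \<Longrightarrow> \<phi> r \<otimes>\<^bsub>N\<^esub> a r c = c \<otimes>\<^bsub>N\<^esub> \<phi> r" if "c \<in> C" for c
    using that LCD(3)[of c \<one>] \<phi>N RG unfolding C_def by (auto simp: a_one)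
  have Csub: "subgroup C N"
  proof (rule N.subgroupI)
    show "C \<noteq> {}" using L_one unfolding C_def by auto
  next
    fix c assume "c \<in> C" then show "inv\<^bsub>N\<^esub> c \<in> C" using L_inv[of c \<one>] unfolding C_def by (auto simp: a_one)
  next
    fix c d assume "c \<in> C" "d \<in> C" then show "c \<otimes>\<^bsub>N\<^esub> d \<in> C" using L_mult[of c \<one> d \<one>] unfolding C_def by (auto simp: a_one)
  qed (auto simp: C_def)
  \<comment> \<open>The graph of \<open>\<phi>\<close>, translated by \<open>c\<close>. As \<open>C\<close>
    commutes with the graph, \<open>\<iota>\<close> is a homomorphism on \<open>C \<times>
    R\<close>.\<close>
  define \<iota> where "\<iota> = (\<lambda>c r. (c \<otimes>\<^bsub>N\<^esub> \<phi> r, r))"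
  have \<iota>_mult: "\<iota> c r \<otimes>\<^bsub>L\<^esub> \<iota> d s = \<iota> (c \<otimes>\<^bsub>N\<^esub> d) (r \<otimes> s)" if "c \<in> C" "d \<in> C" "r \<in> R" "s \<in> R" for c d r s
  proof -
    have "c \<otimes>\<^bsub>N\<^esub> \<phi> r \<otimes>\<^bsub>N\<^esub> a r (d \<otimes>\<^bsub>N\<^esub> \<phi> s) = c \<otimes>\<^bsub>N\<^esub> (\<phi> r \<otimes>\<^bsub>N\<^esub> a r d) \<otimes>\<^bsub>N\<^esub> a r (\<phi> s)"
      using that CD(1) \<phi>N RG by (simp add: N.m_assoc)
    also have "\<dots> = c \<otimes>\<^bsub>N\<^esub> d \<otimes>\<^bsub>N\<^esub> \<phi> (r \<otimes> s)"
      unfolding CD(2)[OF that(2,3)] using that CD(1) \<phi>N RG by (simp add: N.m_assoc \<phi>m)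
    finally show ?thesis unfolding \<iota>_def by simp
  qed
  have \<iota>1: "\<iota> \<one>\<^bsub>N\<^esub> r \<in> LC" if r: "r \<in> R" for r
  proof -
    have "\<phi> s \<otimes>\<^bsub>N\<^esub> a s (\<phi> r) = \<phi> r \<otimes>\<^bsub>N\<^esub> a r (\<phi> (inv r \<otimes> s \<otimes> r))" if s: "s \<in> R" for s
    proof -
      have "s \<otimes> r = r \<otimes> (inv r \<otimes> s \<otimes> r)" using RG r s by (simp add: G.m_assoc G.cancel_inv_left)
      then show ?thesis using \<phi>m[OF s r] \<phi>m[OF r conjR(1)[OF RG[OF r] s]] by simp
    qed
    then show ?thesis unfolding \<iota>_def LC_def using r RG \<phi>N by simp
  qed
  have \<iota>L: "\<iota> c r \<in> LC" if "c \<in> C" "r \<in> R" for c r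
  proof -
    have "(c, \<one>) \<in> LC" using that unfolding C_def by simp
    then have "(c, \<one>) \<otimes>\<^bsub>L\<^esub> \<iota> \<one>\<^bsub>N\<^esub> r \<in> LC" using L.m_closed \<iota>1[OF that(2)] by simp
    then show ?thesis unfolding \<iota>_def using that CD(1) \<phi>N RG by (simp add: a_one)
  qed
  have C1: "\<one>\<^bsub>N\<^esub> \<in> C" and Cm: "\<And>c d. c \<in> C \<Longrightarrow> d \<in> C \<Longrightarrow> c \<otimes>\<^bsub>N\<^esub> d \<in> C" and Ci: "\<And>c. c \<in> C \<Longrightarrow> inv\<^bsub>N\<^esub> c \<in> C"
    using Csub by (auto simp: subgroup.one_closed subgroup.m_closed subgroup.m_inv_closed)
  have \<iota>_one: "\<iota> \<one>\<^bsub>N\<^esub> \<one> = \<one>\<^bsub>L\<^esub>" unfolding \<iota>_def by (simp add: \<phi>1)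
  have \<iota>_inv: "inv\<^bsub>L\<^esub> (\<iota> c r) = \<iota> (inv\<^bsub>N\<^esub> c) (inv r)" if "c \<in> C" "r \<in> R" for c r
  proof (rule L.inv_equality)
    show "\<iota> (inv\<^bsub>N\<^esub> c) (inv r) \<otimes>\<^bsub>L\<^esub> \<iota> c r = \<one>\<^bsub>L\<^esub>"
      using \<iota>_mult[of "inv\<^bsub>N\<^esub> c" c "inv r" r] that Ci CD(1) RG \<iota>_one by simp
  qed (use \<iota>L Ci that in auto)
  have \<iota>_pow: "\<iota> c r [^]\<^bsub>L\<^esub> (j::nat) = \<iota> (c [^]\<^bsub>N\<^esub> j) (r [^] j) \<and> c [^]\<^bsub>N\<^esub> j \<in> C \<and> r [^] j \<in> R"
    if "c \<in> C" "r \<in> R" for c r j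
    using that by (induction j) (simp_all add: \<iota>_one C1 \<iota>_mult Cm)
  \<comment> \<open>The chain of the coefficients, cut down to \<open>C\<close>; its last term is the graph of
    \<open>\<phi>\<close>.\<close>
  define D where "D = (\<lambda>i. {\<iota> c r | c r. c \<in> K i \<inter> C \<and> r \<in> R})"
  have Knorm: "K i \<lhd> N" if "i \<le> n" for i
    using K that unfolding abelian_chain_def by auto
  have Ksub: "subgroup (K i) N" if "i \<le> n" for i
    using normal_imp_subgroup[OF Knorm[OF that]] .
  have KD: "K 0 = carrier N" "K n = {\<one>\<^bsub>N\<^esub>}" "\<And>i. i < n \<Longrightarrow> K (Suc i) \<subseteq> K i"
     "\<And>i x y. i < n \<Longrightarrow> x \<in> K i \<Longrightarrow> y \<in> K i \<Longrightarrow> x \<otimes>\<^bsub>N\<^esub> y \<otimes>\<^bsub>N\<^esub> inv\<^bsub>N\<^esub> x \<otimes>\<^bsub>N\<^esub> inv\<^bsub>N\<^esub> y \<in> K (Suc i)"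
    using K unfolding abelian_chain_def by auto
  have Dnorm: "D i \<lhd> L" if i: "i \<le> n" for i
  proof (rule L.normal_commI)
    interpret Ki: subgroup "K i" N using Ksub[OF i] .
    show "subgroup (D i) L"
    proof (rule L.subgroupI)
      show "D i \<subseteq> carrier L" unfolding D_def using \<iota>L by auto
      show "D i \<noteq> {}" unfolding D_def using C1 Ki.one_closed R.one_closed by blast
    next
      fix x assume "x \<in> D i"
      then obtain c r where "x = \<iota> c r" "c \<in> K i" "c \<in> C" "r \<in> R" unfolding D_def by auto
      then show "inv\<^bsub>L\<^esub> x \<in> D i" unfolding D_def using \<iota>_inv Ci Ki.m_inv_closed R.m_inv_closed by blast
    next
      fix x y assume "x \<in> D i" "y \<in> D i"
      then obtain c r d s where "x = \<iota> c r" "c \<in> K i" "c \<in> C" "r \<in> R" "y = \<iota> d s" "d \<in> K i" "d \<in> C" "s \<in> R"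
        unfolding D_def by auto
      then show "x \<otimes>\<^bsub>L\<^esub> y \<in> D i" unfolding D_def using \<iota>_mult Cm Ki.m_closed R.m_closed by blast
    qed
    fix x h assume x: "x \<in> carrier L" and h: "h \<in> D i"
    obtain m b where mb: "x = (m, b)" by (cases x)
    obtain c r where c: "c \<in> K i" "c \<in> C" and r: "r \<in> R" and h': "h = \<iota> c r" using h unfolding D_def by auto
    have xL: "(m, b) \<in> LC" using x mb by simp
    note m = LCD[OF xL]
    have cN: "c \<in> carrier N" using CD(1)[OF c(2)] .
    define c' where "c' = m \<otimes>\<^bsub>N\<^esub> a b c \<otimes>\<^bsub>N\<^esub> inv\<^bsub>N\<^esub> m"
    define r' where "r' = b \<otimes> r \<otimes> inv b"
    have r': "r' \<in> R" unfolding r'_def using conjR m(2) r by blast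
    have rr: "inv b \<otimes> r' \<otimes> b = r" unfolding r'_def using m(2) RG[OF r] by (simp add: G.m_assoc G.cancel_inv_left)
    have c'N: "c' \<in> carrier N" unfolding c'_def using cN m by simp
    have c'K: "c' \<in> K i" unfolding c'_def
      using N.normal_invE(2)[OF Knorm[OF i] m(1)] aK[OF i m(2) c(1)] by simp
    have "(c', \<one>) \<otimes>\<^bsub>L\<^esub> (m, b) = (m, b) \<otimes>\<^bsub>L\<^esub> (c, \<one>)"
      unfolding c'_def using m cN by (simp add: a_one N.m_assoc)
    moreover have c1L: "(c, \<one>) \<in> LC" using c unfolding C_def by simp
    ultimately have "(c', \<one>) \<otimes>\<^bsub>L\<^esub> (m, b) \<otimes>\<^bsub>L\<^esub> inv\<^bsub>L\<^esub> (m, b) \<in> LC"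
      using L.m_closed L.inv_closed xL L_simps(1) by metis
    moreover have "(c', \<one>) \<otimes>\<^bsub>L\<^esub> (m, b) \<otimes>\<^bsub>L\<^esub> inv\<^bsub>L\<^esub> (m, b) = (c', \<one>)"
    proof -
      obtain u v where uv: "inv\<^bsub>L\<^esub> (m, b) = (u, v)" by fastforce
      have uvL: "(u, v) \<in> LC" using L.inv_closed[of "(m, b)"] xL uv by simp
      have "(m, b) \<otimes>\<^bsub>L\<^esub> (u, v) = (\<one>\<^bsub>N\<^esub>, \<one>)" using L.r_inv[of "(m, b)"] xL uv by simp
      then show ?thesis unfolding uv using LCD(1,2)[OF uvL] m(1,2) c'N by (auto simp: a_one a_mult N.m_assoc G.m_assoc)
    qed
    ultimately have c'C: "c' \<in> C" unfolding C_def using c'N by simp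
    have "(m, b) \<otimes>\<^bsub>L\<^esub> \<iota> c r = \<iota> c' r' \<otimes>\<^bsub>L\<^esub> (m, b)"
    proof -
      have "c' \<otimes>\<^bsub>N\<^esub> \<phi> r' \<otimes>\<^bsub>N\<^esub> a r' m = c' \<otimes>\<^bsub>N\<^esub> (m \<otimes>\<^bsub>N\<^esub> a b (\<phi> r))"
        using m(3)[OF r'] rr c'N m(1) \<phi>N[OF r'] RG[OF r'] by (simp add: N.m_assoc)
      also have "\<dots> = m \<otimes>\<^bsub>N\<^esub> a b (c \<otimes>\<^bsub>N\<^esub> \<phi> r)"
        unfolding c'_def using m(1,2) cN \<phi>N[OF r] by (simp add: N.m_assoc N.cancel_inv_left)
      finally have "c' \<otimes>\<^bsub>N\<^esub> \<phi> r' \<otimes>\<^bsub>N\<^esub> a r' m = m \<otimes>\<^bsub>N\<^esub> a b (c \<otimes>\<^bsub>N\<^esub> \<phi> r)" .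
      moreover have "r' \<otimes> b = b \<otimes> r" unfolding r'_def using m(2) RG[OF r] by (simp add: G.m_assoc)
      ultimately show ?thesis unfolding \<iota>_def by simp
    qed
    then show "\<exists>h'\<in>D i. x \<otimes>\<^bsub>L\<^esub> h = h' \<otimes>\<^bsub>L\<^esub> x" unfolding mb h' D_def using c'K c'C r' by blast
  qed
  interpret Q: group "G Mod R" by (rule R.factorgroup_is_group)
  \<comment> \<open>The subgroup \<open>D 0\<close> is the kernel of \<open>L \<rightarrow> G/R\<close>, so its
    index is that of \<open>R\<close>.\<close>
  interpret f: group_hom L "G Mod R" "\<lambda>x. R #> snd x"
    by unfold_locales (use LCD(2) in \<open>auto simp: hom_def carrier_FactGroup R.rcos_sum\<close>)
  have LN: "\<exists>m. (m, g) \<in> LC" if g: "g \<in> carrier G" for g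
  proof -
    obtain m where m: "m \<in> carrier N" "\<And>r. r \<in> R \<Longrightarrow> a g (\<phi> (inv g \<otimes> r \<otimes> g)) = inv\<^bsub>N\<^esub> m \<otimes>\<^bsub>N\<^esub> \<phi> r \<otimes>\<^bsub>N\<^esub> a r m"
      using inv[OF g] by blast
    then have "(m, g) \<in> LC" unfolding LC_def using g \<phi>N RG by (simp add: N.m_assoc N.cancel_inv_left)
    then show ?thesis by blast
  qed
  have fsurj: "(\<lambda>x. R #> snd x) ` carrier L = carrier (G Mod R)"
  proof
    show "carrier (G Mod R) \<subseteq> (\<lambda>x. R #> snd x) ` carrier L"
    proof
      fix X assume "X \<in> carrier (G Mod R)"
      then obtain g where "g \<in> carrier G" "X = R #> g" by (auto simp: carrier_FactGroup)
      then show "X \<in> (\<lambda>x. R #> snd x) ` carrier L" using LN[of g] by force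
    qed
  qed (use LCD(2) in \<open>auto simp: carrier_FactGroup\<close>)
  have fker: "kernel L (G Mod R) (\<lambda>x. R #> snd x) = D 0"
  proof
    show "kernel L (G Mod R) (\<lambda>x. R #> snd x) \<subseteq> D 0"
    proof
      fix x assume "x \<in> kernel L (G Mod R) (\<lambda>x. R #> snd x)"
      then obtain m g where x: "x = (m, g)" "(m, g) \<in> LC" "R #> g = R" by (cases x) (auto simp: kernel_def)
      have r: "g \<in> R" using G.coset_join1[OF x(3) LCD(2)[OF x(2)] R.subgroup_axioms] .
      have "(m, g) \<otimes>\<^bsub>L\<^esub> inv\<^bsub>L\<^esub> (\<iota> \<one>\<^bsub>N\<^esub> g) \<in> LC" using L.m_closed L.inv_closed x(2) \<iota>1[OF r] L_simps(1) by metis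
      moreover have "(m, g) \<otimes>\<^bsub>L\<^esub> inv\<^bsub>L\<^esub> (\<iota> \<one>\<^bsub>N\<^esub> g) = (m \<otimes>\<^bsub>N\<^esub> inv\<^bsub>N\<^esub> (\<phi> g), \<one>)"
      proof -
        have "\<one>\<^bsub>N\<^esub> = \<phi> g \<otimes>\<^bsub>N\<^esub> a g (\<phi> (inv g))" using \<phi>m[OF r R.m_inv_closed[OF r]] \<phi>1 RG[OF r] by simp
        then have "a g (\<phi> (inv g)) = inv\<^bsub>N\<^esub> (\<phi> g)"
          using N.inv_equality[of "\<phi> g" "a g (\<phi> (inv g))"] N.inv_comm[of "\<phi> g" "a g (\<phi> (inv g))"] \<phi>N r RG
          by (metis N.inv_equality N.inv_comm R.m_inv_closed a_closed)
        then show ?thesis using \<iota>_inv[OF C1 r] \<phi>N[OF R.m_inv_closed[OF r]] RG[OF r] unfolding \<iota>_def by simp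
      qed
      ultimately have "m \<otimes>\<^bsub>N\<^esub> inv\<^bsub>N\<^esub> (\<phi> g) \<in> C" unfolding C_def using LCD(1)[OF x(2)] \<phi>N[OF r] by simp
      moreover have "x = \<iota> (m \<otimes>\<^bsub>N\<^esub> inv\<^bsub>N\<^esub> (\<phi> g)) g" unfolding \<iota>_def x(1) using LCD(1)[OF x(2)] \<phi>N[OF r] by (simp add: N.m_assoc)
      ultimately show "x \<in> D 0" unfolding D_def KD(1) using r CD(1) by auto
    qed
    show "D 0 \<subseteq> kernel L (G Mod R) (\<lambda>x. R #> snd x)"
      unfolding D_def kernel_def using \<iota>L R.rcos_const[OF G.is_group] by (auto simp: \<iota>_def)
  qed
  have cG: "carrier (G Mod R) = rcosets R" by (simp add: FactGroup_def)
  have "\<exists>H. subgroup H L \<and> H \<inter> D 0 = D n \<and> (\<forall>g\<in>carrier L. \<exists>d\<in>D 0. \<exists>h\<in>H. g = d \<otimes>\<^bsub>L\<^esub> h)"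
  proof (rule L.relative_complement[OF Dnorm])
    show "D (Suc i) \<subseteq> D i" if "i < n" for i using KD(3)[OF that] unfolding D_def by auto
    show "finite (rcosets\<^bsub>L\<^esub> D 0)" "coprime k (card (rcosets\<^bsub>L\<^esub> D 0))"
      using f.card_rcosets_kernel[OF fsurj] R(2) k(1) unfolding fker cG by auto
    show "k > 0" by fact
  next
    fix i x y assume i: "i < n" and "x \<in> D i" "y \<in> D i"
    then obtain c r d s where x: "x = \<iota> c r" "c \<in> K i" "c \<in> C" "r \<in> R" and y: "y = \<iota> d s" "d \<in> K i" "d \<in> C" "s \<in> R"
      unfolding D_def by auto
    have "x \<otimes>\<^bsub>L\<^esub> y \<otimes>\<^bsub>L\<^esub> inv\<^bsub>L\<^esub> x \<otimes>\<^bsub>L\<^esub> inv\<^bsub>L\<^esub> y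
       = \<iota> (c \<otimes>\<^bsub>N\<^esub> d \<otimes>\<^bsub>N\<^esub> inv\<^bsub>N\<^esub> c \<otimes>\<^bsub>N\<^esub> inv\<^bsub>N\<^esub> d) (r \<otimes> s \<otimes> inv r \<otimes> inv s)"
      using x y by (simp add: \<iota>_inv \<iota>_mult Cm Ci)
    then show "x \<otimes>\<^bsub>L\<^esub> y \<otimes>\<^bsub>L\<^esub> inv\<^bsub>L\<^esub> x \<otimes>\<^bsub>L\<^esub> inv\<^bsub>L\<^esub> y \<in> D (Suc i)"
      using KD(4)[OF i x(2) y(2)] x y Cm Ci unfolding D_def
      by (intro CollectI exI[of _ "c \<otimes>\<^bsub>N\<^esub> d \<otimes>\<^bsub>N\<^esub> inv\<^bsub>N\<^esub> c \<otimes>\<^bsub>N\<^esub> inv\<^bsub>N\<^esub> d"]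
          exI[of _ "r \<otimes> s \<otimes> inv r \<otimes> inv s"]) simp
  next
    fix x assume "x \<in> D 0"
    then obtain c r where x: "x = \<iota> c r" "c \<in> C" "r \<in> R" unfolding D_def by auto
    then show "x [^]\<^bsub>L\<^esub> k \<in> D n" using \<iota>_pow[OF x(2,3), of k] k(3)[OF CD(1)[OF x(2)]] C1 KD(2) unfolding D_def by auto
  qed
  then obtain H where H: "subgroup H L" "H \<inter> D 0 = D n"
    and HD: "\<And>g. g \<in> LC \<Longrightarrow> \<exists>d\<in>D 0. \<exists>h\<in>H. g = d \<otimes>\<^bsub>L\<^esub> h" by auto
  interpret H: subgroup H L by fact
  have HL: "x \<in> H \<Longrightarrow> x \<in> LC" for x using H.mem_carrier by simp
  have graph: "\<iota> \<one>\<^bsub>N\<^esub> r \<in> H" if "r \<in> R" for r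
    using H(2) C1 that KD(2) unfolding D_def by blast
  have ex: "\<exists>m. (m, g) \<in> H" if g: "g \<in> carrier G" for g
  proof -
    obtain m where m: "(m, g) \<in> LC" using LN[OF g] by blast
    obtain d h where dh: "d \<in> D 0" "h \<in> H" "(m, g) = d \<otimes>\<^bsub>L\<^esub> h" using HD[OF m] by blast
    obtain c r where c: "d = \<iota> c r" "r \<in> R" using dh(1) unfolding D_def by auto
    obtain u v where uv: "h = (u, v)" by (cases h)
    have "\<iota> \<one>\<^bsub>N\<^esub> r \<otimes>\<^bsub>L\<^esub> h \<in> H" using graph[OF c(2)] dh(2) by simp
    moreover have "g = r \<otimes> v" using dh(3) unfolding c uv \<iota>_def by simp
    ultimately show ?thesis unfolding uv \<iota>_def by auto
  qed
  \<comment> \<open>\<open>H\<close> is the graph of a function: two points over the same \<open>g\<close> differ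
    by an element of \<open>H \<inter> D 0 = D n\<close> over \<open>1\<close>.\<close>
  have uniq: "m = m'" if "(m, g) \<in> H" "(m', g) \<in> H" for m m' g
  proof -
    note m = LCD[OF HL[OF that(1)]] and m' = LCD[OF HL[OF that(2)]]
    define z where "z = (m, g) \<otimes>\<^bsub>L\<^esub> inv\<^bsub>L\<^esub> (m', g)"
    have zH: "z \<in> H" unfolding z_def using that by simp
    obtain u v where uv: "z = (u, v)" by (cases z)
    have uvN: "u \<in> carrier N" "v \<in> carrier G" using LCD[of u v] HL[OF zH] uv by auto
    have "z \<otimes>\<^bsub>L\<^esub> (m', g) = (m, g)" unfolding z_def using HL that m(1,2) m'(1,2) by (simp add: L.m_assoc)
    then have e: "u \<otimes>\<^bsub>N\<^esub> a v m' = m" "v \<otimes> g = g" unfolding uv by auto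
    have v1: "v = \<one>" using e(2) m(2) uvN by simp
    have "z \<in> D 0" using HL[OF zH] v1 R.rcos_const[OF G.is_group R.one_closed]
      unfolding fker[symmetric] uv kernel_def by simp
    then have "z \<in> D n" using H(2) zH by blast
    then have "u = \<one>\<^bsub>N\<^esub>" unfolding D_def uv KD(2) \<iota>_def v1 by (auto simp: \<phi>1)
    then show ?thesis using e v1 m'(1) by (simp add: a_one)
  qed
  define \<psi> where "\<psi> = (\<lambda>g. SOME m. (m, g) \<in> H)"
  have \<psi>H: "(\<psi> g, g) \<in> H" if "g \<in> carrier G" for g unfolding \<psi>_def using ex[OF that] by (rule someI_ex)
  have "cocycle (carrier G) \<psi>" unfolding cocycle_def
  proof (intro conjI ballI)
    fix g h assume g: "g \<in> carrier G" and h: "h \<in> carrier G"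
    show "\<psi> g \<in> carrier N" using LCD(1)[OF HL[OF \<psi>H[OF g]]] .
    have "(\<psi> g, g) \<otimes>\<^bsub>L\<^esub> (\<psi> h, h) \<in> H" using \<psi>H g h by blast
    then show "\<psi> (g \<otimes> h) = \<psi> g \<otimes>\<^bsub>N\<^esub> a g (\<psi> h)" using uniq[OF \<psi>H[of "g \<otimes> h"]] g h by simp
  qed
  moreover have "\<psi> r = \<phi> r" if "r \<in> R" for r
    using uniq[OF \<psi>H[OF RG[OF that]]] graph[OF that] \<phi>N[OF that] unfolding \<iota>_def by simp
  ultimately show ?thesis by blast
qed

end

section \<open>Descending to a subgroup with a coprime supplement\<close>

context left_action
begin

lemma cocycle_closed: "cocycle H \<phi> \<Longrightarrow> x \<in> H \<Longrightarrow> \<phi> x \<in> carrier N"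
  unfolding cocycle_def by simp

lemma cocycle_mult: "cocycle H \<phi> \<Longrightarrow> x \<in> H \<Longrightarrow> y \<in> H \<Longrightarrow> \<phi> (x \<otimes> y) = \<phi> x \<otimes>\<^bsub>N\<^esub> a x (\<phi> y)"
  unfolding cocycle_def by simp

lemma cocycle_cohomologous:
  assumes "subgroup H G" "cocycle H \<phi>" "n \<in> carrier N"
  shows "cocycle H (\<lambda>x. inv\<^bsub>N\<^esub> n \<otimes>\<^bsub>N\<^esub> \<phi> x \<otimes>\<^bsub>N\<^esub> a x n)"
  using assms cocycle_closed[OF assms(2)] cocycle_mult[OF assms(2)] subgroup.mem_carrier[OF assms(1)]
  unfolding cocycle_def[of H "\<lambda>x. inv\<^bsub>N\<^esub> n \<otimes>\<^bsub>N\<^esub> \<phi> x \<otimes>\<^bsub>N\<^esub> a x n"]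
  by (simp add: a_mult N.m_assoc N.cancel_inv_left)

text \<open>
  On a subgroup that acts trivially a cocycle is a homomorphism, so \<open>\<phi> x\<close> is
  killed by both \<open>k\<close> and \<open>l\<close>.
\<close>

lemma cocycle_trivial_on_coprime_kernel:
  assumes H: "subgroup H G" and \<phi>: "cocycle H \<phi>" and M: "subgroup M G" and aM: "\<And>x n. x \<in> M \<Longrightarrow> n \<in> carrier N \<Longrightarrow> a x n = n"
    and k: "\<And>x. x \<in> carrier N \<Longrightarrow> x [^]\<^bsub>N\<^esub> (k::nat) = \<one>\<^bsub>N\<^esub>"
    and x: "x \<in> H" "x \<in> M" and l: "coprime l k" "\<phi> (x [^] (l::nat)) = \<one>\<^bsub>N\<^esub>"
  shows "\<phi> x = \<one>\<^bsub>N\<^esub>"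
proof -
  interpret H: subgroup H G by fact
  interpret M: subgroup M G by fact
  have pow: "x [^] (j::nat) \<in> H \<and> x [^] j \<in> M \<and> \<phi> (x [^] j) = \<phi> x [^]\<^bsub>N\<^esub> j" for j
  proof (induction j)
    case 0
    then show ?case using cocycle_one[OF \<phi>] by simp
  next
    case (Suc j)
    then show ?case using x cocycle_mult[OF \<phi>, of "x [^] j" x] aM[of "x [^] j" "\<phi> x"] cocycle_closed[OF \<phi> x(1)] by simp
  qed
  show ?thesis
    using N.coprime_exponents[of "\<phi> x" k l] cocycle_closed[OF \<phi> x(1)] k pow[of l] l by simp
qed

text \<open>
  After replacing \<open>\<phi>\<close> by a cohomologous cocycle both cocycles agree on
  \<open>R\<close>, hence they are cohomologous on \<open>B\<close>. Both are trivial on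
  \<open>M\<close>, so their values on \<open>B M\<close> are those on \<open>B\<close>.
\<close>

lemma restriction_injective:
  assumes B: "subgroup B G" and R: "R \<lhd> G\<lparr>carrier := B\<rparr>" "finite (rcosets\<^bsub>G\<lparr>carrier := B\<rparr>\<^esub> R)"
    and k: "coprime k (card (rcosets\<^bsub>G\<lparr>carrier := B\<rparr>\<^esub> R))" "k > 0"
      "\<And>x. x \<in> carrier N \<Longrightarrow> x [^]\<^bsub>N\<^esub> (k::nat) = \<one>\<^bsub>N\<^esub>"
    and K: "abelian_chain N K n"
    and aK: "\<And>i g x. i \<le> n \<Longrightarrow> g \<in> carrier G \<Longrightarrow> x \<in> K i \<Longrightarrow> a g x \<in> K i"
    and M: "subgroup M G" "\<And>x n. x \<in> M \<Longrightarrow> n \<in> carrier N \<Longrightarrow> a x n = n"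
      "\<And>x. x \<in> M \<Longrightarrow> \<exists>l::nat. coprime l k \<and> x [^] l \<in> U"
    and BM: "\<And>g. g \<in> carrier G \<Longrightarrow> \<exists>b\<in>B. \<exists>m\<in>M. g = b \<otimes> m"
    and U: "U \<subseteq> R"
    and \<phi>: "cocycle (carrier G) \<phi>" "\<And>u. u \<in> U \<Longrightarrow> \<phi> u = \<one>\<^bsub>N\<^esub>"
    and \<psi>: "cocycle (carrier G) \<psi>" "\<And>u. u \<in> U \<Longrightarrow> \<psi> u = \<one>\<^bsub>N\<^esub>"
    and coh: "cohomologous_by R v \<phi> \<psi>"
  shows "\<exists>v. cohomologous_by (carrier G) v \<phi> \<psi>"
proof -
  interpret B: subgroup B G by fact
  have BG: "b \<in> B \<Longrightarrow> b \<in> carrier G" for b by (rule B.mem_carrier)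
  have MG: "m \<in> M \<Longrightarrow> m \<in> carrier G" for m using subgroup.mem_carrier[OF M(1)] .
  have vN: "v \<in> carrier N" and \<psi>R: "\<And>r. r \<in> R \<Longrightarrow> \<psi> r = inv\<^bsub>N\<^esub> v \<otimes>\<^bsub>N\<^esub> \<phi> r \<otimes>\<^bsub>N\<^esub> a r v"
    using coh unfolding cohomologous_by_def by auto
  define \<phi>' where "\<phi>' = (\<lambda>x. inv\<^bsub>N\<^esub> v \<otimes>\<^bsub>N\<^esub> \<phi> x \<otimes>\<^bsub>N\<^esub> a x v)"
  have \<phi>': "cocycle (carrier G) \<phi>'" unfolding \<phi>'_def by (rule cocycle_cohomologous[OF G.subgroup_self \<phi>(1) vN])
  have toB: "cocycle B \<theta>" if "cocycle (carrier G) \<theta>" for \<theta> using that BG unfolding cocycle_def by simp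
  obtain w where w: "cohomologous_by B w \<phi>' \<psi>"
    using cocycle_unique_extension[OF B R k K aK[OF _ BG] toB[OF \<phi>'] toB[OF \<psi>(1)]] \<psi>R unfolding \<phi>'_def by auto
  have wN: "w \<in> carrier N" and wB: "\<And>b. b \<in> B \<Longrightarrow> \<psi> b = inv\<^bsub>N\<^esub> w \<otimes>\<^bsub>N\<^esub> \<phi>' b \<otimes>\<^bsub>N\<^esub> a b w"
    using w unfolding cohomologous_by_def by auto
  have triv: "\<theta> m = \<one>\<^bsub>N\<^esub>" if \<theta>: "cocycle (carrier G) \<theta>" "\<And>u. u \<in> U \<Longrightarrow> \<theta> u = \<one>\<^bsub>N\<^esub>" and m: "m \<in> M" for \<theta> m
  proof -
    obtain l :: nat where l: "coprime l k" "m [^] l \<in> U" using M(3)[OF m] by blast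
    show ?thesis
      by (rule cocycle_trivial_on_coprime_kernel[OF G.subgroup_self \<theta>(1) M(1,2) k(3) MG[OF m] m l(1)])
        (use \<theta>(2) l(2) in auto)
  qed
  have \<phi>'U: "\<phi>' u = \<one>\<^bsub>N\<^esub>" if "u \<in> U" for u using \<psi>R[of u] \<psi>(2)[OF that] U that unfolding \<phi>'_def by auto
  have "\<psi> g = inv\<^bsub>N\<^esub> w \<otimes>\<^bsub>N\<^esub> \<phi>' g \<otimes>\<^bsub>N\<^esub> a g w" if g: "g \<in> carrier G" for g
  proof -
    obtain b m where bm: "b \<in> B" "m \<in> M" "g = b \<otimes> m" using BM[OF g] by blast
    have e: "\<theta> g = \<theta> b" if "cocycle (carrier G) \<theta>" "\<And>u. u \<in> U \<Longrightarrow> \<theta> u = \<one>\<^bsub>N\<^esub>" for \<theta>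
      using cocycle_mult[OF that(1) BG[OF bm(1)] MG[OF bm(2)]] triv[OF that bm(2)] bm BG cocycle_closed[OF that(1)] by simp
    then show ?thesis
      using wB[OF bm(1)] e[OF \<phi>' \<phi>'U] e[OF \<psi>] bm(3) M(2)[OF bm(2) wN] a_mult[OF BG[OF bm(1)] MG[OF bm(2)] wN] by simp
  qed
  then have "cohomologous_by (carrier G) (v \<otimes>\<^bsub>N\<^esub> w) \<phi> \<psi>"
    unfolding cohomologous_by_def \<phi>'_def using vN wN cocycle_closed[OF \<phi>(1)]
    by (simp add: N.m_assoc N.inv_mult_group)
  then show ?thesis by blast
qed

text \<open>
  The inflation of a cocycle along \<open>B M \<rightarrow> B M / M\<close>.
\<close>

lemma cocycle_extend_trivially:
  assumes B: "subgroup B G" and M: "M \<lhd> G" "\<And>x n. x \<in> M \<Longrightarrow> n \<in> carrier N \<Longrightarrow> a x n = n"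
    and \<theta>: "cocycle B \<theta>" and triv: "\<And>x. x \<in> B \<Longrightarrow> x \<in> M \<Longrightarrow> \<theta> x = \<one>\<^bsub>N\<^esub>"
  shows "\<exists>\<psi>. cocycle (B <#> M) \<psi> \<and> (\<forall>b\<in>B. \<forall>m\<in>M. \<psi> (b \<otimes> m) = \<theta> b)"
proof -
  interpret B: subgroup B G by fact
  interpret M: normal M G by fact
  have BG: "b \<in> B \<Longrightarrow> b \<in> carrier G" for b by (rule B.mem_carrier)
  have MG: "m \<in> M \<Longrightarrow> m \<in> carrier G" for m by (rule M.mem_carrier)
  have wd: "\<theta> b = \<theta> b'" if "b \<in> B" "b' \<in> B" "m \<in> M" "m' \<in> M" "b \<otimes> m = b' \<otimes> m'" for b b' m m'
  proof -
    have "inv b' \<otimes> b = inv b' \<otimes> (b \<otimes> m) \<otimes> inv m" using that(1-4) BG MG by (simp add: G.m_assoc)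
    also have "\<dots> = m' \<otimes> inv m" unfolding that(5) using that(1-4) BG MG by (simp add: G.cancel_inv_left)
    finally have "inv b' \<otimes> b = m' \<otimes> inv m" .
    then have "inv b' \<otimes> b \<in> M" using that(3,4) by simp
    moreover have "inv b' \<otimes> b \<in> B" using that(1,2) by simp
    ultimately have z: "inv b' \<otimes> b \<in> M" "inv b' \<otimes> b \<in> B" .
    have "\<theta> b = \<theta> (b' \<otimes> (inv b' \<otimes> b))" using that(1-4) BG by (simp add: G.cancel_inv_left)
    also have "\<dots> = \<theta> b'" using cocycle_mult[OF \<theta> that(2) z(2)] triv[OF z(2,1)] cocycle_closed[OF \<theta>] that BG by simp
    finally show ?thesis .
  qed
  define \<psi> where "\<psi> = (\<lambda>g. \<theta> (SOME b. b \<in> B \<and> (\<exists>m\<in>M. g = b \<otimes> m)))"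
  have \<psi>_eq: "\<psi> (b \<otimes> m) = \<theta> b" if bm: "b \<in> B" "m \<in> M" for b m
  proof -
    define b0 where "b0 = (SOME b'. b' \<in> B \<and> (\<exists>m'\<in>M. b \<otimes> m = b' \<otimes> m'))"
    have "b0 \<in> B \<and> (\<exists>m'\<in>M. b \<otimes> m = b0 \<otimes> m')"
      unfolding b0_def by (rule someI[of _ b]) (use bm in auto)
    then obtain m' where m': "b0 \<in> B" "m' \<in> M" "b \<otimes> m = b0 \<otimes> m'" by blast
    have "\<psi> (b \<otimes> m) = \<theta> b0" unfolding \<psi>_def b0_def ..
    also have "\<dots> = \<theta> b" by (rule wd[OF m'(1) bm(1) m'(2) bm(2) m'(3)[symmetric]])
    finally show ?thesis .
  qed
  have "cocycle (B <#> M) \<psi>" unfolding cocycle_def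
  proof (intro conjI ballI)
    fix g h assume g: "g \<in> B <#> M" and h: "h \<in> B <#> M"
    obtain b m where bm: "b \<in> B" "m \<in> M" "g = b \<otimes> m" using g unfolding set_mult_def by blast
    obtain c m' where cm: "c \<in> B" "m' \<in> M" "h = c \<otimes> m'" using h unfolding set_mult_def by blast
    show "\<psi> g \<in> carrier N" using \<psi>_eq bm cocycle_closed[OF \<theta>] by simp
    have "g \<otimes> h = (b \<otimes> c) \<otimes> ((inv c \<otimes> m \<otimes> c) \<otimes> m')"
      unfolding bm cm using bm cm BG MG by (simp add: G.m_assoc G.cancel_inv_left)
    moreover have "inv c \<otimes> m \<otimes> c \<otimes> m' \<in> M" using M.inv_op_closed1 BG bm cm by simp
    ultimately have "\<psi> (g \<otimes> h) = \<theta> b \<otimes>\<^bsub>N\<^esub> a b (\<theta> c)" using \<psi>_eq bm cm cocycle_mult[OF \<theta>] by simp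
    also have "a b (\<theta> c) = a g (\<theta> c)" using bm cm BG MG M(2) cocycle_closed[OF \<theta>] by (simp add: a_mult)
    finally show "\<psi> (g \<otimes> h) = \<psi> g \<otimes>\<^bsub>N\<^esub> a g (\<psi> h)" using \<psi>_eq bm cm by simp
  qed
  then show ?thesis using \<psi>_eq by blast
qed

text \<open>
  The cocycle extends from \<open>R\<close> to \<open>B\<close> by invariance and coprimality, and
  the extension is trivial on \<open>B \<inter> M\<close>, so it inflates to \<open>B M =
  G\<close>.
\<close>

lemma restriction_surjective:
  assumes B: "subgroup B G" and R: "R \<lhd> G\<lparr>carrier := B\<rparr>" "finite (rcosets\<^bsub>G\<lparr>carrier := B\<rparr>\<^esub> R)"
    and k: "coprime k (card (rcosets\<^bsub>G\<lparr>carrier := B\<rparr>\<^esub> R))" "k > 0"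
      "\<And>x. x \<in> carrier N \<Longrightarrow> x [^]\<^bsub>N\<^esub> (k::nat) = \<one>\<^bsub>N\<^esub>"
    and K: "abelian_chain N K n"
    and aK: "\<And>i g x. i \<le> n \<Longrightarrow> g \<in> carrier G \<Longrightarrow> x \<in> K i \<Longrightarrow> a g x \<in> K i"
    and M: "M \<lhd> G" "\<And>x n. x \<in> M \<Longrightarrow> n \<in> carrier N \<Longrightarrow> a x n = n"
      "\<And>x. x \<in> M \<Longrightarrow> \<exists>l::nat. coprime l k \<and> x [^] l \<in> U"
    and BM: "\<And>g. g \<in> carrier G \<Longrightarrow> \<exists>b\<in>B. \<exists>m\<in>M. g = b \<otimes> m"
    and U: "U \<subseteq> R"
    and \<phi>: "cocycle R \<phi>" "\<And>u. u \<in> U \<Longrightarrow> \<phi> u = \<one>\<^bsub>N\<^esub>"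
    and inv: "\<And>b. b \<in> B \<Longrightarrow> \<exists>m\<in>carrier N. \<forall>r\<in>R. a b (\<phi> (inv b \<otimes> r \<otimes> b)) = inv\<^bsub>N\<^esub> m \<otimes>\<^bsub>N\<^esub> \<phi> r \<otimes>\<^bsub>N\<^esub> a r m"
  shows "\<exists>\<psi>. cocycle (carrier G) \<psi> \<and> (\<forall>r\<in>R. \<psi> r = \<phi> r)"
proof -
  interpret B: subgroup B G by fact
  interpret M: normal M G by fact
  interpret GB: left_action "G\<lparr>carrier := B\<rparr>" N a by (rule restrict_action[OF B])
  have BG: "b \<in> B \<Longrightarrow> b \<in> carrier G" for b by (rule B.mem_carrier)
  have MG: "m \<in> M \<Longrightarrow> m \<in> carrier G" for m by (rule M.mem_carrier)
  have RB: "r \<in> R \<Longrightarrow> r \<in> B" for r using subgroup.mem_carrier[OF normal_imp_subgroup[OF R(1)]] by simp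
  have coc: "GB.cocycle H \<theta> \<longleftrightarrow> cocycle H \<theta>" for H \<theta>
    unfolding GB.cocycle_def cocycle_def by simp
  have "\<exists>\<psi>. GB.cocycle (carrier (G\<lparr>carrier := B\<rparr>)) \<psi> \<and> (\<forall>r\<in>R. \<psi> r = \<phi> r)"
  proof (rule GB.cocycle_extension_normal[OF R k K])
    fix b assume "b \<in> carrier (G\<lparr>carrier := B\<rparr>)"
    then show "\<exists>m\<in>carrier N. \<forall>r\<in>R. a b (\<phi> (inv\<^bsub>G\<lparr>carrier := B\<rparr>\<^esub> b \<otimes>\<^bsub>G\<lparr>carrier := B\<rparr>\<^esub> r \<otimes>\<^bsub>G\<lparr>carrier := B\<rparr>\<^esub> b)) =
        inv\<^bsub>N\<^esub> m \<otimes>\<^bsub>N\<^esub> \<phi> r \<otimes>\<^bsub>N\<^esub> a r m"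
      using inv[of b] G.m_inv_consistent[OF B, of b] by simp
  qed (use aK BG \<phi> coc in auto)
  then obtain \<theta> where \<theta>: "cocycle B \<theta>" "\<And>r. r \<in> R \<Longrightarrow> \<theta> r = \<phi> r" unfolding coc by auto
  have triv: "\<theta> m = \<one>\<^bsub>N\<^esub>" if m: "m \<in> B" "m \<in> M" for m
  proof -
    obtain l :: nat where l: "coprime l k" "m [^] l \<in> U" using M(3)[OF m(2)] by blast
    show ?thesis
      by (rule cocycle_trivial_on_coprime_kernel[OF B \<theta>(1) M.subgroup_axioms M(2) k(3) m(1,2) l(1)])
        (use \<theta>(2) \<phi>(2) l(2) U in auto)
  qed
  have BMG: "B <#> M = carrier G"
  proof
    show "B <#> M \<subseteq> carrier G" using BG MG unfolding set_mult_def by auto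
    show "carrier G \<subseteq> B <#> M" using BM unfolding set_mult_def by blast
  qed
  obtain \<psi> where \<psi>: "cocycle (carrier G) \<psi>" "\<And>b m. b \<in> B \<Longrightarrow> m \<in> M \<Longrightarrow> \<psi> (b \<otimes> m) = \<theta> b"
    using cocycle_extend_trivially[OF B M(1,2) \<theta>(1) triv] unfolding BMG by blast
  have "\<psi> r = \<phi> r" if r: "r \<in> R" for r
    using \<psi>(2)[OF RB[OF r] M.one_closed] \<theta>(2)[OF r] BG[OF RB[OF r]] by simp
  then show ?thesis using \<psi>(1) by blast
qed

end

section \<open>Finite groups whose elements of coprime orders commute\<close>

text \<open>
  Every orbit without a fixed point has a size divisible by \<open>p\<close>.
\<close>

lemma (in group_action) p_group_fixed_point:
  assumes p: "prime (p::nat)" and G: "order G = p ^ b" and E: "finite E" "\<not> p dvd card E"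
  shows "\<exists>x\<in>E. \<forall>g\<in>carrier G. \<phi> g x = x"
proof (rule ccontr)
  assume no: "\<not> ?thesis"
  have "p dvd card orb" if orb: "orb \<in> orbits G E \<phi>" for orb
  proof -
    obtain x where x: "x \<in> E" "orb = orbit G \<phi> x" using orb unfolding orbits_def by blast
    have "card orb dvd p ^ b" using orbit_stabilizer_theorem[OF x(1)] x(2) G by (metis dvd_triv_left)
    then obtain i where i: "card orb = p ^ i" using p divides_primepow_nat by blast
    have "i \<noteq> 0"
    proof
      assume "i = 0"
      then obtain y where y: "orbit G \<phi> x = {y}" using i x(2) by (auto simp: card_1_singleton_iff)
      have "\<phi> g x = x" if g: "g \<in> carrier G" for g
      proof -
        have "\<phi> g x \<in> orbit G \<phi> x" unfolding orbit_def using g by blast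
        then show ?thesis using orbit_refl[OF x(1)] unfolding y by simp
      qed
      then show False using no x(1) by blast
    qed
    then show ?thesis using i by (simp add: dvd_power)
  qed
  then have "p dvd (\<Sum>orb\<in>orbits G E \<phi>. card orb)" by (rule dvd_sum)
  also have "(\<Sum>orb\<in>orbits G E \<phi>. card orb) = card E"
    using disjoint_sum[OF E(1), of "\<lambda>_. 1::nat"] by simp
  finally show False using E(2) by simp
qed

text \<open>
  The second Sylow theorem: \<open>Q\<close> acts on the cosets of \<open>P\<close>, whose number
  is prime to \<open>p\<close>, and the stabilizer of a coset \<open>P g\<close> is the part of
  \<open>Q\<close> contained in \<open>g\<inverse> P g\<close>.
\<close>

lemma (in group) p_subgroup_conjugate_into_sylow:
  assumes p: "prime (p::nat)" and P: "subgroup P G" "finite (rcosets P)" "\<not> p dvd card (rcosets P)"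
    and Q: "subgroup Q G" "card Q = p ^ b"
  shows "\<exists>g\<in>carrier G. \<forall>q\<in>Q. g \<otimes> q \<otimes> inv g \<in> P"
proof -
  interpret P: subgroup P G by fact
  interpret Q: subgroup Q G by fact
  define E where "E = rcosets P"
  define act where "act = (\<lambda>q. \<lambda>X\<in>E. X #> inv q)"
  have PG: "P \<subseteq> carrier G" by (rule P.subset)
  have E_elim: "\<exists>x\<in>carrier G. X = P #> x" if "X \<in> E" for X using that unfolding E_def RCOSETS_def by auto
  have E_sub: "X \<subseteq> carrier G" if "X \<in> E" for X using that unfolding E_def by (rule P.rcosets_carrier[OF is_group])
  have mv: "X #> g \<in> E" if X: "X \<in> E" and g: "g \<in> carrier G" for X g
  proof -
    obtain x where x: "x \<in> carrier G" "X = P #> x" using E_elim[OF X] by blast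
    have "P #> (x \<otimes> g) \<in> rcosets P" using rcosetsI[OF PG] x(1) g by simp
    then show ?thesis using x g PG by (simp add: coset_mult_assoc E_def)
  qed
  have comp: "X #> g #> h = X #> (g \<otimes> h)" if "X \<in> E" "g \<in> carrier G" "h \<in> carrier G" for X g h
    using coset_mult_assoc[OF E_sub[OF that(1)] that(2,3)] .
  have bij: "act q \<in> Bij E" if q: "q \<in> Q" for q
  proof -
    have "bij_betw (act q) E E"
      by (rule bij_betwI[where g = "\<lambda>X. X #> q"])
        (use q Q.mem_carrier mv E_sub in \<open>auto simp: act_def comp\<close>)
    then show ?thesis unfolding Bij_def act_def by auto
  qed
  interpret GQ: group "G\<lparr>carrier := Q\<rparr>" using Q(1) by (rule subgroup_imp_group)
  have "act \<in> hom (G\<lparr>carrier := Q\<rparr>) (BijGroup E)"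
  proof (rule homI)
    fix x y assume "x \<in> carrier (G\<lparr>carrier := Q\<rparr>)" "y \<in> carrier (G\<lparr>carrier := Q\<rparr>)"
    then have xy: "x \<in> Q" "y \<in> Q" by auto
    have "act (x \<otimes> y) = compose E (act x) (act y)"
      using xy Q.mem_carrier mv by (auto simp: act_def compose_def comp inv_mult_group fun_eq_iff)
    then show "act (x \<otimes>\<^bsub>G\<lparr>carrier := Q\<rparr>\<^esub> y) = act x \<otimes>\<^bsub>BijGroup E\<^esub> act y"
      using bij xy by (simp add: BijGroup_def)
  qed (simp add: bij BijGroup_def)
  then interpret ga: group_action "G\<lparr>carrier := Q\<rparr>" E act
    by (simp add: group_action_def group_hom_def group_hom_axioms_def GQ.is_group group_BijGroup)
  have "order (G\<lparr>carrier := Q\<rparr>) = p ^ b" using Q(2) by (simp add: order_def)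
  then obtain X where X: "X \<in> E" "\<And>q. q \<in> Q \<Longrightarrow> act q X = X"
    using ga.p_group_fixed_point[OF p, of b] P(2,3) unfolding E_def by auto
  obtain g where g: "g \<in> carrier G" "X = P #> g" using E_elim[OF X(1)] by blast
  have "g \<otimes> q \<otimes> inv g \<in> P" if q: "q \<in> Q" for q
  proof -
    have "P #> g #> inv (inv q) = P #> g" using X(2)[of "inv q"] X(1) q g(2) unfolding act_def by simp
    then have "P #> (g \<otimes> q) = P #> g" using comp[of X g q] q g PG by (simp add: coset_mult_assoc)
    then have "P #> (g \<otimes> q \<otimes> inv g) = P"
      using coset_mult_inv2[of P "g \<otimes> q" g] g q PG by simp
    then show ?thesis using coset_join1[OF _ _ P(1)] g q by simp
  qed
  then show ?thesis using g(1) by blast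
qed

text \<open>
  For a finite group this is equivalent to nilpotency. It is the only consequence of nilpotency
  used below for finite quotients, and it is stated without orders of elements so that it can be
  verified along chains.
\<close>

definition coprime_elements_commute :: "('a, 'b) monoid_scheme \<Rightarrow> bool" where
  "coprime_elements_commute G \<longleftrightarrow> (\<forall>x\<in>carrier G. \<forall>y\<in>carrier G. \<forall>k l :: nat.
      x [^]\<^bsub>G\<^esub> k = \<one>\<^bsub>G\<^esub> \<longrightarrow> y [^]\<^bsub>G\<^esub> l = \<one>\<^bsub>G\<^esub> \<longrightarrow> coprime k l \<longrightarrow> x \<otimes>\<^bsub>G\<^esub> y = y \<otimes>\<^bsub>G\<^esub> x)"

text \<open>
  If the commutator \<open>c\<close> of \<open>x\<close> and \<open>y\<close> commutes with both,
  then \<open>[x\<^sup>j, y] = c\<^sup>j = [x, y\<^sup>j]\<close>, so \<open>c\<close> is killed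
  by two coprime numbers.
\<close>

lemma (in group) coprime_commutator_trivial:
  fixes k l :: nat
  assumes x: "x \<in> carrier G" "x [^] k = \<one>" and y: "y \<in> carrier G" "y [^] l = \<one>" and kl: "coprime k l"
    and c: "c \<in> carrier G" "x \<otimes> y = c \<otimes> y \<otimes> x" "c \<otimes> x = x \<otimes> c" "c \<otimes> y = y \<otimes> c"
  shows "c = \<one>"
proof -
  have cx: "c \<otimes> x [^] j = x [^] j \<otimes> c" and cy: "c \<otimes> y [^] j = y [^] j \<otimes> c" for j :: nat
    using group_commutes_pow[of x c j] group_commutes_pow[of y c j] c x y by simp_all
  have 1: "x [^] j \<otimes> y = c [^] j \<otimes> y \<otimes> x [^] j" for j :: nat
  proof (induction j)
    case (Suc j)
    have "x [^] Suc j \<otimes> y = x [^] j \<otimes> c \<otimes> y \<otimes> x" using x y c by (simp add: m_assoc)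
    also have "\<dots> = c \<otimes> (x [^] j \<otimes> y) \<otimes> x" using x y c cx[of j] by (simp add: m_assoc[symmetric])
    also have "\<dots> = c \<otimes> (c [^] j \<otimes> y \<otimes> x [^] j) \<otimes> x" using Suc by simp
    also have "\<dots> = c [^] Suc j \<otimes> y \<otimes> x [^] Suc j" using x y c nat_pow_comm[of c 1 j] by (simp add: m_assoc[symmetric])
    finally show ?case .
  qed (use y in simp)
  have 2: "x \<otimes> y [^] j = c [^] j \<otimes> y [^] j \<otimes> x" for j :: nat
  proof (induction j)
    case (Suc j)
    have "x \<otimes> y [^] Suc j = (x \<otimes> y [^] j) \<otimes> y" using x y c by (simp add: m_assoc)
    also have "\<dots> = c [^] j \<otimes> y [^] j \<otimes> (x \<otimes> y)" unfolding Suc using x y c(1) by (simp add: m_assoc)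
    also have "\<dots> = c [^] j \<otimes> (y [^] j \<otimes> c) \<otimes> y \<otimes> x" using x y c(1,2) by (simp add: m_assoc)
    also have "\<dots> = c [^] Suc j \<otimes> y [^] Suc j \<otimes> x" unfolding cy[symmetric] using x y c(1) by (simp add: m_assoc)
    finally show ?case .
  qed (use x in simp)
  have "c [^] k = \<one>" using 1[of k] x y c(1) r_cancel_one'[of y "c [^] k"] by simp
  moreover have "c [^] l = \<one>" using 2[of l] x y c(1) r_cancel_one'[of x "c [^] l"] by simp
  ultimately show ?thesis using coprime_exponents[OF c(1)] kl by (simp add: coprime_commute)
qed

text \<open>
  The conjugation action of \<open>F\<close> is trivial on the factors of the ascending chain
  \<open>H\<close>. For \<open>F = G\<close> this is a central series.
\<close>

definition centralizing_chain :: "('a, 'b) monoid_scheme \<Rightarrow> 'a set \<Rightarrow> (nat \<Rightarrow> 'a set) \<Rightarrow> nat \<Rightarrow> bool" where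
  "centralizing_chain G F H n \<longleftrightarrow> H 0 = {\<one>\<^bsub>G\<^esub>} \<and> H n = carrier G \<and> (\<forall>i\<le>n. H i \<lhd> G) \<and>
     (\<forall>i<n. H i \<subseteq> H (Suc i) \<and> (\<forall>x\<in>H (Suc i). \<forall>f\<in>F. f \<otimes>\<^bsub>G\<^esub> x \<otimes>\<^bsub>G\<^esub> inv\<^bsub>G\<^esub> f \<otimes>\<^bsub>G\<^esub> inv\<^bsub>G\<^esub> x \<in> H i))"

text \<open>
  The commutator of two elements of coprime orders descends the chain: modulo \<open>H i\<close>
  it is central as soon as it lies in \<open>H (Suc i)\<close>, and then it is trivial.
\<close>

lemma (in group) central_chain_imp_coprime_elements_commute:
  assumes H: "centralizing_chain G (carrier G) H n"
  shows "coprime_elements_commute G"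
  unfolding coprime_elements_commute_def
proof (intro ballI allI impI)
  fix x y and k l :: nat
  assume x: "x \<in> carrier G" "x [^] k = \<one>" and y: "y \<in> carrier G" "y [^] l = \<one>" and kl: "coprime k l"
  define c where "c = x \<otimes> y \<otimes> inv x \<otimes> inv y"
  have cG: "c \<in> carrier G" unfolding c_def using x y by simp
  have xy: "x \<otimes> y = c \<otimes> y \<otimes> x" unfolding c_def using x y by (simp add: m_assoc)
  have "c \<in> H 0"
  proof (rule inc_induct[of 0 n])
    show "c \<in> H n" using H cG unfolding centralizing_chain_def by simp
  next
    fix i assume i: "i < n" and c: "c \<in> H (Suc i)"
    interpret Hi: normal "H i" G using H i unfolding centralizing_chain_def by simp
    interpret Q: group "G Mod H i" by (rule Hi.factorgroup_is_group)
    interpret cl: group_hom G "G Mod H i" "\<lambda>x. H i #> x" using Hi.r_coset_hom_Mod by unfold_locales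
    have central: "(H i #> c) \<otimes>\<^bsub>G Mod H i\<^esub> (H i #> z) = (H i #> z) \<otimes>\<^bsub>G Mod H i\<^esub> (H i #> c)" if z: "z \<in> carrier G" for z
    proof -
      have "z \<otimes> c \<otimes> inv z \<otimes> inv c \<in> H i" using H i c z unfolding centralizing_chain_def by simp
      then have "H i #> (z \<otimes> c \<otimes> inv z \<otimes> inv c \<otimes> (c \<otimes> z)) = H i #> (c \<otimes> z)"
        using cG z Hi.rcos_const[OF is_group] by (metis coset_mult_assoc Hi.subset Hi.mem_carrier m_closed)
      then have "H i #> (z \<otimes> c) = H i #> (c \<otimes> z)" using cG z by (simp add: m_assoc cancel_inv_left)
      then show ?thesis by (simp only: mult_FactGroup Hi.rcos_sum[OF cG z] Hi.rcos_sum[OF z cG])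
    qed
    have "H i #> c = \<one>\<^bsub>G Mod H i\<^esub>"
    proof (rule Q.coprime_commutator_trivial[of "H i #> x" k "H i #> y" l])
      show "(H i #> x) \<otimes>\<^bsub>G Mod H i\<^esub> (H i #> y) = (H i #> c) \<otimes>\<^bsub>G Mod H i\<^esub> (H i #> y) \<otimes>\<^bsub>G Mod H i\<^esub> (H i #> x)"
        using Hi.rcos_sum[OF x(1) y(1)] Hi.rcos_sum[OF cG y(1)] Hi.rcos_sum[OF m_closed[OF cG y(1)] x(1)]
        by (simp only: mult_FactGroup xy)
      show "(H i #> x) [^]\<^bsub>G Mod H i\<^esub> k = \<one>\<^bsub>G Mod H i\<^esub>" "(H i #> y) [^]\<^bsub>G Mod H i\<^esub> l = \<one>\<^bsub>G Mod H i\<^esub>"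
        using x y cl.hom_nat_pow[of x k] cl.hom_nat_pow[of y l] cl.hom_one by simp_all
    qed (use cl.hom_closed x y cG central kl in auto)
    then show "c \<in> H i" using coset_join1[OF _ cG Hi.subgroup_axioms] by simp
  qed simp
  then have "c = \<one>" using H unfolding centralizing_chain_def by simp
  then show "x \<otimes> y = y \<otimes> x" using xy x y by simp
qed

lemma (in group) subgroup_pow_card:
  assumes "subgroup T G" "finite T" "t \<in> T"
  shows "t [^] card T = \<one>"
proof -
  interpret GT: group "G\<lparr>carrier := T\<rparr>" using assms(1) by (rule subgroup_imp_group)
  show ?thesis using GT.pow_order_eq_1[of t] assms nat_pow_consistent[of t "card T" T] by (simp add: order_def)
qed

text \<open>
  The normalizer. Both inclusions are demanded so that the definition is right for infinite
  \<open>S\<close> too.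
\<close>

definition normalizing :: "('a, 'b) monoid_scheme \<Rightarrow> 'a set \<Rightarrow> 'a set" where
  "normalizing G S = {g \<in> carrier G. (\<forall>s\<in>S. g \<otimes>\<^bsub>G\<^esub> s \<otimes>\<^bsub>G\<^esub> inv\<^bsub>G\<^esub> g \<in> S) \<and> (\<forall>s\<in>S. inv\<^bsub>G\<^esub> g \<otimes>\<^bsub>G\<^esub> s \<otimes>\<^bsub>G\<^esub> g \<in> S)}"

lemma (in group) normalizing_subgroup:
  assumes "S \<subseteq> carrier G"
  shows "subgroup (normalizing G S) G"
proof (rule subgroupI)
  have "\<one> \<in> normalizing G S" using assms unfolding normalizing_def by auto
  then show "normalizing G S \<noteq> {}" by blast
next
  fix g h assume gh: "g \<in> normalizing G S" "h \<in> normalizing G S"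
  have "g \<otimes> h \<otimes> s \<otimes> inv (g \<otimes> h) = g \<otimes> (h \<otimes> s \<otimes> inv h) \<otimes> inv g"
    "inv (g \<otimes> h) \<otimes> s \<otimes> (g \<otimes> h) = inv h \<otimes> (inv g \<otimes> s \<otimes> g) \<otimes> h" if "s \<in> S" for s
    using gh that assms unfolding normalizing_def by (simp_all add: m_assoc inv_mult_group subset_eq)
  then show "g \<otimes> h \<in> normalizing G S" using gh unfolding normalizing_def by simp
qed (use assms in \<open>auto simp: normalizing_def\<close>)

lemma (in group) subgroup_subset_normalizing:
  assumes "subgroup S G"
  shows "S \<subseteq> normalizing G S"
  unfolding normalizing_def using subgroup.mem_carrier[OF assms] subgroup.m_closed[OF assms] subgroup.m_inv_closed[OF assms] by auto

text \<open>
  The normalizer of \<open>S\<close> contains \<open>S\<close> and, for every prime \<open>q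
  \<noteq> p\<close>, a Sylow \<open>q\<close>-subgroup, which even centralizes \<open>S\<close>.
  So no prime divides its index.
\<close>

lemma (in group) coprime_sylow_normal:
  assumes fin: "finite (carrier G)" and cc: "coprime_elements_commute G"
    and p: "prime (p::nat)" and S: "subgroup S G" "card S = p ^ a" and o: "order G = p ^ a * m" and m: "\<not> p dvd m"
  shows "S \<lhd> G"
proof -
  interpret S: subgroup S G by fact
  have finS: "finite S" using fin S.subset finite_subset by blast
  define M where "M = normalizing G S"
  have M: "subgroup M G" unfolding M_def by (rule normalizing_subgroup[OF S.subset])
  have SM: "S \<subseteq> M" unfolding M_def by (rule subgroup_subset_normalizing[OF S(1)])
  have cM: "card (rcosets M) * card M = order G" by (rule lagrange[OF M])
  have pos: "order G > 0" using fin order_gt_0_iff_finite by blast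
  have "card (rcosets M) = 1"
  proof (rule ccontr)
    assume "card (rcosets M) \<noteq> 1"
    then obtain q where q: "prime q" "q dvd card (rcosets M)" using prime_factor_nat by blast
    define b where "b = multiplicity q (order G)"
    obtain m' where m': "order G = q ^ b * m'" "\<not> q dvd m'"
      using multiplicity_decompose'[of "order G" q] pos q(1) unfolding b_def by (metis not_prime_unit neq0_conv)
    obtain T where T: "subgroup T G" "card T = q ^ b" using sylow_thm[OF q(1) is_group m'(1) fin] by blast
    have "q ^ b dvd card M"
    proof (cases "q = p")
      case True
      have "b = a" using m o p pos multiplicity_decomposeI[of "order G" p a m] unfolding b_def True by (simp add: mult.commute)
      moreover have "card S dvd card M"
      proof -
        interpret GM: group "G\<lparr>carrier := M\<rparr>" using M by (rule subgroup_imp_group)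
        have "subgroup S (G\<lparr>carrier := M\<rparr>)" by (rule subgroup_incl[OF S(1) M SM])
        then have "card (rcosets\<^bsub>G\<lparr>carrier := M\<rparr>\<^esub> S) * card S = card M" using GM.lagrange by (simp add: order_def)
        then show ?thesis by (metis dvd_triv_right)
      qed
      ultimately show ?thesis using S(2) True by simp
    next
      case False
      have TG: "t \<in> T \<Longrightarrow> t \<in> carrier G" for t using subgroup.mem_carrier[OF T(1)] .
      have finT: "finite T" using finite_subset[of T "carrier G"] TG fin by auto
      have cop: "coprime (q ^ b) (p ^ a)" using False q(1) p by (simp add: primes_coprime)
      have "t \<in> M" if t: "t \<in> T" for t
      proof -
        have ts: "t \<otimes> s = s \<otimes> t" if s: "s \<in> S" for s
          using cc subgroup_pow_card[OF T(1) finT t] subgroup_pow_card[OF S(1) finS s] cop TG[OF t] S.mem_carrier[OF s]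
          unfolding coprime_elements_commute_def T(2) S(2) by blast
        have "t \<otimes> s \<otimes> inv t = s" if s: "s \<in> S" for s
          unfolding ts[OF s] using TG[OF t] S.mem_carrier[OF s] by (simp add: m_assoc)
        moreover have "inv t \<otimes> s \<otimes> t = s" if s: "s \<in> S" for s
        proof -
          have "inv t \<otimes> s \<otimes> t = inv t \<otimes> (t \<otimes> s)" unfolding ts[OF s] using TG[OF t] S.mem_carrier[OF s] by (simp add: m_assoc)
          then show ?thesis using TG[OF t] S.mem_carrier[OF s] by (simp add: cancel_inv_left)
        qed
        ultimately show ?thesis unfolding M_def normalizing_def using TG[OF t] by simp
      qed
      then have TM: "T \<subseteq> M" by blast
      interpret GM: group "G\<lparr>carrier := M\<rparr>" using M by (rule subgroup_imp_group)
      have "subgroup T (G\<lparr>carrier := M\<rparr>)" by (rule subgroup_incl[OF T(1) M TM])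
      then have "card (rcosets\<^bsub>G\<lparr>carrier := M\<rparr>\<^esub> T) * card T = card M" using GM.lagrange by (simp add: order_def)
      then show ?thesis unfolding T(2) by (metis dvd_triv_right)
    qed
    then have "q ^ Suc b dvd order G" using q(2) cM by (metis mult_dvd_mono power_Suc)
    then have "q ^ b * q dvd q ^ b * m'" unfolding m'(1) by (simp add: mult.commute)
    then have "q dvd m'" using prime_gt_0_nat[OF q(1)] by simp
    then show False using m'(2) by simp
  qed
  then have "card M = order G" using cM by simp
  then have "M = carrier G" using card_subset_eq[OF fin subgroup.subset[OF M]] unfolding order_def by simp
  then show ?thesis using S(1) unfolding M_def normalizing_def by (intro normal_invI) auto
qed

text \<open>
  A subgroup only under additional assumptions, for instance when elements of coprime orders
  commute and \<open>d\<close> is a unitary divisor of the order of \<open>G\<close>.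
\<close>

definition torsion :: "('a, 'b) monoid_scheme \<Rightarrow> nat \<Rightarrow> 'a set" where
  "torsion G d = {x \<in> carrier G. x [^]\<^bsub>G\<^esub> d = \<one>\<^bsub>G\<^esub>}"

lemma (in group) torsion_commute:
  assumes "coprime_elements_commute G" "coprime d e" "x \<in> torsion G d" "y \<in> torsion G e"
  shows "x \<otimes> y = y \<otimes> x"
  using assms unfolding coprime_elements_commute_def torsion_def by blast

lemma (in group) torsion_mono:
  assumes "x \<in> torsion G d" "d dvd e"
  shows "x \<in> torsion G e"
proof -
  obtain f where "e = d * f" using assms(2) by blast
  then show ?thesis using assms(1) nat_pow_pow[of x d f] unfolding torsion_def by simp
qed

lemma (in group) torsion_conj:
  assumes "x \<in> torsion G d" "g \<in> carrier G"
  shows "g \<otimes> x \<otimes> inv g \<in> torsion G d"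
proof -
  have "(g \<otimes> x \<otimes> inv g) [^] j = g \<otimes> x [^] j \<otimes> inv g" for j :: nat
    using assms unfolding torsion_def by (induction j) (simp_all add: m_assoc cancel_inv_left)
  then show ?thesis using assms unfolding torsion_def by simp
qed

text \<open>
  The exponents come from a Bezout identity for the coprime numbers \<open>d\<close> and
  \<open>e\<close>; it is written with subtraction avoided, whence the inverse in the second
  factor.
\<close>

lemma (in group) torsion_split:
  assumes x: "x \<in> torsion G (d * e)" and s: "e * u = 1 + d * q"
  shows "x [^] (e * u) \<in> torsion G d" "inv (x [^] (d * q)) \<in> torsion G e"
    "x = x [^] (e * u) \<otimes> inv (x [^] (d * q))"
proof -
  have xG: "x \<in> carrier G" "x [^] (d * e) = \<one>" using x unfolding torsion_def by auto
  have "(x [^] (e * u)) [^] d = (x [^] (d * e)) [^] u" using xG(1) by (simp add: nat_pow_pow mult_ac)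
  then show "x [^] (e * u) \<in> torsion G d" using xG unfolding torsion_def by simp
  have "(x [^] (d * q)) [^] e = (x [^] (d * e)) [^] q" using xG(1) by (simp add: nat_pow_pow mult_ac)
  then show "inv (x [^] (d * q)) \<in> torsion G e" using xG unfolding torsion_def by (simp add: nat_pow_inv)
  have "x [^] (e * u) = x \<otimes> x [^] (d * q)" unfolding s using xG(1) nat_pow_mult[of x 1 "d * q"] by simp
  then show "x = x [^] (e * u) \<otimes> inv (x [^] (d * q))" using xG(1) by (simp add: m_assoc)
qed

lemma (in group) torsion_prime_power:
  assumes fin: "finite (carrier G)" and cc: "coprime_elements_commute G"
    and p: "prime (p::nat)" and o: "order G = p ^ a * m" and m: "\<not> p dvd m"
  shows "subgroup (torsion G (p ^ a)) G" "card (torsion G (p ^ a)) = p ^ a"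
proof -
  obtain S where S: "subgroup S G" "card S = p ^ a" using sylow_thm[OF p is_group o fin] by blast
  interpret S: normal S G by (rule coprime_sylow_normal[OF fin cc p S o m])
  interpret Q: group "G Mod S" by (rule S.factorgroup_is_group)
  have pos: "p ^ a > 0" using p prime_gt_0_nat by simp
  have finS: "finite S" using fin S.subset finite_subset by blast
  have "card (rcosets S) * p ^ a = p ^ a * m" using lagrange[OF S(1)] S(2) o by simp
  then have idx: "card (rcosets S) = m" using prime_gt_0_nat[OF p] by simp
  have "torsion G (p ^ a) = S"
  proof
    show "S \<subseteq> torsion G (p ^ a)" unfolding torsion_def using subgroup_pow_card[OF S(1) finS] S(2) by auto
    show "torsion G (p ^ a) \<subseteq> S"
    proof
      fix x assume "x \<in> torsion G (p ^ a)"
      then have x: "x \<in> carrier G" "x [^] (p ^ a) = \<one>" unfolding torsion_def by auto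
      have X: "S #> x \<in> carrier (G Mod S)" using x by (auto simp: carrier_FactGroup)
      have "(S #> x) [^]\<^bsub>G Mod S\<^esub> (p ^ a) = \<one>\<^bsub>G Mod S\<^esub>"
        using S.FactGroup_pow[OF x(1), of "p ^ a"] x S.subset by simp
      moreover have "(S #> x) [^]\<^bsub>G Mod S\<^esub> m = \<one>\<^bsub>G Mod S\<^esub>"
        using Q.pow_order_eq_1[OF X] idx by (simp add: order_def FactGroup_def)
      moreover have "coprime m (p ^ a)" using prime_imp_coprime[OF p m] by (simp add: coprime_commute)
      ultimately have "S #> x = S" using Q.coprime_exponents[OF X] by simp
      then show "x \<in> S" using coset_join1[OF _ x(1) S(1)] by simp
    qed
  qed
  then show "subgroup (torsion G (p ^ a)) G" "card (torsion G (p ^ a)) = p ^ a" using S by auto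
qed

text \<open>
  Split off one prime at a time. For a prime power the set is a normal Sylow subgroup, and factors
  belonging to different primes commute.
\<close>

lemma (in group) torsion_mult_closed:
  assumes fin: "finite (carrier G)" and cc: "coprime_elements_commute G"
    and "order G = d * e" "coprime d e" "x \<in> torsion G d" "y \<in> torsion G d"
  shows "x \<otimes> y \<in> torsion G d"
  using assms(3-)
proof (induction d arbitrary: e x y rule: less_induct)
  case (less d)
  have pos: "order G > 0" using fin order_gt_0_iff_finite by blast
  then have d0: "d > 0" "e > 0" using less.prems(1) by auto
  show ?case
  proof (cases "d = 1")
    case True
    then show ?thesis using less.prems unfolding torsion_def by auto
  next
    case False
    then obtain p where p: "prime p" "p dvd d" using prime_factor_nat by blast
    obtain d' where d': "d = p ^ multiplicity p d * d'" "\<not> p dvd d'"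
      using multiplicity_decompose'[of d p] d0(1) p(1) by (metis not_prime_unit neq0_conv)
    define a where "a = multiplicity p d"
    have dd: "d = p ^ a * d'" using d'(1) unfolding a_def .
    have a0: "a > 0" unfolding a_def using p d0(1) by (simp add: prime_multiplicity_gt_zero_iff)
    have cop: "coprime (p ^ a) d'" using p(1) d'(2) by (simp add: prime_imp_coprime)
    have "\<not> p dvd e" using less.prems(2) p by (meson coprime_common_divisor not_prime_unit)
    then have m: "\<not> p dvd (d' * e)" using d'(2) p(1) by (simp add: prime_dvd_mult_iff)
    have lt: "d' < d"
    proof -
      have "1 < p ^ a" using p(1) a0 prime_gt_1_nat one_less_power by blast
      moreover have "d' > 0" using d0(1) dd by (cases d') auto
      ultimately show ?thesis using n_less_m_mult_n[of d' "p ^ a"] dd by simp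
    qed
    have o: "order G = p ^ a * (d' * e)" "order G = d' * (p ^ a * e)" using less.prems(1) dd by (simp_all add: mult_ac)
    have cop': "coprime d' (p ^ a * e)" using cop less.prems(2) unfolding dd by (simp add: coprime_commute)
    interpret E: subgroup "torsion G (p ^ a)" G by (rule torsion_prime_power(1)[OF fin cc p(1) o(1) m])
    obtain u q where uq: "d' * u = 1 + p ^ a * q"
      using coprime_power_inverse[OF cop] p(1) prime_gt_0_nat dd d0(1) by (metis nat_0_less_mult_iff)
    define s where "s = (\<lambda>z. z [^] (d' * u))"
    define t where "t = (\<lambda>z. inv (z [^] (p ^ a * q)))"
    have st: "s z \<in> torsion G (p ^ a)" "t z \<in> torsion G d'" "z = s z \<otimes> t z" if "z \<in> torsion G d" for z
      using torsion_split[of z "p ^ a" d' u q] that uq unfolding s_def t_def dd by auto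
    note X = st[OF less.prems(3)] and Y = st[OF less.prems(4)]
    have car: "s x \<in> carrier G" "t x \<in> carrier G" "s y \<in> carrier G" "t y \<in> carrier G"
      using X Y unfolding torsion_def by auto
    have A: "s x \<otimes> s y \<in> torsion G d" using E.m_closed[OF X(1) Y(1)] torsion_mono[of _ "p ^ a" d] dd by simp
    have B: "t x \<otimes> t y \<in> torsion G d'" using less.IH[OF lt o(2) cop' X(2) Y(2)] .
    have "x \<otimes> y = (s x \<otimes> t x) \<otimes> (s y \<otimes> t y)" using X(3) Y(3) by simp
    also have "\<dots> = s x \<otimes> (t x \<otimes> s y) \<otimes> t y" using car by (simp add: m_assoc)
    also have "t x \<otimes> s y = s y \<otimes> t x" using torsion_commute[OF cc cop Y(1) X(2)] by simp
    finally have xy: "x \<otimes> y = (s x \<otimes> s y) \<otimes> (t x \<otimes> t y)" using car by (simp add: m_assoc)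
    have "(s x \<otimes> s y) \<otimes> (t x \<otimes> t y) = (t x \<otimes> t y) \<otimes> (s x \<otimes> s y)"
      using torsion_commute[OF cc cop E.m_closed[OF X(1) Y(1)] B] .
    then have "(x \<otimes> y) [^] d = (s x \<otimes> s y) [^] d \<otimes> (t x \<otimes> t y) [^] d"
      unfolding xy using pow_mult_distrib car by simp
    also have "\<dots> = \<one>" using A torsion_mono[OF B, of d] dd unfolding torsion_def by simp
    finally show ?thesis using less.prems unfolding torsion_def by simp
  qed
qed

lemma (in group) torsion_subgroup:
  assumes "finite (carrier G)" "coprime_elements_commute G" "order G = d * e" "coprime d e"
  shows "subgroup (torsion G d) G"
  by (rule subgroupI) (use torsion_mult_closed[OF assms] in \<open>auto simp: torsion_def nat_pow_inv intro: exI[of _ \<one>]\<close>)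

text \<open>
  The exponent \<open>e u\<close> is \<open>1\<close> modulo \<open>d\<close> and \<open>0\<close>
  modulo \<open>e\<close>, so this power map is the projection of \<open>G\<close> onto its
  \<open>d\<close>-torsion along its \<open>e\<close>-torsion.
\<close>

lemma (in group) coprime_power_hom:
  assumes fin: "finite (carrier G)" and cc: "coprime_elements_commute G"
    and o: "order G = d * e" and de: "coprime d e" and s: "e * u = 1 + d * q"
    and x: "x \<in> carrier G" and y: "y \<in> carrier G"
  shows "(x \<otimes> y) [^] (e * u) = x [^] (e * u) \<otimes> y [^] (e * u)"
proof -
  have tor: "z \<in> torsion G (d * e)" if "z \<in> carrier G" for z
    unfolding torsion_def using pow_order_eq_1[OF that] o that by simp
  define v where "v = (\<lambda>z. inv (z [^] (d * q)))"
  have v_app: "inv (z [^] (d * q)) = v z" for z by (simp add: v_def)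
  note X = torsion_split[OF tor[OF x] s, unfolded v_app] and Y = torsion_split[OF tor[OF y] s, unfolded v_app]
  have car: "x [^] (e * u) \<in> carrier G" "v x \<in> carrier G" "y [^] (e * u) \<in> carrier G" "v y \<in> carrier G"
    unfolding v_def using x y by auto
  have A: "x [^] (e * u) \<otimes> y [^] (e * u) \<in> torsion G d" by (rule torsion_mult_closed[OF fin cc o de X(1) Y(1)])
  have B: "v x \<otimes> v y \<in> torsion G e"
    by (rule torsion_mult_closed[OF fin cc _ _ X(2) Y(2)]) (use o de in \<open>auto simp: mult.commute coprime_commute\<close>)
  define w where "w = x [^] (e * u) \<otimes> y [^] (e * u)"
  have "x \<otimes> y = (x [^] (e * u) \<otimes> v x) \<otimes> (y [^] (e * u) \<otimes> v y)" using X(3) Y(3) by simp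
  also have "\<dots> = x [^] (e * u) \<otimes> (v x \<otimes> y [^] (e * u)) \<otimes> v y" using car by (simp add: m_assoc)
  also have "v x \<otimes> y [^] (e * u) = y [^] (e * u) \<otimes> v x" using torsion_commute[OF cc de Y(1) X(2)] by simp
  finally have xy: "x \<otimes> y = w \<otimes> (v x \<otimes> v y)" unfolding w_def using car by (simp add: m_assoc)
  have wG: "w \<in> carrier G" unfolding w_def using car by simp
  have "w \<otimes> (v x \<otimes> v y) = (v x \<otimes> v y) \<otimes> w" using torsion_commute[OF cc de A B] unfolding w_def .
  then have "(x \<otimes> y) [^] (e * u) = w [^] (e * u) \<otimes> (v x \<otimes> v y) [^] (e * u)"
    unfolding xy using pow_mult_distrib wG car by simp
  also have "(v x \<otimes> v y) [^] (e * u) = \<one>" using torsion_mono[OF B, of "e * u"] unfolding torsion_def by simp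
  also have "w [^] (e * u) = w \<otimes> (w [^] d) [^] q"
    unfolding s using wG nat_pow_mult[of w 1 "d * q"] nat_pow_pow[of w d q] by simp
  also have "w [^] d = \<one>" using A unfolding w_def torsion_def by simp
  finally show ?thesis using wG unfolding w_def by simp
qed

text \<open>
  Let \<open>M\<close> be the part of \<open>F\<close> of order prime to \<open>p\<close>. The
  Sylow \<open>p\<close>-subgroup of \<open>F\<close> is normal in \<open>G\<close> and hence
  contained in \<open>P\<close>, so \<open>W = M P\<close> contains \<open>F\<close> and therefore
  all commutators. Thus every conjugate of \<open>P\<close> lies in \<open>W\<close> and is
  conjugate to \<open>P\<close> by an element of \<open>W\<close>. This is the Frattini argument:
  \<open>G\<close> is the product of the normalizer of \<open>P\<close> with \<open>W\<close>,
  hence with \<open>M\<close>.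
\<close>

lemma (in group) frattini_nilpotent:
  assumes fin: "finite (carrier G)" and F: "F \<lhd> G" and cc: "coprime_elements_commute (G\<lparr>carrier := F\<rparr>)"
    and comm: "\<And>x y. x \<in> carrier G \<Longrightarrow> y \<in> carrier G \<Longrightarrow> x \<otimes> y \<otimes> inv x \<otimes> inv y \<in> F"
    and p: "prime (p::nat)" and P: "subgroup P G" "card P = p ^ b" "\<not> p dvd card (rcosets P)"
    and cF: "card F = p ^ a * e" "\<not> p dvd e"
  shows "{x \<in> F. x [^] e = \<one>} \<lhd> G"
    and "\<And>g. g \<in> carrier G \<Longrightarrow> \<exists>n m. n \<in> carrier G \<and> (\<forall>x\<in>P. n \<otimes> x \<otimes> inv n \<in> P) \<and> m \<in> F \<and> m [^] e = \<one> \<and> g = n \<otimes> m"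
proof -
  interpret F: normal F G by fact
  interpret P: subgroup P G by fact
  interpret GF: group "G\<lparr>carrier := F\<rparr>" by (rule subgroup_imp_group) (rule F.subgroup_axioms)
  have finF: "finite (carrier (G\<lparr>carrier := F\<rparr>))" using fin F.subset finite_subset by auto
  have oF: "order (G\<lparr>carrier := F\<rparr>) = p ^ a * e" "order (G\<lparr>carrier := F\<rparr>) = e * p ^ a" using cF(1) by (simp_all add: order_def mult.commute)
  have cop: "coprime (p ^ a) e" "coprime e (p ^ a)" using prime_imp_coprime[OF p cF(2)] by (simp_all add: coprime_commute)
  define M where "M = {x \<in> F. x [^] e = \<one>}"
  define S where "S = {x \<in> F. x [^] (p ^ a) = \<one>}"
  have tor: "torsion (G\<lparr>carrier := F\<rparr>) d = {x \<in> F. x [^] d = \<one>}" for d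
    unfolding torsion_def using nat_pow_consistent[of _ d F] by auto
  have sM: "subgroup M G" using GF.torsion_subgroup[OF finF cc oF(2) cop(2)] incl_subgroup[OF F.subgroup_axioms]
    unfolding tor M_def by blast
  have sS: "subgroup S G" using GF.torsion_prime_power(1)[OF finF cc p oF(1) cF(2)] incl_subgroup[OF F.subgroup_axioms]
    unfolding tor S_def by blast
  have cS: "card S = p ^ a" using GF.torsion_prime_power(2)[OF finF cc p oF(1) cF(2)] unfolding tor S_def .
  have tc: "g \<otimes> x \<otimes> inv g \<in> {x \<in> F. x [^] d = \<one>}" if "x \<in> {x \<in> F. x [^] d = \<one>}" "g \<in> carrier G" for g x and d :: nat
    using torsion_conj[of x d g] that F.inv_op_closed2[of g x] F.mem_carrier[of x] unfolding torsion_def by auto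
  show MG: "{x \<in> F. x [^] e = \<one>} \<lhd> G"
    using normal_invI[OF sM] tc[of _ e] unfolding M_def by blast
  have finR: "finite (rcosets P)" using fin rcosets_subset_PowG[OF P(1)] finite_subset by blast
  have SP: "S \<subseteq> P"
  proof
    fix s assume s: "s \<in> S"
    obtain g where g: "g \<in> carrier G" "\<And>q. q \<in> S \<Longrightarrow> g \<otimes> q \<otimes> inv g \<in> P"
      using p_subgroup_conjugate_into_sylow[OF p P(1) finR P(3) sS cS] by blast
    have sG: "s \<in> carrier G" using subgroup.mem_carrier[OF sS s] .
    have "inv g \<otimes> s \<otimes> inv (inv g) \<in> S" using tc[of s "p ^ a" "inv g"] s g(1) unfolding S_def by simp
    then have "g \<otimes> (inv g \<otimes> s \<otimes> inv (inv g)) \<otimes> inv g \<in> P" by (rule g(2))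
    then show "s \<in> P" using g(1) sG by (simp add: m_assoc cancel_inv_left)
  qed
  have Mnorm: "M \<lhd> G" using MG unfolding M_def .
  interpret M: normal M G by (rule Mnorm)
  define W where "W = M <#> P"
  have Wsub: "subgroup W G" unfolding W_def using mult_norm_subgroup[OF Mnorm P(1)] .
  interpret W: subgroup W G by (rule Wsub)
  interpret GW: group "G\<lparr>carrier := W\<rparr>" using Wsub by (rule subgroup_imp_group)
  have W_I: "m \<otimes> x \<in> W" if "m \<in> M" "x \<in> P" for m x using that unfolding W_def set_mult_def by blast
  have PW: "P \<subseteq> W" using W_I[OF M.one_closed] P.mem_carrier by force
  \<comment> \<open>Each element of \<open>F\<close> is the product of its \<open>p\<close>-part, which lies in
    \<open>P\<close>, and its part in \<open>M\<close>.\<close>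
  have FW: "f \<in> W" if f: "f \<in> F" for f
  proof -
    obtain u q where uq: "e * u = 1 + p ^ a * q"
      using coprime_power_inverse[OF cop(1)] p cF prime_gt_0_nat by (metis dvd_0_right neq0_conv zero_less_power)
    have fG: "f \<in> torsion (G\<lparr>carrier := F\<rparr>) (p ^ a * e)"
      unfolding tor using subgroup_pow_card[OF F.subgroup_axioms _ f] finF f cF(1) by simp
    note sp = GF.torsion_split[OF fG uq]
    have pc: "f [^]\<^bsub>G\<lparr>carrier := F\<rparr>\<^esub> j = f [^] j" for j :: nat using nat_pow_consistent[of f j F] by simp
    have A: "f [^] (e * u) \<in> S" using sp(1) unfolding tor S_def pc .
    have B: "inv (f [^] (p ^ a * q)) \<in> M"
      using sp(2) f m_inv_consistent[OF F.subgroup_axioms, of "f [^] (p ^ a * q)"] GF.nat_pow_closed[of f "p ^ a * q"]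
      unfolding tor M_def pc by simp
    have "f = f [^] (e * u) \<otimes> inv (f [^] (p ^ a * q))"
      using sp(3) f m_inv_consistent[OF F.subgroup_axioms, of "f [^] (p ^ a * q)"] GF.nat_pow_closed[of f "p ^ a * q"]
      unfolding pc by simp
    moreover have "f [^] (e * u) \<in> W" using A SP PW by blast
    moreover have "inv (f [^] (p ^ a * q)) \<in> W" using W_I[OF B P.one_closed] B M.mem_carrier by force
    ultimately show "f \<in> W" using W.m_closed by metis
  qed
  fix g assume g: "g \<in> carrier G"
  define Pg where "Pg = (\<lambda>x. g \<otimes> x \<otimes> inv g) ` P"
  have PgG: "Pg \<subseteq> carrier G" unfolding Pg_def using g by auto
  \<comment> \<open>\<open>g x g\<inverse>\<close> and \<open>x\<close> differ by a commutator, which lies in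
    \<open>F\<close>.\<close>
  have PgW: "Pg \<subseteq> W"
  proof
    fix z assume "z \<in> Pg"
    then obtain x where x: "x \<in> P" "z = g \<otimes> x \<otimes> inv g" unfolding Pg_def by blast
    have "z = (g \<otimes> x \<otimes> inv g \<otimes> inv x) \<otimes> x" using x g P.mem_carrier by (simp add: m_assoc)
    moreover have "g \<otimes> x \<otimes> inv g \<otimes> inv x \<in> W" using FW comm g x P.mem_carrier by blast
    ultimately show "z \<in> W" using W.m_closed PW x(1) by auto
  qed
  have sPg: "subgroup Pg G"
  proof (rule subgroupI)
    show "Pg \<noteq> {}" unfolding Pg_def using P.one_closed by blast
    fix z assume "z \<in> Pg"
    then obtain x where x: "x \<in> P" "z = g \<otimes> x \<otimes> inv g" unfolding Pg_def by blast
    have "inv z = g \<otimes> inv x \<otimes> inv g" unfolding x using x(1) g by (simp add: m_assoc inv_mult_group)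
    then show "inv z \<in> Pg" unfolding Pg_def using x(1) by auto
    fix w assume "w \<in> Pg"
    then obtain y where y: "y \<in> P" "w = g \<otimes> y \<otimes> inv g" unfolding Pg_def by blast
    have "z \<otimes> w = g \<otimes> (x \<otimes> y) \<otimes> inv g" unfolding x y using x(1) y(1) g by (simp add: m_assoc cancel_inv_left)
    then show "z \<otimes> w \<in> Pg" unfolding Pg_def using x(1) y(1) by auto
  qed (rule PgG)
  have cPg: "card Pg = p ^ b"
  proof -
    have "inj_on (\<lambda>x. g \<otimes> x \<otimes> inv g) P" by (rule inj_onI) (use g in \<open>simp add: m_assoc\<close>)
    then show ?thesis unfolding Pg_def using P(2) by (simp add: card_image)
  qed
  have PsubW: "subgroup P (G\<lparr>carrier := W\<rparr>)" by (rule subgroup_incl[OF P(1) Wsub PW])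
  have PgsubW: "subgroup Pg (G\<lparr>carrier := W\<rparr>)" by (rule subgroup_incl[OF sPg Wsub PgW])
  have finW: "finite W" using fin W.subset finite_subset by blast
  have "card (rcosets\<^bsub>G\<lparr>carrier := W\<rparr>\<^esub> P) dvd card (rcosets P)"
  proof -
    have 1: "card (rcosets\<^bsub>G\<lparr>carrier := W\<rparr>\<^esub> P) * card P = card W" using GW.lagrange[OF PsubW] by (simp add: order_def)
    have 2: "card (rcosets P) * card P = card (rcosets W) * card W" using lagrange[OF P(1)] lagrange[OF Wsub] by simp
    have "card (rcosets P) * card P = (card (rcosets W) * card (rcosets\<^bsub>G\<lparr>carrier := W\<rparr>\<^esub> P)) * card P"
      unfolding 2 1[symmetric] by simp
    moreover have "card P > 0" using P(2) p prime_gt_0_nat by simp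
    ultimately have "card (rcosets P) = card (rcosets W) * card (rcosets\<^bsub>G\<lparr>carrier := W\<rparr>\<^esub> P)" by simp
    then show ?thesis by simp
  qed
  then have nd: "\<not> p dvd card (rcosets\<^bsub>G\<lparr>carrier := W\<rparr>\<^esub> P)" using P(3) dvd_trans by blast
  have finRW: "finite (rcosets\<^bsub>G\<lparr>carrier := W\<rparr>\<^esub> P)" using GW.rcosets_subset_PowG[OF PsubW] finW finite_subset[of _ "Pow W"] by simp
  obtain w where w: "w \<in> W" "\<And>q. q \<in> Pg \<Longrightarrow> w \<otimes> q \<otimes> inv\<^bsub>G\<lparr>carrier := W\<rparr>\<^esub> w \<in> P"
    using GW.p_subgroup_conjugate_into_sylow[OF p PsubW finRW nd PgsubW cPg] by auto
  have wG: "w \<in> carrier G" using w(1) W.mem_carrier by blast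
  have wP: "w \<otimes> g \<otimes> x \<otimes> inv (w \<otimes> g) \<in> P" if x: "x \<in> P" for x
  proof -
    have "w \<otimes> (g \<otimes> x \<otimes> inv g) \<otimes> inv w \<in> P"
      using w(2)[of "g \<otimes> x \<otimes> inv g"] x m_inv_consistent[OF Wsub w(1)] unfolding Pg_def by auto
    then show ?thesis using wG g P.mem_carrier[OF x] by (simp add: m_assoc inv_mult_group)
  qed
  have "inv w \<in> M <#> P" using W.m_inv_closed[OF w(1)] unfolding W_def .
  then obtain m x where mx: "m \<in> M" "x \<in> P" "inv w = m \<otimes> x" unfolding set_mult_def by blast
  define n where "n = x \<otimes> (w \<otimes> g)"
  have nG: "n \<in> carrier G" unfolding n_def using mx P.mem_carrier wG g by simp
  have nP: "n \<otimes> y \<otimes> inv n \<in> P" if y: "y \<in> P" for y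
  proof -
    have "n \<otimes> y \<otimes> inv n = x \<otimes> (w \<otimes> g \<otimes> y \<otimes> inv (w \<otimes> g)) \<otimes> inv x"
      unfolding n_def using mx(2) P.mem_carrier y wG g by (simp add: m_assoc inv_mult_group)
    then show ?thesis using wP[OF y] mx(2) by simp
  qed
  have "m \<otimes> n = inv w \<otimes> (w \<otimes> g)" unfolding n_def mx(3) using mx(1,2) P.mem_carrier M.mem_carrier wG g by (simp add: m_assoc)
  also have "\<dots> = g" using wG g by (simp add: cancel_inv_left)
  finally have mn: "m \<otimes> n = g" .
  have "n \<otimes> (inv n \<otimes> m \<otimes> n) = m \<otimes> n" using nG M.mem_carrier[OF mx(1)] by (simp add: m_assoc[symmetric])
  then have "g = n \<otimes> (inv n \<otimes> m \<otimes> n)" unfolding mn by (rule sym)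
  moreover have "inv n \<otimes> m \<otimes> n \<in> M" using M.inv_op_closed1[OF nG mx(1)] .
  ultimately show "\<exists>n m. n \<in> carrier G \<and> (\<forall>x\<in>P. n \<otimes> x \<otimes> inv n \<in> P) \<and> m \<in> F \<and> m [^] e = \<one> \<and> g = n \<otimes> m"
    using nG nP unfolding M_def by blast
qed

section \<open>Chains in nilpotent and supersolvable groups\<close>

lemma (in group) lower_central_series_normal: "lower_central_series G i \<lhd> G"
proof (induction i)
  case 0
  show ?case by (simp add: normal_invI subgroup_self)
next
  case (Suc i)
  interpret K: normal "lower_central_series G i" G by (rule Suc)
  show ?case unfolding lower_central_series.simps
  proof (rule normal_generateI)
    fix h g assume "h \<in> {x \<otimes> y \<otimes> inv x \<otimes> inv y |x y. x \<in> lower_central_series G i \<and> y \<in> carrier G}" and g: "g \<in> carrier G"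
    then obtain x y where xy: "x \<in> lower_central_series G i" "y \<in> carrier G" "h = x \<otimes> y \<otimes> inv x \<otimes> inv y" by blast
    have "g \<otimes> h \<otimes> inv g = (g \<otimes> x \<otimes> inv g) \<otimes> (g \<otimes> y \<otimes> inv g) \<otimes> inv (g \<otimes> x \<otimes> inv g) \<otimes> inv (g \<otimes> y \<otimes> inv g)"
      using xy g by (simp add: m_assoc inv_mult_group cancel_inv_left)
    moreover have "g \<otimes> x \<otimes> inv g \<in> lower_central_series G i" using K.inv_op_closed2[OF g xy(1)] .
    moreover have "g \<otimes> y \<otimes> inv g \<in> carrier G" using g xy(2) by simp
    ultimately show "g \<otimes> h \<otimes> inv g \<in> {x \<otimes> y \<otimes> inv x \<otimes> inv y |x y. x \<in> lower_central_series G i \<and> y \<in> carrier G}" by blast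
  qed auto
qed

lemma (in group) lower_central_series_commutator:
  "x \<in> lower_central_series G i \<Longrightarrow> y \<in> carrier G \<Longrightarrow> x \<otimes> y \<otimes> inv x \<otimes> inv y \<in> lower_central_series G (Suc i)"
  unfolding lower_central_series.simps by (rule generate.incl) blast

lemma (in group) lower_central_series_decreasing: "lower_central_series G (Suc i) \<subseteq> lower_central_series G i"
proof -
  interpret K: normal "lower_central_series G i" G by (rule lower_central_series_normal)
  show ?thesis unfolding lower_central_series.simps(2)
  proof (rule generate_subgroup_incl[OF _ K.subgroup_axioms], clarify)
    fix x y assume x: "x \<in> lower_central_series G i" and y: "y \<in> carrier G"
    have "x \<otimes> (y \<otimes> inv x \<otimes> inv y) \<in> lower_central_series G i" using x y K.inv_op_closed2[of y "inv x"] by simp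
    then show "x \<otimes> y \<otimes> inv x \<otimes> inv y \<in> lower_central_series G i" using x y by (simp add: m_assoc)
  qed
qed

lemma (in group) lower_central_series_hom:
  assumes "h \<in> hom G G" "x \<in> lower_central_series G i"
  shows "h x \<in> lower_central_series G i"
  using assms(2)
proof (induction i arbitrary: x)
  case 0
  then show ?case using assms(1) by (auto simp: hom_def)
next
  case (Suc i)
  interpret h: group_hom G G h using assms(1) by unfold_locales
  interpret K: normal "lower_central_series G i" G by (rule lower_central_series_normal)
  let ?C = "{x \<otimes> y \<otimes> inv x \<otimes> inv y |x y. x \<in> lower_central_series G i \<and> y \<in> carrier G}"
  have "h ` ?C \<subseteq> ?C"
  proof
    fix z assume "z \<in> h ` ?C"
    then obtain x y where xy: "x \<in> lower_central_series G i" "y \<in> carrier G" "z = h (x \<otimes> y \<otimes> inv x \<otimes> inv y)" by blast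
    then have "z = h x \<otimes> h y \<otimes> inv (h x) \<otimes> inv (h y)" using K.mem_carrier[OF xy(1)] by simp
    then show "z \<in> ?C" using Suc.IH[OF xy(1)] h.hom_closed[OF xy(2)] by blast
  qed
  moreover have "?C \<subseteq> carrier G" using K.mem_carrier by auto
  ultimately have "h ` generate G ?C \<subseteq> generate G ?C"
    using h.generate_img[of ?C] mono_generate[of "h ` ?C" ?C] by simp
  then show ?case using Suc.prems unfolding lower_central_series.simps by blast
qed

lemma nilpotent_group_abelian_chain:
  assumes "nilpotent_group G"
  obtains n where "abelian_chain G (lower_central_series G) n"
proof -
  interpret group G using assms unfolding nilpotent_group_def by simp
  obtain n where n: "lower_central_series G n = {\<one>\<^bsub>G\<^esub>}" using assms unfolding nilpotent_group_def by blast
  have "x \<in> carrier G" if "x \<in> lower_central_series G i" for x i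
    using normal_imp_subgroup[OF lower_central_series_normal] that subgroup.mem_carrier by fastforce
  then have "abelian_chain G (lower_central_series G) n"
    unfolding abelian_chain_def
    using n lower_central_series_normal lower_central_series_decreasing lower_central_series_commutator by auto
  then show ?thesis using that by blast
qed

lemma nilpotent_group_central_chain:
  assumes "nilpotent_group G"
  obtains H n where "centralizing_chain G (carrier G) H n"
proof -
  interpret group G using assms unfolding nilpotent_group_def by simp
  obtain n where n: "lower_central_series G n = {\<one>\<^bsub>G\<^esub>}" using assms unfolding nilpotent_group_def by blast
  have "f \<otimes>\<^bsub>G\<^esub> x \<otimes>\<^bsub>G\<^esub> inv\<^bsub>G\<^esub> f \<otimes>\<^bsub>G\<^esub> inv\<^bsub>G\<^esub> x \<in> lower_central_series G (Suc j)"
    if x: "x \<in> lower_central_series G j" and f: "f \<in> carrier G" for x f j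
  proof -
    have s: "subgroup (lower_central_series G (Suc j)) G" by (rule normal_imp_subgroup[OF lower_central_series_normal])
    have xG: "x \<in> carrier G" using normal_imp_subgroup[OF lower_central_series_normal] x subgroup.mem_carrier by fastforce
    have "inv\<^bsub>G\<^esub> (x \<otimes>\<^bsub>G\<^esub> f \<otimes>\<^bsub>G\<^esub> inv\<^bsub>G\<^esub> x \<otimes>\<^bsub>G\<^esub> inv\<^bsub>G\<^esub> f) \<in> lower_central_series G (Suc j)"
      by (rule subgroup.m_inv_closed[OF s lower_central_series_commutator[OF x f]])
    then show ?thesis using xG f by (simp add: inv_mult_group m_assoc)
  qed
  note comm = this
  have "n - i = Suc (n - Suc i)" if "i < n" for i using that by simp
  then have "centralizing_chain G (carrier G) (\<lambda>i. lower_central_series G (n - i)) n"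
    unfolding centralizing_chain_def
    using n lower_central_series_normal lower_central_series_decreasing comm
    by (simp del: lower_central_series.simps(2))
  then show ?thesis using that by blast
qed

text \<open>
  Conjugation by an element of \<open>G\<close> acts on the cyclic group \<open>B/A\<close> as a
  power map, and power maps commute.
\<close>

lemma (in group) cyclic_section_conjugations_commute:
  assumes A: "A \<lhd> G" and B: "B \<lhd> G" and AB: "A \<subseteq> B" and cyc: "cyclic_group (G\<lparr>carrier := B\<rparr> Mod A)"
    and a: "a \<in> carrier G" and b: "b \<in> carrier G" and x: "x \<in> B"
  shows "A #> (a \<otimes> (b \<otimes> x \<otimes> inv b) \<otimes> inv a) = A #> (b \<otimes> (a \<otimes> x \<otimes> inv a) \<otimes> inv b)"
proof -
  interpret A: normal A G by fact
  interpret B: normal B G by fact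
  interpret GB: group "G\<lparr>carrier := B\<rparr>" using B.subgroup_axioms by (rule subgroup_imp_group)
  interpret A': normal A "G\<lparr>carrier := B\<rparr>"
    by (rule GB.normal_invI[OF subgroup_incl[OF A.subgroup_axioms B.subgroup_axioms AB]])
      (use A.inv_op_closed2 m_inv_consistent[OF B.subgroup_axioms] in simp)
  interpret Q: group "G Mod A" by (rule A.factorgroup_is_group)
  interpret QB: group "G\<lparr>carrier := B\<rparr> Mod A" by (rule A'.factorgroup_is_group)
  interpret cl: group_hom G "G Mod A" "\<lambda>x. A #> x" using A.r_coset_hom_Mod by unfold_locales
  obtain X where X: "X \<in> carrier (G\<lparr>carrier := B\<rparr> Mod A)" "carrier (G\<lparr>carrier := B\<rparr> Mod A) = range (\<lambda>n::int. X [^]\<^bsub>G\<lparr>carrier := B\<rparr> Mod A\<^esub> n)"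
    using QB.cyclic_group cyc by blast
  obtain g where g: "g \<in> B" "X = A #> g" using X(1) by (auto simp: carrier_FactGroup)
  have gG: "g \<in> carrier G" using g(1) by simp
  have pow: "\<exists>k::int. A #> y = (A #> g) [^]\<^bsub>G Mod A\<^esub> k" if y: "y \<in> B" for y
  proof -
    have "A #> y \<in> carrier (G\<lparr>carrier := B\<rparr> Mod A)" using y by (auto simp: carrier_FactGroup)
    then obtain k :: int where "A #> y = X [^]\<^bsub>G\<lparr>carrier := B\<rparr> Mod A\<^esub> k" using X(2) by auto
    also have "\<dots> = A #> (g [^] k)"
      using A'.FactGroup_int_pow[of g k] g int_pow_consistent[OF B.subgroup_axioms g(1)] by simp
    finally show ?thesis using cl.hom_int_pow[OF gG, of k] by auto
  qed
  define conj where "conj = (\<lambda>c X. (A #> c) \<otimes>\<^bsub>G Mod A\<^esub> X \<otimes>\<^bsub>G Mod A\<^esub> inv\<^bsub>G Mod A\<^esub> (A #> c))"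
  have clG: "A #> y \<in> carrier (G Mod A)" if "y \<in> carrier G" for y using that by (auto simp: carrier_FactGroup)
  have conj_cl: "A #> (c \<otimes> y \<otimes> inv c) = conj c (A #> y)" if "c \<in> carrier G" "y \<in> carrier G" for c y
    unfolding conj_def using that cl.hom_mult cl.hom_inv by simp
  have conj_hom: "conj c \<in> hom (G Mod A) (G Mod A)" if c: "c \<in> carrier G" for c
    unfolding conj_def by (rule homI) (use clG[OF c] in \<open>simp_all only: Q.m_closed Q.inv_closed Q.m_assoc Q.cancel_inv_left\<close>)
  have conj_pow: "conj c ((A #> g) [^]\<^bsub>G Mod A\<^esub> k) = (conj c (A #> g)) [^]\<^bsub>G Mod A\<^esub> k"
    if "c \<in> carrier G" for c and k :: int
    using hom_int_pow[OF conj_hom[OF that] clG[OF gG]] Q.is_group by simp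
  obtain k l m :: int where k: "A #> x = (A #> g) [^]\<^bsub>G Mod A\<^esub> k"
    and l: "conj a (A #> g) = (A #> g) [^]\<^bsub>G Mod A\<^esub> l" and m: "conj b (A #> g) = (A #> g) [^]\<^bsub>G Mod A\<^esub> m"
    using pow[OF x] pow[OF B.inv_op_closed2[OF a g(1)]] pow[OF B.inv_op_closed2[OF b g(1)]]
      conj_cl[OF a gG] conj_cl[OF b gG] by metis
  have xG: "x \<in> carrier G" using x by simp
  have "conj a (conj b (A #> x)) = (A #> g) [^]\<^bsub>G Mod A\<^esub> (l * (m * k))"
    unfolding k conj_pow[OF b] m using clG[OF gG]
    by (simp only: Q.int_pow_pow conj_pow[OF a] l)
  moreover have "conj b (conj a (A #> x)) = (A #> g) [^]\<^bsub>G Mod A\<^esub> (m * (l * k))"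
    unfolding k conj_pow[OF a] l using clG[OF gG]
    by (simp only: Q.int_pow_pow conj_pow[OF b] m)
  ultimately have "conj a (conj b (A #> x)) = conj b (conj a (A #> x))" by (simp add: mult_ac)
  moreover have "A #> (a \<otimes> (b \<otimes> x \<otimes> inv b) \<otimes> inv a) = conj a (conj b (A #> x))"
    using b xG by (simp only: conj_cl[OF a] conj_cl[OF b] m_closed inv_closed)
  moreover have "A #> (b \<otimes> (a \<otimes> x \<otimes> inv a) \<otimes> inv b) = conj b (conj a (A #> x))"
    using a xG by (simp only: conj_cl[OF a] conj_cl[OF b] m_closed inv_closed)
  ultimately show ?thesis by simp
qed

text \<open>
  \<open>F\<close> is the intersection of the centralizers of the factors of a normal series with
  cyclic factors. It contains all commutators because \<open>G\<close> acts on each factor through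
  an abelian group.
\<close>

lemma supersolvable_group_centralizing_chain:
  assumes "supersolvable_group G"
  obtains F H n where "subgroup F G" "\<And>x y. x \<in> carrier G \<Longrightarrow> y \<in> carrier G \<Longrightarrow> x \<otimes>\<^bsub>G\<^esub> y \<otimes>\<^bsub>G\<^esub> inv\<^bsub>G\<^esub> x \<otimes>\<^bsub>G\<^esub> inv\<^bsub>G\<^esub> y \<in> F"
    "centralizing_chain G F H n"
proof -
  interpret group G using assms unfolding supersolvable_group_def by simp
  have "\<exists>n (H :: nat \<Rightarrow> 'a set).
        H 0 = {\<one>\<^bsub>G\<^esub>} \<and> H n = carrier G \<and> (\<forall>i\<le>n. H i \<lhd> G) \<and>
        (\<forall>i<n. H i \<subseteq> H (Suc i) \<and> cyclic_group (G\<lparr>carrier := H (Suc i)\<rparr> Mod H i))"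
    using assms unfolding supersolvable_group_def by (rule conjunct2)
  then obtain n and H :: "nat \<Rightarrow> 'a set" where
    *: "H 0 = {\<one>\<^bsub>G\<^esub>} \<and> H n = carrier G \<and> (\<forall>i\<le>n. H i \<lhd> G) \<and>
        (\<forall>i<n. H i \<subseteq> H (Suc i) \<and> cyclic_group (G\<lparr>carrier := H (Suc i)\<rparr> Mod H i))"
    by (elim exE) (rule that)
  have H: "H 0 = {\<one>\<^bsub>G\<^esub>}" "H n = carrier G" and HN: "\<And>i. i \<le> n \<Longrightarrow> H i \<lhd> G"
    and HH: "\<And>i. i < n \<Longrightarrow> H i \<subseteq> H (Suc i)" and cyc: "\<And>i. i < n \<Longrightarrow> cyclic_group (G\<lparr>carrier := H (Suc i)\<rparr> Mod H i)"
    using * by simp_all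
  define F where "F = {f \<in> carrier G. \<forall>i<n. \<forall>x\<in>H (Suc i). f \<otimes>\<^bsub>G\<^esub> x \<otimes>\<^bsub>G\<^esub> inv\<^bsub>G\<^esub> f \<otimes>\<^bsub>G\<^esub> inv\<^bsub>G\<^esub> x \<in> H i}"
  have HS: "subgroup (H i) G" if "i \<le> n" for i using HN[OF that] normal_imp_subgroup by blast
  have HG: "x \<in> carrier G" if "x \<in> H i" "i \<le> n" for x i using subgroup.mem_carrier[OF HS[OF that(2)] that(1)] .
  have "subgroup F G"
  proof (rule subgroupI)
    have "\<one>\<^bsub>G\<^esub> \<otimes>\<^bsub>G\<^esub> x \<otimes>\<^bsub>G\<^esub> inv\<^bsub>G\<^esub> \<one>\<^bsub>G\<^esub> \<otimes>\<^bsub>G\<^esub> inv\<^bsub>G\<^esub> x \<in> H i" if "i < n" "x \<in> H (Suc i)" for i x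
      using HG[OF that(2)] subgroup.one_closed[OF HS[of i]] that(1) by simp
    then have "\<one>\<^bsub>G\<^esub> \<in> F" unfolding F_def by simp
    then show "F \<noteq> {}" by blast
  next
    fix f assume f: "f \<in> F"
    then have fG: "f \<in> carrier G" unfolding F_def by simp
    have "inv\<^bsub>G\<^esub> f \<otimes>\<^bsub>G\<^esub> x \<otimes>\<^bsub>G\<^esub> inv\<^bsub>G\<^esub> (inv\<^bsub>G\<^esub> f) \<otimes>\<^bsub>G\<^esub> inv\<^bsub>G\<^esub> x \<in> H i" if i: "i < n" and x: "x \<in> H (Suc i)" for i x
    proof -
      have xG: "x \<in> carrier G" using HG x i by simp
      define y where "y = inv\<^bsub>G\<^esub> f \<otimes>\<^bsub>G\<^esub> x \<otimes>\<^bsub>G\<^esub> f"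
      have y: "y \<in> H (Suc i)" unfolding y_def using normal.inv_op_closed1[OF HN fG x] i by simp
      have "f \<otimes>\<^bsub>G\<^esub> y \<otimes>\<^bsub>G\<^esub> inv\<^bsub>G\<^esub> f \<otimes>\<^bsub>G\<^esub> inv\<^bsub>G\<^esub> y \<in> H i" using f y i unfolding F_def by blast
      then have "inv\<^bsub>G\<^esub> (f \<otimes>\<^bsub>G\<^esub> y \<otimes>\<^bsub>G\<^esub> inv\<^bsub>G\<^esub> f \<otimes>\<^bsub>G\<^esub> inv\<^bsub>G\<^esub> y) \<in> H i" using subgroup.m_inv_closed[OF HS] i by simp
      then show ?thesis unfolding y_def using fG xG by (simp add: m_assoc inv_mult_group cancel_inv_left)
    qed
    then show "inv\<^bsub>G\<^esub> f \<in> F" unfolding F_def using fG by simp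
  next
    fix f g assume f: "f \<in> F" and g: "g \<in> F"
    then have fG: "f \<in> carrier G" "g \<in> carrier G" unfolding F_def by simp_all
    have "f \<otimes>\<^bsub>G\<^esub> g \<otimes>\<^bsub>G\<^esub> x \<otimes>\<^bsub>G\<^esub> inv\<^bsub>G\<^esub> (f \<otimes>\<^bsub>G\<^esub> g) \<otimes>\<^bsub>G\<^esub> inv\<^bsub>G\<^esub> x \<in> H i" if i: "i < n" and x: "x \<in> H (Suc i)" for i x
    proof -
      have xG: "x \<in> carrier G" using HG x i by simp
      define y where "y = g \<otimes>\<^bsub>G\<^esub> x \<otimes>\<^bsub>G\<^esub> inv\<^bsub>G\<^esub> g"
      have y: "y \<in> H (Suc i)" unfolding y_def using normal.inv_op_closed2[OF HN fG(2) x] i by simp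
      have "f \<otimes>\<^bsub>G\<^esub> y \<otimes>\<^bsub>G\<^esub> inv\<^bsub>G\<^esub> f \<otimes>\<^bsub>G\<^esub> inv\<^bsub>G\<^esub> y \<in> H i" using f y i unfolding F_def by blast
      moreover have "y \<otimes>\<^bsub>G\<^esub> inv\<^bsub>G\<^esub> x \<in> H i" unfolding y_def using g x i unfolding F_def by blast
      ultimately have "(f \<otimes>\<^bsub>G\<^esub> y \<otimes>\<^bsub>G\<^esub> inv\<^bsub>G\<^esub> f \<otimes>\<^bsub>G\<^esub> inv\<^bsub>G\<^esub> y) \<otimes>\<^bsub>G\<^esub> (y \<otimes>\<^bsub>G\<^esub> inv\<^bsub>G\<^esub> x) \<in> H i"
        using subgroup.m_closed[OF HS] i by simp
      then show ?thesis unfolding y_def using fG xG by (simp add: m_assoc inv_mult_group cancel_inv_left)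
    qed
    then show "f \<otimes>\<^bsub>G\<^esub> g \<in> F" unfolding F_def using fG by simp
  qed (auto simp: F_def)
  moreover have "a \<otimes>\<^bsub>G\<^esub> b \<otimes>\<^bsub>G\<^esub> inv\<^bsub>G\<^esub> a \<otimes>\<^bsub>G\<^esub> inv\<^bsub>G\<^esub> b \<in> F" if a: "a \<in> carrier G" and b: "b \<in> carrier G" for a b
  proof -
    define c where "c = a \<otimes>\<^bsub>G\<^esub> b \<otimes>\<^bsub>G\<^esub> inv\<^bsub>G\<^esub> a \<otimes>\<^bsub>G\<^esub> inv\<^bsub>G\<^esub> b"
    have cG: "c \<in> carrier G" unfolding c_def using a b by simp
    have "c \<otimes>\<^bsub>G\<^esub> y \<otimes>\<^bsub>G\<^esub> inv\<^bsub>G\<^esub> c \<otimes>\<^bsub>G\<^esub> inv\<^bsub>G\<^esub> y \<in> H i" if i: "i < n" and y: "y \<in> H (Suc i)" for i y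
    proof -
      have yG: "y \<in> carrier G" using HG y i by simp
      interpret Hi: normal "H i" G using HN i by simp
      define x where "x = inv\<^bsub>G\<^esub> a \<otimes>\<^bsub>G\<^esub> (inv\<^bsub>G\<^esub> b \<otimes>\<^bsub>G\<^esub> y \<otimes>\<^bsub>G\<^esub> b) \<otimes>\<^bsub>G\<^esub> a"
      have x: "x \<in> H (Suc i)" unfolding x_def using normal.inv_op_closed1[OF HN] i a b y by simp
      have "H i #>\<^bsub>G\<^esub> (a \<otimes>\<^bsub>G\<^esub> (b \<otimes>\<^bsub>G\<^esub> x \<otimes>\<^bsub>G\<^esub> inv\<^bsub>G\<^esub> b) \<otimes>\<^bsub>G\<^esub> inv\<^bsub>G\<^esub> a) = H i #>\<^bsub>G\<^esub> (b \<otimes>\<^bsub>G\<^esub> (a \<otimes>\<^bsub>G\<^esub> x \<otimes>\<^bsub>G\<^esub> inv\<^bsub>G\<^esub> a) \<otimes>\<^bsub>G\<^esub> inv\<^bsub>G\<^esub> b)"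
        using cyclic_section_conjugations_commute[OF HN HN HH cyc a b x] i by simp
      moreover have "b \<otimes>\<^bsub>G\<^esub> (a \<otimes>\<^bsub>G\<^esub> x \<otimes>\<^bsub>G\<^esub> inv\<^bsub>G\<^esub> a) \<otimes>\<^bsub>G\<^esub> inv\<^bsub>G\<^esub> b = y"
        unfolding x_def using a b yG by (simp add: m_assoc cancel_inv_left)
      moreover have "a \<otimes>\<^bsub>G\<^esub> (b \<otimes>\<^bsub>G\<^esub> x \<otimes>\<^bsub>G\<^esub> inv\<^bsub>G\<^esub> b) \<otimes>\<^bsub>G\<^esub> inv\<^bsub>G\<^esub> a = c \<otimes>\<^bsub>G\<^esub> y \<otimes>\<^bsub>G\<^esub> inv\<^bsub>G\<^esub> c"
        unfolding x_def c_def using a b yG by (simp add: m_assoc inv_mult_group)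
      ultimately have "H i #>\<^bsub>G\<^esub> (c \<otimes>\<^bsub>G\<^esub> y \<otimes>\<^bsub>G\<^esub> inv\<^bsub>G\<^esub> c) = H i #>\<^bsub>G\<^esub> y" by simp
      then have "c \<otimes>\<^bsub>G\<^esub> y \<otimes>\<^bsub>G\<^esub> inv\<^bsub>G\<^esub> c \<in> H i #>\<^bsub>G\<^esub> y"
        using rcos_self[OF _ Hi.subgroup_axioms, of "c \<otimes>\<^bsub>G\<^esub> y \<otimes>\<^bsub>G\<^esub> inv\<^bsub>G\<^esub> c"] cG yG by simp
      then show ?thesis by (rule Hi.rcos_module_imp[OF is_group yG])
    qed
    then show ?thesis unfolding F_def c_def[symmetric] using cG by simp
  qed
  moreover have "centralizing_chain G F H n"
    unfolding centralizing_chain_def using H HN HH unfolding F_def by auto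
  ultimately show ?thesis using that by blast
qed

section \<open>Profinite groups\<close>

lemma topological_group_left_translation:
  assumes "topological_group G T" "g \<in> carrier G"
  shows "continuous_map T T (\<lambda>x. g \<otimes>\<^bsub>G\<^esub> x)"
proof -
  have top: "topspace T = carrier G" and cm: "continuous_map (prod_topology T T) T (\<lambda>(x, y). x \<otimes>\<^bsub>G\<^esub> y)"
    using assms(1) unfolding topological_group_def by auto
  have "continuous_map T (prod_topology T T) (\<lambda>x. (g, x))"
    using assms(2) top by (simp add: continuous_map_pairwise o_def)
  from continuous_map_compose[OF this cm] show ?thesis by (simp add: o_def)
qed

lemma topological_group_open_coset:
  assumes "topological_group G T" "openin T U" "g \<in> carrier G"
  shows "openin T {x \<in> carrier G. inv\<^bsub>G\<^esub> g \<otimes>\<^bsub>G\<^esub> x \<in> U}"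
proof -
  interpret group G using assms(1) unfolding topological_group_def by simp
  have top: "topspace T = carrier G" using assms(1) unfolding topological_group_def by auto
  show ?thesis
    using openin_continuous_map_preimage[OF topological_group_left_translation[OF assms(1), of "inv\<^bsub>G\<^esub> g"] assms(2)] assms(3)
    unfolding top by simp
qed

lemma topological_group_openin_cosets:
  assumes tg: "topological_group G T" and U: "subgroup U G" "openin T U" and A: "A \<subseteq> carrier G"
    and AU: "\<And>x u. x \<in> A \<Longrightarrow> u \<in> U \<Longrightarrow> x \<otimes>\<^bsub>G\<^esub> u \<in> A"
  shows "openin T A"
proof (subst openin_subopen, intro ballI)
  interpret group G using tg unfolding topological_group_def by simp
  fix g assume g: "g \<in> A"
  have gG: "g \<in> carrier G" using g A by blast
  let ?V = "{x \<in> carrier G. inv\<^bsub>G\<^esub> g \<otimes>\<^bsub>G\<^esub> x \<in> U}"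
  have "?V \<subseteq> A"
  proof
    fix x assume x: "x \<in> ?V"
    then have "g \<otimes>\<^bsub>G\<^esub> (inv\<^bsub>G\<^esub> g \<otimes>\<^bsub>G\<^esub> x) \<in> A" using AU[OF g] by blast
    then show "x \<in> A" using x gG by (simp add: cancel_inv_left)
  qed
  moreover have "g \<in> ?V" using gG subgroup.one_closed[OF U(1)] by simp
  ultimately show "\<exists>V. openin T V \<and> g \<in> V \<and> V \<subseteq> A"
    using topological_group_open_coset[OF tg U(2) gG] by blast
qed

lemma topological_group_closedin_cosets:
  assumes tg: "topological_group G T" and U: "subgroup U G" "openin T U" and A: "A \<subseteq> carrier G"
    and AU: "\<And>x u. x \<in> A \<Longrightarrow> u \<in> U \<Longrightarrow> x \<otimes>\<^bsub>G\<^esub> u \<in> A"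
  shows "closedin T A"
proof -
  interpret group G using tg unfolding topological_group_def by simp
  interpret U: subgroup U G by (rule U)
  have top: "topspace T = carrier G" using tg unfolding topological_group_def by auto
  have "openin T (carrier G - A)"
  proof (rule topological_group_openin_cosets[OF tg U])
    fix x u assume x: "x \<in> carrier G - A" and u: "u \<in> U"
    have "x \<in> A" if "x \<otimes>\<^bsub>G\<^esub> u \<in> A"
      using AU[OF that U.m_inv_closed[OF u]] x u by (simp add: m_assoc)
    then show "x \<otimes>\<^bsub>G\<^esub> u \<in> carrier G - A" using x u by auto
  qed auto
  then show ?thesis using A top by (simp add: closedin_def)
qed

text \<open>
  The preimages of points under the coordinate projections form a subbasis of the topology of an
  inverse limit. The index set is directed, so a neighbourhood of the identity contains the kernel
  of a single projection.
\<close>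

lemma pro_group_small_kernel:
  assumes pro: "pro_group C G T" and W: "openin T W" "\<one>\<^bsub>G\<^esub> \<in> W"
  obtains Q :: "nat monoid" and h where "group Q" "finite (carrier Q)" "C Q" "h \<in> hom G Q"
    "openin T {x \<in> carrier G. h x = \<one>\<^bsub>Q\<^esub>}" "{x \<in> carrier G. h x = \<one>\<^bsub>Q\<^esub>} \<subseteq> W"
proof -
  have tg: "topological_group G T" using pro unfolding pro_group_def by (rule conjunct1)
  have "\<exists>(I :: 'a set set) r (Q :: 'a set \<Rightarrow> nat monoid) f h.
        inverse_system I r Q f \<and> (\<forall>i\<in>I. finite (carrier (Q i)) \<and> C (Q i)) \<and>
        h \<in> iso G (inverse_limit I r Q f) \<and>
        homeomorphic_map T (inverse_limit_topology I r Q f) h"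
    using pro unfolding pro_group_def by (rule conjunct2)
  then obtain I :: "'a set set" and r and Q :: "'a set \<Rightarrow> nat monoid" and f \<phi>
    where *: "inverse_system I r Q f \<and> (\<forall>i\<in>I. finite (carrier (Q i)) \<and> C (Q i)) \<and>
        \<phi> \<in> iso G (inverse_limit I r Q f) \<and>
        homeomorphic_map T (inverse_limit_topology I r Q f) \<phi>"
    by (elim exE) (rule that)
  have sys: "inverse_system I r Q f" and fin: "\<And>i. i \<in> I \<Longrightarrow> finite (carrier (Q i))" and CQ: "\<And>i. i \<in> I \<Longrightarrow> C (Q i)"
    and iso: "\<phi> \<in> iso G (inverse_limit I r Q f)" and homeo: "homeomorphic_map T (inverse_limit_topology I r Q f) \<phi>"
    using * by simp_all
  interpret group G using tg unfolding topological_group_def by simp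
  have top: "topspace T = carrier G" using tg unfolding topological_group_def by auto
  have I0: "I \<noteq> {}" and po: "partial_order_on I r" and dir: "\<And>i j. i \<in> I \<Longrightarrow> j \<in> I \<Longrightarrow> \<exists>k\<in>I. (i, k) \<in> r \<and> (j, k) \<in> r"
    and Qg: "\<And>i. i \<in> I \<Longrightarrow> group (Q i)" and fh: "\<And>i j. (i, j) \<in> r \<Longrightarrow> f i j \<in> hom (Q j) (Q i)"
    using sys unfolding inverse_system_def by blast+
  have rI: "i \<in> I" "j \<in> I" if "(i, j) \<in> r" for i j
    using po that unfolding partial_order_on_def preorder_on_def refl_on_def by blast+
  have tr: "trans r" and rf: "\<And>i. i \<in> I \<Longrightarrow> (i, i) \<in> r"
    using po unfolding partial_order_on_def preorder_on_def refl_on_def by blast+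
  let ?L = "inverse_limit_carrier I r Q f"
  let ?X = "product_topology (\<lambda>i. discrete_topology (carrier (Q i))) I"
  have Lsub: "?L \<subseteq> (\<Pi>\<^sub>E i\<in>I. carrier (Q i))" unfolding inverse_limit_carrier_def by blast
  have bij: "bij_betw \<phi> (carrier G) ?L" using iso unfolding iso_def inverse_limit_def by simp
  have \<phi>mult: "\<phi> (x \<otimes>\<^bsub>G\<^esub> y) = (\<lambda>i\<in>I. \<phi> x i \<otimes>\<^bsub>Q i\<^esub> \<phi> y i)" if "x \<in> carrier G" "y \<in> carrier G" for x y
    using iso that unfolding iso_def hom_def inverse_limit_def by simp
  have \<phi>L: "\<phi> x \<in> ?L" if "x \<in> carrier G" for x using bij that by (rule bij_betw_apply)
  have \<phi>car: "\<phi> x i \<in> carrier (Q i)" if "x \<in> carrier G" "i \<in> I" for x i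
    using \<phi>L[OF that(1)] Lsub that(2) by (auto simp: PiE_iff)
  have \<phi>hom: "(\<lambda>x. \<phi> x i) \<in> hom G (Q i)" if i: "i \<in> I" for i
    by (rule homI) (use \<phi>car i \<phi>mult in auto)
  have \<phi>comp: "f i j (\<phi> x j) = \<phi> x i" if "x \<in> carrier G" "(i, j) \<in> r" for x i j
    using \<phi>L[OF that(1)] that(2) unfolding inverse_limit_carrier_def by blast
  have \<phi>one: "\<phi> \<one>\<^bsub>G\<^esub> i = \<one>\<^bsub>Q i\<^esub>" if "i \<in> I" for i
    using hom_one[OF \<phi>hom[OF that] is_group Qg[OF that]] .
  have "openin (inverse_limit_topology I r Q f) (\<phi> ` W)"
    using homeo W(1) homeomorphic_imp_open_map open_map_def by blast
  then obtain S where S: "openin ?X S" "\<phi> ` W = S \<inter> ?L"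
    unfolding inverse_limit_topology_def openin_subtopology by blast
  have "\<phi> \<one>\<^bsub>G\<^esub> \<in> S" using S(2) W(2) by blast
  with S(1)[unfolded openin_product_topology_alt]
  have "\<exists>V. finite {i \<in> I. V i \<noteq> topspace (discrete_topology (carrier (Q i)))} \<and>
      (\<forall>i\<in>I. openin (discrete_topology (carrier (Q i))) (V i)) \<and> \<phi> \<one>\<^bsub>G\<^esub> \<in> Pi\<^sub>E I V \<and> Pi\<^sub>E I V \<subseteq> S"
    by (rule bspec)
  then obtain V where V: "finite {i \<in> I. V i \<noteq> topspace (discrete_topology (carrier (Q i)))}"
     "\<phi> \<one>\<^bsub>G\<^esub> \<in> Pi\<^sub>E I V" "Pi\<^sub>E I V \<subseteq> S"
    by (elim exE conjE) (rule that)
  define E where "E = {i \<in> I. V i \<noteq> carrier (Q i)}"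
  have finE: "finite E" and EI: "E \<subseteq> I" using V(1) unfolding E_def by auto
  have "\<exists>k\<in>I. \<forall>i\<in>E. (i, k) \<in> r" using finE EI
  proof (induction E rule: finite_induct)
    case empty
    then show ?case using I0 by blast
  next
    case (insert x A)
    then obtain k where k: "k \<in> I" "\<forall>i\<in>A. (i, k) \<in> r" by blast
    obtain l where l: "l \<in> I" "(x, l) \<in> r" "(k, l) \<in> r" using dir[of x k] k(1) insert.prems by blast
    then have "\<forall>i\<in>insert x A. (i, l) \<in> r" using k(2) tr unfolding trans_def by blast
    then show ?case using l(1) by blast
  qed
  then obtain k where k: "k \<in> I" "\<And>i. i \<in> E \<Longrightarrow> (i, k) \<in> r" by blast
  have small: "{x \<in> carrier G. \<phi> x k = \<one>\<^bsub>Q k\<^esub>} \<subseteq> W"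
  proof
    fix x assume "x \<in> {x \<in> carrier G. \<phi> x k = \<one>\<^bsub>Q k\<^esub>}"
    then have x: "x \<in> carrier G" "\<phi> x k = \<one>\<^bsub>Q k\<^esub>" by auto
    have "\<phi> x i \<in> V i" if i: "i \<in> I" for i
    proof (cases "i \<in> E")
      case True
      have "\<phi> x i = f i k (\<phi> x k)" using \<phi>comp[OF x(1) k(2)[OF True]] by simp
      also have "\<dots> = \<one>\<^bsub>Q i\<^esub>" unfolding x(2) using hom_one[OF fh[OF k(2)[OF True]] Qg[OF k(1)] Qg[OF i]] .
      also have "\<dots> = \<phi> \<one>\<^bsub>G\<^esub> i" using \<phi>one[OF i] by simp
      also have "\<dots> \<in> V i" using V(2) i by (auto simp: PiE_iff)
      finally show ?thesis .
    next
      case False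
      then show ?thesis using \<phi>car[OF x(1) i] i unfolding E_def by blast
    qed
    moreover have "\<phi> x \<in> extensional I" using \<phi>L[OF x(1)] Lsub by (auto simp: PiE_iff)
    ultimately have "\<phi> x \<in> Pi\<^sub>E I V" by (simp add: PiE_iff)
    then have "\<phi> x \<in> \<phi> ` W" using V(3) S(2) \<phi>L[OF x(1)] by blast
    then obtain y where y: "y \<in> W" "\<phi> x = \<phi> y" by blast
    then have "y \<in> carrier G" using openin_subset[OF W(1)] top by blast
    then have "x = y" using bij_betw_imp_inj_on[OF bij] x(1) y(2) unfolding inj_on_def by blast
    then show "x \<in> W" using y(1) by simp
  qed
  have "continuous_map T (inverse_limit_topology I r Q f) \<phi>" using homeo homeomorphic_imp_continuous_map by blast
  then have "continuous_map T ?X \<phi>" unfolding inverse_limit_topology_def by (simp add: continuous_map_in_subtopology)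
  then have "continuous_map T (discrete_topology (carrier (Q k))) (\<lambda>x. \<phi> x k)"
    using continuous_map_componentwise k(1) by fastforce
  then have "openin T {x \<in> topspace T. \<phi> x k \<in> {\<one>\<^bsub>Q k\<^esub>}}"
    by (rule openin_continuous_map_preimage) (use group.is_monoid[OF Qg[OF k(1)]] monoid.one_closed in auto)
  then have "openin T {x \<in> carrier G. \<phi> x k = \<one>\<^bsub>Q k\<^esub>}" unfolding top by simp
  then show ?thesis
    using that[of "Q k" "\<lambda>x. \<phi> x k"] Qg[OF k(1)] fin[OF k(1)] CQ[OF k(1)] \<phi>hom[OF k(1)] small by blast
qed

lemma profinite_group_open_normal_subgroup:
  assumes pro: "profinite_group G T" and W: "openin T W" "\<one>\<^bsub>G\<^esub> \<in> W"
  obtains U where "U \<lhd> G" "openin T U" "U \<subseteq> W" "finite (rcosets\<^bsub>G\<^esub> U)"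
proof -
  interpret group G using pro unfolding profinite_group_def pro_group_def topological_group_def by blast
  obtain Q :: "nat monoid" and h where Q: "group Q" "finite (carrier Q)" "h \<in> hom G Q"
    "openin T {x \<in> carrier G. h x = \<one>\<^bsub>Q\<^esub>}" "{x \<in> carrier G. h x = \<one>\<^bsub>Q\<^esub>} \<subseteq> W"
    by (rule pro_group_small_kernel[OF pro[unfolded profinite_group_def] W]) (rule that)
  interpret h: group_hom G Q h using Q by (simp add: group_hom_def group_hom_axioms_def)
  have k: "kernel G Q h = {x \<in> carrier G. h x = \<one>\<^bsub>Q\<^esub>}" unfolding kernel_def ..
  have "finite (carrier (G Mod kernel G Q h))"
    by (rule inj_on_finite[OF h.FactGroup_inj_on _ Q(2)]) (use h.FactGroup_the_elem_mem in blast)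
  then have "finite (rcosets\<^bsub>G\<^esub> kernel G Q h)" by (simp add: FactGroup_def)
  then show ?thesis using that[of "kernel G Q h"] h.normal_kernel Q(4,5) unfolding k by blast
qed

text \<open>
  An inverse limit of finite groups is closed in their product, which is compact.
\<close>

lemma profinite_group_compact:
  assumes "profinite_group G T"
  shows "compact_space T"
proof -
  have "\<exists>(I :: 'a set set) r (Q :: 'a set \<Rightarrow> nat monoid) f h.
        inverse_system I r Q f \<and> (\<forall>i\<in>I. finite (carrier (Q i)) \<and> True) \<and>
        h \<in> iso G (inverse_limit I r Q f) \<and>
        homeomorphic_map T (inverse_limit_topology I r Q f) h"
    using assms unfolding profinite_group_def pro_group_def by (rule conjunct2)
  then obtain I :: "'a set set" and r and Q :: "'a set \<Rightarrow> nat monoid" and f \<phi>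
    where *: "inverse_system I r Q f \<and> (\<forall>i\<in>I. finite (carrier (Q i)) \<and> True) \<and>
        \<phi> \<in> iso G (inverse_limit I r Q f) \<and>
        homeomorphic_map T (inverse_limit_topology I r Q f) \<phi>"
    by (elim exE) (rule that)
  have fin: "\<And>i. i \<in> I \<Longrightarrow> finite (carrier (Q i))" and homeo: "homeomorphic_map T (inverse_limit_topology I r Q f) \<phi>"
    and sys: "inverse_system I r Q f" using * by simp_all
  have po: "partial_order_on I r" and fh: "\<And>i j. (i, j) \<in> r \<Longrightarrow> f i j \<in> hom (Q j) (Q i)"
    using sys unfolding inverse_system_def by blast+
  have rI: "i \<in> I" "j \<in> I" if "(i, j) \<in> r" for i j
    using po that unfolding partial_order_on_def preorder_on_def refl_on_def by blast+
  let ?X = "product_topology (\<lambda>i. discrete_topology (carrier (Q i))) I"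
  have cX: "compact_space ?X"
    using fin by (simp add: compact_space_product_topology compact_space_discrete_topology)
  have closed: "closedin ?X {x \<in> topspace ?X. f i j (x j) = x i}" if ij: "(i, j) \<in> r" for i j
  proof -
    have pj: "continuous_map ?X (discrete_topology (carrier (Q j))) (\<lambda>x. x j)"
      and pi: "continuous_map ?X (discrete_topology (carrier (Q i))) (\<lambda>x. x i)"
      using rI[OF ij] by (auto intro: continuous_map_product_projection)
    have ff: "continuous_map (discrete_topology (carrier (Q j))) (discrete_topology (carrier (Q i))) (f i j)"
      using fh[OF ij] by (auto simp: continuous_map_def hom_def)
    have "continuous_map ?X (discrete_topology (carrier (Q i))) (\<lambda>x. f i j (x j))"
      using continuous_map_compose[OF pj ff] by (simp add: o_def)
    then show ?thesis using closedin_continuous_maps_eq[OF _ _ pi] by simp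
  qed
  have "inverse_limit_carrier I r Q f = topspace ?X \<inter> \<Inter> {{x \<in> topspace ?X. f i j (x j) = x i} | i j. (i, j) \<in> r}"
    unfolding inverse_limit_carrier_def by auto
  moreover have "closedin ?X (topspace ?X \<inter> \<Inter> {{x \<in> topspace ?X. f i j (x j) = x i} | i j. (i, j) \<in> r})"
  proof (cases "r = {}")
    case False
    then have "closedin ?X (\<Inter> {{x \<in> topspace ?X. f i j (x j) = x i} | i j. (i, j) \<in> r})"
      using closed by (intro closedin_Inter) auto
    then show ?thesis by (rule closedin_Int[OF closedin_topspace])
  next
    case True
    then show ?thesis using closedin_topspace[of ?X] by simp
  qed
  ultimately have "closedin ?X (inverse_limit_carrier I r Q f)" by simp
  then have "compact_space (inverse_limit_topology I r Q f)"
    unfolding inverse_limit_topology_def using cX closedin_compact_space compact_space_subtopology by blast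
  then show ?thesis using homeo homeomorphic_compact_space homeomorphic_map_imp_homeomorphic_space by blast
qed

text \<open>
  A point \<open>x\<close> outside \<open>K\<close> has a neighbourhood \<open>x U\<close> that
  misses \<open>K\<close>, and then \<open>x\<close> is not in \<open>K U\<close>.
\<close>

lemma closed_subgroup_eq_Inter:
  assumes pro: "profinite_group G T" and K: "subgroup K G" "closedin T K" and x: "x \<in> carrier G"
    and all: "\<And>U. U \<lhd> G \<Longrightarrow> openin T U \<Longrightarrow> finite (rcosets\<^bsub>G\<^esub> U) \<Longrightarrow> x \<in> K <#>\<^bsub>G\<^esub> U"
  shows "x \<in> K"
proof (rule ccontr)
  assume nx: "x \<notin> K"
  have tg: "topological_group G T" using pro unfolding profinite_group_def pro_group_def by blast
  interpret group G using tg unfolding topological_group_def by simp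
  interpret K: subgroup K G by (rule K)
  have top: "topspace T = carrier G" using tg unfolding topological_group_def by auto
  have "openin T (carrier G - K)" using K(2) top by (metis closedin_def)
  then have "openin T {y \<in> carrier G. inv\<^bsub>G\<^esub> (inv\<^bsub>G\<^esub> x) \<otimes>\<^bsub>G\<^esub> y \<in> carrier G - K}"
    using topological_group_open_coset[OF tg _ inv_closed[OF x]] by blast
  moreover have "\<one>\<^bsub>G\<^esub> \<in> {y \<in> carrier G. inv\<^bsub>G\<^esub> (inv\<^bsub>G\<^esub> x) \<otimes>\<^bsub>G\<^esub> y \<in> carrier G - K}" using x nx by simp
  ultimately obtain U where U: "U \<lhd> G" "openin T U" "U \<subseteq> {y \<in> carrier G. inv\<^bsub>G\<^esub> (inv\<^bsub>G\<^esub> x) \<otimes>\<^bsub>G\<^esub> y \<in> carrier G - K}"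
    "finite (rcosets\<^bsub>G\<^esub> U)"
    by (rule profinite_group_open_normal_subgroup[OF pro]) (rule that)
  interpret U: normal U G by (rule U)
  obtain k u where ku: "k \<in> K" "u \<in> U" "x = k \<otimes>\<^bsub>G\<^esub> u" using all[OF U(1,2,4)] unfolding set_mult_def by blast
  have "x \<otimes>\<^bsub>G\<^esub> inv\<^bsub>G\<^esub> u \<notin> K" using U(3) U.m_inv_closed[OF ku(2)] x by auto
  then show False using ku by (simp add: m_assoc)
qed

section \<open>Invariance of a cocycle at a finite level\<close>

lemma (in group) subgroup_mult_normal:
  assumes "subgroup K G" "U \<lhd> G"
  shows "subgroup (K <#> U) G"
  using mult_norm_subgroup[OF assms(2,1)] commut_normal[OF assms] by simp

locale profinite_action = left_action G N a
  for G :: "('g, 'a) monoid_scheme" (structure) and N :: "('n, 'b) monoid_scheme" and a :: "'g \<Rightarrow> 'n \<Rightarrow> 'n" +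
  fixes T :: "'g topology"
  assumes profinite: "profinite_group G T"
begin

lemma is_topological_group: "topological_group G T"
  using profinite unfolding profinite_group_def pro_group_def by blast

lemma topspace [simp]: "topspace T = carrier G"
  using is_topological_group unfolding topological_group_def by blast

text \<open>
  The action factors through the finite quotient by such a subgroup, and every continuous cocycle
  is trivial on one of them.
\<close>

definition small_subgroup :: "'g set \<Rightarrow> bool" where
  "small_subgroup U \<longleftrightarrow> U \<lhd> G \<and> openin T U \<and> finite (rcosets U) \<and> (\<forall>u\<in>U. \<forall>n\<in>carrier N. a u n = n)"

lemma small_subgroupD:
  assumes "small_subgroup U"
  shows "U \<lhd> G" "subgroup U G" "openin T U" "finite (rcosets U)" "\<And>u n. u \<in> U \<Longrightarrow> n \<in> carrier N \<Longrightarrow> a u n = n"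
  using assms normal_imp_subgroup unfolding small_subgroup_def by auto

lemma small_subgroup_Int:
  assumes U: "small_subgroup U" and W: "openin T W" "\<one> \<in> W"
  obtains V where "small_subgroup V" "V \<subseteq> U" "V \<subseteq> W"
proof -
  have "openin T (U \<inter> W)" using small_subgroupD(3)[OF U] W(1) by (rule openin_Int)
  moreover have "\<one> \<in> U \<inter> W" using W(2) subgroup.one_closed[OF small_subgroupD(2)[OF U]] by blast
  ultimately obtain V where V: "V \<lhd> G" "openin T V" "V \<subseteq> U \<inter> W" "finite (rcosets V)"
    by (rule profinite_group_open_normal_subgroup[OF profinite]) (rule that)
  then have "small_subgroup V" using small_subgroupD(5)[OF U] unfolding small_subgroup_def by blast
  then show ?thesis using that[of V] V(3) by blast
qed

text \<open>
  Suppose that for every small \<open>V\<close> some element normalizes \<open>K V\<close> without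
  fixing the class of \<open>\<phi>'\<close> on \<open>K V\<close>. The sets of these elements are
  closed, nonempty and decrease with \<open>V\<close>, so by compactness they have a common
  element. It normalizes \<open>K\<close>, which is the intersection of the groups \<open>K
  V\<close>, and the assumed invariance under this element yields a contradiction.
\<close>

lemma invariant_at_finite_level:
  assumes K: "subgroup K G" "closedin T K" and U: "small_subgroup U"
    and \<phi>': "cocycle (K <#> U) \<phi>'" "\<And>k u. k \<in> K \<Longrightarrow> u \<in> U \<Longrightarrow> \<phi>' (k \<otimes> u) = \<phi>' k"
    and inv: "\<And>j. j \<in> carrier G \<Longrightarrow> (\<And>x. x \<in> K \<Longrightarrow> inv j \<otimes> x \<otimes> j \<in> K) \<Longrightarrow>
      \<exists>n\<in>carrier N. \<forall>x\<in>K. a j (\<phi>' (inv j \<otimes> x \<otimes> j)) = inv\<^bsub>N\<^esub> n \<otimes>\<^bsub>N\<^esub> \<phi>' x \<otimes>\<^bsub>N\<^esub> a x n"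
  shows "\<exists>V. small_subgroup V \<and> V \<subseteq> U \<and> (\<forall>j\<in>normalizing G (K <#> V). \<exists>n\<in>carrier N. \<forall>x\<in>K <#> V.
      a j (\<phi>' (inv j \<otimes> x \<otimes> j)) = inv\<^bsub>N\<^esub> n \<otimes>\<^bsub>N\<^esub> \<phi>' x \<otimes>\<^bsub>N\<^esub> a x n)"
proof (rule ccontr)
  assume no: "\<not> ?thesis"
  interpret K: subgroup K G by (rule K)
  interpret U: normal U G by (rule small_subgroupD[OF U])
  define ok where "ok = (\<lambda>V j. \<exists>n\<in>carrier N. \<forall>x\<in>K <#> V. a j (\<phi>' (inv j \<otimes> x \<otimes> j)) = inv\<^bsub>N\<^esub> n \<otimes>\<^bsub>N\<^esub> \<phi>' x \<otimes>\<^bsub>N\<^esub> a x n)"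
  define Bad where "Bad = (\<lambda>V. {j \<in> normalizing G (K <#> V). \<not> ok V j})"
  define I where "I = {V. small_subgroup V \<and> V \<subseteq> U}"
  have UI: "U \<in> I" unfolding I_def using U by blast
  have KV: "subgroup (K <#> V) G" if "V \<in> I" for V
    using G.subgroup_mult_normal[OF K(1)] small_subgroupD(1) that unfolding I_def by blast
  have nsub: "subgroup (normalizing G (K <#> V)) G" if "V \<in> I" for V
    using G.normalizing_subgroup[OF subgroup.subset[OF KV[OF that]]] .
  have mem: "k \<otimes> v \<in> K <#> V" if "k \<in> K" "v \<in> V" for k v V using that unfolding set_mult_def by blast
  have elim: "\<exists>k\<in>K. \<exists>v\<in>V. x = k \<otimes> v" if "x \<in> K <#> V" for x V using that unfolding set_mult_def by blast
  have VU: "V \<subseteq> U" and Vs: "small_subgroup V" if "V \<in> I" for V using that unfolding I_def by auto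
  have mono: "K <#> V \<subseteq> K <#> W" if "V \<subseteq> W" for V W using that unfolding set_mult_def by blast
  have \<phi>U: "\<phi>' (x \<otimes> u) = \<phi>' x" if x: "x \<in> K <#> U" and u: "u \<in> U" for x u
  proof -
    obtain k v where kv: "k \<in> K" "v \<in> U" "x = k \<otimes> v" using elim[OF x] by blast
    have "x \<otimes> u = k \<otimes> (v \<otimes> u)" unfolding kv using kv u by (simp add: G.m_assoc)
    then show ?thesis using \<phi>'(2)[OF kv(1)] kv u by simp
  qed
  \<comment> \<open>The property depends only on the coset \<open>j V\<close>, which makes the bad set closed.\<close>
  have ok_mult: "ok V j" if V: "V \<in> I" and j: "j \<in> carrier G" and jn: "j \<in> normalizing G (K <#> V)" and u: "u \<in> V" and o: "ok V (j \<otimes> u)" for V j u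
  proof -
    interpret V: normal V G by (rule small_subgroupD[OF Vs[OF V]])
    have "a (j \<otimes> u) (\<phi>' (inv (j \<otimes> u) \<otimes> x \<otimes> (j \<otimes> u))) = a j (\<phi>' (inv j \<otimes> x \<otimes> j))" if x: "x \<in> K <#> V" for x
    proof -
      define s where "s = inv j \<otimes> x \<otimes> j"
      have s: "s \<in> K <#> V" using jn x unfolding s_def normalizing_def by blast
      have sG: "s \<in> carrier G" using s subgroup.mem_carrier[OF KV[OF V]] by blast
      have xG: "x \<in> carrier G" using x subgroup.mem_carrier[OF KV[OF V]] by blast
      have "inv (j \<otimes> u) \<otimes> x \<otimes> (j \<otimes> u) = s \<otimes> ((inv s \<otimes> inv u \<otimes> s) \<otimes> u)"
        unfolding s_def using j u xG by (simp add: G.m_assoc G.inv_mult_group G.cancel_inv_left)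
      moreover have "(inv s \<otimes> inv u \<otimes> s) \<otimes> u \<in> U" using V.inv_op_closed1[OF sG, of "inv u"] u VU[OF V] by auto
      moreover have sU: "s \<in> K <#> U" using s mono[OF VU[OF V]] by blast
      ultimately have e: "\<phi>' (inv (j \<otimes> u) \<otimes> x \<otimes> (j \<otimes> u)) = \<phi>' s" using \<phi>U by simp
      have "\<phi>' s \<in> carrier N" using cocycle_closed[OF \<phi>'(1) sU] .
      then show ?thesis unfolding e using j u small_subgroupD(5)[OF Vs[OF V] u] by (simp add: a_mult s_def)
    qed
    then show ?thesis using o unfolding ok_def by auto
  qed
  have closed: "closedin T (Bad V)" if V: "V \<in> I" for V
  proof (rule topological_group_closedin_cosets[OF is_topological_group small_subgroupD(2,3)[OF Vs[OF V]]])
    show "Bad V \<subseteq> carrier G" unfolding Bad_def normalizing_def by blast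
    fix j u assume j: "j \<in> Bad V" and u: "u \<in> V"
    have jG: "j \<in> carrier G" using j unfolding Bad_def normalizing_def by blast
    have un: "u \<in> normalizing G (K <#> V)"
      using G.subgroup_subset_normalizing[OF KV[OF V]] mem[OF K.one_closed u] u subgroup.mem_carrier[OF small_subgroupD(2)[OF Vs[OF V]] u] by auto
    have "j \<otimes> u \<in> normalizing G (K <#> V)" using subgroup.m_closed[OF nsub[OF V] _ un] j unfolding Bad_def by blast
    moreover have "\<not> ok V (j \<otimes> u)" using ok_mult[OF V jG _ u] j unfolding Bad_def by blast
    ultimately show "j \<otimes> u \<in> Bad V" unfolding Bad_def by blast
  qed
  have BadNE: "Bad V \<noteq> {}" if "V \<in> I" for V
    using no that unfolding Bad_def I_def ok_def by blast
  have BadMono: "Bad V \<subseteq> Bad W" if V: "V \<in> I" and W: "W \<in> I" and sub: "V \<subseteq> W" for V W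
  proof
    interpret W: normal W G by (rule small_subgroupD[OF Vs[OF W]])
    fix j assume j: "j \<in> Bad V"
    then have jG: "j \<in> carrier G" unfolding Bad_def normalizing_def by blast
    have 1: "g \<otimes> x \<otimes> inv g \<in> K <#> W" if g: "g \<in> normalizing G (K <#> V)" and x: "x \<in> K <#> W" for g x
    proof -
      have gG: "g \<in> carrier G" using g unfolding normalizing_def by blast
      obtain k w where kw: "k \<in> K" "w \<in> W" "x = k \<otimes> w" using elim[OF x] by blast
      have "k \<in> K <#> V" using mem[OF kw(1) subgroup.one_closed[OF small_subgroupD(2)[OF Vs[OF V]]]] kw(1) by simp
      then have "g \<otimes> k \<otimes> inv g \<in> K <#> W" using g mono[OF sub] unfolding normalizing_def by blast
      moreover have "g \<otimes> w \<otimes> inv g \<in> K <#> W"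
        using mem[OF K.one_closed W.inv_op_closed2[OF gG kw(2)]] gG kw(2) by simp
      ultimately have "(g \<otimes> k \<otimes> inv g) \<otimes> (g \<otimes> w \<otimes> inv g) \<in> K <#> W" using subgroup.m_closed[OF KV[OF W]] by blast
      then show ?thesis using kw gG by (simp add: G.m_assoc G.cancel_inv_left)
    qed
    have jn: "j \<in> normalizing G (K <#> V)" using j unfolding Bad_def by blast
    have "j \<in> normalizing G (K <#> W)" unfolding normalizing_def
      using jG 1[OF jn] 1[OF subgroup.m_inv_closed[OF nsub[OF V] jn]] by simp
    moreover have "\<not> ok W j" using j mono[OF sub] unfolding Bad_def ok_def by blast
    ultimately show "j \<in> Bad W" unfolding Bad_def by blast
  qed
  have lower: "\<exists>V\<in>I. \<forall>W\<in>F. V \<subseteq> W" if "finite F" "F \<subseteq> I" for F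
    using that
  proof (induction F rule: finite_induct)
    case empty
    then show ?case using UI by blast
  next
    case (insert W F)
    then obtain V where V: "V \<in> I" "\<forall>W\<in>F. V \<subseteq> W" by blast
    have W: "W \<in> I" using insert.prems by blast
    obtain V' where "small_subgroup V'" "V' \<subseteq> V" "V' \<subseteq> W"
      by (rule small_subgroup_Int[OF Vs[OF V(1)] small_subgroupD(3)[OF Vs[OF W]]
            subgroup.one_closed[OF small_subgroupD(2)[OF Vs[OF W]]]])
    then show ?case using V VU[OF V(1)] unfolding I_def by blast
  qed
  \<comment> \<open>By monotonicity, finitely many bad sets contain a common smaller one.\<close>
  have fip: "\<Inter> F \<noteq> {}" if F: "finite F" "F \<subseteq> Bad ` I" for F
  proof -
    obtain F' where F': "F' \<subseteq> I" "finite F'" "F = Bad ` F'" using finite_subset_image[OF F] by blast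
    obtain V where V: "V \<in> I" "\<forall>W\<in>F'. V \<subseteq> W" using lower[OF F'(2,1)] by blast
    then have "Bad V \<subseteq> \<Inter> F" unfolding F'(3) using BadMono F'(1) by blast
    then show ?thesis using BadNE[OF V(1)] by blast
  qed
  have "\<Inter> (Bad ` I) \<noteq> {}"
    using profinite_group_compact[OF profinite, unfolded compact_space_fip, rule_format, of "Bad ` I"] closed fip by blast
  then obtain j where j: "\<And>V. V \<in> I \<Longrightarrow> j \<in> Bad V" by blast
  have jG: "j \<in> carrier G" using j[OF UI] unfolding Bad_def normalizing_def by blast
  have jK: "inv j \<otimes> x \<otimes> j \<in> K" if x: "x \<in> K" for x
  proof (rule closed_subgroup_eq_Inter[OF profinite K])
    show "inv j \<otimes> x \<otimes> j \<in> carrier G" using jG x by simp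
    fix W assume W: "W \<lhd> G" "openin T W" "finite (rcosets W)"
    obtain V where V: "small_subgroup V" "V \<subseteq> U" "V \<subseteq> W"
      using small_subgroup_Int[OF U W(2) subgroup.one_closed[OF normal_imp_subgroup[OF W(1)]]] by blast
    then have VI: "V \<in> I" unfolding I_def by blast
    have "x \<in> K <#> V" using mem[OF x subgroup.one_closed[OF small_subgroupD(2)[OF V(1)]]] x by simp
    then have "inv j \<otimes> x \<otimes> j \<in> K <#> V" using j[OF VI] unfolding Bad_def normalizing_def by blast
    then show "inv j \<otimes> x \<otimes> j \<in> K <#> W" using mono[OF V(3)] by blast
  qed
  obtain n where n: "n \<in> carrier N" "\<And>x. x \<in> K \<Longrightarrow> a j (\<phi>' (inv j \<otimes> x \<otimes> j)) = inv\<^bsub>N\<^esub> n \<otimes>\<^bsub>N\<^esub> \<phi>' x \<otimes>\<^bsub>N\<^esub> a x n"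
    using inv[OF jG jK] by blast
  have KU: "k \<in> K <#> U" if "k \<in> K" for k using mem[OF that U.one_closed] that by simp
  have "ok U j" unfolding ok_def
  proof (intro bexI[of _ n] ballI)
    fix x assume x: "x \<in> K <#> U"
    obtain k u where ku: "k \<in> K" "u \<in> U" "x = k \<otimes> u" using elim[OF x] by blast
    have "inv j \<otimes> x \<otimes> j = (inv j \<otimes> k \<otimes> j) \<otimes> (inv j \<otimes> u \<otimes> j)"
      unfolding ku using ku jG by (simp add: G.m_assoc G.cancel_inv_left)
    then have "\<phi>' (inv j \<otimes> x \<otimes> j) = \<phi>' (inv j \<otimes> k \<otimes> j)"
      using \<phi>U[OF KU[OF jK[OF ku(1)]] U.inv_op_closed1[OF jG ku(2)]] by simp
    moreover have "\<phi>' x = \<phi>' k" unfolding ku(3) using \<phi>'(2) ku by blast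
    moreover have "a x n = a k n" unfolding ku(3) using ku n(1) small_subgroupD(5)[OF U ku(2) n(1)] by (simp add: a_mult)
    ultimately show "a j (\<phi>' (inv j \<otimes> x \<otimes> j)) = inv\<^bsub>N\<^esub> n \<otimes>\<^bsub>N\<^esub> \<phi>' x \<otimes>\<^bsub>N\<^esub> a x n" using n(2)[OF ku(1)] by simp
  qed (rule n(1))
  then show False using j[OF UI] unfolding Bad_def by blast
qed

end

section \<open>Restriction to a subgroup whose index is prime to the exponent\<close>

lemma (in group) rcosets_finite_mono:
  assumes U: "subgroup U G" and R: "subgroup R G" and UR: "U \<subseteq> R" and fin: "finite (rcosets U)"
  shows "finite (rcosets R)"
proof -
  have "R #> g = R <#> (U #> g)" if g: "g \<in> carrier G" for g
  proof -
    have "R <#> U = R"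
      using set_mult_subgroup_idem[OF R subgroup_incl[OF U R UR]] .
    then show ?thesis using setmult_rcos_assoc[OF subgroup.subset[OF R] subgroup.subset[OF U] g] by simp
  qed
  then have "rcosets R \<subseteq> (\<lambda>X. R <#> X) ` (rcosets U)" unfolding RCOSETS_def by auto
  then show ?thesis using fin finite_surj by blast
qed

lemma (in group) subgroups_subset_set_mult:
  assumes "subgroup K G" "subgroup U G"
  shows "K \<subseteq> K <#> U" "U \<subseteq> K <#> U"
proof -
  interpret K: subgroup K G by fact
  interpret U: subgroup U G by fact
  have I: "k \<otimes> u \<in> K <#> U" if "k \<in> K" "u \<in> U" for k u using that unfolding set_mult_def by blast
  show "K \<subseteq> K <#> U" using I[OF _ U.one_closed] by auto
  show "U \<subseteq> K <#> U" using I[OF K.one_closed] by auto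
qed

text \<open>
  Each coset of \<open>B\<close> contains the same number of cosets of \<open>R\<close>. The
  groups themselves may be infinite.
\<close>

lemma (in group) index_mult:
  assumes R: "subgroup R G" and B: "subgroup B G" and RB: "R \<subseteq> B" and fin: "finite (rcosets R)"
  shows "card (rcosets R) = card (rcosets B) * card (rcosets\<^bsub>G\<lparr>carrier := B\<rparr>\<^esub> R)"
proof -
  interpret R: subgroup R G by fact
  interpret B: subgroup B G by fact
  have finB: "finite (rcosets B)" by (rule rcosets_finite_mono[OF R B RB fin])
  have rB: "rcosets\<^bsub>G\<lparr>carrier := B\<rparr>\<^esub> R = (\<lambda>b. R #> b) ` B" unfolding RCOSETS_def by auto
  define fib where "fib = (\<lambda>X. {Y \<in> rcosets R. Y \<subseteq> X})"
  have sub: "R #> g \<subseteq> B #> g" for g using RB unfolding r_coset_def by blast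
  have un: "rcosets R = (\<Union>X\<in>rcosets B. fib X)"
  proof
    show "rcosets R \<subseteq> (\<Union>X\<in>rcosets B. fib X)"
    proof
      fix Y assume Y: "Y \<in> rcosets R"
      then obtain g where "g \<in> carrier G" "Y = R #> g" unfolding RCOSETS_def by blast
      then show "Y \<in> (\<Union>X\<in>rcosets B. fib X)" using Y sub[of g] rcosetsI[OF B.subset] unfolding fib_def by blast
    qed
  qed (auto simp: fib_def)
  have disj: "fib X \<inter> fib X' = {}" if X: "X \<in> rcosets B" "X' \<in> rcosets B" "X \<noteq> X'" for X X'
  proof -
    have d: "X \<inter> X' = {}" using rcos_disjoint[OF B] X unfolding pairwise_def disjnt_def by blast
    have "Y \<noteq> {}" if "Y \<in> rcosets R" for Y by (rule R.rcosets_non_empty[OF that])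
    then show ?thesis using d unfolding fib_def by blast
  qed
  have cfib: "card (fib X) = card (rcosets\<^bsub>G\<lparr>carrier := B\<rparr>\<^esub> R)" if X: "X \<in> rcosets B" for X
  proof -
    obtain g where g: "g \<in> carrier G" "X = B #> g" using X unfolding RCOSETS_def by blast
    have "bij_betw (\<lambda>Y. Y #> g) ((\<lambda>b. R #> b) ` B) (fib X)"
      unfolding bij_betw_def
    proof
      show "inj_on (\<lambda>Y. Y #> g) ((\<lambda>b. R #> b) ` B)"
      proof (rule inj_onI)
        fix Y Y' assume Y: "Y \<in> (\<lambda>b. R #> b) ` B" "Y' \<in> (\<lambda>b. R #> b) ` B" and e: "Y #> g = Y' #> g"
        have "R #> b \<subseteq> carrier G" if "b \<in> B" for b using r_coset_subset_G[OF R.subset B.mem_carrier[OF that]] .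
        then have c: "Y \<subseteq> carrier G" "Y' \<subseteq> carrier G" using Y by blast+
        have "Y #> g #> inv g = Y' #> g #> inv g" using e by simp
        then show "Y = Y'" using c g(1) by (simp add: coset_mult_assoc)
      qed
      show "(\<lambda>Y. Y #> g) ` ((\<lambda>b. R #> b) ` B) = fib X"
      proof
        show "(\<lambda>Y. Y #> g) ` ((\<lambda>b. R #> b) ` B) \<subseteq> fib X"
        proof clarify
          fix b assume b: "b \<in> B"
          have "R #> b #> g = R #> (b \<otimes> g)" using b g R.subset by (simp add: coset_mult_assoc)
          moreover have "R #> (b \<otimes> g) \<in> rcosets R" using b g rcosetsI[OF R.subset, of "b \<otimes> g"] by simp
          moreover have "R #> b \<subseteq> B" using RB b unfolding r_coset_def by auto
          then have "R #> b #> g \<subseteq> B #> g" unfolding r_coset_def by blast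
          ultimately show "R #> b #> g \<in> fib X" unfolding fib_def g(2) by simp
        qed
        show "fib X \<subseteq> (\<lambda>Y. Y #> g) ` ((\<lambda>b. R #> b) ` B)"
        proof
          fix Y assume Y: "Y \<in> fib X"
          then obtain h where h: "h \<in> carrier G" "Y = R #> h" unfolding fib_def RCOSETS_def by blast
          have "h \<in> B #> g" using Y rcos_self[OF h(1) R] h(2) g(2) unfolding fib_def by blast
          then obtain b where b: "b \<in> B" "h = b \<otimes> g" unfolding r_coset_def by blast
          have "Y = R #> b #> g" unfolding h(2) b(2) using b(1) g(1) R.subset by (simp add: coset_mult_assoc)
          then show "Y \<in> (\<lambda>Y. Y #> g) ` ((\<lambda>b. R #> b) ` B)" using b(1) by blast
        qed
      qed
    qed
    then show ?thesis unfolding rB by (simp add: bij_betw_same_card)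
  qed
  have "card (rcosets R) = (\<Sum>X\<in>rcosets B. card (fib X))"
    by (subst un, rule card_UN_disjoint) (use finB fin disj in \<open>auto simp: fib_def\<close>)
  also have "\<dots> = (\<Sum>X\<in>rcosets B. card (rcosets\<^bsub>G\<lparr>carrier := B\<rparr>\<^esub> R))" using cfib by simp
  finally show ?thesis by simp
qed

lemma (in group) rcosets_subgroup_finite:
  assumes R: "subgroup R G" and B: "subgroup B G" and fin: "finite (rcosets R)"
  shows "finite (rcosets\<^bsub>G\<lparr>carrier := B\<rparr>\<^esub> R)"
  by (rule finite_subset[OF _ fin]) (use subgroup.subset[OF B] in \<open>auto simp: RCOSETS_def\<close>)

lemma (in group) normal_in_normalizing:
  assumes "subgroup R G"
  shows "R \<lhd> G\<lparr>carrier := normalizing G R\<rparr>"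
proof -
  have B: "subgroup (normalizing G R) G" by (rule normalizing_subgroup[OF subgroup.subset[OF assms]])
  interpret GB: group "G\<lparr>carrier := normalizing G R\<rparr>" by (rule subgroup_imp_group[OF B])
  show ?thesis
    by (rule GB.normal_invI[OF subgroup_incl[OF assms B subgroup_subset_normalizing[OF assms]]])
      (use m_inv_consistent[OF B] in \<open>auto simp: normalizing_def\<close>)
qed

context profinite_action
begin

text \<open>
  The normalizer of \<open>K U\<close> is large enough to control cohomology: what it misses is
  covered by \<open>M\<close>, which is invisible to cocycles that are trivial on \<open>U\<close>
  with values in a group of exponent \<open>k\<close>.
\<close>

definition sylow_supplement :: "nat \<Rightarrow> 'g set \<Rightarrow> 'g set \<Rightarrow> bool" where
  "sylow_supplement k K U \<longleftrightarrow> (\<exists>M. M \<lhd> G \<and> (\<forall>x\<in>M. \<forall>n\<in>carrier N. a x n = n) \<and>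
     (\<forall>x\<in>M. \<exists>l::nat. coprime l k \<and> x [^] l \<in> U) \<and>
     (\<forall>g\<in>carrier G. \<exists>b\<in>normalizing G (K <#> U). \<exists>m\<in>M. g = b \<otimes> m))"

lemma cocycle_mult_trivial:
  assumes "cocycle H \<phi>" "x \<in> H" "u \<in> H" "\<phi> u = \<one>\<^bsub>N\<^esub>" "x \<in> carrier G"
  shows "\<phi> (x \<otimes> u) = \<phi> x"
  using assms cocycle_mult[OF assms(1-3)] cocycle_closed[OF assms(1,2)] by simp

text \<open>
  The abstract injectivity statement, applied to \<open>R = K U\<close> and its normalizer
  \<open>B\<close>.
\<close>

lemma sylow_restriction_injective:
  assumes K: "subgroup K G" and U: "small_subgroup U" and k: "k > 0" "\<And>x. x \<in> carrier N \<Longrightarrow> x [^]\<^bsub>N\<^esub> (k::nat) = \<one>\<^bsub>N\<^esub>"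
    and C: "abelian_chain N C n" "\<And>i g x. i \<le> n \<Longrightarrow> g \<in> carrier G \<Longrightarrow> x \<in> C i \<Longrightarrow> a g x \<in> C i"
    and idx: "coprime k (card (rcosets (K <#> U)))" and sup: "sylow_supplement k K U"
    and \<phi>: "cocycle (carrier G) \<phi>" "\<And>u. u \<in> U \<Longrightarrow> \<phi> u = \<one>\<^bsub>N\<^esub>"
    and \<psi>: "cocycle (carrier G) \<psi>" "\<And>u. u \<in> U \<Longrightarrow> \<psi> u = \<one>\<^bsub>N\<^esub>"
    and coh: "cohomologous_by K v \<phi> \<psi>"
  shows "\<exists>v. cohomologous_by (carrier G) v \<phi> \<psi>"
proof -
  interpret K: subgroup K G by (rule K)
  interpret U: normal U G by (rule small_subgroupD[OF U])
  define R where "R = K <#> U"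
  define B where "B = normalizing G R"
  have R: "subgroup R G" unfolding R_def by (rule G.subgroup_mult_normal[OF K U.normal_axioms])
  have B: "subgroup B G" unfolding B_def by (rule G.normalizing_subgroup[OF subgroup.subset[OF R]])
  have UR: "U \<subseteq> R" unfolding R_def by (rule G.subgroups_subset_set_mult(2)[OF K U.subgroup_axioms])
  have finR: "finite (rcosets R)"
    by (rule G.rcosets_finite_mono[OF U.subgroup_axioms R UR small_subgroupD(4)[OF U]])
  have RB: "R \<subseteq> B" unfolding B_def by (rule G.subgroup_subset_normalizing[OF R])
  have cop: "coprime k (card (rcosets\<^bsub>G\<lparr>carrier := B\<rparr>\<^esub> R))"
    using idx G.index_mult[OF R B RB finR] unfolding R_def[symmetric] by simp
  obtain M where M: "M \<lhd> G" "\<And>x n. x \<in> M \<Longrightarrow> n \<in> carrier N \<Longrightarrow> a x n = n"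
    "\<And>x. x \<in> M \<Longrightarrow> \<exists>l::nat. coprime l k \<and> x [^] l \<in> U" "\<And>g. g \<in> carrier G \<Longrightarrow> \<exists>b\<in>B. \<exists>m\<in>M. g = b \<otimes> m"
    using sup unfolding sylow_supplement_def R_def[symmetric] B_def[symmetric] by blast
  have cohR: "cohomologous_by R v \<phi> \<psi>" unfolding cohomologous_by_def
  proof (intro conjI ballI)
    show v: "v \<in> carrier N" using coh unfolding cohomologous_by_def by simp
    fix x assume "x \<in> R"
    then obtain y u where yu: "y \<in> K" "u \<in> U" "x = y \<otimes> u" unfolding R_def set_mult_def by blast
    have "a x v = a y v" unfolding yu(3) using yu v small_subgroupD(5)[OF U yu(2) v] by (simp add: a_mult)
    moreover have "\<phi> x = \<phi> y" "\<psi> x = \<psi> y" unfolding yu(3)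
      using cocycle_mult_trivial[OF \<phi>(1) _ _ \<phi>(2)] cocycle_mult_trivial[OF \<psi>(1) _ _ \<psi>(2)] yu by auto
    ultimately show "\<psi> x = inv\<^bsub>N\<^esub> v \<otimes>\<^bsub>N\<^esub> \<phi> x \<otimes>\<^bsub>N\<^esub> a x v" using coh yu(1) unfolding cohomologous_by_def by simp
  qed
  show ?thesis
    by (rule restriction_injective[OF B G.normal_in_normalizing[OF R, folded B_def] G.rcosets_subgroup_finite[OF R B finR]
        cop k C normal_imp_subgroup[OF M(1)] M(2,3,4) UR \<phi> \<psi> cohR])
qed

text \<open>
  The group \<open>U\<close> on which \<open>\<phi>\<close> is trivial is first shrunk to
  \<open>V\<close> so that \<open>\<phi>\<close> is invariant under the normalizer of \<open>K
  V\<close>; then the abstract surjectivity statement applies to \<open>R = K V\<close>.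
\<close>

lemma sylow_restriction_surjective:
  assumes K: "subgroup K G" "closedin T K" and k: "k > 0" "\<And>x. x \<in> carrier N \<Longrightarrow> x [^]\<^bsub>N\<^esub> (k::nat) = \<one>\<^bsub>N\<^esub>"
    and C: "abelian_chain N C n" "\<And>i g x. i \<le> n \<Longrightarrow> g \<in> carrier G \<Longrightarrow> x \<in> C i \<Longrightarrow> a g x \<in> C i"
    and idx: "\<And>U. small_subgroup U \<Longrightarrow> coprime k (card (rcosets (K <#> U)))"
    and sup: "\<And>U. small_subgroup U \<Longrightarrow> sylow_supplement k K U"
    and U: "small_subgroup U" and \<phi>: "cocycle K \<phi>" "\<And>u. u \<in> K \<Longrightarrow> u \<in> U \<Longrightarrow> \<phi> u = \<one>\<^bsub>N\<^esub>"
    and inv: "\<And>j. j \<in> carrier G \<Longrightarrow> (\<And>x. x \<in> K \<Longrightarrow> inv j \<otimes> x \<otimes> j \<in> K) \<Longrightarrow>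
      \<exists>n\<in>carrier N. \<forall>x\<in>K. a j (\<phi> (inv j \<otimes> x \<otimes> j)) = inv\<^bsub>N\<^esub> n \<otimes>\<^bsub>N\<^esub> \<phi> x \<otimes>\<^bsub>N\<^esub> a x n"
  shows "\<exists>\<psi> V. cocycle (carrier G) \<psi> \<and> (\<forall>x\<in>K. \<psi> x = \<phi> x) \<and> small_subgroup V \<and> (\<forall>u\<in>V. \<psi> u = \<one>\<^bsub>N\<^esub>)"
proof -
  interpret K: subgroup K G by (rule K)
  interpret U: normal U G by (rule small_subgroupD[OF U])
  obtain \<phi>' where \<phi>': "cocycle (K <#> U) \<phi>'" "\<And>x u. x \<in> K \<Longrightarrow> u \<in> U \<Longrightarrow> \<phi>' (x \<otimes> u) = \<phi> x"
    using cocycle_extend_trivially[OF K(1) small_subgroupD(1,5)[OF U] \<phi>(1)] \<phi>(2) by blast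
  have \<phi>'K: "\<phi>' x = \<phi> x" if "x \<in> K" for x using \<phi>'(2)[OF that U.one_closed] that by simp
  have \<phi>'U: "\<phi>' (x \<otimes> u) = \<phi>' x" if "x \<in> K" "u \<in> U" for x u using \<phi>'(2)[OF that] \<phi>'K[OF that(1)] by simp
  have inv': "\<exists>n\<in>carrier N. \<forall>x\<in>K. a j (\<phi>' (inv j \<otimes> x \<otimes> j)) = inv\<^bsub>N\<^esub> n \<otimes>\<^bsub>N\<^esub> \<phi>' x \<otimes>\<^bsub>N\<^esub> a x n"
    if "j \<in> carrier G" "\<And>x. x \<in> K \<Longrightarrow> inv j \<otimes> x \<otimes> j \<in> K" for j
    using inv[OF that(1)] that(2) \<phi>'K by simp
  have "\<exists>V. small_subgroup V \<and> V \<subseteq> U \<and> (\<forall>j\<in>normalizing G (K <#> V). \<exists>n\<in>carrier N. \<forall>x\<in>K <#> V.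
      a j (\<phi>' (inv j \<otimes> x \<otimes> j)) = inv\<^bsub>N\<^esub> n \<otimes>\<^bsub>N\<^esub> \<phi>' x \<otimes>\<^bsub>N\<^esub> a x n)"
    by (rule invariant_at_finite_level[OF K U \<phi>'(1) \<phi>'U inv'])
  then obtain V where V: "small_subgroup V" "V \<subseteq> U" and Vinv: "\<And>j. j \<in> normalizing G (K <#> V) \<Longrightarrow> \<exists>n\<in>carrier N. \<forall>x\<in>K <#> V.
      a j (\<phi>' (inv j \<otimes> x \<otimes> j)) = inv\<^bsub>N\<^esub> n \<otimes>\<^bsub>N\<^esub> \<phi>' x \<otimes>\<^bsub>N\<^esub> a x n"
    by blast
  interpret V: normal V G by (rule small_subgroupD[OF V(1)])
  define R where "R = K <#> V"
  define B where "B = normalizing G R"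
  have R: "subgroup R G" unfolding R_def by (rule G.subgroup_mult_normal[OF K(1) V.normal_axioms])
  have B: "subgroup B G" unfolding B_def by (rule G.normalizing_subgroup[OF subgroup.subset[OF R]])
  have VR: "V \<subseteq> R" unfolding R_def by (rule G.subgroups_subset_set_mult(2)[OF K(1) V.subgroup_axioms])
  have KR: "K \<subseteq> R" unfolding R_def by (rule G.subgroups_subset_set_mult(1)[OF K(1) V.subgroup_axioms])
  have finR: "finite (rcosets R)"
    by (rule G.rcosets_finite_mono[OF V.subgroup_axioms R VR small_subgroupD(4)[OF V(1)]])
  have RB: "R \<subseteq> B" unfolding B_def by (rule G.subgroup_subset_normalizing[OF R])
  have cop: "coprime k (card (rcosets\<^bsub>G\<lparr>carrier := B\<rparr>\<^esub> R))"
    using idx[OF V(1)] G.index_mult[OF R B RB finR] unfolding R_def[symmetric] by simp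
  obtain M where M: "M \<lhd> G" "\<And>x n. x \<in> M \<Longrightarrow> n \<in> carrier N \<Longrightarrow> a x n = n"
    "\<And>x. x \<in> M \<Longrightarrow> \<exists>l::nat. coprime l k \<and> x [^] l \<in> V" "\<And>g. g \<in> carrier G \<Longrightarrow> \<exists>b\<in>B. \<exists>m\<in>M. g = b \<otimes> m"
    using sup[OF V(1)] unfolding sylow_supplement_def R_def[symmetric] B_def[symmetric] by blast
  have RU: "R \<subseteq> K <#> U" unfolding R_def set_mult_def using V(2) by blast
  have \<phi>R: "cocycle R \<phi>'" using \<phi>'(1) RU unfolding cocycle_def by blast
  have \<phi>V: "\<phi>' u = \<one>\<^bsub>N\<^esub>" if u: "u \<in> V" for u
  proof -
    have "\<phi>' u = \<phi>' (\<one> \<otimes> u)" using u by simp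
    also have "\<dots> = \<phi> \<one>" using \<phi>'(2)[OF K.one_closed, of u] u V(2) by blast
    also have "\<dots> = \<one>\<^bsub>N\<^esub>" by (rule cocycle_one[OF \<phi>(1) K.one_closed])
    finally show ?thesis .
  qed
  have "\<exists>\<psi>. cocycle (carrier G) \<psi> \<and> (\<forall>r\<in>R. \<psi> r = \<phi>' r)"
    by (rule restriction_surjective[OF B G.normal_in_normalizing[OF R, folded B_def] G.rcosets_subgroup_finite[OF R B finR]
        cop k C M VR \<phi>R \<phi>V Vinv[folded R_def, folded B_def]])
  then obtain \<psi> where \<psi>: "cocycle (carrier G) \<psi>" "\<And>r. r \<in> R \<Longrightarrow> \<psi> r = \<phi>' r" by blast
  have "\<psi> x = \<phi> x" if "x \<in> K" for x using \<psi>(2)[of x] KR \<phi>'K[OF that] that by auto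
  moreover have "\<psi> u = \<one>\<^bsub>N\<^esub>" if "u \<in> V" for u using \<psi>(2)[of u] VR \<phi>V[OF that] that by auto
  ultimately show ?thesis using V(1) \<psi>(1) by blast
qed

text \<open>
  Supplements are constructed in the finite group \<open>G/U\<close>, where the Sylow theorems are
  available, and pulled back to \<open>G\<close>.
\<close>

lemma supplement_from_quotient:
  assumes K: "subgroup K G" and U: "small_subgroup U" and M: "M \<lhd> G Mod U"
    and sup: "\<And>x. x \<in> carrier (G Mod U) \<Longrightarrow> \<exists>n m. n \<in> carrier (G Mod U) \<and>
        (\<forall>y\<in>(\<lambda>x. U #> x) ` K. n \<otimes>\<^bsub>G Mod U\<^esub> y \<otimes>\<^bsub>G Mod U\<^esub> inv\<^bsub>G Mod U\<^esub> n \<in> (\<lambda>x. U #> x) ` K) \<and> m \<in> M \<and> x = n \<otimes>\<^bsub>G Mod U\<^esub> m"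
    and triv: "\<And>x n. x \<in> carrier G \<Longrightarrow> U #> x \<in> M \<Longrightarrow> n \<in> carrier N \<Longrightarrow> a x n = n"
    and ex: "\<And>x. x \<in> M \<Longrightarrow> x [^]\<^bsub>G Mod U\<^esub> (e::nat) = \<one>\<^bsub>G Mod U\<^esub>" and e: "coprime e k"
  shows "sylow_supplement k K U"
proof -
  interpret K: subgroup K G by (rule K)
  interpret U: normal U G by (rule small_subgroupD[OF U])
  interpret Q: group "G Mod U" by (rule U.factorgroup_is_group)
  interpret cl: group_hom G "G Mod U" "\<lambda>x. U #> x" using U.r_coset_hom_Mod by unfold_locales
  define P where "P = (\<lambda>x. U #> x) ` K"
  have finQ: "finite (carrier (G Mod U))" using small_subgroupD(4)[OF U] by (simp add: FactGroup_def)
  have PQ: "P \<subseteq> carrier (G Mod U)" unfolding P_def by (auto simp: carrier_FactGroup)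
  have finP: "finite P" using PQ finQ finite_subset by blast
  have KU_iff: "x \<in> K <#> U \<longleftrightarrow> U #> x \<in> P" if x: "x \<in> carrier G" for x
  proof
    assume "x \<in> K <#> U"
    then obtain y u where yu: "y \<in> K" "u \<in> U" "x = y \<otimes> u" unfolding set_mult_def by blast
    have "U #> x = (U #> y) \<otimes>\<^bsub>G Mod U\<^esub> (U #> u)" unfolding yu(3) by (rule cl.hom_mult[OF K.mem_carrier[OF yu(1)] U.mem_carrier[OF yu(2)]])
    also have "\<dots> = U #> y" using U.rcos_const[OF G.is_group yu(2)] Q.r_one[of "U #> y"] yu(1) by (auto simp: carrier_FactGroup)
    finally show "U #> x \<in> P" using yu(1) unfolding P_def by blast
  next
    assume "U #> x \<in> P"
    then obtain y where y: "y \<in> K" "U #> x = U #> y" unfolding P_def by blast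
    then have "x \<in> U #> y" using G.rcos_self[OF x U.subgroup_axioms] by simp
    then have "x \<in> U <#> K" using y(1) unfolding r_coset_def set_mult_def by blast
    then show "x \<in> K <#> U" using G.commut_normal[OF K U.normal_axioms] by simp
  qed
  define M' where "M' = {x \<in> carrier G. U #> x \<in> M}"
  have M': "M' \<lhd> G"
  proof (rule G.normal_invI)
    interpret M: normal M "G Mod U" by (rule M)
    show "subgroup M' G"
    proof (rule G.subgroupI)
      have "\<one> \<in> M'" unfolding M'_def using cl.hom_one M.one_closed by simp
      then show "M' \<noteq> {}" by blast
    qed (use M.m_inv_closed M.m_closed cl.hom_inv cl.hom_mult in \<open>auto simp: M'_def\<close>)
    fix x h assume "x \<in> carrier G" "h \<in> M'"
    then show "x \<otimes> h \<otimes> inv x \<in> M'" unfolding M'_def using M.inv_op_closed2[of "U #> x" "U #> h"] cl.hom_closed cl.hom_inv cl.hom_mult by simp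
  qed
  have "\<exists>b\<in>normalizing G (K <#> U). \<exists>m\<in>M'. g = b \<otimes> m" if g: "g \<in> carrier G" for g
  proof -
    obtain n m where nm: "n \<in> carrier (G Mod U)" "\<And>y. y \<in> P \<Longrightarrow> n \<otimes>\<^bsub>G Mod U\<^esub> y \<otimes>\<^bsub>G Mod U\<^esub> inv\<^bsub>G Mod U\<^esub> n \<in> P"
      "m \<in> M" "U #> g = n \<otimes>\<^bsub>G Mod U\<^esub> m"
      using sup[OF cl.hom_closed[OF g]] unfolding P_def[symmetric] by blast
    have "m \<in> carrier (G Mod U)" using subgroup.mem_carrier[OF normal_imp_subgroup[OF M] nm(3)] .
    then obtain m' where m': "m' \<in> carrier G" "m = U #> m'" by (auto simp: carrier_FactGroup)
    define b where "b = g \<otimes> inv m'"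
    have bG: "b \<in> carrier G" unfolding b_def using g m' by simp
    have "U #> b = n \<otimes>\<^bsub>G Mod U\<^esub> m \<otimes>\<^bsub>G Mod U\<^esub> inv\<^bsub>G Mod U\<^esub> m"
      unfolding b_def using cl.hom_mult[OF g G.inv_closed[OF m'(1)]] cl.hom_inv[OF m'(1)] nm(4) m'(2) by metis
    then have b: "U #> b = n" using Q.m_assoc[OF nm(1) \<open>m \<in> carrier (G Mod U)\<close> Q.inv_closed[OF \<open>m \<in> carrier (G Mod U)\<close>]]
        Q.r_inv[OF \<open>m \<in> carrier (G Mod U)\<close>] Q.r_one[OF nm(1)] by metis
    define c where "c = (\<lambda>y. n \<otimes>\<^bsub>G Mod U\<^esub> y \<otimes>\<^bsub>G Mod U\<^esub> inv\<^bsub>G Mod U\<^esub> n)"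
    \<comment> \<open>Only one inclusion is given for conjugation by \<open>n\<close>; the other follows from the
      finiteness of \<open>P\<close>.\<close>
    have cinj: "inj_on c P"
    proof (rule inj_onI)
      fix y z assume "y \<in> P" "z \<in> P" and eq: "c y = c z"
      then have yz: "y \<in> carrier (G Mod U)" "z \<in> carrier (G Mod U)" using PQ by auto
      have "n \<otimes>\<^bsub>G Mod U\<^esub> y = n \<otimes>\<^bsub>G Mod U\<^esub> z"
        using eq Q.right_cancel[OF Q.inv_closed[OF nm(1)] Q.m_closed[OF nm(1) yz(1)] Q.m_closed[OF nm(1) yz(2)]] unfolding c_def by simp
      then have "inv\<^bsub>G Mod U\<^esub> n \<otimes>\<^bsub>G Mod U\<^esub> (n \<otimes>\<^bsub>G Mod U\<^esub> y) = inv\<^bsub>G Mod U\<^esub> n \<otimes>\<^bsub>G Mod U\<^esub> (n \<otimes>\<^bsub>G Mod U\<^esub> z)"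
        by (rule arg_cong)
      then show "y = z" by (simp only: Q.cancel_inv_left(2)[OF nm(1) yz(1)] Q.cancel_inv_left(2)[OF nm(1) yz(2)])
    qed
    have "c ` P \<subseteq> P" using nm(2) unfolding c_def by blast
    then have surj: "c ` P = P" using endo_inj_surj[OF finP _ cinj] by blast
    have conjP: "inv\<^bsub>G Mod U\<^esub> n \<otimes>\<^bsub>G Mod U\<^esub> y \<otimes>\<^bsub>G Mod U\<^esub> n \<in> P" if yP: "y \<in> P" for y
    proof -
      obtain z where z: "z \<in> P" "y = c z" using surj yP by blast
      have zQ: "z \<in> carrier (G Mod U)" using z PQ by blast
      have "inv\<^bsub>G Mod U\<^esub> n \<otimes>\<^bsub>G Mod U\<^esub> y \<otimes>\<^bsub>G Mod U\<^esub> n = z"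
        unfolding z(2) c_def using nm(1) zQ by (simp only: Q.m_assoc Q.m_closed Q.inv_closed Q.l_inv Q.cancel_inv_left Q.r_one)
      then show ?thesis using z(1) by simp
    qed
    have "b \<in> normalizing G (K <#> U)" unfolding normalizing_def
    proof (intro CollectI conjI ballI bG)
      fix s assume s: "s \<in> K <#> U"
      have sG: "s \<in> carrier G" using subgroup.mem_carrier[OF G.subgroup_mult_normal[OF K U.normal_axioms] s] .
      have sP: "U #> s \<in> P" using s KU_iff[OF sG] by blast
      have "U #> (b \<otimes> s \<otimes> inv b) = n \<otimes>\<^bsub>G Mod U\<^esub> (U #> s) \<otimes>\<^bsub>G Mod U\<^esub> inv\<^bsub>G Mod U\<^esub> n"
        using cl.hom_mult[OF G.m_closed[OF bG sG] G.inv_closed[OF bG]] cl.hom_mult[OF bG sG] cl.hom_inv[OF bG] b by metis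
      then show "b \<otimes> s \<otimes> inv b \<in> K <#> U" using KU_iff[of "b \<otimes> s \<otimes> inv b"] nm(2)[OF sP] bG sG by simp
      have "U #> (inv b \<otimes> s \<otimes> b) = inv\<^bsub>G Mod U\<^esub> n \<otimes>\<^bsub>G Mod U\<^esub> (U #> s) \<otimes>\<^bsub>G Mod U\<^esub> n"
        using cl.hom_mult[OF G.m_closed[OF G.inv_closed[OF bG] sG] bG] cl.hom_mult[OF G.inv_closed[OF bG] sG] cl.hom_inv[OF bG] b by metis
      then show "inv b \<otimes> s \<otimes> b \<in> K <#> U" using KU_iff[of "inv b \<otimes> s \<otimes> b"] conjP[OF sP] bG sG by simp
    qed
    moreover have "m' \<in> M'" unfolding M'_def using m' nm(3) by simp
    moreover have "g = b \<otimes> m'" unfolding b_def using g m' by (simp add: G.m_assoc)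
    ultimately show ?thesis by blast
  qed
  moreover have "\<exists>l::nat. coprime l k \<and> x [^] l \<in> U" if x: "x \<in> M'" for x
  proof -
    have xG: "x \<in> carrier G" "U #> x \<in> M" using x unfolding M'_def by auto
    have "U #> (x [^] e) = U" using cl.hom_nat_pow[OF xG(1), of e] ex[OF xG(2)] by simp
    then have "x [^] e \<in> U" using G.coset_join1[OF _ _ U.subgroup_axioms] xG(1) by simp
    then show ?thesis using e by blast
  qed
  moreover have "\<forall>x\<in>M'. \<forall>n\<in>carrier N. a x n = n" using triv unfolding M'_def by blast
  ultimately show ?thesis unfolding sylow_supplement_def using M' by blast
qed

end

section \<open>Supplements to normalizers of Sylow subgroups\<close>

lemma prime_power_if_unique_prime_divisor:
  fixes m p :: nat
  assumes "m > 0" "prime p" "\<And>q. prime q \<Longrightarrow> q dvd m \<Longrightarrow> q = p"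
  shows "\<exists>b. m = p ^ b"
proof -
  obtain y where y: "m = p ^ multiplicity p m * y" "\<not> p dvd y"
    using multiplicity_decompose'[of m p] assms(1,2) by (metis not_prime_unit neq0_conv)
  have "y = 1"
  proof (rule ccontr)
    assume "y \<noteq> 1"
    then obtain q where "prime q" "q dvd y" using prime_factor_nat by blast
    then show False using assms(3)[of q] y by (metis dvd_mult)
  qed
  then show ?thesis using y(1) by auto
qed

lemma multiplicity_zero_iff_not_dvd:
  fixes n q :: nat
  assumes "prime q" "0 < n"
  shows "multiplicity q n = 0 \<longleftrightarrow> \<not> q dvd n"
  using prime_multiplicity_gt_zero_iff[of q n] assms by auto

lemma SUP_enat_less_one:
  fixes f :: "'a \<Rightarrow> nat"
  assumes "\<not> 1 \<le> (SUP x\<in>A. enat (f x))" "x \<in> A"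
  shows "f x = 0"
proof -
  have "enat (f x) \<le> (SUP x\<in>A. enat (f x))" using assms(2) by (rule SUP_upper)
  then have "\<not> 1 \<le> enat (f x)" using assms(1) by (meson order_trans)
  then show ?thesis by (simp add: one_enat_def)
qed

context profinite_action
begin

text \<open>
  The supernatural order is a supremum over all open normal subgroups, \<open>U\<close> among
  them.
\<close>

lemma not_in_prime_set_index:
  assumes p: "prime p" "p \<notin> prime_set G T" and U: "small_subgroup U"
  shows "\<not> p dvd card (rcosets U)"
proof -
  have "multiplicity p (order (G Mod U)) = 0"
    using p small_subgroupD[OF U] unfolding prime_set_def prime_dvd_supernatural_def supernatural_order_def
    by (intro SUP_enat_less_one[of "\<lambda>U. multiplicity p (order (G Mod U))" "{U. U \<lhd> G \<and> openin T U}"]) auto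
  moreover have "card (rcosets U) > 0"
    using small_subgroupD(4)[OF U] subgroup.subgroup_in_rcosets[OF small_subgroupD(2)[OF U] G.is_group]
    by (auto simp: card_gt_0_iff)
  ultimately show ?thesis using p(1) by (simp add: order_def FactGroup_def multiplicity_zero_iff_not_dvd)
qed

text \<open>
  The two conditions on a Sylow subgroup at the level of \<open>G/U\<close>: the image of
  \<open>K\<close> is a \<open>p\<close>-group of index prime to \<open>p\<close>.
\<close>

lemma sylow_finite_quotient:
  assumes S: "sylow_subgroup p K G T" and U: "small_subgroup U"
  shows "\<not> p dvd card (rcosets (K <#> U))"
    and "\<exists>b. card (rcosets\<^bsub>G\<lparr>carrier := K\<rparr>\<^esub> (K \<inter> U)) = p ^ b"
    and "finite (rcosets\<^bsub>G\<lparr>carrier := K\<rparr>\<^esub> (K \<inter> U))"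
    and "subgroup ((\<lambda>x. U #> x) ` K) (G Mod U)"
    and "\<exists>b. card ((\<lambda>x. U #> x) ` K) = p ^ b"
    and "\<not> p dvd card (rcosets\<^bsub>G Mod U\<^esub> ((\<lambda>x. U #> x) ` K))"
proof -
  have p: "prime p" and K: "subgroup K G" and Kp: "prime_set (G\<lparr>carrier := K\<rparr>) (subtopology T K) \<subseteq> {p}"
    and Ki: "\<not> prime_dvd_supernatural p (supernatural_index G T K)"
    using S unfolding sylow_subgroup_def closed_subgroup_def by auto
  interpret K: subgroup K G by (rule K)
  interpret U: normal U G by (rule small_subgroupD[OF U])
  interpret Q: group "G Mod U" by (rule U.factorgroup_is_group)
  interpret cl: group_hom G "G Mod U" "\<lambda>x. U #> x" using U.r_coset_hom_Mod by unfold_locales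
  interpret GK: group "G\<lparr>carrier := K\<rparr>" by (rule G.subgroup_imp_group[OF K])
  have finU: "finite (rcosets U)" by (rule small_subgroupD(4)[OF U])
  have KU: "subgroup (K <#> U) G" by (rule G.subgroup_mult_normal[OF K U.normal_axioms])
  have U_KU: "U \<subseteq> K <#> U" by (rule G.subgroups_subset_set_mult(2)[OF K U.subgroup_axioms])
  have finKU: "finite (rcosets (K <#> U))" by (rule G.rcosets_finite_mono[OF U.subgroup_axioms KU U_KU finU])
  have posKU: "card (rcosets (K <#> U)) > 0"
    using finKU subgroup.subgroup_in_rcosets[OF KU G.is_group] by (auto simp: card_gt_0_iff)
  have "multiplicity p (card (rcosets (K <#> U))) = 0"
    using p Ki small_subgroupD[OF U] unfolding prime_dvd_supernatural_def supernatural_index_def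
    by (intro SUP_enat_less_one[of "\<lambda>U. multiplicity p (card (rcosets (K <#> U)))" "{U. U \<lhd> G \<and> openin T U}"]) auto
  then show nd: "\<not> p dvd card (rcosets (K <#> U))" using p posKU by (simp add: multiplicity_zero_iff_not_dvd)
  define P where "P = (\<lambda>x. U #> x) ` K"
  have P: "subgroup P (G Mod U)" unfolding P_def by (rule cl.subgroup_img_is_subgroup[OF K])
  then show "subgroup ((\<lambda>x. U #> x) ` K) (G Mod U)" unfolding P_def .
  interpret QP: group "(G Mod U)\<lparr>carrier := P\<rparr>" by (rule Q.subgroup_imp_group[OF P])
  interpret f: group_hom "G\<lparr>carrier := K\<rparr>" "(G Mod U)\<lparr>carrier := P\<rparr>" "\<lambda>x. U #> x"
    by unfold_locales (use cl.hom_mult K.mem_carrier in \<open>auto simp: hom_def P_def\<close>)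
  have ker: "kernel (G\<lparr>carrier := K\<rparr>) ((G Mod U)\<lparr>carrier := P\<rparr>) (\<lambda>x. U #> x) = K \<inter> U"
    using G.coset_join1[OF _ _ U.subgroup_axioms] U.rcos_const[OF G.is_group] K.mem_carrier by (auto simp: kernel_def)
  have finQ: "finite (carrier (G Mod U))" using finU by (simp add: FactGroup_def)
  have finP: "finite P" using finQ subgroup.subset[OF P] finite_subset by blast
  have cP: "card (rcosets\<^bsub>G\<lparr>carrier := K\<rparr>\<^esub> (K \<inter> U)) = card P" and finKK: "finite (rcosets\<^bsub>G\<lparr>carrier := K\<rparr>\<^esub> (K \<inter> U))"
    using f.card_rcosets_kernel finP unfolding ker by (simp_all add: P_def)
  show "finite (rcosets\<^bsub>G\<lparr>carrier := K\<rparr>\<^esub> (K \<inter> U))" by (rule finKK)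
  have nKU: "K \<inter> U \<lhd> G\<lparr>carrier := K\<rparr>" using f.normal_kernel unfolding ker .
  have oKU: "openin (subtopology T K) (K \<inter> U)" using openin_subtopology_Int2[OF small_subgroupD(3)[OF U]] .
  have posP: "card P > 0" using finP subgroup.one_closed[OF P] by (auto simp: card_gt_0_iff)
  have "q = p" if q: "prime q" "q dvd card P" for q
  proof (rule ccontr)
    assume "q \<noteq> p"
    then have "\<not> 1 \<le> supernatural_order (G\<lparr>carrier := K\<rparr>) (subtopology T K) q"
      using Kp q(1) unfolding prime_set_def prime_dvd_supernatural_def by auto
    then have "multiplicity q (order (G\<lparr>carrier := K\<rparr> Mod (K \<inter> U))) = 0"
      unfolding supernatural_order_def
      by (rule SUP_enat_less_one[of "\<lambda>U. multiplicity q (order (G\<lparr>carrier := K\<rparr> Mod U))"]) (use nKU oKU in auto)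
    then have "multiplicity q (card P) = 0" using cP by (simp add: order_def FactGroup_def)
    then show False using q posP by (simp add: multiplicity_zero_iff_not_dvd)
  qed
  then obtain b where b: "card P = p ^ b" using prime_power_if_unique_prime_divisor[OF posP p] by blast
  then show "\<exists>b. card (rcosets\<^bsub>G\<lparr>carrier := K\<rparr>\<^esub> (K \<inter> U)) = p ^ b" "\<exists>b. card ((\<lambda>x. U #> x) ` K) = p ^ b"
    using cP unfolding P_def by auto
  have "P = rcosets\<^bsub>G\<lparr>carrier := K <#> U\<rparr>\<^esub> U"
  proof
    show "P \<subseteq> rcosets\<^bsub>G\<lparr>carrier := K <#> U\<rparr>\<^esub> U"
      unfolding P_def RCOSETS_def using G.subgroups_subset_set_mult(1)[OF K U.subgroup_axioms] by auto
    show "rcosets\<^bsub>G\<lparr>carrier := K <#> U\<rparr>\<^esub> U \<subseteq> P"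
    proof
      fix X assume "X \<in> rcosets\<^bsub>G\<lparr>carrier := K <#> U\<rparr>\<^esub> U"
      then obtain x where x: "x \<in> K <#> U" "X = U #> x" unfolding RCOSETS_def by auto
      have "x \<in> U <#> K" using x(1) G.commut_normal[OF K U.normal_axioms] by simp
      then obtain u k where uk: "u \<in> U" "k \<in> K" "x = u \<otimes> k" unfolding set_mult_def by blast
      have "U #> u #> k = U #> x" unfolding uk(3) using uk U.subset by (simp add: G.coset_mult_assoc)
      then have "U #> x = U #> k" using U.rcos_const[OF G.is_group uk(1)] by simp
      then show "X \<in> P" unfolding x(2) P_def using uk(2) by blast
    qed
  qed
  then have "card (rcosets U) = card (rcosets (K <#> U)) * card P"
    using G.index_mult[OF U.subgroup_axioms KU U_KU finU] by simp
  moreover have "card (rcosets\<^bsub>G Mod U\<^esub> P) * card P = card (rcosets U)"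
    using Q.lagrange[OF P] by (simp add: order_def FactGroup_def)
  ultimately have "card (rcosets\<^bsub>G Mod U\<^esub> P) = card (rcosets (K <#> U))" using posP by simp
  then show "\<not> p dvd card (rcosets\<^bsub>G Mod U\<^esub> ((\<lambda>x. U #> x) ` K))" using nd unfolding P_def by simp
qed

text \<open>
  The Sylow subgroup of the nilpotent group \<open>G/U\<close> is normal, so \<open>M = U\<close>
  works.
\<close>

lemma sylow_supplement_nilpotent:
  assumes S: "sylow_subgroup p K G T" and U: "small_subgroup U" and cc: "coprime_elements_commute (G Mod U)"
  shows "sylow_supplement k K U"
proof (rule supplement_from_quotient[OF _ U, where M = "{\<one>\<^bsub>G Mod U\<^esub>}" and e = 1])
  have p: "prime p" and K: "subgroup K G" using S unfolding sylow_subgroup_def closed_subgroup_def by auto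
  show "subgroup K G" by fact
  interpret U: normal U G by (rule small_subgroupD[OF U])
  interpret Q: group "G Mod U" by (rule U.factorgroup_is_group)
  show "{\<one>\<^bsub>G Mod U\<^esub>} \<lhd> G Mod U" by (rule Q.one_is_normal)
  note sq = sylow_finite_quotient[OF S U]
  obtain b where b: "card ((\<lambda>x. U #> x) ` K) = p ^ b" using sq(5) by blast
  have finQ: "finite (carrier (G Mod U))" using small_subgroupD(4)[OF U] by (simp add: FactGroup_def)
  have o: "order (G Mod U) = p ^ b * card (rcosets\<^bsub>G Mod U\<^esub> ((\<lambda>x. U #> x) ` K))"
    using Q.lagrange[OF sq(4)] b by (simp add: mult.commute)
  interpret P: normal "(\<lambda>x. U #> x) ` K" "G Mod U" by (rule Q.coprime_sylow_normal[OF finQ cc p sq(4) b o sq(6)])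
  fix x assume x: "x \<in> carrier (G Mod U)"
  show "\<exists>n m. n \<in> carrier (G Mod U) \<and>
        (\<forall>y\<in>(\<lambda>x. U #> x) ` K. n \<otimes>\<^bsub>G Mod U\<^esub> y \<otimes>\<^bsub>G Mod U\<^esub> inv\<^bsub>G Mod U\<^esub> n \<in> (\<lambda>x. U #> x) ` K) \<and> m \<in> {\<one>\<^bsub>G Mod U\<^esub>} \<and> x = n \<otimes>\<^bsub>G Mod U\<^esub> m"
    using P.inv_op_closed2[OF x] x Q.r_one[OF x] by (intro exI[of _ x] exI[of _ "\<one>\<^bsub>G Mod U\<^esub>"]) auto
next
  interpret U: normal U G by (rule small_subgroupD[OF U])
  fix x n assume x: "x \<in> carrier G" "U #> x \<in> {\<one>\<^bsub>G Mod U\<^esub>}" and n: "n \<in> carrier N"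
  have "x \<in> U" using x G.coset_join1[OF _ x(1) U.subgroup_axioms] by simp
  then show "a x n = n" using small_subgroupD(5)[OF U _ n] by blast
next
  interpret U: normal U G by (rule small_subgroupD[OF U])
  interpret Q: group "G Mod U" by (rule U.factorgroup_is_group)
  fix x assume "x \<in> {\<one>\<^bsub>G Mod U\<^esub>}"
  then show "x [^]\<^bsub>G Mod U\<^esub> (1::nat) = \<one>\<^bsub>G Mod U\<^esub>" using Q.nat_pow_one[of 1] by auto
qed simp

text \<open>
  If \<open>f\<close> fixes \<open>Y i\<close> pointwise and moves \<open>z \<in> Y (Suc
  i)\<close> by \<open>h \<in> Y i\<close>, then \<open>f\<^sup>j\<close> moves \<open>z\<close>
  by \<open>h\<^sup>j\<close>. For \<open>j = e\<close> this gives \<open>h\<^sup>e = 1\<close>,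
  while \<open>h\<^sup>k = 1\<close>.
\<close>

lemma coprime_chain_action_trivial:
  assumes Y: "\<And>i. i \<le> n \<Longrightarrow> subgroup (Y i) N" "Y 0 = {\<one>\<^bsub>N\<^esub>}" "Y n = carrier N"
    and f: "f \<in> carrier G" and stab: "\<And>i z. i < n \<Longrightarrow> z \<in> Y (Suc i) \<Longrightarrow> a f z \<otimes>\<^bsub>N\<^esub> inv\<^bsub>N\<^esub> z \<in> Y i"
    and e: "\<And>z. z \<in> carrier N \<Longrightarrow> a (f [^] (e::nat)) z = z" and k: "coprime e k" "\<And>z. z \<in> carrier N \<Longrightarrow> z [^]\<^bsub>N\<^esub> (k::nat) = \<one>\<^bsub>N\<^esub>"
    and z: "z \<in> carrier N"
  shows "a f z = z"
proof -
  have "\<forall>z\<in>Y i. a f z = z" if "i \<le> n" for i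
    using that
  proof (induction i)
    case 0
    then show ?case using Y(2) f by simp
  next
    case (Suc i)
    then have i: "i < n" "i \<le> n" and IH: "\<forall>z\<in>Y i. a f z = z" by auto
    show ?case
    proof
      fix z assume z: "z \<in> Y (Suc i)"
      have zN: "z \<in> carrier N" using subgroup.mem_carrier[OF Y(1)[OF Suc.prems] z] .
      define h where "h = a f z \<otimes>\<^bsub>N\<^esub> inv\<^bsub>N\<^esub> z"
      have h: "h \<in> Y i" unfolding h_def by (rule stab[OF i(1) z])
      have hN: "h \<in> carrier N" using subgroup.mem_carrier[OF Y(1)[OF i(2)] h] .
      have fz: "a f z = h \<otimes>\<^bsub>N\<^esub> z" unfolding h_def using zN f by (simp add: N.m_assoc)
      have fh: "a f h = h" using IH h by blast
      have "a (f [^] j) z = h [^]\<^bsub>N\<^esub> j \<otimes>\<^bsub>N\<^esub> z" for j :: nat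
      proof (induction j)
        case 0
        then show ?case using zN by (simp add: a_one)
      next
        case (Suc j)
        have "a (f [^] Suc j) z = a (f [^] j) (h \<otimes>\<^bsub>N\<^esub> z)" using f zN hN by (simp add: a_mult fz)
        also have "\<dots> = a (f [^] j) h \<otimes>\<^bsub>N\<^esub> (h [^]\<^bsub>N\<^esub> j \<otimes>\<^bsub>N\<^esub> z)" using f zN hN Suc by simp
        also have "a (f [^] j) h = h"
          by (induction j) (use f hN fh in \<open>simp_all add: a_one a_mult\<close>)
        also have "h \<otimes>\<^bsub>N\<^esub> (h [^]\<^bsub>N\<^esub> j \<otimes>\<^bsub>N\<^esub> z) = h [^]\<^bsub>N\<^esub> Suc j \<otimes>\<^bsub>N\<^esub> z"
          using hN zN N.nat_pow_Suc2[OF hN, of j] by (simp add: N.m_assoc)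
        finally show ?case .
      qed
      then have "h [^]\<^bsub>N\<^esub> e \<otimes>\<^bsub>N\<^esub> z = z" using e[OF zN] by metis
      then have "h [^]\<^bsub>N\<^esub> e = \<one>\<^bsub>N\<^esub>" using hN zN N.r_cancel_one[of z "h [^]\<^bsub>N\<^esub> e"] by simp
      then have "h = \<one>\<^bsub>N\<^esub>" using N.coprime_exponents[OF hN k(2)[OF hN] _ k(1)] by simp
      then show "a f z = z" using fz zN by simp
    qed
  qed
  from this[of n] show ?thesis using Y(3) z by simp
qed

text \<open>
  The images of \<open>X i \<inter> F\<close> form a central series of the image of
  \<open>F\<close> in \<open>G/U\<close>.
\<close>

lemma quotient_coprime_elements_commute:
  assumes U: "U \<lhd> G" and Fn: "F \<lhd> G"
    and X: "\<And>i. i \<le> n \<Longrightarrow> X i \<lhd> G" "X 0 \<subseteq> U" "X n = carrier G" "\<And>i. i < n \<Longrightarrow> X i \<subseteq> X (Suc i)"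
      "\<And>i x f. i < n \<Longrightarrow> x \<in> X (Suc i) \<Longrightarrow> f \<in> F \<Longrightarrow> f \<otimes> x \<otimes> inv f \<otimes> inv x \<in> X i"
  shows "coprime_elements_commute ((G Mod U)\<lparr>carrier := (\<lambda>x. U #> x) ` F\<rparr>)"
proof -
  interpret U: normal U G by (rule U)
  interpret Q: group "G Mod U" by (rule U.factorgroup_is_group)
  interpret cl: group_hom G "G Mod U" "\<lambda>x. U #> x" using U.r_coset_hom_Mod by unfold_locales
  interpret F: normal F G by (rule Fn)
  have surj: "(\<lambda>x. U #> x) ` carrier G = carrier (G Mod U)" by (simp add: carrier_FactGroup)
  define F' where "F' = (\<lambda>x. U #> x) ` F"
  have F': "F' \<lhd> G Mod U" unfolding F'_def by (rule normal.surj_hom_normal_subgroup[OF Fn cl.group_hom_axioms surj])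
  interpret F': normal F' "G Mod U" by (rule F')
  interpret QF: group "(G Mod U)\<lparr>carrier := F'\<rparr>" by (rule Q.subgroup_imp_group[OF F'.subgroup_axioms])
  have "coprime_elements_commute ((G Mod U)\<lparr>carrier := F'\<rparr>)"
  proof (rule QF.central_chain_imp_coprime_elements_commute)
    let ?H = "\<lambda>i. (\<lambda>x. U #> x) ` (X i \<inter> F)"
    show "centralizing_chain ((G Mod U)\<lparr>carrier := F'\<rparr>) (carrier ((G Mod U)\<lparr>carrier := F'\<rparr>)) ?H n"
      unfolding centralizing_chain_def
    proof (intro conjI allI impI ballI)
      have "\<one> \<in> X 0" using subgroup.one_closed[OF normal_imp_subgroup[OF X(1)[of 0]]] by simp
      moreover have "U #> x = U" if "x \<in> X 0" for x using X(2) U.rcos_const[OF G.is_group] that by blast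
      ultimately show "?H 0 = {\<one>\<^bsub>(G Mod U)\<lparr>carrier := F'\<rparr>\<^esub>}" using F.one_closed by force
      show "?H n = carrier ((G Mod U)\<lparr>carrier := F'\<rparr>)" using X(3) F.subset unfolding F'_def by (simp add: Int_absorb1)
    next
      fix i assume i: "i \<le> n"
      have "X i \<inter> F \<lhd> G" by (rule G.normal_subgroup_intersect[OF X(1)[OF i] Fn])
      then have H: "?H i \<lhd> G Mod U" by (rule normal.surj_hom_normal_subgroup[OF _ cl.group_hom_axioms surj])
      have HF: "?H i \<subseteq> F'" unfolding F'_def by blast
      show "?H i \<lhd> (G Mod U)\<lparr>carrier := F'\<rparr>"
        by (rule QF.normal_invI[OF Q.subgroup_incl[OF normal_imp_subgroup[OF H] F'.subgroup_axioms HF]])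
          (use Q.m_inv_consistent[OF F'.subgroup_axioms] normal.inv_op_closed2[OF H] F'.mem_carrier in auto)
    next
      fix i assume i: "i < n"
      show "?H i \<subseteq> ?H (Suc i)" using X(4)[OF i] by blast
      fix x f assume "x \<in> ?H (Suc i)" "f \<in> carrier ((G Mod U)\<lparr>carrier := F'\<rparr>)"
      then obtain y g where y: "y \<in> X (Suc i)" "y \<in> F" "x = U #> y" and g: "g \<in> F" "f = U #> g" unfolding F'_def by auto
      have fx: "f \<in> F'" "x \<in> F'" using y g unfolding F'_def by auto
      have "g \<otimes> y \<otimes> inv g \<otimes> inv y \<in> X i \<inter> F" using X(5)[OF i y(1) g(1)] y(2) g(1) by simp
      moreover have "U #> (g \<otimes> y \<otimes> inv g \<otimes> inv y) = f \<otimes>\<^bsub>G Mod U\<^esub> x \<otimes>\<^bsub>G Mod U\<^esub> inv\<^bsub>G Mod U\<^esub> f \<otimes>\<^bsub>G Mod U\<^esub> inv\<^bsub>G Mod U\<^esub> x"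
        unfolding g(2) y(3) using F.mem_carrier[OF g(1)] F.mem_carrier[OF y(2)]
        by (simp only: cl.hom_mult cl.hom_inv G.m_closed G.inv_closed)
      ultimately have "f \<otimes>\<^bsub>G Mod U\<^esub> x \<otimes>\<^bsub>G Mod U\<^esub> inv\<^bsub>G Mod U\<^esub> f \<otimes>\<^bsub>G Mod U\<^esub> inv\<^bsub>G Mod U\<^esub> x \<in> ?H i" by (metis imageI)
      then show "f \<otimes>\<^bsub>(G Mod U)\<lparr>carrier := F'\<rparr>\<^esub> x \<otimes>\<^bsub>(G Mod U)\<lparr>carrier := F'\<rparr>\<^esub> inv\<^bsub>(G Mod U)\<lparr>carrier := F'\<rparr>\<^esub> f
          \<otimes>\<^bsub>(G Mod U)\<lparr>carrier := F'\<rparr>\<^esub> inv\<^bsub>(G Mod U)\<lparr>carrier := F'\<rparr>\<^esub> x \<in> ?H i"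
        using Q.m_inv_consistent[OF F'.subgroup_axioms] fx by simp
    qed
  qed
  then show ?thesis unfolding F'_def .
qed

text \<open>
  The subgroup \<open>M\<close> is the preimage of the part of order prime to \<open>p\<close> of
  the image of \<open>F\<close> in \<open>G/U\<close>. An element of \<open>M\<close> agrees up to
  \<open>U\<close> with an element of \<open>F\<close>, which stabilizes the chain
  \<open>Y\<close> and has order prime to \<open>p\<close> modulo \<open>U\<close>; so it acts
  trivially.
\<close>

lemma sylow_supplement_supersolvable:
  assumes S: "sylow_subgroup p K G T" and U: "small_subgroup U"
    and F: "subgroup F G" "\<And>x y. x \<in> carrier G \<Longrightarrow> y \<in> carrier G \<Longrightarrow> x \<otimes> y \<otimes> inv x \<otimes> inv y \<in> F"
    and X: "\<And>i. i \<le> n \<Longrightarrow> X i \<lhd> G" "X 0 \<subseteq> U" "X n = carrier G" "\<And>i. i < n \<Longrightarrow> X i \<subseteq> X (Suc i)"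
      "\<And>i x f. i < n \<Longrightarrow> x \<in> X (Suc i) \<Longrightarrow> f \<in> F \<Longrightarrow> f \<otimes> x \<otimes> inv f \<otimes> inv x \<in> X i"
    and Y: "\<And>i. i \<le> n \<Longrightarrow> subgroup (Y i) N" "Y 0 = {\<one>\<^bsub>N\<^esub>}" "Y n = carrier N"
      "\<And>i z f. i < n \<Longrightarrow> z \<in> Y (Suc i) \<Longrightarrow> f \<in> F \<Longrightarrow> a f z \<otimes>\<^bsub>N\<^esub> inv\<^bsub>N\<^esub> z \<in> Y i"
    and k: "\<And>z. z \<in> carrier N \<Longrightarrow> z [^]\<^bsub>N\<^esub> (p ^ c) = \<one>\<^bsub>N\<^esub>"
  shows "sylow_supplement (p ^ c) K U"
proof -
  have p: "prime p" and K: "subgroup K G" using S unfolding sylow_subgroup_def closed_subgroup_def by auto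
  interpret U: normal U G by (rule small_subgroupD[OF U])
  interpret Q: group "G Mod U" by (rule U.factorgroup_is_group)
  interpret cl: group_hom G "G Mod U" "\<lambda>x. U #> x" using U.r_coset_hom_Mod by unfold_locales
  interpret F: subgroup F G by (rule F)
  have surj: "(\<lambda>x. U #> x) ` carrier G = carrier (G Mod U)" by (simp add: carrier_FactGroup)
  have Fn: "F \<lhd> G"
  proof (rule G.normal_invI[OF F(1)])
    fix x h assume x: "x \<in> carrier G" and h: "h \<in> F"
    have "(x \<otimes> h \<otimes> inv x \<otimes> inv h) \<otimes> h \<in> F" using F(2)[OF x F.mem_carrier[OF h]] h by simp
    then show "x \<otimes> h \<otimes> inv x \<in> F" using x h by (simp add: G.m_assoc)
  qed
  define F' where "F' = (\<lambda>x. U #> x) ` F"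
  have F': "F' \<lhd> G Mod U" unfolding F'_def by (rule normal.surj_hom_normal_subgroup[OF Fn cl.group_hom_axioms surj])
  interpret F': normal F' "G Mod U" by (rule F')
  interpret QF: group "(G Mod U)\<lparr>carrier := F'\<rparr>" by (rule Q.subgroup_imp_group[OF F'.subgroup_axioms])
  have comm: "x \<otimes>\<^bsub>G Mod U\<^esub> y \<otimes>\<^bsub>G Mod U\<^esub> inv\<^bsub>G Mod U\<^esub> x \<otimes>\<^bsub>G Mod U\<^esub> inv\<^bsub>G Mod U\<^esub> y \<in> F'"
    if x: "x \<in> carrier (G Mod U)" and y: "y \<in> carrier (G Mod U)" for x y
  proof -
    obtain g where g: "g \<in> carrier G" "x = U #> g" using x surj by blast
    obtain h where h: "h \<in> carrier G" "y = U #> h" using y surj by blast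
    have "U #> (g \<otimes> h \<otimes> inv g \<otimes> inv h) = x \<otimes>\<^bsub>G Mod U\<^esub> y \<otimes>\<^bsub>G Mod U\<^esub> inv\<^bsub>G Mod U\<^esub> x \<otimes>\<^bsub>G Mod U\<^esub> inv\<^bsub>G Mod U\<^esub> y"
      unfolding g(2) h(2) using g(1) h(1) by (simp only: cl.hom_mult cl.hom_inv G.m_closed G.inv_closed)
    then show ?thesis unfolding F'_def using F(2)[OF g(1) h(1)] by (metis imageI)
  qed
  have cc: "coprime_elements_commute ((G Mod U)\<lparr>carrier := F'\<rparr>)"
    unfolding F'_def by (rule quotient_coprime_elements_commute[OF U.normal_axioms Fn X])
  have finQ: "finite (carrier (G Mod U))" using small_subgroupD(4)[OF U] by (simp add: FactGroup_def)
  have "finite F'" using finQ F'.subset finite_subset by blast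
  then have pos: "card F' > 0" using F'.one_closed by (auto simp: card_gt_0_iff)
  obtain e where e: "card F' = p ^ multiplicity p (card F') * e" "\<not> p dvd e"
    using multiplicity_decompose'[of "card F'" p] pos p by (metis not_prime_unit neq0_conv)
  note sq = sylow_finite_quotient[OF S U]
  obtain b where b: "card ((\<lambda>x. U #> x) ` K) = p ^ b" using sq(5) by blast
  have frM: "{x \<in> F'. x [^]\<^bsub>G Mod U\<^esub> e = \<one>\<^bsub>G Mod U\<^esub>} \<lhd> G Mod U"
    by (rule Q.frattini_nilpotent(1)[OF finQ F' cc _ p sq(4) b sq(6) e]) (rule comm)
  have frS: "\<exists>n m. n \<in> carrier (G Mod U) \<and>
        (\<forall>y\<in>(\<lambda>x. U #> x) ` K. n \<otimes>\<^bsub>G Mod U\<^esub> y \<otimes>\<^bsub>G Mod U\<^esub> inv\<^bsub>G Mod U\<^esub> n \<in> (\<lambda>x. U #> x) ` K) \<and>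
        m \<in> F' \<and> m [^]\<^bsub>G Mod U\<^esub> e = \<one>\<^bsub>G Mod U\<^esub> \<and> x = n \<otimes>\<^bsub>G Mod U\<^esub> m" if x: "x \<in> carrier (G Mod U)" for x
    by (rule Q.frattini_nilpotent(2)[OF finQ F' cc _ p sq(4) b sq(6) e x]) (rule comm)
  define M where "M = {x \<in> F'. x [^]\<^bsub>G Mod U\<^esub> e = \<one>\<^bsub>G Mod U\<^esub>}"
  have cop: "coprime e (p ^ c)" using prime_imp_coprime[OF p e(2)] by (simp add: coprime_commute)
  show ?thesis
  proof (rule supplement_from_quotient[OF K U, where M = M and e = e])
    show "M \<lhd> G Mod U" unfolding M_def by (rule frM)
    show "coprime e (p ^ c)" by (rule cop)
    show "x [^]\<^bsub>G Mod U\<^esub> e = \<one>\<^bsub>G Mod U\<^esub>" if "x \<in> M" for x using that unfolding M_def by blast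
    show "\<exists>n m. n \<in> carrier (G Mod U) \<and>
        (\<forall>y\<in>(\<lambda>x. U #> x) ` K. n \<otimes>\<^bsub>G Mod U\<^esub> y \<otimes>\<^bsub>G Mod U\<^esub> inv\<^bsub>G Mod U\<^esub> n \<in> (\<lambda>x. U #> x) ` K) \<and> m \<in> M \<and> x = n \<otimes>\<^bsub>G Mod U\<^esub> m"
      if x: "x \<in> carrier (G Mod U)" for x
      using frS[OF x] unfolding M_def by blast
    fix x z assume x: "x \<in> carrier G" "U #> x \<in> M" and z: "z \<in> carrier N"
    obtain f where f: "f \<in> F" "U #> x = U #> f" using x(2) unfolding M_def F'_def by blast
    have fG: "f \<in> carrier G" using f by simp
    have "x \<in> U #> f" using f(2) G.rcos_self[OF x(1) U.subgroup_axioms] by simp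
    then obtain u where u: "u \<in> U" "x = u \<otimes> f" unfolding r_coset_def by blast
    have "U #> (f [^] e) = U" using cl.hom_nat_pow[OF fG, of e] x(2) f(2) unfolding M_def by simp
    then have fe: "f [^] e \<in> U" using G.coset_join1[OF _ _ U.subgroup_axioms] fG by simp
    have "a f z = z"
      by (rule coprime_chain_action_trivial[OF Y(1,2,3) fG Y(4)[OF _ _ f(1)] small_subgroupD(5)[OF U fe] cop k z])
    then show "a x z = z" unfolding u(2) using u(1) fG z small_subgroupD(5)[OF U u(1) z] by (simp add: a_mult)
  qed
qed

end

section \<open>Primary components of a nilpotent group of coefficients\<close>

lemma (in left_action) restrict_coefficients:
  assumes S: "subgroup S N" and aS: "\<And>g x. g \<in> carrier G \<Longrightarrow> x \<in> S \<Longrightarrow> a g x \<in> S"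
  shows "left_action G (N\<lparr>carrier := S\<rparr>) a"
proof (intro left_action.intro left_action_axioms.intro)
  show "group (N\<lparr>carrier := S\<rparr>)" by (rule N.subgroup_imp_group[OF S])
qed (use aS subgroup.mem_carrier[OF S] in \<open>auto simp: hom_def a_one a_mult\<close>)

lemma (in left_action) restrict_coefficients_cocycle:
  assumes S: "subgroup S N" and aS: "\<And>g x. g \<in> carrier G \<Longrightarrow> x \<in> S \<Longrightarrow> a g x \<in> S"
  shows "left_action.cocycle G (N\<lparr>carrier := S\<rparr>) a H \<phi> \<longleftrightarrow> cocycle H \<phi> \<and> (\<forall>x\<in>H. \<phi> x \<in> S)"
proof -
  have la: "left_action G (N\<lparr>carrier := S\<rparr>) a" by (rule restrict_coefficients[OF S aS])
  show ?thesis unfolding left_action.cocycle_def[OF la] cocycle_def using subgroup.mem_carrier[OF S] by auto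
qed

lemma (in left_action) restrict_coefficients_cohomologous:
  assumes S: "subgroup S N" and aS: "\<And>g x. g \<in> carrier G \<Longrightarrow> x \<in> S \<Longrightarrow> a g x \<in> S"
  shows "left_action.cohomologous_by (N\<lparr>carrier := S\<rparr>) a H n \<phi> \<psi> \<longleftrightarrow> n \<in> S \<and> cohomologous_by H n \<phi> \<psi>"
proof -
  have la: "left_action G (N\<lparr>carrier := S\<rparr>) a" by (rule restrict_coefficients[OF S aS])
  show ?thesis unfolding left_action.cohomologous_by_def[OF la] cohomologous_by_def
    using subgroup.mem_carrier[OF S] N.m_inv_consistent[OF S] by auto
qed

locale nilpotent_action = profinite_action G N a T
  for G :: "('g, 'a) monoid_scheme" (structure) and N :: "('n, 'b) monoid_scheme" and a :: "'g \<Rightarrow> 'n \<Rightarrow> 'n" and T :: "'g topology" +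
  assumes finN: "finite (carrier N)" and nilN: "nilpotent_group N"
begin

lemma N_coprime_elements_commute: "coprime_elements_commute N"
  using nilpotent_group_central_chain[OF nilN] N.central_chain_imp_coprime_elements_commute by metis

lemma order_pos: "order N > 0"
  using finN N.order_gt_0_iff_finite by blast

definition part :: "nat \<Rightarrow> nat" where "part p = p ^ multiplicity p (order N)"

definition component :: "nat \<Rightarrow> 'n set" where "component p = torsion N (part p)"

lemma part_cofactor:
  assumes "prime p"
  obtains m where "order N = part p * m" "coprime (part p) m" "\<not> p dvd m"
proof -
  obtain m where m: "order N = part p * m" "\<not> p dvd m"
    using multiplicity_decompose'[of "order N" p] order_pos assms unfolding part_def by (metis not_prime_unit neq0_conv)
  then show ?thesis using that[of m] prime_imp_coprime[OF assms m(2)] unfolding part_def by simp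
qed

text \<open>
  An exponent that is \<open>1\<close> modulo the \<open>p\<close>-part of the order of
  \<open>N\<close> and \<open>0\<close> modulo the rest.
\<close>

definition projector :: "nat \<Rightarrow> nat" where
  "projector p = (SOME e. \<exists>m u q. order N = part p * m \<and> \<not> p dvd m \<and> e = m * u \<and> e = 1 + part p * q)"

text \<open>
  The projection onto the \<open>p\<close>-component is a power map, so it commutes with every
  action by automorphisms.
\<close>

definition proj :: "nat \<Rightarrow> 'n \<Rightarrow> 'n" where "proj p x = x [^]\<^bsub>N\<^esub> projector p"

lemma projector:
  assumes p: "prime p"
  obtains m u q where "order N = part p * m" "coprime (part p) m" "\<not> p dvd m" "projector p = m * u" "m * u = 1 + part p * q"
proof -
  obtain m where m: "order N = part p * m" "coprime (part p) m" "\<not> p dvd m" using part_cofactor[OF p] .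
  have "part p > 0" "m > 0" using m(1) order_pos by (metis gr0I mult_is_0 neq0_conv)+
  then obtain u q where "m * u = 1 + part p * q" using coprime_power_inverse[OF m(2)] by metis
  then have "\<exists>m u q. order N = part p * m \<and> \<not> p dvd m \<and> m * u = m * u \<and> m * u = 1 + part p * q" using m by blast
  then have "\<exists>e m u q. order N = part p * m \<and> \<not> p dvd m \<and> e = m * u \<and> e = 1 + part p * q" by metis
  then have "\<exists>m u q. order N = part p * m \<and> \<not> p dvd m \<and> projector p = m * u \<and> projector p = 1 + part p * q"
    unfolding projector_def by (rule someI_ex)
  then obtain m' u q where "order N = part p * m'" "\<not> p dvd m'" "projector p = m' * u" "projector p = 1 + part p * q" by blast
  moreover have "coprime (part p) m'" unfolding part_def using prime_imp_coprime[OF p \<open>\<not> p dvd m'\<close>] by simp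
  ultimately show ?thesis using that by metis
qed

lemma in_torsion_order: "x \<in> carrier N \<Longrightarrow> x \<in> torsion N (order N)"
  unfolding torsion_def using N.pow_order_eq_1 by simp

lemma component_subgroup: "prime p \<Longrightarrow> subgroup (component p) N"
  using N.torsion_subgroup[OF finN N_coprime_elements_commute] part_cofactor unfolding component_def by metis

lemma component_carrier: "x \<in> component p \<Longrightarrow> x \<in> carrier N"
  unfolding component_def torsion_def by simp

lemma component_pow: "x \<in> component p \<Longrightarrow> x [^]\<^bsub>N\<^esub> part p = \<one>\<^bsub>N\<^esub>"
  unfolding component_def torsion_def by simp

lemma a_component: "g \<in> carrier G \<Longrightarrow> x \<in> component p \<Longrightarrow> a g x \<in> component p"
  unfolding component_def torsion_def by (auto simp: a_N_pow[symmetric])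

lemma proj_closed [simp]: "x \<in> carrier N \<Longrightarrow> proj p x \<in> carrier N"
  unfolding proj_def by simp

lemma proj_component: "prime p \<Longrightarrow> x \<in> carrier N \<Longrightarrow> proj p x \<in> component p"
proof -
  assume p: "prime p" and x: "x \<in> carrier N"
  obtain m u q where m: "order N = part p * m" "projector p = m * u" "m * u = 1 + part p * q" using projector[OF p] by metis
  show ?thesis using N.torsion_split(1)[of x "part p" m u q] in_torsion_order[OF x] m unfolding proj_def component_def by simp
qed

lemma proj_mult:
  assumes "prime p" "x \<in> carrier N" "y \<in> carrier N"
  shows "proj p (x \<otimes>\<^bsub>N\<^esub> y) = proj p x \<otimes>\<^bsub>N\<^esub> proj p y"
proof -
  obtain m u q where "order N = part p * m" "coprime (part p) m" "projector p = m * u" "m * u = 1 + part p * q"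
    using projector[OF assms(1)] by metis
  note m = this
  show ?thesis unfolding proj_def m(3) by (rule N.coprime_power_hom[OF finN N_coprime_elements_commute m(1,2,4) assms(2,3)])
qed

lemma proj_hom: "prime p \<Longrightarrow> group_hom N N (proj p)"
  by unfold_locales (use proj_mult in \<open>auto simp: hom_def\<close>)

lemma proj_id: "prime p \<Longrightarrow> x \<in> component p \<Longrightarrow> proj p x = x"
proof -
  assume p: "prime p" and x: "x \<in> component p"
  obtain m u q where m: "projector p = m * u" "m * u = 1 + part p * q" using projector[OF p] by metis
  have xN: "x \<in> carrier N" using component_carrier[OF x] .
  have "proj p x = x \<otimes>\<^bsub>N\<^esub> (x [^]\<^bsub>N\<^esub> part p) [^]\<^bsub>N\<^esub> q"
    unfolding proj_def m using xN N.nat_pow_mult[of x 1 "part p * q"] by (simp add: N.nat_pow_pow)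
  then show ?thesis using component_pow[OF x] xN by simp
qed

lemma proj_other: "prime p \<Longrightarrow> prime q \<Longrightarrow> p \<noteq> q \<Longrightarrow> x \<in> component q \<Longrightarrow> proj p x = \<one>\<^bsub>N\<^esub>"
proof -
  assume p: "prime p" and q: "prime q" and pq: "p \<noteq> q" and x: "x \<in> component q"
  obtain m u where m: "order N = part p * m" "projector p = m * u" using projector[OF p] by metis
  have "part q dvd order N" unfolding part_def by (rule multiplicity_dvd)
  then have "part q dvd part p * m" using m(1) by simp
  moreover have "coprime (part q) (part p)" unfolding part_def using primes_coprime[OF q p] pq by simp
  ultimately have "part q dvd m * u" by (simp add: coprime_dvd_mult_right_iff)
  then have "x \<in> torsion N (m * u)" using N.torsion_mono x unfolding component_def by blast
  then show ?thesis unfolding proj_def m(2) torsion_def by simp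
qed

lemma a_proj: "g \<in> carrier G \<Longrightarrow> x \<in> carrier N \<Longrightarrow> a g (proj p x) = proj p (a g x)"
  unfolding proj_def by (rule a_N_pow)

definition "prime_divisors = {p. prime p \<and> p dvd order N}"

lemma prime_divisors_prime: "p \<in> prime_divisors \<Longrightarrow> prime p" unfolding prime_divisors_def by simp

lemma finite_prime_divisors: "finite prime_divisors"
proof -
  have "prime_divisors \<subseteq> {..order N}" unfolding prime_divisors_def using dvd_imp_le order_pos by auto
  then show ?thesis using finite_subset by blast
qed

text \<open>
  If a prime \<open>p\<close> divides the order of \<open>x\<close>, then the projection of
  \<open>x\<close> to the \<open>p\<close>-component is nontrivial.
\<close>

lemma proj_all_one:
  assumes x: "x \<in> carrier N" and all: "\<And>p. p \<in> prime_divisors \<Longrightarrow> proj p x = \<one>\<^bsub>N\<^esub>"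
  shows "x = \<one>\<^bsub>N\<^esub>"
proof (rule ccontr)
  assume "x \<noteq> \<one>\<^bsub>N\<^esub>"
  have "N.ord x \<noteq> 1"
  proof
    assume "N.ord x = 1"
    then have "x = \<one>\<^bsub>N\<^esub>" using N.pow_ord_eq_1[OF x] x by simp
    then show False using \<open>x \<noteq> \<one>\<^bsub>N\<^esub>\<close> by simp
  qed
  then obtain p where p: "prime p" "p dvd N.ord x" using prime_factor_nat by blast
  have po: "p dvd order N" using p(2) N.ord_dvd_group_order[OF x] dvd_trans by blast
  obtain m u q where m: "projector p = m * u" "m * u = 1 + part p * q" using projector[OF p(1)] by metis
  have "x [^]\<^bsub>N\<^esub> projector p = \<one>\<^bsub>N\<^esub>" using all[of p] p(1) po unfolding prime_divisors_def proj_def by simp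
  then have "N.ord x dvd projector p" using N.pow_eq_id[OF x] by simp
  then have "p dvd 1 + part p * q" using p(2) m dvd_trans by metis
  moreover have "p dvd part p" unfolding part_def
    using prime_multiplicity_gt_zero_iff[of p "order N"] p(1) po order_pos by (auto intro: dvd_power)
  ultimately show False using p(1) by (metis dvd_add_left_iff dvd_mult2 not_prime_unit)
qed

lemma proj_ext:
  assumes x: "x \<in> carrier N" and y: "y \<in> carrier N" and all: "\<And>p. p \<in> prime_divisors \<Longrightarrow> proj p x = proj p y"
  shows "x = y"
proof -
  have "x \<otimes>\<^bsub>N\<^esub> inv\<^bsub>N\<^esub> y = \<one>\<^bsub>N\<^esub>"
  proof (rule proj_all_one)
    fix p assume p: "p \<in> prime_divisors"
    interpret h: group_hom N N "proj p" by (rule proj_hom[OF prime_divisors_prime[OF p]])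
    show "proj p (x \<otimes>\<^bsub>N\<^esub> inv\<^bsub>N\<^esub> y) = \<one>\<^bsub>N\<^esub>" using x y all[OF p] by simp
  qed (use x y in simp)
  then show ?thesis using x y N.inv_equality[of x "inv\<^bsub>N\<^esub> y"] by simp
qed

text \<open>
  Together with the preceding uniqueness this is the direct product decomposition of
  \<open>N\<close>. The element is corrected in one component at a time.
\<close>

lemma proj_family:
  assumes n: "\<And>p. p \<in> prime_divisors \<Longrightarrow> n p \<in> component p"
  obtains x where "x \<in> carrier N" "\<And>p. p \<in> prime_divisors \<Longrightarrow> proj p x = n p"
proof -
  have "\<exists>x\<in>carrier N. \<forall>p\<in>Q'. proj p x = n p" if "finite Q'" "Q' \<subseteq> prime_divisors" for Q'
    using that
  proof (induction Q' rule: finite_induct)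
    case empty
    then show ?case using N.one_closed by blast
  next
    case (insert q Q')
    then obtain x where x: "x \<in> carrier N" "\<forall>p\<in>Q'. proj p x = n p" by auto
    have q: "prime q" "n q \<in> component q" using insert.prems prime_divisors_prime n by auto
    interpret h: group_hom N N "proj q" by (rule proj_hom[OF q(1)])
    have pc: "inv\<^bsub>N\<^esub> (proj q x) \<otimes>\<^bsub>N\<^esub> n q \<in> component q"
      using subgroup.m_closed[OF component_subgroup[OF q(1)] subgroup.m_inv_closed[OF component_subgroup[OF q(1)] proj_component[OF q(1) x(1)]] q(2)] .
    define y where "y = x \<otimes>\<^bsub>N\<^esub> (inv\<^bsub>N\<^esub> (proj q x) \<otimes>\<^bsub>N\<^esub> n q)"
    have "proj p y = n p" if p: "p \<in> insert q Q'" for p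
    proof (cases "p = q")
      case True
      have "proj q y = proj q x \<otimes>\<^bsub>N\<^esub> (inv\<^bsub>N\<^esub> (proj q x) \<otimes>\<^bsub>N\<^esub> n q)"
        unfolding y_def using proj_mult[OF q(1) x(1) component_carrier[OF pc]] proj_id[OF q(1) pc] by simp
      then show ?thesis using True x(1) q component_carrier[OF q(2)] by (simp add: N.cancel_inv_left)
    next
      case False
      then have p': "p \<in> Q'" "prime p" using p insert.prems prime_divisors_prime by auto
      have "proj p y = proj p x"
        unfolding y_def using proj_mult[OF p'(2) x(1) component_carrier[OF pc]] proj_other[OF p'(2) q(1) False pc] p'(2) x(1) by simp
      then show ?thesis using x(2) p'(1) by simp
    qed
    moreover have "y \<in> carrier N" unfolding y_def using x(1) component_carrier[OF pc] by simp
    ultimately show ?case by blast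
  qed
  from this[OF finite_prime_divisors] show ?thesis using that by blast
qed

lemma proj_cocycle:
  assumes "subgroup H G" "cocycle H \<phi>" "prime p"
  shows "cocycle H (\<lambda>x. proj p (\<phi> x))" "\<And>x. x \<in> H \<Longrightarrow> proj p (\<phi> x) \<in> component p"
  using assms(2) proj_mult[OF assms(3)] proj_component[OF assms(3)] subgroup.mem_carrier[OF assms(1)] assms(3)
  unfolding cocycle_def by (auto simp: a_proj)

text \<open>
  The elements that realize the cohomologies in the components are themselves the components of
  one element of \<open>N\<close>.
\<close>

lemma cohomologous_if_components:
  assumes H: "subgroup H G" and \<phi>: "cocycle H \<phi>" and \<psi>: "cocycle H \<psi>"
    and all: "\<And>p. p \<in> prime_divisors \<Longrightarrow> \<exists>n\<in>component p. cohomologous_by H n (\<lambda>x. proj p (\<phi> x)) (\<lambda>x. proj p (\<psi> x))"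
  shows "\<exists>n. cohomologous_by H n \<phi> \<psi>"
proof -
  have "\<forall>p\<in>prime_divisors. \<exists>n. n \<in> component p \<and> cohomologous_by H n (\<lambda>x. proj p (\<phi> x)) (\<lambda>x. proj p (\<psi> x))" using all by blast
  from bchoice[OF this] obtain n where
    n: "\<And>p. p \<in> prime_divisors \<Longrightarrow> n p \<in> component p" "\<And>p. p \<in> prime_divisors \<Longrightarrow> cohomologous_by H (n p) (\<lambda>x. proj p (\<phi> x)) (\<lambda>x. proj p (\<psi> x))"
    by blast
  obtain v where v: "v \<in> carrier N" "\<And>p. p \<in> prime_divisors \<Longrightarrow> proj p v = n p" using proj_family[OF n(1)] by blast
  have "\<psi> x = inv\<^bsub>N\<^esub> v \<otimes>\<^bsub>N\<^esub> \<phi> x \<otimes>\<^bsub>N\<^esub> a x v" if x: "x \<in> H" for x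
  proof (rule proj_ext)
    have xG: "x \<in> carrier G" using subgroup.mem_carrier[OF H x] .
    have N: "\<phi> x \<in> carrier N" "\<psi> x \<in> carrier N" using cocycle_closed \<phi> \<psi> x by auto
    show "\<psi> x \<in> carrier N" "inv\<^bsub>N\<^esub> v \<otimes>\<^bsub>N\<^esub> \<phi> x \<otimes>\<^bsub>N\<^esub> a x v \<in> carrier N" using N v(1) xG by simp_all
    fix p assume p: "p \<in> prime_divisors"
    interpret h: group_hom N N "proj p" by (rule proj_hom[OF prime_divisors_prime[OF p]])
    have "proj p (inv\<^bsub>N\<^esub> v \<otimes>\<^bsub>N\<^esub> \<phi> x \<otimes>\<^bsub>N\<^esub> a x v) = inv\<^bsub>N\<^esub> (n p) \<otimes>\<^bsub>N\<^esub> proj p (\<phi> x) \<otimes>\<^bsub>N\<^esub> a x (n p)"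
      using N v(1) xG v(2)[OF p] by (simp add: a_proj[symmetric])
    then show "proj p (\<psi> x) = proj p (inv\<^bsub>N\<^esub> v \<otimes>\<^bsub>N\<^esub> \<phi> x \<otimes>\<^bsub>N\<^esub> a x v)"
      using n(2)[OF p] x unfolding cohomologous_by_def by simp
  qed
  then show ?thesis unfolding cohomologous_by_def using v(1) by blast
qed

lemma component_action: "prime p \<Longrightarrow> profinite_action G (N\<lparr>carrier := component p\<rparr>) a T"
  using restrict_coefficients[OF component_subgroup a_component] profinite
  by (simp add: profinite_action_def profinite_action_axioms_def)

lemma component_cocycle:
  "prime p \<Longrightarrow> left_action.cocycle G (N\<lparr>carrier := component p\<rparr>) a H \<phi> \<longleftrightarrow> cocycle H \<phi> \<and> (\<forall>x\<in>H. \<phi> x \<in> component p)"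
  by (rule restrict_coefficients_cocycle[OF component_subgroup a_component])

lemma component_cohomologous:
  "prime p \<Longrightarrow> left_action.cohomologous_by (N\<lparr>carrier := component p\<rparr>) a H n \<phi> \<psi> \<longleftrightarrow> n \<in> component p \<and> cohomologous_by H n \<phi> \<psi>"
  by (rule restrict_coefficients_cohomologous[OF component_subgroup a_component])

text \<open>
  The lower central series of \<open>N\<close> is characteristic and can be intersected with the
  component.
\<close>

lemma component_chain:
  assumes p: "prime p"
  obtains C n where "abelian_chain (N\<lparr>carrier := component p\<rparr>) C n"
    "\<forall>i g x. i \<le> n \<longrightarrow> g \<in> carrier G \<longrightarrow> x \<in> C i \<longrightarrow> a g x \<in> C i"
proof -
  obtain n where n: "abelian_chain N (lower_central_series N) n" using nilpotent_group_abelian_chain[OF nilN] .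
  let ?S = "component p"
  interpret S: subgroup ?S N by (rule component_subgroup[OF p])
  interpret NS: group "N\<lparr>carrier := ?S\<rparr>" by (rule N.subgroup_imp_group[OF S.subgroup_axioms])
  define C where "C = (\<lambda>i. lower_central_series N i \<inter> ?S)"
  have "C i \<lhd> N\<lparr>carrier := ?S\<rparr>" for i
  proof (rule NS.normal_invI)
    note nl = N.lower_central_series_normal[of i]
    show "subgroup (C i) (N\<lparr>carrier := ?S\<rparr>)" unfolding C_def
      by (rule N.subgroup_incl[OF N.subgroups_Inter_pair[OF normal_imp_subgroup[OF nl] S.subgroup_axioms] S.subgroup_axioms]) simp
    fix x h assume "x \<in> carrier (N\<lparr>carrier := ?S\<rparr>)" "h \<in> C i"
    then show "x \<otimes>\<^bsub>N\<lparr>carrier := ?S\<rparr>\<^esub> h \<otimes>\<^bsub>N\<lparr>carrier := ?S\<rparr>\<^esub> inv\<^bsub>N\<lparr>carrier := ?S\<rparr>\<^esub> x \<in> C i"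
      using N.m_inv_consistent[OF S.subgroup_axioms, of x] N.normal_invE(2)[OF nl] unfolding C_def by simp
  qed
  then have "abelian_chain (N\<lparr>carrier := ?S\<rparr>) C n"
    using n S.one_closed S.subset N.m_inv_consistent[OF S.subgroup_axioms]
    unfolding abelian_chain_def C_def by auto
  moreover have "a g x \<in> C i" if "g \<in> carrier G" "x \<in> C i" for i g x
    using that N.lower_central_series_hom[OF a_hom] a_component unfolding C_def by blast
  ultimately show ?thesis using that by blast
qed

lemma component_exponent: "x \<in> carrier (N\<lparr>carrier := component p\<rparr>) \<Longrightarrow> x [^]\<^bsub>N\<lparr>carrier := component p\<rparr>\<^esub> part p = \<one>\<^bsub>N\<lparr>carrier := component p\<rparr>\<^esub>"
  using component_pow[of x p] N.nat_pow_consistent[of x "part p" "component p"] by simp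

lemma part_pos: "prime p \<Longrightarrow> part p > 0"
  unfolding part_def using prime_gt_0_nat by simp

lemma part_coprime: "prime p \<Longrightarrow> \<not> p dvd m \<Longrightarrow> coprime (part p) m"
  unfolding part_def using prime_imp_coprime[of p m] by simp

text \<open>
  The case where no Sylow subgroup is involved: \<open>p\<close> does not divide the order of the
  finite quotient of \<open>H\<close> that matters.
\<close>

lemma components_cohomologous_coprime:
  assumes p: "prime p" and H: "subgroup H G" and R: "R \<lhd> G\<lparr>carrier := H\<rparr>" "finite (rcosets\<^bsub>G\<lparr>carrier := H\<rparr>\<^esub> R)"
    "\<not> p dvd card (rcosets\<^bsub>G\<lparr>carrier := H\<rparr>\<^esub> R)"
    and \<phi>: "cocycle H \<phi>" "\<And>r. r \<in> R \<Longrightarrow> \<phi> r = \<one>\<^bsub>N\<^esub>" and \<psi>: "cocycle H \<psi>" "\<And>r. r \<in> R \<Longrightarrow> \<psi> r = \<one>\<^bsub>N\<^esub>"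
  shows "\<exists>n\<in>component p. cohomologous_by H n (\<lambda>x. proj p (\<phi> x)) (\<lambda>x. proj p (\<psi> x))"
proof -
  let ?S = "component p"
  note S = component_subgroup[OF p]
  interpret NP: profinite_action G "N\<lparr>carrier := ?S\<rparr>" a T by (rule component_action[OF p])
  have HG: "x \<in> H \<Longrightarrow> x \<in> carrier G" for x using subgroup.mem_carrier[OF H] .
  obtain C n where C0: "abelian_chain (N\<lparr>carrier := ?S\<rparr>) C n" "\<forall>i g x. i \<le> n \<longrightarrow> g \<in> carrier G \<longrightarrow> x \<in> C i \<longrightarrow> a g x \<in> C i"
    by (rule component_chain[OF p])
  then have C: "abelian_chain (N\<lparr>carrier := ?S\<rparr>) C n" "\<And>i g x. i \<le> n \<Longrightarrow> g \<in> carrier G \<Longrightarrow> x \<in> C i \<Longrightarrow> a g x \<in> C i"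
    by blast+
  have coc: "NP.cocycle H (\<lambda>x. proj p (\<theta> x))" if "cocycle H \<theta>" for \<theta>
    unfolding component_cocycle[OF p] using proj_cocycle[OF H that p] by blast
  have "\<exists>v. NP.cohomologous_by H v (\<lambda>x. proj p (\<phi> x)) (\<lambda>x. proj p (\<psi> x))"
    by (rule NP.cocycle_unique_extension[OF H R(1,2) part_coprime[OF p R(3)] part_pos[OF p] component_exponent C(1) _
        coc[OF \<phi>(1)] coc[OF \<psi>(1)]]) (use C(2) HG \<phi>(2) \<psi>(2) in auto)
  then show ?thesis unfolding component_cohomologous[OF p] by blast
qed

lemma component_small_subgroup:
  assumes "prime p" "small_subgroup U"
  shows "profinite_action.small_subgroup G (N\<lparr>carrier := component p\<rparr>) a T U"
  using assms(2) component_carrier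
  unfolding profinite_action.small_subgroup_def[OF component_action[OF assms(1)]] small_subgroup_def by auto

lemma components_cohomologous_sylow:
  assumes p: "prime p" and K: "subgroup K G" and U: "small_subgroup U"
    and idx: "\<not> p dvd card (rcosets (K <#> U))"
    and sup: "profinite_action.sylow_supplement G (N\<lparr>carrier := component p\<rparr>) a (part p) K U"
    and \<phi>: "cocycle (carrier G) \<phi>" "\<And>u. u \<in> U \<Longrightarrow> \<phi> u = \<one>\<^bsub>N\<^esub>" and \<psi>: "cocycle (carrier G) \<psi>" "\<And>u. u \<in> U \<Longrightarrow> \<psi> u = \<one>\<^bsub>N\<^esub>"
    and coh: "cohomologous_by K v \<phi> \<psi>"
  shows "\<exists>n\<in>component p. cohomologous_by (carrier G) n (\<lambda>x. proj p (\<phi> x)) (\<lambda>x. proj p (\<psi> x))"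
proof -
  let ?S = "component p"
  note S = component_subgroup[OF p]
  interpret NP: profinite_action G "N\<lparr>carrier := ?S\<rparr>" a T by (rule component_action[OF p])
  interpret h: group_hom N N "proj p" by (rule proj_hom[OF p])
  obtain C n where C0: "abelian_chain (N\<lparr>carrier := ?S\<rparr>) C n" "\<forall>i g x. i \<le> n \<longrightarrow> g \<in> carrier G \<longrightarrow> x \<in> C i \<longrightarrow> a g x \<in> C i"
    by (rule component_chain[OF p])
  then have C: "abelian_chain (N\<lparr>carrier := ?S\<rparr>) C n" "\<And>i g x. i \<le> n \<Longrightarrow> g \<in> carrier G \<Longrightarrow> x \<in> C i \<Longrightarrow> a g x \<in> C i"
    by blast+
  have coc: "NP.cocycle (carrier G) (\<lambda>x. proj p (\<theta> x))" if "cocycle (carrier G) \<theta>" for \<theta>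
    unfolding component_cocycle[OF p] using proj_cocycle[OF G.subgroup_self that p] by blast
  have v: "v \<in> carrier N" using coh unfolding cohomologous_by_def by simp
  have cohK: "NP.cohomologous_by K (proj p v) (\<lambda>x. proj p (\<phi> x)) (\<lambda>x. proj p (\<psi> x))"
    unfolding component_cohomologous[OF p] cohomologous_by_def
  proof (intro conjI ballI)
    show "proj p v \<in> ?S" "proj p v \<in> carrier N" using proj_component[OF p v] v p by simp_all
    fix x assume x: "x \<in> K"
    have xG: "x \<in> carrier G" using subgroup.mem_carrier[OF K x] .
    show "proj p (\<psi> x) = inv\<^bsub>N\<^esub> (proj p v) \<otimes>\<^bsub>N\<^esub> proj p (\<phi> x) \<otimes>\<^bsub>N\<^esub> a x (proj p v)"
      using coh x v cocycle_closed[OF \<phi>(1) xG] xG unfolding cohomologous_by_def by (simp add: a_proj)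
  qed
  have "\<exists>v. NP.cohomologous_by (carrier G) v (\<lambda>x. proj p (\<phi> x)) (\<lambda>x. proj p (\<psi> x))"
    by (rule NP.sylow_restriction_injective[OF K component_small_subgroup[OF p U] part_pos[OF p] component_exponent C(1) _
        part_coprime[OF p idx] sup coc[OF \<phi>(1)] _ coc[OF \<psi>(1)] _ cohK]) (use C(2) \<phi>(2) \<psi>(2) in auto)
  then show ?thesis unfolding component_cohomologous[OF p] by blast
qed

lemma component_extension_sylow:
  assumes p: "prime p" and K: "subgroup K G" "closedin T K"
    and idx: "\<And>U. U \<lhd> G \<Longrightarrow> openin T U \<Longrightarrow> finite (rcosets U) \<Longrightarrow> \<not> p dvd card (rcosets (K <#> U))"
    and sup: "\<And>U. profinite_action.small_subgroup G (N\<lparr>carrier := component p\<rparr>) a T U \<Longrightarrow>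
       profinite_action.sylow_supplement G (N\<lparr>carrier := component p\<rparr>) a (part p) K U"
    and U: "small_subgroup U" and \<phi>: "cocycle K \<phi>" "\<And>u. u \<in> K \<Longrightarrow> u \<in> U \<Longrightarrow> \<phi> u = \<one>\<^bsub>N\<^esub>"
    and inv: "\<And>j. j \<in> carrier G \<Longrightarrow> (\<And>x. x \<in> K \<Longrightarrow> inv j \<otimes> x \<otimes> j \<in> K) \<Longrightarrow>
      \<exists>n\<in>carrier N. \<forall>x\<in>K. a j (\<phi> (inv j \<otimes> x \<otimes> j)) = inv\<^bsub>N\<^esub> n \<otimes>\<^bsub>N\<^esub> \<phi> x \<otimes>\<^bsub>N\<^esub> a x n"
  obtains \<psi> V where "cocycle (carrier G) \<psi>" "\<And>x. x \<in> carrier G \<Longrightarrow> \<psi> x \<in> component p" "\<And>x. x \<in> K \<Longrightarrow> \<psi> x = proj p (\<phi> x)"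
    "small_subgroup V" "\<And>u. u \<in> V \<Longrightarrow> \<psi> u = \<one>\<^bsub>N\<^esub>"
proof -
  let ?S = "component p"
  note S = component_subgroup[OF p]
  interpret NP: profinite_action G "N\<lparr>carrier := ?S\<rparr>" a T by (rule component_action[OF p])
  interpret h: group_hom N N "proj p" by (rule proj_hom[OF p])
  interpret K: subgroup K G by (rule K)
  obtain C n where C0: "abelian_chain (N\<lparr>carrier := ?S\<rparr>) C n" "\<forall>i g x. i \<le> n \<longrightarrow> g \<in> carrier G \<longrightarrow> x \<in> C i \<longrightarrow> a g x \<in> C i"
    by (rule component_chain[OF p])
  then have C: "abelian_chain (N\<lparr>carrier := ?S\<rparr>) C n" "\<And>i g x. i \<le> n \<Longrightarrow> g \<in> carrier G \<Longrightarrow> x \<in> C i \<Longrightarrow> a g x \<in> C i"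
    by blast+
  have coc: "NP.cocycle K (\<lambda>x. proj p (\<phi> x))"
    unfolding component_cocycle[OF p] using proj_cocycle[OF K(1) \<phi>(1) p] by blast
  have "\<exists>\<psi> V. NP.cocycle (carrier G) \<psi> \<and> (\<forall>x\<in>K. \<psi> x = proj p (\<phi> x)) \<and> NP.small_subgroup V \<and> (\<forall>u\<in>V. \<psi> u = \<one>\<^bsub>N\<lparr>carrier := ?S\<rparr>\<^esub>)"
  proof (rule NP.sylow_restriction_surjective[OF K part_pos[OF p] component_exponent C(1) _ _ sup component_small_subgroup[OF p U] coc])
    fix j assume j: "j \<in> carrier G" and jK: "\<And>x. x \<in> K \<Longrightarrow> inv j \<otimes> x \<otimes> j \<in> K"
    obtain n where n: "n \<in> carrier N" "\<And>x. x \<in> K \<Longrightarrow> a j (\<phi> (inv j \<otimes> x \<otimes> j)) = inv\<^bsub>N\<^esub> n \<otimes>\<^bsub>N\<^esub> \<phi> x \<otimes>\<^bsub>N\<^esub> a x n"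
      using inv[OF j jK] by blast
    have "a j (proj p (\<phi> (inv j \<otimes> x \<otimes> j))) = inv\<^bsub>N\<lparr>carrier := ?S\<rparr>\<^esub> (proj p n) \<otimes>\<^bsub>N\<lparr>carrier := ?S\<rparr>\<^esub> proj p (\<phi> x) \<otimes>\<^bsub>N\<lparr>carrier := ?S\<rparr>\<^esub> a x (proj p n)"
      if x: "x \<in> K" for x
      using n x j jK[OF x] cocycle_closed[OF \<phi>(1)] K.mem_carrier[OF x] N.m_inv_consistent[OF S proj_component[OF p n(1)]]
      by (simp add: a_proj)
    then show "\<exists>n\<in>carrier (N\<lparr>carrier := ?S\<rparr>). \<forall>x\<in>K. a j (proj p (\<phi> (inv j \<otimes> x \<otimes> j))) =
        inv\<^bsub>N\<lparr>carrier := ?S\<rparr>\<^esub> n \<otimes>\<^bsub>N\<lparr>carrier := ?S\<rparr>\<^esub> proj p (\<phi> x) \<otimes>\<^bsub>N\<lparr>carrier := ?S\<rparr>\<^esub> a x n"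
      using proj_component[OF p n(1)] by (intro bexI[of _ "proj p n"]) auto
  qed (use C(2) \<phi>(2) idx NP.small_subgroupD part_coprime[OF p] in auto)
  then obtain \<psi> V where \<psi>: "NP.cocycle (carrier G) \<psi>" "\<And>x. x \<in> K \<Longrightarrow> \<psi> x = proj p (\<phi> x)" and V: "NP.small_subgroup V" "\<And>u. u \<in> V \<Longrightarrow> \<psi> u = \<one>\<^bsub>N\<^esub>"
    by auto
  obtain V' where V': "small_subgroup V'" "V' \<subseteq> V"
    by (rule small_subgroup_Int[OF U NP.small_subgroupD(3)[OF V(1)] subgroup.one_closed[OF NP.small_subgroupD(2)[OF V(1)]]])
      (rule that)
  have c: "cocycle (carrier G) \<psi>" "\<forall>x\<in>carrier G. \<psi> x \<in> component p"
    using \<psi>(1) unfolding component_cocycle[OF p] by simp_all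
  have "\<psi> u = \<one>\<^bsub>N\<^esub>" if u: "u \<in> V'" for u using V(2)[of u] V'(2) u by auto
  with c \<psi>(2) V'(1) show ?thesis by (intro that[of \<psi> V']) simp_all
qed

end

section \<open>Restriction to all Sylow subgroups\<close>

text \<open>
  The data extracted from a finite supersolvable quotient of \<open>NJ\<close>. The chain
  \<open>X\<close> starts inside \<open>U\<close> rather than at \<open>1\<close> because only the
  quotient of \<open>G\<close> by \<open>U\<close> matters.
\<close>

definition stabilizing_chains ::
    "('g, 'a) monoid_scheme \<Rightarrow> ('n, 'b) monoid_scheme \<Rightarrow> ('g \<Rightarrow> 'n \<Rightarrow> 'n) \<Rightarrow> 'g set \<Rightarrow> 'g set \<Rightarrow> (nat \<Rightarrow> 'g set) \<Rightarrow> (nat \<Rightarrow> 'n set) \<Rightarrow> nat \<Rightarrow> bool" where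
  "stabilizing_chains G N a U F X Y n \<longleftrightarrow> subgroup F G \<and>
     (\<forall>x\<in>carrier G. \<forall>y\<in>carrier G. x \<otimes>\<^bsub>G\<^esub> y \<otimes>\<^bsub>G\<^esub> inv\<^bsub>G\<^esub> x \<otimes>\<^bsub>G\<^esub> inv\<^bsub>G\<^esub> y \<in> F) \<and>
     (\<forall>i\<le>n. X i \<lhd> G \<and> subgroup (Y i) N) \<and> X 0 \<subseteq> U \<and> X n = carrier G \<and> Y 0 = {\<one>\<^bsub>N\<^esub>} \<and> Y n = carrier N \<and>
     (\<forall>i<n. X i \<subseteq> X (Suc i) \<and> (\<forall>x\<in>X (Suc i). \<forall>f\<in>F. f \<otimes>\<^bsub>G\<^esub> x \<otimes>\<^bsub>G\<^esub> inv\<^bsub>G\<^esub> f \<otimes>\<^bsub>G\<^esub> inv\<^bsub>G\<^esub> x \<in> X i) \<and>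
        (\<forall>z\<in>Y (Suc i). \<forall>f\<in>F. a f z \<otimes>\<^bsub>N\<^esub> inv\<^bsub>N\<^esub> z \<in> Y i))"

lemma (in group_hom) centralizing_chain_preimage:
  assumes "centralizing_chain H F K n"
  shows "\<And>i. i \<le> n \<Longrightarrow> {x \<in> carrier G. h x \<in> K i} \<lhd> G"
    and "{x \<in> carrier G. h x \<in> K 0} = {x \<in> carrier G. h x = \<one>\<^bsub>H\<^esub>}"
    and "{x \<in> carrier G. h x \<in> K n} = carrier G"
    and "\<And>i. i < n \<Longrightarrow> {x \<in> carrier G. h x \<in> K i} \<subseteq> {x \<in> carrier G. h x \<in> K (Suc i)}"
    and "\<And>i x f. i < n \<Longrightarrow> x \<in> {x \<in> carrier G. h x \<in> K (Suc i)} \<Longrightarrow> f \<in> carrier G \<Longrightarrow> h f \<in> F \<Longrightarrow>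
      f \<otimes> x \<otimes> inv f \<otimes> inv x \<in> {x \<in> carrier G. h x \<in> K i}"
proof -
  have K: "\<And>i. i \<le> n \<Longrightarrow> K i \<lhd> H" "K 0 = {\<one>\<^bsub>H\<^esub>}" "K n = carrier H" "\<And>i. i < n \<Longrightarrow> K i \<subseteq> K (Suc i)"
    "\<And>i x f. i < n \<Longrightarrow> x \<in> K (Suc i) \<Longrightarrow> f \<in> F \<Longrightarrow> f \<otimes>\<^bsub>H\<^esub> x \<otimes>\<^bsub>H\<^esub> inv\<^bsub>H\<^esub> f \<otimes>\<^bsub>H\<^esub> inv\<^bsub>H\<^esub> x \<in> K i"
    using assms unfolding centralizing_chain_def by simp_all
  show "{x \<in> carrier G. h x \<in> K i} \<lhd> G" if i: "i \<le> n" for i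
  proof -
    interpret Ki: normal "K i" H by (rule K(1)[OF i])
    show ?thesis
    proof (rule G.normal_invI)
      show "subgroup {x \<in> carrier G. h x \<in> K i} G"
        by (rule G.subgroupI) (auto intro!: exI[of _ \<one>])
    qed (auto simp: Ki.inv_op_closed2)
  qed
  show "{x \<in> carrier G. h x \<in> K 0} = {x \<in> carrier G. h x = \<one>\<^bsub>H\<^esub>}" using K(2) by simp
  show "{x \<in> carrier G. h x \<in> K n} = carrier G" unfolding K(3) using hom_closed by blast
  show "{x \<in> carrier G. h x \<in> K i} \<subseteq> {x \<in> carrier G. h x \<in> K (Suc i)}" if "i < n" for i using K(4)[OF that] by blast
  show "f \<otimes> x \<otimes> inv f \<otimes> inv x \<in> {x \<in> carrier G. h x \<in> K i}"
    if "i < n" "x \<in> {x \<in> carrier G. h x \<in> K (Suc i)}" "f \<in> carrier G" "h f \<in> F" for i x f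
    using K(5)[OF that(1) _ that(4), of "h x"] that(2,3) by simp
qed

lemma J_group_left_action:
  assumes "group J" "J_group J T N act"
  shows "left_action J N (\<lambda>j n. act n (inv\<^bsub>J\<^esub> j))"
proof -
  interpret J: group J by fact
  have N: "group N" and iso: "\<And>j. j \<in> carrier J \<Longrightarrow> (\<lambda>n. act n j) \<in> iso N N" and one: "\<And>n. n \<in> carrier N \<Longrightarrow> act n \<one>\<^bsub>J\<^esub> = n"
    and mult: "\<And>n j k. n \<in> carrier N \<Longrightarrow> j \<in> carrier J \<Longrightarrow> k \<in> carrier J \<Longrightarrow> act n (j \<otimes>\<^bsub>J\<^esub> k) = act (act n j) k"
    using assms(2) unfolding J_group_def by auto
  show ?thesis
    by (intro left_action.intro left_action_axioms.intro)
      (use assms(1) N iso one mult in \<open>auto simp: iso_def J.inv_mult_group\<close>)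
qed

text \<open>
  Choose a finite supersolvable quotient \<open>h\<close> of \<open>NJ\<close> whose kernel is
  contained in \<open>{1} \<times> U\<close>, and pull its chain and centralizer back along the
  two embeddings \<open>J \<rightarrow> NJ\<close> and \<open>N \<rightarrow> NJ\<close>. The
  action of \<open>J\<close> on \<open>N\<close> is conjugation in \<open>NJ\<close>, so
  centralizing factors in \<open>NJ\<close> means stabilizing the chain in \<open>N\<close>.
\<close>

lemma J_group_stabilizing_chains:
  assumes J: "group J" "topspace T = carrier J" and JN: "J_group J T N act"
    and ss: "prosupersolvable_group (semidirect_product N J act) (semidirect_topology N T)"
    and U: "openin T U" "\<one>\<^bsub>J\<^esub> \<in> U"
  shows "\<exists>F X Y n. stabilizing_chains J N (\<lambda>j n. act n (inv\<^bsub>J\<^esub> j)) U F X Y n"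
proof -
  interpret A: left_action J N "\<lambda>j n. act n (inv\<^bsub>J\<^esub> j)" by (rule J_group_left_action[OF J(1) JN])
  define S where "S = semidirect_product N J act"
  have Sg: "group S" using ss unfolding prosupersolvable_group_def pro_group_def topological_group_def S_def by blast
  have S_simps [simp]: "carrier S = carrier N \<times> carrier J" "\<one>\<^bsub>S\<^esub> = (\<one>\<^bsub>N\<^esub>, \<one>\<^bsub>J\<^esub>)"
    "\<And>n j m k. (n, j) \<otimes>\<^bsub>S\<^esub> (m, k) = (n \<otimes>\<^bsub>N\<^esub> act m (inv\<^bsub>J\<^esub> j), j \<otimes>\<^bsub>J\<^esub> k)"
    unfolding S_def semidirect_product_def by simp_all
  interpret S: group S by (rule Sg)
  have W: "openin (semidirect_topology N T) ({\<one>\<^bsub>N\<^esub>} \<times> U)"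
    unfolding semidirect_topology_def using U(1) by (simp add: openin_prod_Times_iff)
  obtain Q :: "nat monoid" and h where Q: "group Q" "finite (carrier Q)" "supersolvable_group Q" "h \<in> hom S Q"
    "{x \<in> carrier S. h x = \<one>\<^bsub>Q\<^esub>} \<subseteq> {\<one>\<^bsub>N\<^esub>} \<times> U"
  proof -
    have "\<one>\<^bsub>S\<^esub> \<in> {\<one>\<^bsub>N\<^esub>} \<times> U" using U(2) by simp
    from pro_group_small_kernel[OF ss[folded S_def, unfolded prosupersolvable_group_def] W this] show ?thesis
      using that by blast
  qed
  interpret Q: group Q by (rule Q)
  interpret h: group_hom S Q h using Q(4) by unfold_locales
  obtain F H n where F: "subgroup F Q" "\<And>x y. x \<in> carrier Q \<Longrightarrow> y \<in> carrier Q \<Longrightarrow> x \<otimes>\<^bsub>Q\<^esub> y \<otimes>\<^bsub>Q\<^esub> inv\<^bsub>Q\<^esub> x \<otimes>\<^bsub>Q\<^esub> inv\<^bsub>Q\<^esub> y \<in> F"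
    and H: "centralizing_chain Q F H n"
    using supersolvable_group_centralizing_chain[OF Q(3)] by metis
  interpret F: subgroup F Q by (rule F)
  define hJ where "hJ = (\<lambda>j. h (\<one>\<^bsub>N\<^esub>, j))"
  define hN where "hN = (\<lambda>z. h (z, \<one>\<^bsub>J\<^esub>))"
  have act1: "act \<one>\<^bsub>N\<^esub> j = \<one>\<^bsub>N\<^esub>" if "j \<in> carrier J" for j
    using A.a_N_one[of "inv\<^bsub>J\<^esub> j"] that by simp
  have act_one: "act z \<one>\<^bsub>J\<^esub> = z" if "z \<in> carrier N" for z
    using A.a_one[OF that] by simp
  interpret hJ: group_hom J Q hJ
  proof unfold_locales
    show "hJ \<in> hom J Q"
    proof (rule homI)
      fix j k assume jk: "j \<in> carrier J" "k \<in> carrier J"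
      then have "(\<one>\<^bsub>N\<^esub>, j) \<otimes>\<^bsub>S\<^esub> (\<one>\<^bsub>N\<^esub>, k) = (\<one>\<^bsub>N\<^esub>, j \<otimes>\<^bsub>J\<^esub> k)" by (simp add: act1)
      then show "hJ (j \<otimes>\<^bsub>J\<^esub> k) = hJ j \<otimes>\<^bsub>Q\<^esub> hJ k"
        using h.hom_mult[of "(\<one>\<^bsub>N\<^esub>, j)" "(\<one>\<^bsub>N\<^esub>, k)"] jk unfolding hJ_def by simp
    qed (use h.hom_closed in \<open>auto simp: hJ_def\<close>)
  qed
  interpret hN: group_hom N Q hN
  proof unfold_locales
    show "hN \<in> hom N Q"
    proof (rule homI)
      fix x y assume xy: "x \<in> carrier N" "y \<in> carrier N"
      then have "(x, \<one>\<^bsub>J\<^esub>) \<otimes>\<^bsub>S\<^esub> (y, \<one>\<^bsub>J\<^esub>) = (x \<otimes>\<^bsub>N\<^esub> y, \<one>\<^bsub>J\<^esub>)" by (simp add: act_one)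
      then show "hN (x \<otimes>\<^bsub>N\<^esub> y) = hN x \<otimes>\<^bsub>Q\<^esub> hN y"
        using h.hom_mult[of "(x, \<one>\<^bsub>J\<^esub>)" "(y, \<one>\<^bsub>J\<^esub>)"] xy unfolding hN_def by simp
    qed (use h.hom_closed in \<open>auto simp: hN_def\<close>)
  qed
  have conj: "hN (act z (inv\<^bsub>J\<^esub> f)) = hJ f \<otimes>\<^bsub>Q\<^esub> hN z \<otimes>\<^bsub>Q\<^esub> inv\<^bsub>Q\<^esub> (hJ f)" if f: "f \<in> carrier J" and z: "z \<in> carrier N" for f z
  proof -
    have az: "act z (inv\<^bsub>J\<^esub> f) \<in> carrier N" using A.a_closed[OF f z] .
    have "(act z (inv\<^bsub>J\<^esub> f), \<one>\<^bsub>J\<^esub>) \<otimes>\<^bsub>S\<^esub> (\<one>\<^bsub>N\<^esub>, f) = (\<one>\<^bsub>N\<^esub>, f) \<otimes>\<^bsub>S\<^esub> (z, \<one>\<^bsub>J\<^esub>)" using f z az by (simp add: act1)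
    then have "hN (act z (inv\<^bsub>J\<^esub> f)) \<otimes>\<^bsub>Q\<^esub> hJ f = hJ f \<otimes>\<^bsub>Q\<^esub> hN z"
      using h.hom_mult[of "(act z (inv\<^bsub>J\<^esub> f), \<one>\<^bsub>J\<^esub>)" "(\<one>\<^bsub>N\<^esub>, f)"] h.hom_mult[of "(\<one>\<^bsub>N\<^esub>, f)" "(z, \<one>\<^bsub>J\<^esub>)"] f z az
      unfolding hN_def hJ_def by simp
    then show ?thesis using f z az Q.inv_solve_right[of "hN (act z (inv\<^bsub>J\<^esub> f))" "hJ f \<otimes>\<^bsub>Q\<^esub> hN z" "hJ f"] by simp
  qed
  define F' where "F' = {j \<in> carrier J. hJ j \<in> F}"
  have "subgroup F' J" by (rule A.G.subgroupI) (auto simp: F'_def intro!: exI[of _ "\<one>\<^bsub>J\<^esub>"])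
  moreover have "x \<otimes>\<^bsub>J\<^esub> y \<otimes>\<^bsub>J\<^esub> inv\<^bsub>J\<^esub> x \<otimes>\<^bsub>J\<^esub> inv\<^bsub>J\<^esub> y \<in> F'" if "x \<in> carrier J" "y \<in> carrier J" for x y
    using F(2)[of "hJ x" "hJ y"] that unfolding F'_def by simp
  moreover note X = hJ.centralizing_chain_preimage[OF H] and Y = hN.centralizing_chain_preimage[OF H]
  have Y0: "{x \<in> carrier N. hN x \<in> H 0} = {\<one>\<^bsub>N\<^esub>}"
    unfolding Y(2) using Q(5) hN.hom_one unfolding hN_def by auto
  have X0: "{x \<in> carrier J. hJ x \<in> H 0} \<subseteq> U"
    unfolding X(2) using Q(5) unfolding hJ_def by auto
  have YF: "act z (inv\<^bsub>J\<^esub> f) \<otimes>\<^bsub>N\<^esub> inv\<^bsub>N\<^esub> z \<in> {x \<in> carrier N. hN x \<in> H i}"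
    if i: "i < n" and z: "z \<in> {x \<in> carrier N. hN x \<in> H (Suc i)}" and f: "f \<in> F'" for i z f
  proof -
    have "hJ f \<otimes>\<^bsub>Q\<^esub> hN z \<otimes>\<^bsub>Q\<^esub> inv\<^bsub>Q\<^esub> (hJ f) \<otimes>\<^bsub>Q\<^esub> inv\<^bsub>Q\<^esub> (hN z) \<in> H i"
      using H i z f unfolding centralizing_chain_def F'_def by simp
    then show ?thesis using conj[of f z] z f A.a_closed[of f z] unfolding F'_def by simp
  qed
  ultimately have "stabilizing_chains J N (\<lambda>j n. act n (inv\<^bsub>J\<^esub> j)) U F' (\<lambda>i. {x \<in> carrier J. hJ x \<in> H i}) (\<lambda>i. {x \<in> carrier N. hN x \<in> H i}) n"
    unfolding stabilizing_chains_def
    using X Y X0 Y0 YF normal_imp_subgroup[OF Y(1)] by (auto simp: F'_def)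
  then show ?thesis by blast
qed

context nilpotent_action
begin

lemma component_supplement_nilpotent:
  assumes nil: "pronilpotent_group G T" and S: "sylow_subgroup p K G T"
    and U: "profinite_action.small_subgroup G (N\<lparr>carrier := component p\<rparr>) a T U"
  shows "profinite_action.sylow_supplement G (N\<lparr>carrier := component p\<rparr>) a (part p) K U"
proof -
  have p: "prime p" using S unfolding sylow_subgroup_def by simp
  interpret NP: profinite_action G "N\<lparr>carrier := component p\<rparr>" a T by (rule component_action[OF p])
  note Ud = NP.small_subgroupD[OF U]
  interpret U: normal U G by (rule Ud)
  obtain Q :: "nat monoid" and h where Q: "group Q" "finite (carrier Q)" "nilpotent_group Q" "h \<in> hom G Q"
    "openin T {x \<in> carrier G. h x = \<one>\<^bsub>Q\<^esub>}" "{x \<in> carrier G. h x = \<one>\<^bsub>Q\<^esub>} \<subseteq> U"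
    by (rule pro_group_small_kernel[OF nil[unfolded pronilpotent_group_def] Ud(3) U.one_closed]) (rule that)
  interpret Q: group Q by (rule Q)
  interpret h: group_hom G Q h using Q(4) by unfold_locales
  obtain H n where H: "centralizing_chain Q (carrier Q) H n" by (rule nilpotent_group_central_chain[OF Q(3)])
  note X = h.centralizing_chain_preimage[OF H]
  have Gn: "carrier G \<lhd> G" by (rule G.normal_invI[OF G.subgroup_self]) simp
  have "coprime_elements_commute ((G Mod U)\<lparr>carrier := (\<lambda>x. U #> x) ` carrier G\<rparr>)"
    by (rule NP.quotient_coprime_elements_commute[OF Ud(1) Gn X(1) _ X(3) X(4) X(5)])
      (use Q(6) X(2) h.hom_closed in auto)
  moreover have "(G Mod U)\<lparr>carrier := (\<lambda>x. U #> x) ` carrier G\<rparr> = G Mod U"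
    by (simp add: carrier_FactGroup[symmetric])
  ultimately have "coprime_elements_commute (G Mod U)" by simp
  then show ?thesis by (rule NP.sylow_supplement_nilpotent[OF S U])
qed

lemma component_supplement_supersolvable:
  assumes chains: "\<And>U. openin T U \<Longrightarrow> \<one> \<in> U \<Longrightarrow> \<exists>F X Y n. stabilizing_chains G N a U F X Y n"
    and S: "sylow_subgroup p K G T"
    and U: "profinite_action.small_subgroup G (N\<lparr>carrier := component p\<rparr>) a T U"
  shows "profinite_action.sylow_supplement G (N\<lparr>carrier := component p\<rparr>) a (part p) K U"
proof -
  have p: "prime p" using S unfolding sylow_subgroup_def by simp
  interpret NP: profinite_action G "N\<lparr>carrier := component p\<rparr>" a T by (rule component_action[OF p])
  note Ud = NP.small_subgroupD[OF U]
  note Cs = component_subgroup[OF p]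
  obtain F X Y n where ch: "stabilizing_chains G N a U F X Y n"
    using chains[OF Ud(3) subgroup.one_closed[OF Ud(2)]] by blast
  have F: "subgroup F G" "\<And>x y. x \<in> carrier G \<Longrightarrow> y \<in> carrier G \<Longrightarrow> x \<otimes> y \<otimes> inv x \<otimes> inv y \<in> F"
    and X: "\<And>i. i \<le> n \<Longrightarrow> X i \<lhd> G" "X 0 \<subseteq> U" "X n = carrier G" "\<And>i. i < n \<Longrightarrow> X i \<subseteq> X (Suc i)"
      "\<And>i x f. i < n \<Longrightarrow> x \<in> X (Suc i) \<Longrightarrow> f \<in> F \<Longrightarrow> f \<otimes> x \<otimes> inv f \<otimes> inv x \<in> X i"
    and Y: "\<And>i. i \<le> n \<Longrightarrow> subgroup (Y i) N" "Y 0 = {\<one>\<^bsub>N\<^esub>}" "Y n = carrier N"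
      "\<And>i z f. i < n \<Longrightarrow> z \<in> Y (Suc i) \<Longrightarrow> f \<in> F \<Longrightarrow> a f z \<otimes>\<^bsub>N\<^esub> inv\<^bsub>N\<^esub> z \<in> Y i"
    using ch unfolding stabilizing_chains_def by simp_all
  show ?thesis unfolding part_def
  proof (rule NP.sylow_supplement_supersolvable[OF S U F X, where Y = "\<lambda>i. Y i \<inter> component p"])
    fix i assume "i \<le> n"
    then show "subgroup (Y i \<inter> component p) (N\<lparr>carrier := component p\<rparr>)"
      by (intro N.subgroup_incl[OF N.subgroups_Inter_pair[OF Y(1) Cs] Cs]) auto
  next
    show "Y 0 \<inter> component p = {\<one>\<^bsub>N\<lparr>carrier := component p\<rparr>\<^esub>}" using Y(2) subgroup.one_closed[OF Cs] by auto
    show "Y n \<inter> component p = carrier (N\<lparr>carrier := component p\<rparr>)" using Y(3) component_carrier by auto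
  next
    fix i z f assume i: "i < n" and z: "z \<in> Y (Suc i) \<inter> component p" and f: "f \<in> F"
    have "a f z \<otimes>\<^bsub>N\<^esub> inv\<^bsub>N\<^esub> z \<in> component p"
      using subgroup.m_closed[OF Cs a_component subgroup.m_inv_closed[OF Cs]] z subgroup.mem_carrier[OF F(1) f] by blast
    then show "a f z \<otimes>\<^bsub>N\<lparr>carrier := component p\<rparr>\<^esub> inv\<^bsub>N\<lparr>carrier := component p\<rparr>\<^esub> z \<in> Y i \<inter> component p"
      using Y(4)[OF i _ f, of z] z N.m_inv_consistent[OF Cs, of z] by simp
  next
    fix z assume "z \<in> carrier (N\<lparr>carrier := component p\<rparr>)"
    then show "z [^]\<^bsub>N\<lparr>carrier := component p\<rparr>\<^esub> p ^ multiplicity p (order N) = \<one>\<^bsub>N\<lparr>carrier := component p\<rparr>\<^esub>"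
      using component_exponent[of z p] unfolding part_def by simp
  qed
qed

lemma small_subgroup_family:
  assumes "finite A" "\<And>p. p \<in> A \<Longrightarrow> small_subgroup (V p)" "small_subgroup U"
  shows "\<exists>W. small_subgroup W \<and> W \<subseteq> U \<and> (\<forall>p\<in>A. W \<subseteq> V p)"
  using assms(1,2)
proof (induction A rule: finite_induct)
  case empty
  then show ?case using assms(3) by blast
next
  case (insert q A)
  then obtain W where W: "small_subgroup W" "W \<subseteq> U" "\<forall>p\<in>A. W \<subseteq> V p" by auto
  have Vq: "small_subgroup (V q)" using insert.prems by simp
  obtain W' where W': "small_subgroup W'" "W' \<subseteq> W" "W' \<subseteq> V q"
    by (rule small_subgroup_Int[OF W(1) small_subgroupD(3)[OF Vq] subgroup.one_closed[OF small_subgroupD(2)[OF Vq]]]) (rule that)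
  show ?case
  proof (intro exI[of _ W'] conjI ballI)
    fix p assume "p \<in> insert q A"
    then show "W' \<subseteq> V p" using W(3) W'(2,3) by blast
  qed (use W W' in auto)
qed

text \<open>
  Component by component: for \<open>p \<in> \<pi>(G)\<close> restriction to the Sylow
  \<open>p\<close>-subgroup detects the class of the \<open>p\<close>-component, and for the other
  primes there is only one class.
\<close>

lemma restriction_to_sylows_injective:
  assumes S: "\<And>p. p \<in> prime_set G T \<Longrightarrow> sylow_subgroup p (P p) G T"
    and sup: "\<And>p U. p \<in> prime_set G T \<Longrightarrow> profinite_action.small_subgroup G (N\<lparr>carrier := component p\<rparr>) a T U \<Longrightarrow>
       profinite_action.sylow_supplement G (N\<lparr>carrier := component p\<rparr>) a (part p) (P p) U"
    and U: "small_subgroup U"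
    and \<phi>: "cocycle (carrier G) \<phi>" "\<And>u. u \<in> U \<Longrightarrow> \<phi> u = \<one>\<^bsub>N\<^esub>" and \<psi>: "cocycle (carrier G) \<psi>" "\<And>u. u \<in> U \<Longrightarrow> \<psi> u = \<one>\<^bsub>N\<^esub>"
    and coh: "\<And>p. p \<in> prime_set G T \<Longrightarrow> \<exists>v. cohomologous_by (P p) v \<phi> \<psi>"
  shows "\<exists>v. cohomologous_by (carrier G) v \<phi> \<psi>"
proof (rule cohomologous_if_components[OF G.subgroup_self \<phi>(1) \<psi>(1)])
  fix p assume pQ: "p \<in> prime_divisors"
  have p: "prime p" by (rule prime_divisors_prime[OF pQ])
  show "\<exists>n\<in>component p. cohomologous_by (carrier G) n (\<lambda>x. proj p (\<phi> x)) (\<lambda>x. proj p (\<psi> x))"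
  proof (cases "p \<in> prime_set G T")
    case True
    have K: "subgroup (P p) G" using S[OF True] unfolding sylow_subgroup_def closed_subgroup_def by simp
    obtain v where "cohomologous_by (P p) v \<phi> \<psi>" using coh[OF True] by blast
    then show ?thesis
      by (intro components_cohomologous_sylow[OF p K U sylow_finite_quotient(1)[OF S[OF True] U]
          sup[OF True component_small_subgroup[OF p U]] \<phi>(1) _ \<psi>(1)]) (use \<phi>(2) \<psi>(2) in auto)
  next
    case False
    have nd: "\<not> p dvd card (rcosets U)" by (rule not_in_prime_set_index[OF p False U])
    show ?thesis
      by (rule components_cohomologous_coprime[OF p G.subgroup_self, where R = U])
        (use small_subgroupD[OF U] nd \<phi> \<psi> in auto)
  qed
qed

text \<open>
  The \<open>p\<close>-component of the given cocycle on \<open>P p\<close> extends to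
  \<open>G\<close>, and \<open>\<Phi>\<close> is assembled from these extensions. On \<open>P
  q\<close> its \<open>q\<close>-component is the prescribed one, and the other components are
  cohomologous to the prescribed ones because \<open>P q\<close> is a pro-\<open>q\<close>-group.
\<close>

lemma restriction_to_sylows_surjective:
  assumes S: "\<And>p. p \<in> prime_set G T \<Longrightarrow> sylow_subgroup p (P p) G T"
    and sup: "\<And>p U. p \<in> prime_set G T \<Longrightarrow> profinite_action.small_subgroup G (N\<lparr>carrier := component p\<rparr>) a T U \<Longrightarrow>
       profinite_action.sylow_supplement G (N\<lparr>carrier := component p\<rparr>) a (part p) (P p) U"
    and U: "\<And>p. p \<in> prime_set G T \<Longrightarrow> small_subgroup (U p)"
    and \<phi>: "\<And>p. p \<in> prime_set G T \<Longrightarrow> cocycle (P p) (\<phi> p)"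
      "\<And>p u. p \<in> prime_set G T \<Longrightarrow> u \<in> P p \<Longrightarrow> u \<in> U p \<Longrightarrow> \<phi> p u = \<one>\<^bsub>N\<^esub>"
    and inv: "\<And>p j. p \<in> prime_set G T \<Longrightarrow> j \<in> carrier G \<Longrightarrow> (\<forall>x\<in>P p. inv j \<otimes> x \<otimes> j \<in> P p) \<Longrightarrow>
      \<exists>n\<in>carrier N. \<forall>x\<in>P p. a j (\<phi> p (inv j \<otimes> x \<otimes> j)) = inv\<^bsub>N\<^esub> n \<otimes>\<^bsub>N\<^esub> \<phi> p x \<otimes>\<^bsub>N\<^esub> a x n"
    and U0: "small_subgroup U0"
  shows "\<exists>\<Phi> V. cocycle (carrier G) \<Phi> \<and> small_subgroup V \<and> (\<forall>u\<in>V. \<Phi> u = \<one>\<^bsub>N\<^esub>) \<and>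
    (\<forall>p\<in>prime_set G T. \<exists>v. cohomologous_by (P p) v \<Phi> (\<phi> p))"
proof -
  have K: "subgroup (P p) G" "closedin T (P p)" if "p \<in> prime_set G T" for p
    using S[OF that] unfolding sylow_subgroup_def closed_subgroup_def by auto
  have "\<forall>p\<in>prime_divisors. \<exists>\<Psi>V. cocycle (carrier G) (fst \<Psi>V) \<and> (\<forall>x\<in>carrier G. fst \<Psi>V x \<in> component p) \<and>
      (p \<in> prime_set G T \<longrightarrow> (\<forall>x\<in>P p. fst \<Psi>V x = proj p (\<phi> p x))) \<and> small_subgroup (snd \<Psi>V) \<and> (\<forall>u\<in>snd \<Psi>V. fst \<Psi>V u = \<one>\<^bsub>N\<^esub>)"
  proof
    fix p assume pQ: "p \<in> prime_divisors"
    have p: "prime p" by (rule prime_divisors_prime[OF pQ])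
    show "\<exists>\<Psi>V. cocycle (carrier G) (fst \<Psi>V) \<and> (\<forall>x\<in>carrier G. fst \<Psi>V x \<in> component p) \<and>
      (p \<in> prime_set G T \<longrightarrow> (\<forall>x\<in>P p. fst \<Psi>V x = proj p (\<phi> p x))) \<and> small_subgroup (snd \<Psi>V) \<and> (\<forall>u\<in>snd \<Psi>V. fst \<Psi>V u = \<one>\<^bsub>N\<^esub>)"
    proof (cases "p \<in> prime_set G T")
      case True
      have idx: "\<not> p dvd card (rcosets (P p <#> W))" if W: "W \<lhd> G" "openin T W" "finite (rcosets W)" for W
      proof -
        obtain W' where W': "small_subgroup W'" "W' \<subseteq> W"
          by (rule small_subgroup_Int[OF U0 W(2) subgroup.one_closed[OF normal_imp_subgroup[OF W(1)]]])
        have s1: "subgroup (P p <#> W') G" by (rule G.subgroup_mult_normal[OF K(1)[OF True] small_subgroupD(1)[OF W'(1)]])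
        have s2: "subgroup (P p <#> W) G" by (rule G.subgroup_mult_normal[OF K(1)[OF True] W(1)])
        have sub: "P p <#> W' \<subseteq> P p <#> W" using W'(2) unfolding set_mult_def by blast
        have f: "finite (rcosets (P p <#> W'))"
          by (rule G.rcosets_finite_mono[OF small_subgroupD(2)[OF W'(1)] s1 G.subgroups_subset_set_mult(2)[OF K(1)[OF True] small_subgroupD(2)[OF W'(1)]] small_subgroupD(4)[OF W'(1)]])
        show ?thesis
          using sylow_finite_quotient(1)[OF S[OF True] W'(1)] G.index_mult[OF s1 s2 sub f] by auto
      qed
      have inv': "\<exists>n\<in>carrier N. \<forall>x\<in>P p. a j (\<phi> p (inv j \<otimes> x \<otimes> j)) = inv\<^bsub>N\<^esub> n \<otimes>\<^bsub>N\<^esub> \<phi> p x \<otimes>\<^bsub>N\<^esub> a x n"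
        if "j \<in> carrier G" "\<And>x. x \<in> P p \<Longrightarrow> inv j \<otimes> x \<otimes> j \<in> P p" for j
        using inv[OF True that(1)] that(2) by blast
      obtain \<psi> V where "cocycle (carrier G) \<psi>" "\<And>x. x \<in> carrier G \<Longrightarrow> \<psi> x \<in> component p" "\<And>x. x \<in> P p \<Longrightarrow> \<psi> x = proj p (\<phi> p x)"
        "small_subgroup V" "\<And>u. u \<in> V \<Longrightarrow> \<psi> u = \<one>\<^bsub>N\<^esub>"
        by (rule component_extension_sylow[OF p K[OF True] idx sup[OF True] U[OF True] \<phi>(1)[OF True] \<phi>(2)[OF True] inv']) (assumption | rule that)+
      then show ?thesis by (intro exI[of _ "(\<psi>, V)"]) simp
    next
      case False
      have "cocycle (carrier G) (\<lambda>_. \<one>\<^bsub>N\<^esub>)" unfolding cocycle_def by simp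
      then show ?thesis using False U0 subgroup.one_closed[OF component_subgroup[OF p]] by (intro exI[of _ "(\<lambda>_. \<one>\<^bsub>N\<^esub>, U0)"]) simp
    qed
  qed
  from bchoice[OF this] obtain \<Psi>V where
    \<Psi>V: "\<forall>p\<in>prime_divisors. cocycle (carrier G) (fst (\<Psi>V p)) \<and> (\<forall>x\<in>carrier G. fst (\<Psi>V p) x \<in> component p) \<and>
      (p \<in> prime_set G T \<longrightarrow> (\<forall>x\<in>P p. fst (\<Psi>V p) x = proj p (\<phi> p x))) \<and> small_subgroup (snd (\<Psi>V p)) \<and> (\<forall>u\<in>snd (\<Psi>V p). fst (\<Psi>V p) u = \<one>\<^bsub>N\<^esub>)"
    by blast
  define \<Psi> where "\<Psi> = (\<lambda>p. fst (\<Psi>V p))"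
  define V where "V = (\<lambda>p. snd (\<Psi>V p))"
  have \<Psi>: "cocycle (carrier G) (\<Psi> p)" "\<And>x. x \<in> carrier G \<Longrightarrow> \<Psi> p x \<in> component p"
    "\<And>x. p \<in> prime_set G T \<Longrightarrow> x \<in> P p \<Longrightarrow> \<Psi> p x = proj p (\<phi> p x)" "small_subgroup (V p)" "\<And>u. u \<in> V p \<Longrightarrow> \<Psi> p u = \<one>\<^bsub>N\<^esub>"
    if "p \<in> prime_divisors" for p
    using \<Psi>V that unfolding \<Psi>_def V_def by blast+
  have "\<exists>n. n \<in> carrier N \<and> (\<forall>p\<in>prime_divisors. proj p n = \<Psi> p x)" if "x \<in> carrier G" for x
    using proj_family[of "\<lambda>p. \<Psi> p x"] \<Psi>(2) that by metis
  then have "\<forall>x\<in>carrier G. \<exists>n. n \<in> carrier N \<and> (\<forall>p\<in>prime_divisors. proj p n = \<Psi> p x)" by blast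
  from bchoice[OF this] obtain \<Phi> where \<Phi>: "\<And>x. x \<in> carrier G \<Longrightarrow> \<Phi> x \<in> carrier N" "\<And>x p. x \<in> carrier G \<Longrightarrow> p \<in> prime_divisors \<Longrightarrow> proj p (\<Phi> x) = \<Psi> p x"
    by blast
  have \<Phi>c: "cocycle (carrier G) \<Phi>" unfolding cocycle_def
  proof (intro conjI ballI)
    fix x y assume x: "x \<in> carrier G" and y: "y \<in> carrier G"
    show "\<Phi> x \<in> carrier N" by (rule \<Phi>(1)[OF x])
    show "\<Phi> (x \<otimes> y) = \<Phi> x \<otimes>\<^bsub>N\<^esub> a x (\<Phi> y)"
    proof (rule proj_ext)
      fix p assume p: "p \<in> prime_divisors"
      show "proj p (\<Phi> (x \<otimes> y)) = proj p (\<Phi> x \<otimes>\<^bsub>N\<^esub> a x (\<Phi> y))"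
        using \<Phi> x y p cocycle_mult[OF \<Psi>(1)[OF p] x y] by (simp add: proj_mult[OF prime_divisors_prime[OF p]] a_proj[symmetric])
    qed (use \<Phi>(1) x y in auto)
  qed
  obtain W where W: "small_subgroup W" "W \<subseteq> U0" "\<forall>p\<in>prime_divisors. W \<subseteq> V p"
    using small_subgroup_family[of prime_divisors V U0, OF finite_prime_divisors \<Psi>(4) U0] by blast
  have \<Phi>W: "\<Phi> u = \<one>\<^bsub>N\<^esub>" if u: "u \<in> W" for u
  proof (rule proj_all_one)
    have uG: "u \<in> carrier G" using subgroup.mem_carrier[OF small_subgroupD(2)[OF W(1)] u] .
    show "\<Phi> u \<in> carrier N" by (rule \<Phi>(1)[OF uG])
    fix p assume p: "p \<in> prime_divisors"
    then show "proj p (\<Phi> u) = \<one>\<^bsub>N\<^esub>" using \<Phi>(2)[OF uG p] \<Psi>(5)[OF p] W(3) u by auto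
  qed
  have "\<exists>v. cohomologous_by (P q) v \<Phi> (\<phi> q)" if q: "q \<in> prime_set G T" for q
  proof -
    have qp: "prime q" using S[OF q] unfolding sylow_subgroup_def by simp
    have KG: "x \<in> P q \<Longrightarrow> x \<in> carrier G" for x using subgroup.mem_carrier[OF K(1)[OF q]] .
    have \<Phi>q: "cocycle (P q) \<Phi>" using \<Phi>c KG unfolding cocycle_def by blast
    obtain W' where W': "small_subgroup W'" "W' \<subseteq> W" "W' \<subseteq> U q"
      by (rule small_subgroup_Int[OF W(1) small_subgroupD(3)[OF U[OF q]] subgroup.one_closed[OF small_subgroupD(2)[OF U[OF q]]]]) (rule that)
    note sq = sylow_finite_quotient[OF S[OF q] W'(1)]
    interpret GK: group "G\<lparr>carrier := P q\<rparr>" by (rule G.subgroup_imp_group[OF K(1)[OF q]])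
    have nR: "P q \<inter> W' \<lhd> G\<lparr>carrier := P q\<rparr>"
    proof (rule GK.normal_invI)
      show "subgroup (P q \<inter> W') (G\<lparr>carrier := P q\<rparr>)"
        by (rule G.subgroup_incl[OF G.subgroups_Inter_pair[OF K(1)[OF q] small_subgroupD(2)[OF W'(1)]] K(1)[OF q]]) simp
      fix x h assume "x \<in> carrier (G\<lparr>carrier := P q\<rparr>)" "h \<in> P q \<inter> W'"
      then show "x \<otimes>\<^bsub>G\<lparr>carrier := P q\<rparr>\<^esub> h \<otimes>\<^bsub>G\<lparr>carrier := P q\<rparr>\<^esub> inv\<^bsub>G\<lparr>carrier := P q\<rparr>\<^esub> x \<in> P q \<inter> W'"
        using G.m_inv_consistent[OF K(1)[OF q], of x] G.normal_invE(2)[OF small_subgroupD(1)[OF W'(1)], of x h] KG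
          subgroup.m_closed[OF K(1)[OF q]] subgroup.m_inv_closed[OF K(1)[OF q]] by simp
    qed
    show ?thesis
    proof (rule cohomologous_if_components[OF K(1)[OF q] \<Phi>q \<phi>(1)[OF q]])
      fix p assume p: "p \<in> prime_divisors"
      have pp: "prime p" by (rule prime_divisors_prime[OF p])
      show "\<exists>n\<in>component p. cohomologous_by (P q) n (\<lambda>x. proj p (\<Phi> x)) (\<lambda>x. proj p (\<phi> q x))"
      proof (cases "p = q")
        case True
        have "cohomologous_by (P q) \<one>\<^bsub>N\<^esub> (\<lambda>x. proj p (\<Phi> x)) (\<lambda>x. proj p (\<phi> q x))"
          unfolding cohomologous_by_def using \<Phi>(1) \<Phi>(2)[OF _ p] \<Psi>(3)[OF p] KG True q cocycle_closed[OF \<phi>(1)[OF q]] by simp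
        then show ?thesis using subgroup.one_closed[OF component_subgroup[OF pp]] by blast
      next
        case False
        obtain b where b: "card (rcosets\<^bsub>G\<lparr>carrier := P q\<rparr>\<^esub> (P q \<inter> W')) = q ^ b" using sq(2) by blast
        have "\<not> p dvd q ^ b" using False pp qp prime_dvd_power primes_dvd_imp_eq by blast
        then have nd: "\<not> p dvd card (rcosets\<^bsub>G\<lparr>carrier := P q\<rparr>\<^esub> (P q \<inter> W'))" unfolding b .
        show ?thesis
          by (rule components_cohomologous_coprime[OF pp K(1)[OF q] nR sq(3) nd \<Phi>q _ \<phi>(1)[OF q]])
            (use \<Phi>W W' \<phi>(2)[OF q] in auto)
      qed
    qed
  qed
  then show ?thesis using \<Phi>c W(1) \<Phi>W by blast
qed

end

section \<open>The isomorphism of pointed sets\<close>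

locale finite_J_group =
  fixes J :: "('j, 'a) monoid_scheme" (structure) and T :: "'j topology"
    and N :: "('n, 'b) monoid_scheme" and act :: "'n \<Rightarrow> 'j \<Rightarrow> 'n"
  assumes profinite_J: "profinite_group J T" and J_group: "J_group J T N act" and finite_N: "finite (carrier N)"
begin

lemma profinite_action_J: "profinite_action J N (\<lambda>j n. act n (inv j)) T"
proof (intro profinite_action.intro profinite_action_axioms.intro profinite_J)
  have "group J" using profinite_J unfolding profinite_group_def pro_group_def topological_group_def by blast
  then show "left_action J N (\<lambda>j n. act n (inv j))" by (rule J_group_left_action) (rule J_group)
qed

end

sublocale finite_J_group \<subseteq> profinite_action J N "\<lambda>j n. act n (inv\<^bsub>J\<^esub> j)" T
  by (rule profinite_action_J)

context finite_J_group
begin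

text \<open>
  The kernel of the action is open because the action is continuous and \<open>N\<close> is finite
  and discrete.
\<close>

lemma small_subgroup_exists: "\<exists>U. small_subgroup U"
proof -
  have stab: "openin T {j \<in> carrier J. act n j = n}" if n: "n \<in> carrier N" for n
  proof -
    have "continuous_map T (prod_topology (discrete_topology (carrier N)) T) (\<lambda>j. (n, j))"
      using n by (simp add: continuous_map_pairwise o_def)
    moreover have "continuous_map (prod_topology (discrete_topology (carrier N)) T) (discrete_topology (carrier N)) (\<lambda>(n, j). act n j)"
      using J_group unfolding J_group_def by blast
    ultimately have "continuous_map T (discrete_topology (carrier N)) ((\<lambda>(n, j). act n j) \<circ> (\<lambda>j. (n, j)))"
      by (rule continuous_map_compose)
    from openin_continuous_map_preimage[OF this, of "{n}"] show ?thesis using n by simp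
  qed
  have "openin T (\<Inter>n\<in>carrier N. {j \<in> carrier J. act n j = n})"
    by (rule openin_Inter) (use stab finite_N N.one_closed in auto)
  moreover have "\<one> \<in> (\<Inter>n\<in>carrier N. {j \<in> carrier J. act n j = n})" using a_one by simp
  ultimately obtain U where U: "U \<lhd> J" "openin T U" "U \<subseteq> (\<Inter>n\<in>carrier N. {j \<in> carrier J. act n j = n})" "finite (rcosets U)"
    by (rule profinite_group_open_normal_subgroup[OF profinite_J]) (rule that)
  have "act n (inv u) = n" if "u \<in> U" "n \<in> carrier N" for u n
    using subgroup.m_inv_closed[OF normal_imp_subgroup[OF U(1)] that(1)] U(3) that(2) by blast
  then show ?thesis using U unfolding small_subgroup_def by blast
qed

text \<open>
  Continuity into a discrete finite group means triviality on some small subgroup; this removes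
  the topology from all further arguments.
\<close>

lemma Z1_iff:
  assumes K: "subgroup K J"
  shows "\<phi> \<in> Z1 J T N act K \<longleftrightarrow> \<phi> \<in> extensional K \<and> cocycle K \<phi> \<and> (\<exists>U. small_subgroup U \<and> (\<forall>u\<in>K \<inter> U. \<phi> u = \<one>\<^bsub>N\<^esub>))"
proof -
  have top: "topspace (subtopology T K) = K" using subgroup.subset[OF K] by auto
  have "continuous_map (subtopology T K) (discrete_topology (carrier N)) \<phi>"
    if c: "cocycle K \<phi>" and U: "small_subgroup U" "\<forall>u\<in>K \<inter> U. \<phi> u = \<one>\<^bsub>N\<^esub>" for U
    unfolding continuous_map_def top
  proof (intro conjI allI impI)
    show "\<phi> \<in> K \<rightarrow> topspace (discrete_topology (carrier N))" using cocycle_closed[OF c] by simp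
    fix S
    define A where "A = {x \<in> K. \<phi> x \<in> S}"
    have "openin T (A <#> U)"
    proof (rule topological_group_openin_cosets[OF is_topological_group small_subgroupD(2,3)[OF U(1)]])
      show "A <#> U \<subseteq> carrier J"
        using G.set_mult_closed[of A U] subgroup.subset[OF K] subgroup.subset[OF small_subgroupD(2)[OF U(1)]] unfolding A_def by blast
      fix x u assume "x \<in> A <#> U" and u: "u \<in> U"
      then obtain k v where kv: "k \<in> A" "v \<in> U" "x = k \<otimes> v" unfolding set_mult_def by blast
      have "x \<otimes> u = k \<otimes> (v \<otimes> u)"
        using kv u subgroup.mem_carrier[OF K] subgroup.mem_carrier[OF small_subgroupD(2)[OF U(1)]] unfolding A_def by (simp add: G.m_assoc)
      then show "x \<otimes> u \<in> A <#> U"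
        using kv(1) subgroup.m_closed[OF small_subgroupD(2)[OF U(1)] kv(2) u] unfolding set_mult_def by blast
    qed
    moreover have "(A <#> U) \<inter> K = A"
    proof
      show "A \<subseteq> (A <#> U) \<inter> K"
      proof
        fix x assume x: "x \<in> A"
        then have "x = x \<otimes> \<one>" using subgroup.mem_carrier[OF K] unfolding A_def by simp
        then show "x \<in> (A <#> U) \<inter> K"
          using x subgroup.one_closed[OF small_subgroupD(2)[OF U(1)]] unfolding A_def set_mult_def by blast
      qed
      show "(A <#> U) \<inter> K \<subseteq> A"
      proof
        fix x assume x: "x \<in> (A <#> U) \<inter> K"
        then obtain k v where kv: "k \<in> A" "v \<in> U" "x = k \<otimes> v" unfolding set_mult_def by blast
        have kK: "k \<in> K" using kv(1) unfolding A_def by simp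
        have G: "k \<in> carrier J" "v \<in> carrier J"
          using subgroup.mem_carrier[OF K kK] subgroup.mem_carrier[OF small_subgroupD(2)[OF U(1)] kv(2)] by auto
        have "v = inv k \<otimes> x" using G kv(3) by (simp add: G.m_assoc[symmetric])
        then have vK: "v \<in> K" using subgroup.m_closed[OF K subgroup.m_inv_closed[OF K kK]] x by simp
        have "\<phi> x = \<phi> k" using cocycle_mult[OF c kK vK] U(2) vK kv(2) cocycle_closed[OF c kK] G unfolding kv(3) by simp
        then show "x \<in> A" using x kv(1) unfolding A_def by simp
      qed
    qed
    ultimately show "openin (subtopology T K) {x \<in> K. \<phi> x \<in> S}" unfolding openin_subtopology A_def by metis
  qed
  moreover have "cocycle K \<phi> \<and> (\<exists>U. small_subgroup U \<and> (\<forall>u\<in>K \<inter> U. \<phi> u = \<one>\<^bsub>N\<^esub>))"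
    if \<phi>: "\<phi> \<in> Z1 J T N act K"
  proof
    have cm: "continuous_map (subtopology T K) (discrete_topology (carrier N)) \<phi>" using \<phi> unfolding Z1_def by blast
    have v: "\<phi> x \<in> carrier N" if "x \<in> K" for x
      using cm that unfolding continuous_map_def top by auto
    then show c: "cocycle K \<phi>" using \<phi> unfolding cocycle_def Z1_def by blast
    have "openin (subtopology T K) {x \<in> K. \<phi> x \<in> {\<one>\<^bsub>N\<^esub>}}"
      using openin_continuous_map_preimage[OF cm, of "{\<one>\<^bsub>N\<^esub>}"] unfolding top by simp
    then obtain W where W: "openin T W" "{x \<in> K. \<phi> x \<in> {\<one>\<^bsub>N\<^esub>}} = W \<inter> K" unfolding openin_subtopology by blast
    have "\<one> \<in> W" using W(2) cocycle_one[OF c subgroup.one_closed[OF K]] subgroup.one_closed[OF K] by blast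
    moreover obtain U where "small_subgroup U" using small_subgroup_exists by blast
    ultimately obtain V where "small_subgroup V" "V \<subseteq> W" using small_subgroup_Int[OF _ W(1)] by metis
    then show "\<exists>U. small_subgroup U \<and> (\<forall>u\<in>K \<inter> U. \<phi> u = \<one>\<^bsub>N\<^esub>)" using W(2) by blast
  qed
  ultimately show ?thesis unfolding Z1_def cocycle_def by blast
qed

lemma cohomologous_iff:
  "(\<phi>, \<psi>) \<in> cohomologous J T N act K \<longleftrightarrow> \<phi> \<in> Z1 J T N act K \<and> \<psi> \<in> Z1 J T N act K \<and> (\<exists>n. cohomologous_by K n \<phi> \<psi>)"
  unfolding cohomologous_def cohomologous_by_def by blast

lemma Z1_restrict:
  assumes K: "subgroup K J" and H: "subgroup H J" "H \<subseteq> K" and \<phi>: "\<phi> \<in> Z1 J T N act K"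
  shows "restrict \<phi> H \<in> Z1 J T N act H"
proof -
  have "cocycle H (restrict \<phi> H)"
    using \<phi> H(2) subgroup.m_closed[OF H(1)] unfolding Z1_iff[OF K] cocycle_def by (simp add: subset_eq)
  then show ?thesis using \<phi> H(2) unfolding Z1_iff[OF K] Z1_iff[OF H(1)] by fastforce
qed

lemma Z1_twist:
  assumes K: "subgroup K J" and \<phi>: "\<phi> \<in> Z1 J T N act K" and n: "n \<in> carrier N"
  shows "(\<lambda>x\<in>K. inv\<^bsub>N\<^esub> n \<otimes>\<^bsub>N\<^esub> \<phi> x \<otimes>\<^bsub>N\<^esub> act n (inv x)) \<in> Z1 J T N act K"
proof -
  have c: "cocycle K \<phi>" using \<phi> unfolding Z1_iff[OF K] by simp
  obtain U where U: "small_subgroup U" "\<forall>u\<in>K \<inter> U. \<phi> u = \<one>\<^bsub>N\<^esub>" using \<phi> unfolding Z1_iff[OF K] by blast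
  have "cocycle K (\<lambda>x\<in>K. inv\<^bsub>N\<^esub> n \<otimes>\<^bsub>N\<^esub> \<phi> x \<otimes>\<^bsub>N\<^esub> act n (inv x))"
    using cocycle_cohomologous[OF K c n] subgroup.m_closed[OF K] unfolding cocycle_def by simp
  moreover have "\<forall>u\<in>K \<inter> U. (\<lambda>x\<in>K. inv\<^bsub>N\<^esub> n \<otimes>\<^bsub>N\<^esub> \<phi> x \<otimes>\<^bsub>N\<^esub> act n (inv x)) u = \<one>\<^bsub>N\<^esub>"
    using U(2) small_subgroupD(5)[OF U(1) _ n] n by simp
  ultimately show ?thesis unfolding Z1_iff[OF K] using U(1) by blast
qed

lemma equiv_cohomologous:
  assumes K: "subgroup K J"
  shows "equiv (Z1 J T N act K) (cohomologous J T N act K)"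
proof (rule equivI)
  have KG: "x \<in> K \<Longrightarrow> x \<in> carrier J" for x using subgroup.mem_carrier[OF K] .
  have vN: "\<phi> x \<in> carrier N" if "\<phi> \<in> Z1 J T N act K" "x \<in> K" for \<phi> x
    using that cocycle_closed unfolding Z1_iff[OF K] by blast
  show "cohomologous J T N act K \<subseteq> Z1 J T N act K \<times> Z1 J T N act K" unfolding cohomologous_def by blast
  show "refl_on (Z1 J T N act K) (cohomologous J T N act K)"
  proof (rule refl_onI)
    fix \<phi> assume \<phi>: "\<phi> \<in> Z1 J T N act K"
    then have "cohomologous_by K \<one>\<^bsub>N\<^esub> \<phi> \<phi>" unfolding cohomologous_by_def using vN KG a_N_one by simp
    then show "(\<phi>, \<phi>) \<in> cohomologous J T N act K" using \<phi> unfolding cohomologous_iff by blast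
  qed
  show "sym (cohomologous J T N act K)"
  proof (rule symI)
    fix \<phi> \<psi> assume "(\<phi>, \<psi>) \<in> cohomologous J T N act K"
    then obtain n where Z: "\<phi> \<in> Z1 J T N act K" "\<psi> \<in> Z1 J T N act K" and n: "cohomologous_by K n \<phi> \<psi>"
      unfolding cohomologous_iff by blast
    have nN: "n \<in> carrier N" using n unfolding cohomologous_by_def by simp
    have "\<phi> x = inv\<^bsub>N\<^esub> (inv\<^bsub>N\<^esub> n) \<otimes>\<^bsub>N\<^esub> \<psi> x \<otimes>\<^bsub>N\<^esub> act (inv\<^bsub>N\<^esub> n) (inv x)" if x: "x \<in> K" for x
    proof -
      have e: "\<psi> x = inv\<^bsub>N\<^esub> n \<otimes>\<^bsub>N\<^esub> \<phi> x \<otimes>\<^bsub>N\<^esub> act n (inv x)" using n x unfolding cohomologous_by_def by simp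
      have i: "act (inv\<^bsub>N\<^esub> n) (inv x) = inv\<^bsub>N\<^esub> (act n (inv x))" using a_N_inv[OF KG[OF x] nN] .
      show ?thesis unfolding e i using nN vN[OF Z(1) x] a_closed[OF KG[OF x] nN]
        by (simp add: N.m_assoc N.cancel_inv_left)
    qed
    then have "cohomologous_by K (inv\<^bsub>N\<^esub> n) \<psi> \<phi>" unfolding cohomologous_by_def using nN by simp
    then show "(\<psi>, \<phi>) \<in> cohomologous J T N act K" using Z unfolding cohomologous_iff by blast
  qed
  show "trans (cohomologous J T N act K)"
  proof (rule transI)
    fix \<phi> \<psi> \<theta> assume "(\<phi>, \<psi>) \<in> cohomologous J T N act K" "(\<psi>, \<theta>) \<in> cohomologous J T N act K"
    then obtain n m where Z: "\<phi> \<in> Z1 J T N act K" "\<theta> \<in> Z1 J T N act K" and nm: "cohomologous_by K n \<phi> \<psi>" "cohomologous_by K m \<psi> \<theta>"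
      unfolding cohomologous_iff by blast
    have N: "n \<in> carrier N" "m \<in> carrier N" using nm unfolding cohomologous_by_def by simp_all
    have "\<theta> x = inv\<^bsub>N\<^esub> (n \<otimes>\<^bsub>N\<^esub> m) \<otimes>\<^bsub>N\<^esub> \<phi> x \<otimes>\<^bsub>N\<^esub> act (n \<otimes>\<^bsub>N\<^esub> m) (inv x)" if x: "x \<in> K" for x
    proof -
      have e: "\<theta> x = inv\<^bsub>N\<^esub> m \<otimes>\<^bsub>N\<^esub> (inv\<^bsub>N\<^esub> n \<otimes>\<^bsub>N\<^esub> \<phi> x \<otimes>\<^bsub>N\<^esub> act n (inv x)) \<otimes>\<^bsub>N\<^esub> act m (inv x)"
        using nm x unfolding cohomologous_by_def by simp
      have i: "act (n \<otimes>\<^bsub>N\<^esub> m) (inv x) = act n (inv x) \<otimes>\<^bsub>N\<^esub> act m (inv x)" using a_N_mult[OF KG[OF x] N] .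
      show ?thesis unfolding e i using N vN[OF Z(1) x] a_closed[OF KG[OF x]]
        by (simp add: N.m_assoc N.inv_mult_group)
    qed
    then have "cohomologous_by K (n \<otimes>\<^bsub>N\<^esub> m) \<phi> \<theta>" unfolding cohomologous_by_def using N by simp
    then show "(\<phi>, \<theta>) \<in> cohomologous J T N act K" using Z unfolding cohomologous_iff by blast
  qed
qed

lemma H1_class_eq_iff:
  assumes "subgroup K J" "\<phi> \<in> Z1 J T N act K" "\<psi> \<in> Z1 J T N act K"
  shows "H1_class J T N act K \<phi> = H1_class J T N act K \<psi> \<longleftrightarrow> (\<phi>, \<psi>) \<in> cohomologous J T N act K"
  unfolding H1_class_def using eq_equiv_class_iff[OF equiv_cohomologous] assms by metis

lemma conj_inv_subgroup:
  assumes K: "subgroup K J" and j: "j \<in> carrier J"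
  shows "subgroup (conj_inv J K j) J"
proof (rule G.subgroupI)
  have KG: "x \<in> K \<Longrightarrow> x \<in> carrier J" for x using subgroup.mem_carrier[OF K] .
  show "conj_inv J K j \<subseteq> carrier J" using KG j unfolding conj_inv_def by auto
  show "conj_inv J K j \<noteq> {}" using subgroup.one_closed[OF K] unfolding conj_inv_def by blast
  fix x assume "x \<in> conj_inv J K j"
  then obtain k where k: "k \<in> K" "x = j \<otimes> k \<otimes> inv j" unfolding conj_inv_def by blast
  have "inv x = j \<otimes> inv k \<otimes> inv j" unfolding k(2) using KG[OF k(1)] j by (simp add: G.inv_mult_group G.m_assoc)
  then show "inv x \<in> conj_inv J K j" using subgroup.m_inv_closed[OF K k(1)] unfolding conj_inv_def by blast
  fix y assume "y \<in> conj_inv J K j"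
  then obtain l where l: "l \<in> K" "y = j \<otimes> l \<otimes> inv j" unfolding conj_inv_def by blast
  have "x \<otimes> y = j \<otimes> (k \<otimes> l) \<otimes> inv j" unfolding k(2) l(2) using KG[OF k(1)] KG[OF l(1)] j
    by (simp add: G.m_assoc G.cancel_inv_left)
  then show "x \<otimes> y \<in> conj_inv J K j" using subgroup.m_closed[OF K k(1) l(1)] unfolding conj_inv_def by blast
qed

text \<open>
  For a cocycle \<open>\<phi>\<close> on all of \<open>J\<close>, the conjugate of
  \<open>\<phi>\<close> by \<open>j\<close> is cohomologous to \<open>\<phi>\<close> by the
  element \<open>\<phi> j\<close>.
\<close>

lemma invariant_cocycle_restrict:
  assumes K: "subgroup K J" and \<phi>: "\<phi> \<in> Z1 J T N act (carrier J)"
  shows "invariant_cocycle J T N act K (restrict \<phi> K)"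
  unfolding invariant_cocycle_def
proof (intro conjI ballI)
  show "restrict \<phi> K \<in> Z1 J T N act K" by (rule Z1_restrict[OF G.subgroup_self K subgroup.subset[OF K] \<phi>])
  fix j assume j: "j \<in> carrier J"
  define D where "D = K \<inter> conj_inv J K j"
  have D: "subgroup D J" unfolding D_def by (rule G.subgroups_Inter_pair[OF K conj_inv_subgroup[OF K j]])
  have c: "cocycle (carrier J) \<phi>" using \<phi> unfolding Z1_iff[OF G.subgroup_self] by simp
  have jN: "\<phi> j \<in> carrier N" by (rule cocycle_closed[OF c j])
  have r: "restrict (restrict \<phi> K) D = restrict \<phi> D" unfolding D_def by auto
  have Zr: "restrict \<phi> D \<in> Z1 J T N act D" by (rule Z1_restrict[OF G.subgroup_self D subgroup.subset[OF D] \<phi>])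
  have eq: "conj_cocycle J act K (restrict \<phi> K) j x = inv\<^bsub>N\<^esub> (\<phi> j) \<otimes>\<^bsub>N\<^esub> \<phi> x \<otimes>\<^bsub>N\<^esub> act (\<phi> j) (inv x)" if x: "x \<in> D" for x
  proof -
    have xG: "x \<in> carrier J" using subgroup.mem_carrier[OF D x] .
    have xc: "x \<in> conj_inv J K j" using x unfolding D_def by simp
    then obtain k where k: "k \<in> K" "x = j \<otimes> k \<otimes> inv j" unfolding conj_inv_def by blast
    have kG: "k \<in> carrier J" using subgroup.mem_carrier[OF K k(1)] .
    have e: "inv j \<otimes> x \<otimes> j = k" unfolding k(2) using j kG by (simp add: G.m_assoc G.cancel_inv_left)
    have xj: "x \<otimes> j = j \<otimes> k" unfolding k(2) using j kG by (simp add: G.m_assoc)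
    have kN: "\<phi> k \<in> carrier N" and xN: "\<phi> x \<in> carrier N" using cocycle_closed[OF c] kG xG by auto
    have axN: "act (\<phi> j) (inv x) \<in> carrier N" and ajN: "act (\<phi> k) (inv j) \<in> carrier N" using a_closed[OF xG jN] a_closed[OF j kN] .
    have "\<phi> j \<otimes>\<^bsub>N\<^esub> act (\<phi> k) (inv j) = \<phi> x \<otimes>\<^bsub>N\<^esub> act (\<phi> j) (inv x)"
      using cocycle_mult[OF c xG j] cocycle_mult[OF c j kG] unfolding xj by simp
    then have "act (\<phi> k) (inv j) = inv\<^bsub>N\<^esub> (\<phi> j) \<otimes>\<^bsub>N\<^esub> (\<phi> x \<otimes>\<^bsub>N\<^esub> act (\<phi> j) (inv x))"
      using N.inv_solve_left[OF ajN jN, of "\<phi> x \<otimes>\<^bsub>N\<^esub> act (\<phi> j) (inv x)"] xN axN by simp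
    then show ?thesis unfolding conj_cocycle_def using xc k(1) xN axN jN by (simp add: e N.m_assoc)
  qed
  have "restrict (conj_cocycle J act K (restrict \<phi> K) j) D = (\<lambda>x\<in>D. inv\<^bsub>N\<^esub> (\<phi> j) \<otimes>\<^bsub>N\<^esub> restrict \<phi> D x \<otimes>\<^bsub>N\<^esub> act (\<phi> j) (inv x))"
    using eq by (auto simp: restrict_def)
  moreover have "(restrict \<phi> D, \<lambda>x\<in>D. inv\<^bsub>N\<^esub> (\<phi> j) \<otimes>\<^bsub>N\<^esub> restrict \<phi> D x \<otimes>\<^bsub>N\<^esub> act (\<phi> j) (inv x)) \<in> cohomologous J T N act D"
    unfolding cohomologous_iff cohomologous_by_def using Zr Z1_twist[OF D Zr jN] jN by (auto intro!: exI[of _ "\<phi> j"])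
  ultimately show "(restrict (restrict \<phi> K) (K \<inter> conj_inv J K j), restrict (conj_cocycle J act K (restrict \<phi> K) j) (K \<inter> conj_inv J K j))
      \<in> cohomologous J T N act (K \<inter> conj_inv J K j)"
    unfolding D_def[symmetric] r by simp
qed

text \<open>
  Invariance is only ever applied to elements \<open>j\<close> that normalize \<open>K\<close>,
  where \<open>K \<inter> K\<^bsup>j\<inverse>\<^esup> = K\<close>.
\<close>

lemma invariant_cocycle_normalizing:
  assumes inv: "invariant_cocycle J T N act K \<phi>" and K: "subgroup K J" and j: "j \<in> carrier J" "\<forall>x\<in>K. inv j \<otimes> x \<otimes> j \<in> K"
  shows "\<exists>n\<in>carrier N. \<forall>x\<in>K. act (\<phi> (inv j \<otimes> x \<otimes> j)) (inv j) = inv\<^bsub>N\<^esub> n \<otimes>\<^bsub>N\<^esub> \<phi> x \<otimes>\<^bsub>N\<^esub> act n (inv x)"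
proof -
  have sub: "x \<in> conj_inv J K j" if x: "x \<in> K" for x
  proof -
    have "x = j \<otimes> (inv j \<otimes> x \<otimes> j) \<otimes> inv j" using j(1) subgroup.mem_carrier[OF K x] by (simp add: G.m_assoc G.cancel_inv_left)
    then show ?thesis using j(2) x unfolding conj_inv_def by blast
  qed
  then have "K \<inter> conj_inv J K j = K" by blast
  then have "(restrict \<phi> K, restrict (conj_cocycle J act K \<phi> j) K) \<in> cohomologous J T N act K"
    using inv j(1) unfolding invariant_cocycle_def by metis
  then show ?thesis using sub unfolding cohomologous_def conj_cocycle_def by simp
qed

end

theorem lemma1p2:
  fixes J :: "('j, 'a) monoid_scheme" and T :: "'j topology"
    and N :: "('n, 'b) monoid_scheme" and act :: "'n \<Rightarrow> 'j \<Rightarrow> 'n"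
    and P :: "nat \<Rightarrow> 'j set"
  assumes "profinite_group J T"
    and "J_group J T N act" and "finite (carrier N)" and "nilpotent_group N"
    and "prosupersolvable_group (semidirect_product N J act) (semidirect_topology N T)
         \<or> pronilpotent_group J T"
    and "\<forall>p\<in>prime_set J T. sylow_subgroup p (P p) J T"
  shows "\<exists>F. (\<forall>\<phi>\<in>Z1 J T N act (carrier J).
               F (H1_class J T N act (carrier J) \<phi>)
                 = (\<lambda>p\<in>prime_set J T. H1_class J T N act (P p) (restrict \<phi> (P p)))) \<and>
             pointed_iso F
               (H1 J T N act (carrier J), H1_point J T N act (carrier J))
               (\<Pi>\<^sub>E p\<in>prime_set J T. inv_H1 J T N act (P p),
                \<lambda>p\<in>prime_set J T. H1_point J T N act (P p))"
proof -
  interpret finite_J_group J T N act by unfold_locales (fact assms)+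
  interpret nilpotent_action J N "\<lambda>j n. act n (inv\<^bsub>J\<^esub> j)" T
    by unfold_locales (fact assms)+
  have S: "sylow_subgroup p (P p) J T" if "p \<in> prime_set J T" for p using assms(6) that by blast
  have K: "subgroup (P p) J" if "p \<in> prime_set J T" for p using S[OF that] unfolding sylow_subgroup_def closed_subgroup_def by blast
  note self = G.subgroup_self
  have sup: "profinite_action.sylow_supplement J (N\<lparr>carrier := component p\<rparr>) (\<lambda>j n. act n (inv\<^bsub>J\<^esub> j)) (part p) (P p) U"
    if p: "p \<in> prime_set J T" and U: "profinite_action.small_subgroup J (N\<lparr>carrier := component p\<rparr>) (\<lambda>j n. act n (inv\<^bsub>J\<^esub> j)) T U" for p U
    using assms(5)
  proof
    assume "prosupersolvable_group (semidirect_product N J act) (semidirect_topology N T)"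
    then show ?thesis
      by (intro component_supplement_supersolvable[OF _ S[OF p] U])
        (rule J_group_stabilizing_chains[OF G.is_group topspace assms(2)])
  next
    assume "pronilpotent_group J T"
    then show ?thesis by (rule component_supplement_nilpotent[OF _ S[OF p] U])
  qed
  let ?Z = "Z1 J T N act" and ?R = "cohomologous J T N act" and ?c = "H1_class J T N act"
  \<comment> \<open>The value does not depend on the representative of the class, as the fact \<open>F\<close>
    below shows.\<close>
  define F where "F = (\<lambda>c. \<lambda>p\<in>prime_set J T. ?c (P p) (restrict (SOME \<phi>. \<phi> \<in> c) (P p)))"
  have rZ: "restrict \<phi> (P p) \<in> ?Z (P p)" if "\<phi> \<in> ?Z (carrier J)" "p \<in> prime_set J T" for \<phi> p
    using Z1_restrict[OF self K[OF that(2)] subgroup.subset[OF K[OF that(2)]] that(1)] .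
  have F: "F (?c (carrier J) \<phi>) = (\<lambda>p\<in>prime_set J T. ?c (P p) (restrict \<phi> (P p)))" if \<phi>: "\<phi> \<in> ?Z (carrier J)" for \<phi>
  proof -
    define \<psi> where "\<psi> = (SOME \<psi>. \<psi> \<in> ?c (carrier J) \<phi>)"
    have "\<phi> \<in> ?c (carrier J) \<phi>" unfolding H1_class_def by (rule equiv_class_self[OF equiv_cohomologous[OF self] \<phi>])
    then have "\<psi> \<in> ?c (carrier J) \<phi>" unfolding \<psi>_def by (rule someI[of "\<lambda>\<psi>. \<psi> \<in> ?c (carrier J) \<phi>"])
    then obtain n where \<psi>: "\<psi> \<in> ?Z (carrier J)" "cohomologous_by (carrier J) n \<phi> \<psi>"
      unfolding H1_class_def using cohomologous_iff by auto
    have "?c (P p) (restrict \<psi> (P p)) = ?c (P p) (restrict \<phi> (P p))" if p: "p \<in> prime_set J T" for p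
    proof -
      have "cohomologous_by (P p) n (restrict \<phi> (P p)) (restrict \<psi> (P p))"
        using \<psi>(2) subgroup.mem_carrier[OF K[OF p]] unfolding cohomologous_by_def by simp
      then have "(restrict \<phi> (P p), restrict \<psi> (P p)) \<in> ?R (P p)" unfolding cohomologous_iff using rZ[OF _ p] \<phi> \<psi>(1) by blast
      then show ?thesis using H1_class_eq_iff[OF K[OF p] rZ[OF \<phi> p] rZ[OF \<psi>(1) p]] by simp
    qed
    then show ?thesis unfolding F_def \<psi>_def[symmetric] by (rule restrict_ext)
  qed
  have H1E: "\<exists>\<phi>\<in>?Z (carrier J). c = ?c (carrier J) \<phi>" if "c \<in> H1 J T N act (carrier J)" for c
    using that unfolding H1_def H1_class_def quotient_def by blast
  have inj: "inj_on F (H1 J T N act (carrier J))"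
  proof (rule inj_onI)
    fix c d assume "c \<in> H1 J T N act (carrier J)" "d \<in> H1 J T N act (carrier J)" and FF: "F c = F d"
    then obtain \<phi> \<psi> where Z: "\<phi> \<in> ?Z (carrier J)" "\<psi> \<in> ?Z (carrier J)" and cd: "c = ?c (carrier J) \<phi>" "d = ?c (carrier J) \<psi>"
      using H1E by metis
    have coh: "\<exists>v. cohomologous_by (P p) v \<phi> \<psi>" if p: "p \<in> prime_set J T" for p
    proof -
      have "?c (P p) (restrict \<phi> (P p)) = ?c (P p) (restrict \<psi> (P p))"
        using fun_cong[OF FF[unfolded cd F[OF Z(1)] F[OF Z(2)]], of p] p by simp
      then have "(restrict \<phi> (P p), restrict \<psi> (P p)) \<in> ?R (P p)"
        using H1_class_eq_iff[OF K[OF p] rZ[OF Z(1) p] rZ[OF Z(2) p]] by simp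
      then show ?thesis unfolding cohomologous_iff cohomologous_by_def by auto
    qed
    obtain U where U: "small_subgroup U" "\<forall>u\<in>carrier J \<inter> U. \<phi> u = \<one>\<^bsub>N\<^esub>" using Z(1) unfolding Z1_iff[OF self] by blast
    obtain V where V: "small_subgroup V" "\<forall>u\<in>carrier J \<inter> V. \<psi> u = \<one>\<^bsub>N\<^esub>" using Z(2) unfolding Z1_iff[OF self] by blast
    obtain W where W: "small_subgroup W" "W \<subseteq> U" "W \<subseteq> V"
      by (rule small_subgroup_Int[OF U(1) small_subgroupD(3)[OF V(1)] subgroup.one_closed[OF small_subgroupD(2)[OF V(1)]]])
    have W1: "\<phi> u = \<one>\<^bsub>N\<^esub>" "\<psi> u = \<one>\<^bsub>N\<^esub>" if "u \<in> W" for u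
      using that W U(2) V(2) subgroup.mem_carrier[OF small_subgroupD(2)[OF W(1)] that] by auto
    have cc: "cocycle (carrier J) \<phi>" "cocycle (carrier J) \<psi>" using Z unfolding Z1_iff[OF self] by simp_all
    have "\<exists>v. cohomologous_by (carrier J) v \<phi> \<psi>"
      by (rule restriction_to_sylows_injective[where P = P, OF S sup W(1) cc(1) W1(1) cc(2) W1(2) coh])
    then show "c = d" unfolding cd H1_class_eq_iff[OF self Z] cohomologous_iff using Z by simp
  qed
  have into: "F c \<in> (\<Pi>\<^sub>E p\<in>prime_set J T. inv_H1 J T N act (P p))" if "c \<in> H1 J T N act (carrier J)" for c
  proof -
    obtain \<phi> where \<phi>: "\<phi> \<in> ?Z (carrier J)" "c = ?c (carrier J) \<phi>" using H1E \<open>c \<in> _\<close> by blast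
    show ?thesis unfolding \<phi>(2) F[OF \<phi>(1)] inv_H1_def using invariant_cocycle_restrict[OF K \<phi>(1)] by auto
  qed
  have onto: "\<exists>c\<in>H1 J T N act (carrier J). F c = y" if y: "y \<in> (\<Pi>\<^sub>E p\<in>prime_set J T. inv_H1 J T N act (P p))" for y
  proof -
    have "\<forall>p\<in>prime_set J T. \<exists>\<phi>. invariant_cocycle J T N act (P p) \<phi> \<and> y p = ?c (P p) \<phi>"
      using y unfolding inv_H1_def by (auto simp: PiE_def Pi_def)
    from bchoice[OF this] obtain \<phi> where \<phi>: "\<And>p. p \<in> prime_set J T \<Longrightarrow> invariant_cocycle J T N act (P p) (\<phi> p)"
      "\<And>p. p \<in> prime_set J T \<Longrightarrow> y p = ?c (P p) (\<phi> p)" by blast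
    have \<phi>Z: "\<phi> p \<in> ?Z (P p)" if "p \<in> prime_set J T" for p using \<phi>(1)[OF that] unfolding invariant_cocycle_def by simp
    have "\<forall>p\<in>prime_set J T. \<exists>U. small_subgroup U \<and> (\<forall>u\<in>P p \<inter> U. \<phi> p u = \<one>\<^bsub>N\<^esub>)"
      using \<phi>Z Z1_iff[OF K] by blast
    from bchoice[OF this] obtain U where U: "\<And>p. p \<in> prime_set J T \<Longrightarrow> small_subgroup (U p)"
      "\<And>p u. p \<in> prime_set J T \<Longrightarrow> u \<in> P p \<Longrightarrow> u \<in> U p \<Longrightarrow> \<phi> p u = \<one>\<^bsub>N\<^esub>" by blast
    have \<phi>c: "cocycle (P p) (\<phi> p)" if "p \<in> prime_set J T" for p using \<phi>Z[OF that] unfolding Z1_iff[OF K[OF that]] by simp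
    obtain U0 where U0: "small_subgroup U0" using small_subgroup_exists by blast
    have "\<exists>\<Phi> V. cocycle (carrier J) \<Phi> \<and> small_subgroup V \<and> (\<forall>u\<in>V. \<Phi> u = \<one>\<^bsub>N\<^esub>) \<and>
        (\<forall>p\<in>prime_set J T. \<exists>v. cohomologous_by (P p) v \<Phi> (\<phi> p))"
      by (rule restriction_to_sylows_surjective[where P = P and U = U and \<phi> = \<phi>, OF S sup U(1) \<phi>c U(2) invariant_cocycle_normalizing[OF \<phi>(1) K] U0])
    then obtain \<Phi> V where \<Phi>: "cocycle (carrier J) \<Phi>" "small_subgroup V" "\<forall>u\<in>V. \<Phi> u = \<one>\<^bsub>N\<^esub>"
      "\<forall>p\<in>prime_set J T. \<exists>v. cohomologous_by (P p) v \<Phi> (\<phi> p)" by blast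
    define \<Phi>' where "\<Phi>' = restrict \<Phi> (carrier J)"
    have Z: "\<Phi>' \<in> ?Z (carrier J)"
      unfolding Z1_iff[OF self] \<Phi>'_def using \<Phi>(1,2,3) unfolding cocycle_def by (auto intro!: exI[of _ V])
    have "?c (P p) (restrict \<Phi>' (P p)) = y p" if p: "p \<in> prime_set J T" for p
    proof -
      obtain v where "cohomologous_by (P p) v \<Phi> (\<phi> p)" using \<Phi>(4) p by blast
      then have "cohomologous_by (P p) v (restrict \<Phi>' (P p)) (\<phi> p)"
        unfolding cohomologous_by_def \<Phi>'_def using subgroup.mem_carrier[OF K[OF p]] by simp
      then have "(restrict \<Phi>' (P p), \<phi> p) \<in> ?R (P p)" unfolding cohomologous_iff using rZ[OF Z p] \<phi>Z[OF p] by blast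
      then show ?thesis unfolding \<phi>(2)[OF p] H1_class_eq_iff[OF K[OF p] rZ[OF Z p] \<phi>Z[OF p]] .
    qed
    then have "F (?c (carrier J) \<Phi>') = restrict y (prime_set J T)" unfolding F[OF Z] by (rule restrict_ext)
    then have "F (?c (carrier J) \<Phi>') = y" unfolding PiE_restrict[OF y] .
    moreover have "?c (carrier J) \<Phi>' \<in> H1 J T N act (carrier J)" unfolding H1_def H1_class_def using Z by (rule quotientI)
    ultimately show ?thesis by blast
  qed
  have "bij_betw F (H1 J T N act (carrier J)) (\<Pi>\<^sub>E p\<in>prime_set J T. inv_H1 J T N act (P p))"
    unfolding bij_betw_def using inj into onto by blast
  moreover have "F (H1_point J T N act (carrier J)) = (\<lambda>p\<in>prime_set J T. H1_point J T N act (P p))"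
  proof -
    obtain U where "small_subgroup U" using small_subgroup_exists by blast
    then have "(\<lambda>x\<in>carrier J. \<one>\<^bsub>N\<^esub>) \<in> ?Z (carrier J)"
      unfolding Z1_iff[OF self] cocycle_def using a_N_one by (auto intro!: exI[of _ U])
    moreover have "restrict (\<lambda>x\<in>carrier J. \<one>\<^bsub>N\<^esub>) (P p) = (\<lambda>x\<in>P p. \<one>\<^bsub>N\<^esub>)" if "p \<in> prime_set J T" for p
      using subgroup.mem_carrier[OF K[OF that]] by (auto simp: restrict_def)
    ultimately show ?thesis unfolding H1_point_def by (simp add: F cong: restrict_cong)
  qed
  ultimately show ?thesis unfolding pointed_iso_def using F by (intro exI[of _ F]) simp
qed

end
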